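(* For a pcfb-closed subset $S\subseteq\mathbb{S}$ of the set of supernatural numbers, let $K_S$ be the Grothendieck topology on the big cell $\mathtt{D}$ for which a sieve $L$ on $n$ is covering if and only if, as a subset of $\mathbb{S}$, $L$ contains $(n)\cap S$. Then $$S\mapsto K_S$$ is a bijective correspondence from pcfb-closed subsets $S\subseteq\mathbb{S}$ to Grothendieck topologies on $\mathtt{D}$ with enough points. Under this correspondence, $S$ (with the subspace topology induced from the localic topology on $\mathbb{S}$) is the space of points of $\mathrm{Sh}(\mathtt{D},K_S)$, and there is an equivalence $\mathrm{Sh}(\mathtt{D},K_S)\simeq\mathrm{Sh}(S)$ fitting in a commutative diagram of geometric morphisms $$\begin{array}{ccc}\mathrm{Sh}(\mathtt{D},K_S)&\xrightarrow{\ \sim\ }&\mathrm{Sh}(S)\\ \downarrow&&\downarrow\\ \widehat{\mathtt{D}}&\xrightarrow{\ \sim\ }&\mathrm{Sh}(\mathbb{S})\end{array}$$ in which the vertical arrows are the canonical inclusions of subtoposes and the bottom arrow is the standard equivalence $\widehat{\mathtt{D}}\simeq\mathrm{Sh}(\mathbb{S})$.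
   Context: The big cell $\mathtt{D}$ is the poset category whose objects are the strictly positive natural numbers $\mathbb{N}_+$, with a unique morphism $m\to n$ whenever $n\mid m$. $\widehat{\mathtt{D}}$ is the category of presheaves of sets on $\mathtt{D}$. $\mathbb{S}$ is the set of supernatural numbers, i.e. formal products $\prod_p p^{e_p}$ over all primes with $e_p\in\{0,1,2,\dots\}\cup\{\infty\}$, with the obvious divisibility relation. The localic topology on $\mathbb{S}$ has as open sets the sets $(n_i)_{i\in I}=\{s\in\mathbb{S}:\exists i\in I,\ n_i\mid s\}$ with $n_i\in\mathbb{N}_+$; in particular $(n)=\{s: n\mid s\}$ and the closure of a point is $\overline{\{s\}}=\{x\in\mathbb{S}:x\mid s\}$. The standard equivalence $\mathrm{Sh}(\mathbb{S})\simeq\widehat{\mathtt{D}}$ (sheaves for the localic topology) sends a sheaf $F$ to the presheaf $n\mapsto F((n))$; accordingly the point $s\in\mathbb{S}$ has stalk functor $F\mapsto\varinjlim_{n\mid s}F(n)$ on $\widehat{\mathtt{D}}$, $n$ ranging over natural numbers. The pcfb-topology on $\mathbb{S}$ is the topology with basis the sets $(n)\cap\overline{\{s\}}$, for $s\in\mathbb{S}$ and $n\in\mathbb{N}_+$ with $n\mid s$. A subset is pcfb-closed if it is closed for this topology. A sieve $\{n_i\to n\}_{i\in I}$ on $n$ is identified with the open set $(n_i)_{i\in I}\subseteq\mathbb{S}$. A Grothendieck topology has enough points if its sheaf topos has enough points. *)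

theory Defs
  imports
    "HOL-Analysis.Analysis"
    "HOL-Library.Equipollence"
    "HOL-Library.Extended_Nat"
    "HOL-Computational_Algebra.Primes"
begin

section \<open>Categories and functors\<close>

text \<open>
  Hom-sets need not be disjoint: \<open>Cmp C a b c g f\<close> is the composite of \<open>f : a \<rightarrow> b\<close> and
  \<open>g : b \<rightarrow> c\<close>, and functors act on an arrow together with its source and target.
\<close>

record ('o, 'm) cat =
  Obj :: "'o set"
  Hom :: "'o \<Rightarrow> 'o \<Rightarrow> 'm set"
  Idn :: "'o \<Rightarrow> 'm"
  Cmp :: "'o \<Rightarrow> 'o \<Rightarrow> 'o \<Rightarrow> 'm \<Rightarrow> 'm \<Rightarrow> 'm"

definition is_category :: "('o, 'm) cat \<Rightarrow> bool" where
  "is_category C \<longleftrightarrow>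
     (\<forall>a\<in>Obj C. Idn C a \<in> Hom C a a) \<and>
     (\<forall>a\<in>Obj C. \<forall>b\<in>Obj C. \<forall>c\<in>Obj C. \<forall>f\<in>Hom C a b. \<forall>g\<in>Hom C b c. Cmp C a b c g f \<in> Hom C a c) \<and>
     (\<forall>a\<in>Obj C. \<forall>b\<in>Obj C. \<forall>f\<in>Hom C a b.
        Cmp C a a b f (Idn C a) = f \<and> Cmp C a b b (Idn C b) f = f) \<and>
     (\<forall>a\<in>Obj C. \<forall>b\<in>Obj C. \<forall>c\<in>Obj C. \<forall>d\<in>Obj C.
        \<forall>f\<in>Hom C a b. \<forall>g\<in>Hom C b c. \<forall>h\<in>Hom C c d.
        Cmp C a c d h (Cmp C a b c g f) = Cmp C a b d (Cmp C b c d h g) f)"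

definition finite_category :: "('o, 'm) cat \<Rightarrow> bool" where
  "finite_category C \<longleftrightarrow>
     is_category C \<and> finite (Obj C) \<and> (\<forall>a\<in>Obj C. \<forall>b\<in>Obj C. finite (Hom C a b))"

definition op_cat :: "('o, 'm) cat \<Rightarrow> ('o, 'm) cat" where
  "op_cat C = \<lparr>Obj = Obj C, Hom = (\<lambda>a b. Hom C b a), Idn = Idn C,
               Cmp = (\<lambda>a b c g f. Cmp C c b a f g)\<rparr>"

definition full_subcat :: "('o, 'm) cat \<Rightarrow> ('o \<Rightarrow> bool) \<Rightarrow> ('o, 'm) cat" where
  "full_subcat C P = C\<lparr>Obj := {a \<in> Obj C. P a}\<rparr>"

definition poset_cat :: "'a set \<Rightarrow> ('a \<Rightarrow> 'a \<Rightarrow> bool) \<Rightarrow> ('a, unit) cat" where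
  "poset_cat A le = \<lparr>Obj = A, Hom = (\<lambda>a b. if le a b then {()} else {}), Idn = (\<lambda>a. ()),
                     Cmp = (\<lambda>a b c g f. ())\<rparr>"

definition is_iso :: "('o, 'm) cat \<Rightarrow> 'o \<Rightarrow> 'o \<Rightarrow> 'm \<Rightarrow> bool" where
  "is_iso C a b f \<longleftrightarrow>
     f \<in> Hom C a b \<and> (\<exists>g\<in>Hom C b a. Cmp C a b a g f = Idn C a \<and> Cmp C b a b f g = Idn C b)"

definition terminal :: "('o, 'm) cat \<Rightarrow> 'o \<Rightarrow> bool" where
  "terminal C t \<longleftrightarrow> t \<in> Obj C \<and> (\<forall>a\<in>Obj C. \<exists>!f. f \<in> Hom C a t)"

definition subterminal :: "('o, 'm) cat \<Rightarrow> 'o \<Rightarrow> bool" where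
  "subterminal C u \<longleftrightarrow> u \<in> Obj C \<and> (\<forall>a\<in>Obj C. \<forall>f\<in>Hom C a u. \<forall>g\<in>Hom C a u. f = g)"

record ('o, 'm, 'p, 'n) fctr =
  ob :: "'o \<Rightarrow> 'p"
  ar :: "'o \<Rightarrow> 'o \<Rightarrow> 'm \<Rightarrow> 'n"

definition is_functor :: "('o, 'm) cat \<Rightarrow> ('p, 'n) cat \<Rightarrow> ('o, 'm, 'p, 'n) fctr \<Rightarrow> bool" where
  "is_functor C D F \<longleftrightarrow>
     (\<forall>a\<in>Obj C. ob F a \<in> Obj D) \<and>
     (\<forall>a\<in>Obj C. \<forall>b\<in>Obj C. \<forall>f\<in>Hom C a b. ar F a b f \<in> Hom D (ob F a) (ob F b)) \<and>
     (\<forall>a\<in>Obj C. ar F a a (Idn C a) = Idn D (ob F a)) \<and>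
     (\<forall>a\<in>Obj C. \<forall>b\<in>Obj C. \<forall>c\<in>Obj C. \<forall>f\<in>Hom C a b. \<forall>g\<in>Hom C b c.
        ar F a c (Cmp C a b c g f) =
          Cmp D (ob F a) (ob F b) (ob F c) (ar F b c g) (ar F a b f))"

definition id_fctr :: "('o, 'm, 'o, 'm) fctr" where
  "id_fctr = \<lparr>ob = (\<lambda>a. a), ar = (\<lambda>a b f. f)\<rparr>"

definition comp_fctr ::
  "('p, 'n, 'q, 'k) fctr \<Rightarrow> ('o, 'm, 'p, 'n) fctr \<Rightarrow> ('o, 'm, 'q, 'k) fctr" where
  "comp_fctr G F = \<lparr>ob = (\<lambda>a. ob G (ob F a)),
                    ar = (\<lambda>a b f. ar G (ob F a) (ob F b) (ar F a b f))\<rparr>"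

text \<open>
  The components are required to be \<open>extensional\<close> so that natural transformations are equal
  if and only if their components at all objects of the source category are.
\<close>

definition is_nat_trans ::
  "('o, 'm) cat \<Rightarrow> ('p, 'n) cat \<Rightarrow> ('o, 'm, 'p, 'n) fctr \<Rightarrow> ('o, 'm, 'p, 'n) fctr \<Rightarrow> ('o \<Rightarrow> 'n) \<Rightarrow> bool"
  where
  "is_nat_trans C D F G \<alpha> \<longleftrightarrow>
     \<alpha> \<in> extensional (Obj C) \<and>
     (\<forall>a\<in>Obj C. \<alpha> a \<in> Hom D (ob F a) (ob G a)) \<and>
     (\<forall>a\<in>Obj C. \<forall>b\<in>Obj C. \<forall>f\<in>Hom C a b.
        Cmp D (ob F a) (ob F b) (ob G b) (\<alpha> b) (ar F a b f) =
        Cmp D (ob F a) (ob G a) (ob G b) (ar G a b f) (\<alpha> a))"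

definition isomorphic_functors ::
  "('o, 'm) cat \<Rightarrow> ('p, 'n) cat \<Rightarrow> ('o, 'm, 'p, 'n) fctr \<Rightarrow> ('o, 'm, 'p, 'n) fctr \<Rightarrow> bool" where
  "isomorphic_functors C D F G \<longleftrightarrow>
     (\<exists>\<alpha>. is_nat_trans C D F G \<alpha> \<and> (\<forall>a\<in>Obj C. is_iso D (ob F a) (ob G a) (\<alpha> a)))"

definition functor_cat ::
  "('o, 'm) cat \<Rightarrow> ('p, 'n) cat \<Rightarrow> (('o, 'm, 'p, 'n) fctr, 'o \<Rightarrow> 'n) cat" where
  "functor_cat C D =
     \<lparr>Obj = {F. is_functor C D F},
      Hom = (\<lambda>F G. {\<alpha>. is_nat_trans C D F G \<alpha>}),
      Idn = (\<lambda>F. \<lambda>a\<in>Obj C. Idn D (ob F a)),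
      Cmp = (\<lambda>F G H \<beta> \<alpha>. \<lambda>a\<in>Obj C. Cmp D (ob F a) (ob G a) (ob H a) (\<beta> a) (\<alpha> a))\<rparr>"

definition fully_faithful ::
  "('o, 'm) cat \<Rightarrow> ('p, 'n) cat \<Rightarrow> ('o, 'm, 'p, 'n) fctr \<Rightarrow> bool" where
  "fully_faithful C D F \<longleftrightarrow>
     (\<forall>a\<in>Obj C. \<forall>b\<in>Obj C. bij_betw (ar F a b) (Hom C a b) (Hom D (ob F a) (ob F b)))"

definition is_equivalence ::
  "('o, 'm) cat \<Rightarrow> ('p, 'n) cat \<Rightarrow> ('o, 'm, 'p, 'n) fctr \<Rightarrow> bool" where
  "is_equivalence C D F \<longleftrightarrow>
     is_functor C D F \<and>
     (\<exists>G. is_functor D C G \<and>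
          isomorphic_functors C C (comp_fctr G F) id_fctr \<and>
          isomorphic_functors D D (comp_fctr F G) id_fctr)"

text \<open>\<open>adjoint C D L R\<close>: the functor \<open>L : C \<rightarrow> D\<close> is left adjoint to \<open>R : D \<rightarrow> C\<close>.\<close>

definition adjoint ::
  "('o, 'm) cat \<Rightarrow> ('p, 'n) cat \<Rightarrow> ('o, 'm, 'p, 'n) fctr \<Rightarrow> ('p, 'n, 'o, 'm) fctr \<Rightarrow> bool" where
  "adjoint C D L R \<longleftrightarrow>
     is_functor C D L \<and> is_functor D C R \<and>
     (\<exists>\<phi>. (\<forall>c\<in>Obj C. \<forall>d\<in>Obj D. bij_betw (\<phi> c d) (Hom D (ob L c) d) (Hom C c (ob R d))) \<and>
          (\<forall>c\<in>Obj C. \<forall>c'\<in>Obj C. \<forall>d\<in>Obj D. \<forall>d'\<in>Obj D.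
             \<forall>h\<in>Hom C c' c. \<forall>k\<in>Hom D d d'. \<forall>g\<in>Hom D (ob L c) d.
             \<phi> c' d' (Cmp D (ob L c') d d' k (Cmp D (ob L c') (ob L c) d g (ar L c' c h))) =
             Cmp C c' (ob R d) (ob R d') (ar R d d' k) (Cmp C c' c (ob R d) (\<phi> c d g) h)))"

definition limit_cone ::
  "('j, 'i) cat \<Rightarrow> ('o, 'm) cat \<Rightarrow> ('j, 'i, 'o, 'm) fctr \<Rightarrow> 'o \<Rightarrow> ('j \<Rightarrow> 'm) \<Rightarrow> bool" where
  "limit_cone J C \<Delta> x \<pi> \<longleftrightarrow>
     (let cone = (\<lambda>y \<rho>. y \<in> Obj C \<and> (\<forall>j\<in>Obj J. \<rho> j \<in> Hom C y (ob \<Delta> j)) \<and>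
            (\<forall>j\<in>Obj J. \<forall>k\<in>Obj J. \<forall>u\<in>Hom J j k.
               Cmp C y (ob \<Delta> j) (ob \<Delta> k) (ar \<Delta> j k u) (\<rho> j) = \<rho> k))
      in cone x \<pi> \<and>
         (\<forall>y \<rho>. cone y \<rho> \<longrightarrow>
            (\<exists>!f. f \<in> Hom C y x \<and> (\<forall>j\<in>Obj J. Cmp C y x (ob \<Delta> j) (\<pi> j) f = \<rho> j))))"

definition colimit_cocone ::
  "('j, 'i) cat \<Rightarrow> ('o, 'm) cat \<Rightarrow> ('j, 'i, 'o, 'm) fctr \<Rightarrow> 'o \<Rightarrow> ('j \<Rightarrow> 'm) \<Rightarrow> bool" where
  "colimit_cocone J C \<Delta> x \<iota> \<longleftrightarrow>
     (let cocone = (\<lambda>y \<rho>. y \<in> Obj C \<and> (\<forall>j\<in>Obj J. \<rho> j \<in> Hom C (ob \<Delta> j) y) \<and>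
            (\<forall>j\<in>Obj J. \<forall>k\<in>Obj J. \<forall>u\<in>Hom J j k.
               Cmp C (ob \<Delta> j) (ob \<Delta> k) y (\<rho> k) (ar \<Delta> j k u) = \<rho> j))
      in cocone x \<iota> \<and>
         (\<forall>y \<rho>. cocone y \<rho> \<longrightarrow>
            (\<exists>!f. f \<in> Hom C x y \<and> (\<forall>j\<in>Obj J. Cmp C (ob \<Delta> j) x y f (\<iota> j) = \<rho> j))))"

text \<open>
  Index categories with objects and arrows in \<open>nat\<close> suffice, since every finite category is
  isomorphic to one of these.
\<close>

definition left_exact ::
  "('o, 'm) cat \<Rightarrow> ('p, 'n) cat \<Rightarrow> ('o, 'm, 'p, 'n) fctr \<Rightarrow> bool" where
  "left_exact C D F \<longleftrightarrow>
     (\<forall>(J :: (nat, nat) cat) \<Delta> x \<pi>.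
        finite_category J \<and> is_functor J C \<Delta> \<and> limit_cone J C \<Delta> x \<pi> \<longrightarrow>
        limit_cone J D (comp_fctr F \<Delta>) (ob F x) (\<lambda>j. ar F x (ob \<Delta> j) (\<pi> j)))"


section \<open>Geometric morphisms and points\<close>

record ('o, 'm, 'p, 'n) geom =
  inv_im :: "('p, 'n, 'o, 'm) fctr"
  dir_im :: "('o, 'm, 'p, 'n) fctr"

definition geometric_morphism ::
  "('o, 'm) cat \<Rightarrow> ('p, 'n) cat \<Rightarrow> ('o, 'm, 'p, 'n) geom \<Rightarrow> bool" where
  "geometric_morphism E F f \<longleftrightarrow>
     adjoint F E (inv_im f) (dir_im f) \<and> left_exact F E (inv_im f)"

definition comp_geom ::
  "('p, 'n, 'q, 'k) geom \<Rightarrow> ('o, 'm, 'p, 'n) geom \<Rightarrow> ('o, 'm, 'q, 'k) geom" where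
  "comp_geom g f = \<lparr>inv_im = comp_fctr (inv_im f) (inv_im g),
                    dir_im = comp_fctr (dir_im g) (dir_im f)\<rparr>"

definition isomorphic_geom ::
  "('o, 'm) cat \<Rightarrow> ('p, 'n) cat \<Rightarrow> ('o, 'm, 'p, 'n) geom \<Rightarrow> ('o, 'm, 'p, 'n) geom \<Rightarrow> bool" where
  "isomorphic_geom E F f g \<longleftrightarrow> isomorphic_functors F E (inv_im f) (inv_im g)"

definition geometric_inclusion ::
  "('o, 'm) cat \<Rightarrow> ('p, 'n) cat \<Rightarrow> ('o, 'm, 'p, 'n) geom \<Rightarrow> bool" where
  "geometric_inclusion E F f \<longleftrightarrow> geometric_morphism E F f \<and> fully_faithful E F (dir_im f)"

definition geometric_equivalence ::
  "('o, 'm) cat \<Rightarrow> ('p, 'n) cat \<Rightarrow> ('o, 'm, 'p, 'n) geom \<Rightarrow> bool" where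
  "geometric_equivalence E F f \<longleftrightarrow> geometric_morphism E F f \<and> is_equivalence E F (dir_im f)"

text \<open>
  The category of sets is that of the members of a universe \<open>U\<close>, which is closed under
  countable products, besides subsets and quotients: this suffices to sheafify presheaves on a
  countable category. The sets of cardinality \<open>\<le> \<kappa>\<close> with \<open>\<kappa>\<close> to the power
  \<open>\<aleph>\<^sub>0\<close> equal to \<open>\<kappa>\<close> form such a universe, and so do the sets of cardinality
  \<open>< \<kappa>\<close> with \<open>\<kappa>\<close> uncountable and strongly inaccessible (a Grothendieck universe).
\<close>

definition set_universe :: "'u set set \<Rightarrow> bool" where
  "set_universe U \<longleftrightarrow>
     (\<forall>A\<in>U. \<forall>B. B \<lesssim> A \<longrightarrow> B \<in> U) \<and>
     (\<exists>A\<in>U. \<exists>a\<in>A. \<exists>b\<in>A. a \<noteq> b) \<and>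
     (\<forall>A :: nat \<Rightarrow> 'u set. (\<forall>n. A n \<in> U) \<longrightarrow> (\<exists>B\<in>U. PiE UNIV A \<lesssim> B))"

definition set_cat :: "'u set set \<Rightarrow> ('u set, 'u \<Rightarrow> 'u) cat" where
  "set_cat U = \<lparr>Obj = U, Hom = (\<lambda>A B. A \<rightarrow>\<^sub>E B), Idn = (\<lambda>A. \<lambda>x\<in>A. x),
                Cmp = (\<lambda>A B C g f. compose A g f)\<rparr>"

type_synonym ('o, 'm, 'u) point = "('u set, 'u \<Rightarrow> 'u, 'o, 'm) geom"

definition points :: "'u set set \<Rightarrow> ('o, 'm) cat \<Rightarrow> ('o, 'm, 'u) point set" where
  "points U E = {p. geometric_morphism (set_cat U) E p}"

definition has_enough_points :: "'u set set \<Rightarrow> ('o, 'm) cat \<Rightarrow> bool" where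
  "has_enough_points U E \<longleftrightarrow>
     (\<forall>a\<in>Obj E. \<forall>b\<in>Obj E. \<forall>f\<in>Hom E a b.
        (\<forall>p\<in>points U E.
           is_iso (set_cat U) (ob (inv_im p) a) (ob (inv_im p) b) (ar (inv_im p) a b f)) \<longrightarrow>
        is_iso E a b f)"

definition point_classes :: "'u set set \<Rightarrow> ('o, 'm) cat \<Rightarrow> ('o, 'm, 'u) point set set" where
  "point_classes U E =
     points U E // {(p, q). p \<in> points U E \<and> q \<in> points U E \<and> isomorphic_geom (set_cat U) E p q}"

text \<open>
  The open sets are those of the form \<open>{p. p\<^sup>*u = 1}\<close> for \<open>u\<close> a subobject of the
  terminal object; in a topos these are already closed under unions and finite intersections.
\<close>

definition space_of_points :: "'u set set \<Rightarrow> ('o, 'm) cat \<Rightarrow> ('o, 'm, 'u) point set topology" where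
  "space_of_points U E =
     topology_generated_by
       {{c \<in> point_classes U E. \<exists>p\<in>c. terminal (set_cat U) (ob (inv_im p) u)} | u. subterminal E u}"


section \<open>Sheaves on a site over a poset\<close>

text \<open>
  For a poset category \<open>C\<close>, a sieve on \<open>c\<close> is identified with a set of objects below \<open>c\<close>.
  A Grothendieck topology assigns to each object its set of covering sieves (and \<open>{}\<close>
  outside \<open>Obj C\<close>, so that distinct functions are distinct topologies).
\<close>

definition arrow_to :: "('c, unit) cat \<Rightarrow> 'c \<Rightarrow> 'c \<Rightarrow> bool" where
  "arrow_to C d c \<longleftrightarrow> d \<in> Obj C \<and> c \<in> Obj C \<and> Hom C d c \<noteq> {}"

definition is_sieve :: "('c, unit) cat \<Rightarrow> 'c \<Rightarrow> 'c set \<Rightarrow> bool" where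
  "is_sieve C c L \<longleftrightarrow> (\<forall>d\<in>L. arrow_to C d c \<and> (\<forall>e. arrow_to C e d \<longrightarrow> e \<in> L))"

definition pullback_sieve :: "('c, unit) cat \<Rightarrow> 'c set \<Rightarrow> 'c \<Rightarrow> 'c set" where
  "pullback_sieve C L d = {e \<in> L. arrow_to C e d}"

definition grothendieck_topology :: "('c, unit) cat \<Rightarrow> ('c \<Rightarrow> 'c set set) \<Rightarrow> bool" where
  "grothendieck_topology C J \<longleftrightarrow>
     (\<forall>c. c \<notin> Obj C \<longrightarrow> J c = {}) \<and>
     (\<forall>c\<in>Obj C.
        (\<forall>L\<in>J c. is_sieve C c L) \<and>
        {d. arrow_to C d c} \<in> J c \<and>
        (\<forall>L\<in>J c. \<forall>d. arrow_to C d c \<longrightarrow> pullback_sieve C L d \<in> J d) \<and>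
        (\<forall>L\<in>J c. \<forall>R. is_sieve C c R \<and> (\<forall>d\<in>L. pullback_sieve C R d \<in> J d) \<longrightarrow> R \<in> J c))"

type_synonym ('c, 'u) presheaf = "('c, unit, 'u set, 'u \<Rightarrow> 'u) fctr"

definition presheaves ::
  "'u set set \<Rightarrow> ('c, unit) cat \<Rightarrow> (('c, 'u) presheaf, 'c \<Rightarrow> 'u \<Rightarrow> 'u) cat" where
  "presheaves U C = functor_cat (op_cat C) (set_cat U)"

definition restr :: "('c, 'u) presheaf \<Rightarrow> 'c \<Rightarrow> 'c \<Rightarrow> 'u \<Rightarrow> 'u" where
  "restr F c d = ar F c d ()"

definition matching_family ::
  "('c, unit) cat \<Rightarrow> ('c, 'u) presheaf \<Rightarrow> 'c set \<Rightarrow> ('c \<Rightarrow> 'u) \<Rightarrow> bool" where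
  "matching_family C F L x \<longleftrightarrow>
     (\<forall>d\<in>L. x d \<in> ob F d \<and> (\<forall>e. arrow_to C e d \<longrightarrow> restr F d e (x d) = x e))"

definition is_sheaf ::
  "('c, unit) cat \<Rightarrow> ('c \<Rightarrow> 'c set set) \<Rightarrow> ('c, 'u) presheaf \<Rightarrow> bool" where
  "is_sheaf C J F \<longleftrightarrow>
     (\<forall>c\<in>Obj C. \<forall>L\<in>J c. \<forall>x. matching_family C F L x \<longrightarrow>
        (\<exists>!y. y \<in> ob F c \<and> (\<forall>d\<in>L. restr F c d y = x d)))"

definition sheaves ::
  "'u set set \<Rightarrow> ('c, unit) cat \<Rightarrow> ('c \<Rightarrow> 'c set set) \<Rightarrow> (('c, 'u) presheaf, 'c \<Rightarrow> 'u \<Rightarrow> 'u) cat" where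
  "sheaves U C J = full_subcat (presheaves U C) (is_sheaf C J)"

definition opens :: "'a topology \<Rightarrow> ('a set, unit) cat" where
  "opens X = poset_cat {V. openin X V} (\<subseteq>)"

definition open_covers :: "'a topology \<Rightarrow> 'a set \<Rightarrow> 'a set set set" where
  "open_covers X V = (if openin X V then {L. is_sieve (opens X) V L \<and> \<Union>L = V} else {})"

definition space_sheaves ::
  "'u set set \<Rightarrow> 'a topology \<Rightarrow> (('a set, 'u) presheaf, 'a set \<Rightarrow> 'u \<Rightarrow> 'u) cat" where
  "space_sheaves U X = sheaves U (opens X) (open_covers X)"

definition pushforward ::
  "'a topology \<Rightarrow> 'b topology \<Rightarrow> ('a \<Rightarrow> 'b) \<Rightarrow>
   (('a set, 'u) presheaf, 'a set \<Rightarrow> 'u \<Rightarrow> 'u, ('b set, 'u) presheaf, 'b set \<Rightarrow> 'u \<Rightarrow> 'u) fctr" where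
  "pushforward X Y f =
     (let pre = (\<lambda>V. {x \<in> topspace X. f x \<in> V})
      in \<lparr>ob = (\<lambda>F. \<lparr>ob = (\<lambda>V. ob F (pre V)), ar = (\<lambda>V W. ar F (pre V) (pre W))\<rparr>),
          ar = (\<lambda>F G \<alpha>. \<lambda>V\<in>Obj (opens Y). \<alpha> (pre V))\<rparr>)"


section \<open>Supernatural numbers and the big cell\<close>

text \<open>A supernatural number is represented by its exponents at the primes.\<close>

typedef supernat = "{e :: nat \<Rightarrow> enat. \<forall>p. \<not> prime p \<longrightarrow> e p = 0}"
  morphisms expo Abs_supernat
  by (rule exI[of _ "\<lambda>_. 0"]) simp

setup_lifting type_definition_supernat

definition sdvd :: "supernat \<Rightarrow> supernat \<Rightarrow> bool" (infix "sdvd" 50) where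
  "s sdvd t \<longleftrightarrow> (\<forall>p. expo s p \<le> expo t p)"

text \<open>Only meaningful for \<open>n > 0\<close>.\<close>

lift_definition snat :: "nat \<Rightarrow> supernat" is
  "\<lambda>n p. if prime p then enat (multiplicity p n) else 0"
  by simp

definition nat_open :: "nat set \<Rightarrow> supernat set" where
  "nat_open I = {s. \<exists>n\<in>I. snat n sdvd s}"

lemma sdvd_refl: "s sdvd s"
  by (simp add: sdvd_def)

lemma sdvd_trans: "s sdvd t \<Longrightarrow> t sdvd u \<Longrightarrow> s sdvd u"
  by (meson order_trans sdvd_def)

lemma snat_one_sdvd: "snat 1 sdvd s"
  by (simp add: sdvd_def snat.rep_eq flip: zero_enat_def)

lemma snat_lcm_sdvd:
  assumes "m > 0" "n > 0"
  shows "snat (lcm m n) sdvd s \<longleftrightarrow> snat m sdvd s \<and> snat n sdvd s"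
proof -
  have "enat (multiplicity p (lcm m n)) \<le> e \<longleftrightarrow>
      enat (multiplicity p m) \<le> e \<and> enat (multiplicity p n) \<le> e" if "prime p" for p e
    using assms that by (cases e) (simp_all add: multiplicity_lcm)
  then show ?thesis
    unfolding sdvd_def snat.rep_eq by auto
qed

definition localic :: "supernat topology" where
  "localic = topology (\<lambda>V. \<exists>I \<subseteq> {0<..}. V = nat_open I)"

lemma nat_open_Int:
  assumes "I \<subseteq> {0<..}" "I' \<subseteq> {0<..}"
  shows "nat_open I \<inter> nat_open I' = nat_open ((\<lambda>(m, n). lcm m n) ` (I \<times> I'))"
proof -
  have "snat m sdvd s \<and> snat n sdvd s \<longleftrightarrow> snat (lcm m n) sdvd s"
    if "m \<in> I" "n \<in> I'" for m n s
    using assms that snat_lcm_sdvd[of m n s] by auto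
  then show ?thesis
    unfolding nat_open_def by fastforce
qed

lemma openin_localic: "openin localic V \<longleftrightarrow> (\<exists>I \<subseteq> {0<..}. V = nat_open I)"
proof -
  have "istopology (\<lambda>V. \<exists>I \<subseteq> {0<..}. V = nat_open I)"
    unfolding istopology_def
  proof (intro conjI allI impI)
    fix V W assume "\<exists>I\<subseteq>{0<..}. V = nat_open I" "\<exists>I\<subseteq>{0<..}. W = nat_open I"
    then obtain I I' where I: "I \<subseteq> {0<..}" "I' \<subseteq> {0<..}" "V = nat_open I" "W = nat_open I'"
      by blast
    have "(\<lambda>(m, n). lcm m n) ` (I \<times> I') \<subseteq> {0<..}"
      using I(1,2) by (fastforce intro: lcm_pos_nat)
    then show "\<exists>I\<subseteq>{0<..}. V \<inter> W = nat_open I"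
      using nat_open_Int[OF I(1,2)] I(3,4) by blast
  next
    fix \<V> assume "\<forall>V\<in>\<V>. \<exists>I\<subseteq>{0<..}. V = nat_open I"
    then obtain I where I: "\<And>V. V \<in> \<V> \<Longrightarrow> I V \<subseteq> {0<..} \<and> V = nat_open (I V)"
      by metis
    have "\<Union>\<V> = nat_open (\<Union>V\<in>\<V>. I V)"
      using I unfolding nat_open_def by blast
    then show "\<exists>I\<subseteq>{0<..}. \<Union>\<V> = nat_open I"
      using I by (metis UN_least)
  qed
  then show ?thesis
    by (simp add: localic_def)
qed

lemma topspace_localic: "topspace localic = UNIV"
proof -
  have "openin localic (nat_open {1})"
    unfolding openin_localic by (rule exI[of _ "{1}"]) simp
  moreover have "nat_open {1} = UNIV"
    using snat_one_sdvd by (simp add: nat_open_def)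
  ultimately show ?thesis
    by (metis openin_subset top.extremum_uniqueI)
qed

definition pcfb :: "supernat topology" where
  "pcfb = topology (arbitrary union_of
     (\<lambda>B. \<exists>n s. n > 0 \<and> snat n sdvd s \<and> B = nat_open {n} \<inter> localic closure_of {s}))"

lemma openin_pcfb:
  "openin pcfb = arbitrary union_of
     (\<lambda>B. \<exists>n s. n > 0 \<and> snat n sdvd s \<and> B = nat_open {n} \<inter> localic closure_of {s})"
proof -
  let ?P = "\<lambda>B. \<exists>n s. n > 0 \<and> snat n sdvd s \<and> B = nat_open {n} \<inter> localic closure_of {s}"
  have "istopology (arbitrary union_of ?P)"
    unfolding istopology_base_eq
  proof (intro allI impI)
    fix A B assume "?P A \<and> ?P B"
    then obtain m s n t where mn: "m > 0" "n > 0"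
      and A: "A = nat_open {m} \<inter> localic closure_of {s}"
      and B: "B = nat_open {n} \<inter> localic closure_of {t}"
      by blast
    have "\<exists>C. ?P C \<and> x \<in> C \<and> C \<subseteq> A \<inter> B" if x: "x \<in> A \<inter> B" for x
    proof (intro exI conjI)
      let ?C = "nat_open {lcm m n} \<inter> localic closure_of {x}"
      show "lcm m n > 0"
        using mn by (simp add: lcm_pos_nat)
      show lx: "snat (lcm m n) sdvd x"
        using x A B snat_lcm_sdvd[OF mn] by (auto simp: nat_open_def)
      show "?C = ?C" ..
      show "x \<in> ?C"
        using lx closure_of_subset[of "{x}" localic]
        by (auto simp: nat_open_def topspace_localic)
      have "localic closure_of {x} \<subseteq> localic closure_of {s}"
        "localic closure_of {x} \<subseteq> localic closure_of {t}"
        using x A B by (simp_all add: closure_of_minimal)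
      then show "?C \<subseteq> A \<inter> B"
        unfolding A B nat_open_def using snat_lcm_sdvd[OF mn] by auto
    qed
    then show "(arbitrary union_of ?P) (A \<inter> B)"
      unfolding arbitrary_union_of_alt by blast
  qed
  then show ?thesis
    by (simp add: pcfb_def)
qed

definition big_cell :: "(nat, unit) cat" where
  "big_cell = poset_cat {0<..} (\<lambda>m n. n dvd m)"

definition K_top :: "supernat set \<Rightarrow> nat \<Rightarrow> nat set set" where
  "K_top S n =
     (if n > 0 then {L. is_sieve big_cell n L \<and> nat_open {n} \<inter> S \<subseteq> nat_open L} else {})"

text \<open>The standard equivalence, sending a sheaf \<open>F\<close> to the presheaf \<open>n \<mapsto> F((n))\<close>.\<close>

definition base_sections ::
  "((supernat set, 'u) presheaf, supernat set \<Rightarrow> 'u \<Rightarrow> 'u, (nat, 'u) presheaf, nat \<Rightarrow> 'u \<Rightarrow> 'u) fctr"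
  where
  "base_sections =
     \<lparr>ob = (\<lambda>F. \<lparr>ob = (\<lambda>n. ob F (nat_open {n})), ar = (\<lambda>m n. ar F (nat_open {m}) (nat_open {n}))\<rparr>),
      ar = (\<lambda>F G \<alpha>. \<lambda>n\<in>Obj big_cell. \<alpha> (nat_open {n}))\<rparr>"

text \<open>
  \<open>P\<close> is, up to natural isomorphism, the functor sending \<open>F\<close> to the colimit of the \<open>F(n)\<close>
  over the positive natural numbers \<open>n\<close> dividing \<open>s\<close>. The presheaf \<open>F\<close> is itself the diagram.
\<close>

definition is_stalk_functor ::
  "'u set set \<Rightarrow> ((nat, 'u) presheaf, nat \<Rightarrow> 'u \<Rightarrow> 'u) cat \<Rightarrow> supernat \<Rightarrow>
   ((nat, 'u) presheaf, nat \<Rightarrow> 'u \<Rightarrow> 'u, 'u set, 'u \<Rightarrow> 'u) fctr \<Rightarrow> bool" where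
  "is_stalk_functor U E s P \<longleftrightarrow>
     is_functor E (set_cat U) P \<and>
     (\<exists>\<gamma>. (\<forall>F\<in>Obj E. colimit_cocone (full_subcat (op_cat big_cell) (\<lambda>n. snat n sdvd s)) (set_cat U)
                        F (ob P F) (\<gamma> F)) \<and>
          (\<forall>F\<in>Obj E. \<forall>G\<in>Obj E. \<forall>\<alpha>\<in>Hom E F G. \<forall>n>0. snat n sdvd s \<longrightarrow>
             compose (ob F n) (ar P F G \<alpha>) (\<gamma> F n) = compose (ob F n) (\<gamma> G n) (\<alpha> n)))"

definition point_at ::
  "'u set set \<Rightarrow> ((nat, 'u) presheaf, nat \<Rightarrow> 'u \<Rightarrow> 'u) cat \<Rightarrow> supernat \<Rightarrow>
   ((nat, 'u) presheaf, nat \<Rightarrow> 'u \<Rightarrow> 'u, 'u) point set" where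
  "point_at U E s = {p \<in> points U E. is_stalk_functor U E s (inv_im p)}"

end

theory Submission
  imports Defs
begin

text \<open>
  For an arbitrary topology \<open>J\<close>, a point of the topos of \<open>J\<close>-sheaves is determined by the natural
  numbers \<open>n\<close> whose sheafified representable it does not kill. These are the natural divisors of a
  supernatural number \<open>s\<close>, the point is the stalk at \<open>s\<close>, and the \<open>s\<close> that occur are those in
  \<open>spec = {s. \<forall>n | s. \<forall>L \<in> J n. \<exists>m \<in> L. m | s}\<close>. This set is closed for the pcfb-topology. If the points
  detect isomorphisms, then they detect covers, that is \<open>J = K_top spec\<close>; conversely, the stalks at the
  points of \<open>S\<close> detect isomorphisms of \<open>K_top S\<close>-sheaves, and pcfb-closedness of \<open>S\<close> says exactly
  that no further points occur for \<open>K_top S\<close>. Finally, the sets \<open>nat_open {n} \<inter> S\<close> are a basis of \<open>S\<close>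
  stable under intersection, and \<open>K_top S\<close> is the topology induced on this basis, so that sheaves on
  \<open>S\<close> are \<open>K_top S\<close>-sheaves by restriction to it.
\<close>

section \<open>Categories, adjunctions and equivalences\<close>

text \<open>The obstacle behind much of the detail is smallness: sheaves take values in sets over
  the one type \<open>'u\<close>, in a universe closed only under smaller sets and countable
  products. A sheaf whose sections are of another kind (sets of local sections, families indexed by
  basic opens) is therefore built in its natural type and then coded by partial functions on
  \<open>nat\<close>, which works because the big cell is countable.

  One theory of sheafification, for an arbitrary \<open>J\<close>, is used at several topologies.
  For \<open>K_top UNIV\<close> all presheaves are sheaves, so facts about limits of sheaves serve
  presheaves too. For \<open>K_top {s}\<close> sheaves amount to sets, so that the stalk at
  \<open>s\<close> is sheafification followed by evaluation at 1, and its right adjoint and its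
  exactness are inherited.

  Supernatural numbers enter through exactness: the big cell is a poset with greatest element 1 and
  meets given by \<open>lcm\<close>, so the numbers not killed by an inverse image contain 1 and are
  closed under divisors and \<open>lcm\<close>. Such sets are exactly the sets of natural divisors
  of supernatural numbers.\<close>

lemma cat_id: "is_category C \<Longrightarrow> a \<in> Obj C \<Longrightarrow> Idn C a \<in> Hom C a a"
  by (simp add: is_category_def)

lemma cat_cmp:
  "is_category C \<Longrightarrow> a \<in> Obj C \<Longrightarrow> b \<in> Obj C \<Longrightarrow> c \<in> Obj C \<Longrightarrow>
    f \<in> Hom C a b \<Longrightarrow> g \<in> Hom C b c \<Longrightarrow> Cmp C a b c g f \<in> Hom C a c"
  by (simp add: is_category_def)

lemma cat_idr:
  "is_category C \<Longrightarrow> a \<in> Obj C \<Longrightarrow> b \<in> Obj C \<Longrightarrow> f \<in> Hom C a b \<Longrightarrow> Cmp C a a b f (Idn C a) = f"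
  by (simp add: is_category_def)

lemma cat_idl:
  "is_category C \<Longrightarrow> a \<in> Obj C \<Longrightarrow> b \<in> Obj C \<Longrightarrow> f \<in> Hom C a b \<Longrightarrow> Cmp C a b b (Idn C b) f = f"
  by (simp add: is_category_def)

lemma cat_assoc:
  "is_category C \<Longrightarrow> a \<in> Obj C \<Longrightarrow> b \<in> Obj C \<Longrightarrow> c \<in> Obj C \<Longrightarrow> d \<in> Obj C \<Longrightarrow>
    f \<in> Hom C a b \<Longrightarrow> g \<in> Hom C b c \<Longrightarrow> h \<in> Hom C c d \<Longrightarrow>
    Cmp C a c d h (Cmp C a b c g f) = Cmp C a b d (Cmp C b c d h g) f"
  by (simp add: is_category_def)

lemma fun_ob: "is_functor C D F \<Longrightarrow> a \<in> Obj C \<Longrightarrow> ob F a \<in> Obj D"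
  by (simp add: is_functor_def)

lemma fun_ar:
  "is_functor C D F \<Longrightarrow> a \<in> Obj C \<Longrightarrow> b \<in> Obj C \<Longrightarrow> f \<in> Hom C a b \<Longrightarrow>
    ar F a b f \<in> Hom D (ob F a) (ob F b)"
  by (simp add: is_functor_def)

lemma fun_id: "is_functor C D F \<Longrightarrow> a \<in> Obj C \<Longrightarrow> ar F a a (Idn C a) = Idn D (ob F a)"
  by (simp add: is_functor_def)

lemma fun_cmp:
  "is_functor C D F \<Longrightarrow> a \<in> Obj C \<Longrightarrow> b \<in> Obj C \<Longrightarrow> c \<in> Obj C \<Longrightarrow>
    f \<in> Hom C a b \<Longrightarrow> g \<in> Hom C b c \<Longrightarrow>
    ar F a c (Cmp C a b c g f) = Cmp D (ob F a) (ob F b) (ob F c) (ar F b c g) (ar F a b f)"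
  by (simp add: is_functor_def)

lemma ob_id_fctr [simp]: "ob id_fctr a = a"
  by (simp add: id_fctr_def)

lemma ar_id_fctr [simp]: "ar id_fctr a b f = f"
  by (simp add: id_fctr_def)

lemma ob_comp_fctr [simp]: "ob (comp_fctr G F) a = ob G (ob F a)"
  by (simp add: comp_fctr_def)

lemma ar_comp_fctr [simp]: "ar (comp_fctr G F) a b f = ar G (ob F a) (ob F b) (ar F a b f)"
  by (simp add: comp_fctr_def)

lemma comp_fctr_assoc: "comp_fctr (comp_fctr H G) F = comp_fctr H (comp_fctr G F)"
  by (simp add: comp_fctr_def)

lemma comp_id_fctr [simp]: "comp_fctr id_fctr F = F"
  by (simp add: comp_fctr_def)

lemma comp_fctr_id [simp]: "comp_fctr F id_fctr = F"
  by (simp add: comp_fctr_def)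

lemma is_functor_comp: "is_functor C D F \<Longrightarrow> is_functor D E G \<Longrightarrow> is_functor C E (comp_fctr G F)"
  by (simp add: is_functor_def)

lemma is_category_full_subcat: "is_category C \<Longrightarrow> is_category (full_subcat C P)"
  by (simp add: is_category_def full_subcat_def)

lemma is_category_op_cat: "is_category C \<Longrightarrow> is_category (op_cat C)"
  by (simp add: is_category_def op_cat_def)

lemma is_category_set_cat: "is_category (set_cat U)"
  unfolding is_category_def set_cat_def
  by (auto simp: compose_assoc Id_compose compose_Id PiE_mem compose_def restrict_def PiE_def
      extensional_def fun_eq_iff)

lemma is_category_poset_cat:
  assumes "\<And>a. a \<in> A \<Longrightarrow> le a a" "\<And>a b c. le a b \<Longrightarrow> le b c \<Longrightarrow> le a c"
  shows "is_category (poset_cat A le)"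
  unfolding is_category_def poset_cat_def using assms by (auto split: if_splits)

lemma nat_trans_mem: "is_nat_trans C D F G \<alpha> \<Longrightarrow> a \<in> Obj C \<Longrightarrow> \<alpha> a \<in> Hom D (ob F a) (ob G a)"
  by (simp add: is_nat_trans_def)

lemma nat_trans_nat:
  "is_nat_trans C D F G \<alpha> \<Longrightarrow> a \<in> Obj C \<Longrightarrow> b \<in> Obj C \<Longrightarrow> f \<in> Hom C a b \<Longrightarrow>
    Cmp D (ob F a) (ob F b) (ob G b) (\<alpha> b) (ar F a b f) =
    Cmp D (ob F a) (ob G a) (ob G b) (ar G a b f) (\<alpha> a)"
  by (simp add: is_nat_trans_def)

lemma is_category_functor_cat:
  assumes C: "is_category C" and D: "is_category D"
  shows "is_category (functor_cat C D)"
proof -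
  let ?F = "functor_cat C D"
  have id: "is_nat_trans C D F F (\<lambda>a\<in>Obj C. Idn D (ob F a))" if "is_functor C D F" for F
    unfolding is_nat_trans_def using that D
    by (simp add: fun_ob cat_id cat_idl[OF D] cat_idr[OF D] fun_ar)
  have cmp: "is_nat_trans C D F H (\<lambda>a\<in>Obj C. Cmp D (ob F a) (ob G a) (ob H a) (\<beta> a) (\<alpha> a))"
    if F: "is_functor C D F" and G: "is_functor C D G" and H: "is_functor C D H"
      and \<alpha>: "is_nat_trans C D F G \<alpha>" and \<beta>: "is_nat_trans C D G H \<beta>" for F G H \<alpha> \<beta>
    unfolding is_nat_trans_def
  proof (intro conjI ballI)
    fix a b f assume a: "a \<in> Obj C" and b: "b \<in> Obj C" and f: "f \<in> Hom C a b"
    note o = fun_ob[OF F a] fun_ob[OF F b] fun_ob[OF G a] fun_ob[OF G b] fun_ob[OF H a] fun_ob[OF H b]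
    note m = nat_trans_mem[OF \<alpha> a] nat_trans_mem[OF \<alpha> b] nat_trans_mem[OF \<beta> a] nat_trans_mem[OF \<beta> b]
      fun_ar[OF F a b f] fun_ar[OF G a b f] fun_ar[OF H a b f]
    have "Cmp D (ob F a) (ob F b) (ob H b) (Cmp D (ob F b) (ob G b) (ob H b) (\<beta> b) (\<alpha> b)) (ar F a b f) =
        Cmp D (ob F a) (ob G b) (ob H b) (\<beta> b) (Cmp D (ob F a) (ob F b) (ob G b) (\<alpha> b) (ar F a b f))"
      using o m by (simp add: cat_assoc[OF D])
    also have "\<dots> = Cmp D (ob F a) (ob G a) (ob H b) (Cmp D (ob G a) (ob G b) (ob H b) (\<beta> b) (ar G a b f)) (\<alpha> a)"
      using o m by (simp add: nat_trans_nat[OF \<alpha> a b f] cat_assoc[OF D])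
    also have "\<dots> = Cmp D (ob F a) (ob H a) (ob H b) (ar H a b f) (Cmp D (ob F a) (ob G a) (ob H a) (\<beta> a) (\<alpha> a))"
      using o m by (simp add: nat_trans_nat[OF \<beta> a b f] cat_assoc[OF D])
    finally show "Cmp D (ob F a) (ob F b) (ob H b) ((\<lambda>a\<in>Obj C. Cmp D (ob F a) (ob G a) (ob H a) (\<beta> a) (\<alpha> a)) b) (ar F a b f) =
        Cmp D (ob F a) (ob H a) (ob H b) (ar H a b f) ((\<lambda>a\<in>Obj C. Cmp D (ob F a) (ob G a) (ob H a) (\<beta> a) (\<alpha> a)) a)"
      using a b by simp
  next
    fix a assume a: "a \<in> Obj C"
    show "(\<lambda>a\<in>Obj C. Cmp D (ob F a) (ob G a) (ob H a) (\<beta> a) (\<alpha> a)) a \<in> Hom D (ob F a) (ob H a)"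
      using a cat_cmp[OF D fun_ob[OF F a] fun_ob[OF G a] fun_ob[OF H a] nat_trans_mem[OF \<alpha> a] nat_trans_mem[OF \<beta> a]]
      by simp
  qed simp
  show ?thesis
    unfolding is_category_def
  proof (intro conjI ballI)
    fix F G \<alpha> assume "F \<in> Obj ?F" "G \<in> Obj ?F" "\<alpha> \<in> Hom ?F F G"
    then have F: "is_functor C D F" and G: "is_functor C D G" and \<alpha>: "is_nat_trans C D F G \<alpha>"
      by (auto simp: functor_cat_def)
    then have ext: "\<alpha> \<in> extensional (Obj C)"
      by (simp add: is_nat_trans_def)
    show "Cmp ?F F F G \<alpha> (Idn ?F F) = \<alpha>"
      by (rule extensionalityI[OF _ ext])
        (simp_all add: functor_cat_def cat_idr[OF D fun_ob[OF F] fun_ob[OF G] nat_trans_mem[OF \<alpha>]])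
    show "Cmp ?F F G G (Idn ?F G) \<alpha> = \<alpha>"
      by (rule extensionalityI[OF _ ext])
        (simp_all add: functor_cat_def cat_idl[OF D fun_ob[OF F] fun_ob[OF G] nat_trans_mem[OF \<alpha>]])
  next
    fix F G H K \<alpha> \<beta> \<gamma>
    assume "F \<in> Obj ?F" "G \<in> Obj ?F" "H \<in> Obj ?F" "K \<in> Obj ?F"
      "\<alpha> \<in> Hom ?F F G" "\<beta> \<in> Hom ?F G H" "\<gamma> \<in> Hom ?F H K"
    then have F: "is_functor C D F" "is_functor C D G" "is_functor C D H" "is_functor C D K"
      and m: "is_nat_trans C D F G \<alpha>" "is_nat_trans C D G H \<beta>" "is_nat_trans C D H K \<gamma>"
      by (auto simp: functor_cat_def)
    have "Cmp D (ob F a) (ob H a) (ob K a) (\<gamma> a) (Cmp D (ob F a) (ob G a) (ob H a) (\<beta> a) (\<alpha> a)) =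
        Cmp D (ob F a) (ob G a) (ob K a) (Cmp D (ob G a) (ob H a) (ob K a) (\<gamma> a) (\<beta> a)) (\<alpha> a)"
      if "a \<in> Obj C" for a
      using that by (intro cat_assoc[OF D] fun_ob[OF F(1)] fun_ob[OF F(2)] fun_ob[OF F(3)] fun_ob[OF F(4)]
          nat_trans_mem[OF m(1)] nat_trans_mem[OF m(2)] nat_trans_mem[OF m(3)])
    then show "Cmp ?F F H K \<gamma> (Cmp ?F F G H \<beta> \<alpha>) = Cmp ?F F G K (Cmp ?F G H K \<gamma> \<beta>) \<alpha>"
      by (auto simp: functor_cat_def intro!: restrict_ext)
  qed (auto simp: functor_cat_def id cmp)
qed

text \<open>Whiskering. In the final square it cancels \<open>H\<close> against its quasi-inverse in
  front of \<open>comp_fctr a base_sections\<close>.\<close>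

lemma isomorphic_functors_comp_right:
  assumes "is_functor B C K" and "isomorphic_functors C D F G"
  shows "isomorphic_functors B D (comp_fctr F K) (comp_fctr G K)"
proof -
  obtain \<alpha> where \<alpha>: "is_nat_trans C D F G \<alpha>" "\<And>a. a \<in> Obj C \<Longrightarrow> is_iso D (ob F a) (ob G a) (\<alpha> a)"
    using assms(2) by (auto simp: isomorphic_functors_def)
  show ?thesis
    unfolding isomorphic_functors_def
    by (rule exI[of _ "\<lambda>b\<in>Obj B. \<alpha> (ob K b)"])
      (use assms(1) \<alpha> in \<open>auto simp: is_nat_trans_def fun_ob fun_ar\<close>)
qed

lemma fully_faithfulD:
  assumes "fully_faithful C D F" "a \<in> Obj C" "b \<in> Obj C"
  shows "inj_on (ar F a b) (Hom C a b)"
    and "h \<in> Hom D (ob F a) (ob F b) \<Longrightarrow> \<exists>f\<in>Hom C a b. ar F a b f = h"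
proof -
  have *: "inj_on (ar F a b) (Hom C a b) \<and> ar F a b ` Hom C a b = Hom D (ob F a) (ob F b)"
    using assms by (simp add: fully_faithful_def bij_betw_def)
  then show "inj_on (ar F a b) (Hom C a b)" ..
  show "\<exists>f\<in>Hom C a b. ar F a b f = h" if "h \<in> Hom D (ob F a) (ob F b)"
  proof -
    have "h \<in> ar F a b ` Hom C a b"
      using * that by simp
    then show ?thesis
      by auto
  qed
qed

section \<open>Adjunctions: one-variable naturality, universal arrows, limits, composition and
  restriction\<close>

lemma adjointE:
  assumes C: "is_category C" and D: "is_category D" and adj: "adjoint C D L R"
  obtains \<phi> where "is_functor C D L" "is_functor D C R"
    "\<And>c d. c \<in> Obj C \<Longrightarrow> d \<in> Obj D \<Longrightarrow> bij_betw (\<phi> c d) (Hom D (ob L c) d) (Hom C c (ob R d))"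
    "\<And>c c' d d' h k g. c \<in> Obj C \<Longrightarrow> c' \<in> Obj C \<Longrightarrow> d \<in> Obj D \<Longrightarrow> d' \<in> Obj D \<Longrightarrow>
      h \<in> Hom C c' c \<Longrightarrow> k \<in> Hom D d d' \<Longrightarrow> g \<in> Hom D (ob L c) d \<Longrightarrow>
      \<phi> c' d' (Cmp D (ob L c') d d' k (Cmp D (ob L c') (ob L c) d g (ar L c' c h))) =
      Cmp C c' (ob R d) (ob R d') (ar R d d' k) (Cmp C c' c (ob R d) (\<phi> c d g) h)"
    "\<And>c d d' k g. c \<in> Obj C \<Longrightarrow> d \<in> Obj D \<Longrightarrow> d' \<in> Obj D \<Longrightarrow> k \<in> Hom D d d' \<Longrightarrow> g \<in> Hom D (ob L c) d \<Longrightarrow>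
      \<phi> c d' (Cmp D (ob L c) d d' k g) = Cmp C c (ob R d) (ob R d') (ar R d d' k) (\<phi> c d g)"
    "\<And>c c' d h g. c \<in> Obj C \<Longrightarrow> c' \<in> Obj C \<Longrightarrow> d \<in> Obj D \<Longrightarrow> h \<in> Hom C c' c \<Longrightarrow> g \<in> Hom D (ob L c) d \<Longrightarrow>
      \<phi> c' d (Cmp D (ob L c') (ob L c) d g (ar L c' c h)) = Cmp C c' c (ob R d) (\<phi> c d g) h"
proof -
  obtain \<phi> where L: "is_functor C D L" and R: "is_functor D C R" and
    bij: "\<And>c d. c \<in> Obj C \<Longrightarrow> d \<in> Obj D \<Longrightarrow> bij_betw (\<phi> c d) (Hom D (ob L c) d) (Hom C c (ob R d))" and
    nat: "\<And>c c' d d' h k g. c \<in> Obj C \<Longrightarrow> c' \<in> Obj C \<Longrightarrow> d \<in> Obj D \<Longrightarrow> d' \<in> Obj D \<Longrightarrow>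
      h \<in> Hom C c' c \<Longrightarrow> k \<in> Hom D d d' \<Longrightarrow> g \<in> Hom D (ob L c) d \<Longrightarrow>
      \<phi> c' d' (Cmp D (ob L c') d d' k (Cmp D (ob L c') (ob L c) d g (ar L c' c h))) =
      Cmp C c' (ob R d) (ob R d') (ar R d d' k) (Cmp C c' c (ob R d) (\<phi> c d g) h)"
    using adj unfolding adjoint_def by blast
  have mem: "\<phi> c d g \<in> Hom C c (ob R d)" if "c \<in> Obj C" "d \<in> Obj D" "g \<in> Hom D (ob L c) d" for c d g
    using bij_betw_apply[OF bij[OF that(1,2)] that(3)] .
  \<comment> \<open>The definition of \<open>adjoint\<close> states naturality in both variables at
    once; putting an identity for \<open>h\<close> here, and for \<open>k\<close> in
    \<open>natl\<close>, separates the two laws.\<close>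
  have natr: "\<phi> c d' (Cmp D (ob L c) d d' k g) = Cmp C c (ob R d) (ob R d') (ar R d d' k) (\<phi> c d g)"
    if o: "c \<in> Obj C" "d \<in> Obj D" "d' \<in> Obj D" and k: "k \<in> Hom D d d'" and g: "g \<in> Hom D (ob L c) d" for c d d' k g
    using nat[OF o(1) o(1) o(2,3) cat_id[OF C o(1)] k g] o g mem[OF o(1,2) g]
    by (simp add: fun_id[OF L] fun_ob[OF L] fun_ob[OF R] cat_idr[OF D] cat_idr[OF C])
  have natl: "\<phi> c' d (Cmp D (ob L c') (ob L c) d g (ar L c' c h)) = Cmp C c' c (ob R d) (\<phi> c d g) h"
    if o: "c \<in> Obj C" "c' \<in> Obj C" "d \<in> Obj D" and h: "h \<in> Hom C c' c" and g: "g \<in> Hom D (ob L c) d" for c c' d h g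
  proof -
    have "Cmp D (ob L c') (ob L c) d g (ar L c' c h) \<in> Hom D (ob L c') d"
      using o h g L by (auto intro!: cat_cmp[OF D] fun_ob fun_ar)
    note l = cat_idl[OF D fun_ob[OF L o(2)] o(3) this]
    have "Cmp C c' c (ob R d) (\<phi> c d g) h \<in> Hom C c' (ob R d)"
      using o h mem[OF o(1,3) g] R by (auto intro!: cat_cmp[OF C] fun_ob)
    note r = cat_idl[OF C o(2) fun_ob[OF R o(3)] this]
    show ?thesis
      using nat[OF o(1,2) o(3) o(3) h cat_id[OF D o(3)] g] unfolding fun_id[OF R o(3)] l r .
  qed
  show thesis
    by (rule that[OF L R bij nat natr natl])
qed

text \<open>The usual construction of a left adjoint from universal arrows. Naturality of the unit
  stays in the conclusion because both applications, sheafification and quasi-inverses, compute with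
  \<open>L\<close> on arrows only through it.\<close>

lemma adjoint_of_universal:
  assumes C: "is_category C" and D: "is_category D" and R: "is_functor D C R"
    and L0: "\<And>c. c \<in> Obj C \<Longrightarrow> L0 c \<in> Obj D"
    and \<eta>: "\<And>c. c \<in> Obj C \<Longrightarrow> \<eta> c \<in> Hom C c (ob R (L0 c))"
    and univ: "\<And>c d h. c \<in> Obj C \<Longrightarrow> d \<in> Obj D \<Longrightarrow> h \<in> Hom C c (ob R d) \<Longrightarrow>
      \<exists>!k. k \<in> Hom D (L0 c) d \<and> Cmp C c (ob R (L0 c)) (ob R d) (ar R (L0 c) d k) (\<eta> c) = h"
  shows "\<exists>L. adjoint C D L R \<and> ob L = L0 \<and>
    (\<forall>c\<in>Obj C. \<forall>c'\<in>Obj C. \<forall>f\<in>Hom C c c'.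
      Cmp C c (ob R (L0 c)) (ob R (L0 c')) (ar R (L0 c) (L0 c') (ar L c c' f)) (\<eta> c) = Cmp C c c' (ob R (L0 c')) (\<eta> c') f)"
proof -
  \<comment> \<open>\<open>T c d k\<close> is the transpose of \<open>k\<close> under the adjunction
    to be built; by \<open>univ\<close> transposition is injective, and every equation between
    arrows out of \<open>L0 c\<close> below is proved by comparing transposes.\<close>
  define T where "T c d k = Cmp C c (ob R (L0 c)) (ob R d) (ar R (L0 c) d k) (\<eta> c)" for c d k
  have RO: "ob R d \<in> Obj C" if "d \<in> Obj D" for d
    using R that by (rule fun_ob)
  note RA = fun_ar[OF R]
  have T: "T c d k \<in> Hom C c (ob R d)" if "c \<in> Obj C" "d \<in> Obj D" "k \<in> Hom D (L0 c) d" for c d k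
    unfolding T_def using that by (intro cat_cmp[OF C] RO RA L0 \<eta>)
  have Tinj: "k = k'" if "c \<in> Obj C" "d \<in> Obj D" "k \<in> Hom D (L0 c) d" "k' \<in> Hom D (L0 c) d" "T c d k = T c d k'" for c d k k'
    using univ[OF that(1,2) T[OF that(1,2,3)]] that(3-5) unfolding T_def[symmetric] by (auto elim!: ex1E)
  have Tcmp: "T c d' (Cmp D (L0 c) d d' k g) = Cmp C c (ob R d) (ob R d') (ar R d d' k) (T c d g)"
    if "c \<in> Obj C" "d \<in> Obj D" "d' \<in> Obj D" "g \<in> Hom D (L0 c) d" "k \<in> Hom D d d'" for c d d' g k
    unfolding T_def using that
    by (simp add: fun_cmp[OF R] L0 cat_assoc[OF C] RO RA \<eta>)
  \<comment> \<open>The action on arrows is forced: the image of \<open>f\<close> must be the arrow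
    whose transpose is the unit after \<open>f\<close>.\<close>
  define A where "A c c' f = (THE k. k \<in> Hom D (L0 c) (L0 c') \<and> T c (L0 c') k = Cmp C c c' (ob R (L0 c')) (\<eta> c') f)" for c c' f
  have A: "A c c' f \<in> Hom D (L0 c) (L0 c')" "T c (L0 c') (A c c' f) = Cmp C c c' (ob R (L0 c')) (\<eta> c') f"
    if *: "c \<in> Obj C" "c' \<in> Obj C" "f \<in> Hom C c c'" for c c' f
  proof -
    have "Cmp C c c' (ob R (L0 c')) (\<eta> c') f \<in> Hom C c (ob R (L0 c'))"
      using * by (intro cat_cmp[OF C] RO L0 \<eta>)
    from theI'[OF univ[OF *(1) L0[OF *(2)] this]]
    show "A c c' f \<in> Hom D (L0 c) (L0 c')" "T c (L0 c') (A c c' f) = Cmp C c c' (ob R (L0 c')) (\<eta> c') f"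
      unfolding A_def T_def by auto
  qed
  define L where "L = \<lparr>ob = L0, ar = A\<rparr>"
  have L: "is_functor C D L"
    unfolding is_functor_def L_def fctr.simps
  proof (intro conjI ballI)
    fix c assume c: "c \<in> Obj C"
    have i: "Idn D (L0 c) \<in> Hom D (L0 c) (L0 c)"
      using c D L0 by (simp add: cat_id)
    have "T c (L0 c) (Idn D (L0 c)) = \<eta> c"
      unfolding T_def using c by (simp add: fun_id[OF R] L0 cat_idl[OF C] RO \<eta>)
    then show "A c c (Idn C c) = Idn D (L0 c)"
      using c i A[of c c "Idn C c"] cat_id[OF C c]
      by (intro Tinj[of c "L0 c"]) (auto simp: L0 cat_idr[OF C] RO \<eta>)
  next
    fix a b c f g assume o: "a \<in> Obj C" "b \<in> Obj C" "c \<in> Obj C" and f: "f \<in> Hom C a b" and g: "g \<in> Hom C b c"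
    note Af = A[OF o(1,2) f] and Ag = A[OF o(2,3) g]
    have gf: "Cmp C a b c g f \<in> Hom C a c"
      using o f g by (intro cat_cmp[OF C])
    note Agf = A[OF o(1,3) gf]
    have "T a (L0 c) (Cmp D (L0 a) (L0 b) (L0 c) (A b c g) (A a b f)) =
        Cmp C a (ob R (L0 b)) (ob R (L0 c)) (ar R (L0 b) (L0 c) (A b c g)) (Cmp C a b (ob R (L0 b)) (\<eta> b) f)"
      using o Af Ag by (simp add: Tcmp L0)
    also have "\<dots> = Cmp C a b (ob R (L0 c)) (T b (L0 c) (A b c g)) f"
      unfolding T_def using o Af Ag f by (simp add: cat_assoc[OF C] RO L0 \<eta> RA)
    also have "\<dots> = T a (L0 c) (A a c (Cmp C a b c g f))"
      using o Ag Agf f g by (simp add: cat_assoc[OF C] RO L0 \<eta>)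
    finally show "A a c (Cmp C a b c g f) = Cmp D (L0 a) (L0 b) (L0 c) (A b c g) (A a b f)"
      using o Agf Af Ag by (intro Tinj[of a "L0 c"]) (auto intro: cat_cmp[OF D] L0)
  qed (auto simp: L0 A)
  have "adjoint C D L R"
    unfolding adjoint_def
  proof (intro conjI L R exI[of _ T] ballI)
    fix c d assume *: "c \<in> Obj C" "d \<in> Obj D"
    show "bij_betw (T c d) (Hom D (ob L c) d) (Hom C c (ob R d))"
      unfolding bij_betw_def
    proof (intro conjI inj_onI equalityI subsetI)
      fix h assume "h \<in> Hom C c (ob R d)"
      from univ[OF * this] show "h \<in> T c d ` Hom D (ob L c) d"
        unfolding T_def L_def by auto
    qed (use * in \<open>auto simp: L_def intro: T Tinj\<close>)
  next
    fix c c' d d' h k g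
    assume o: "c \<in> Obj C" "c' \<in> Obj C" "d \<in> Obj D" "d' \<in> Obj D"
      and h: "h \<in> Hom C c' c" and k: "k \<in> Hom D d d'" and "g \<in> Hom D (ob L c) d"
    then have g: "g \<in> Hom D (L0 c) d" by (simp add: L_def)
    note Ah = A[OF o(2,1) h]
    have "T c' d (Cmp D (L0 c') (L0 c) d g (A c' c h)) = Cmp C c' c (ob R d) (T c d g) h"
      using o h g Ah by (simp add: Tcmp L0) (simp add: T_def cat_assoc[OF C] RO L0 \<eta> RA)
    then show "T c' d' (Cmp D (ob L c') d d' k (Cmp D (ob L c') (ob L c) d g (ar L c' c h))) =
        Cmp C c' (ob R d) (ob R d') (ar R d d' k) (Cmp C c' c (ob R d) (T c d g) h)"
      using o k g Ah by (simp add: L_def Tcmp L0 cat_cmp[OF D])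
  qed
  then show ?thesis
    by (rule exI[of _ L, OF conjI]) (use A(2) in \<open>auto simp: L_def T_def\<close>)
qed

text \<open>A cone over the image of \<open>\<Delta>\<close> is transposed to a cone over
  \<open>\<Delta>\<close> with vertex \<open>ob L y\<close>, factored there, and transposed back.
  This supplies exactness of the inclusion of sheaves into presheaves and of every equivalence, an
  equivalence being also a right adjoint.\<close>

lemma right_adjoint_left_exact:
  assumes C: "is_category C" and D: "is_category D" and adj: "adjoint C D L R"
  shows "left_exact D C R"
  unfolding left_exact_def
proof (intro allI impI, elim conjE)
  fix J :: "(nat, nat) cat" and \<Delta> x \<pi>
  assume J: "finite_category J" and \<Delta>: "is_functor J D \<Delta>" and lim: "limit_cone J D \<Delta> x \<pi>"
  obtain \<phi> where L: "is_functor C D L" and R: "is_functor D C R" and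
    bij: "\<And>c d. c \<in> Obj C \<Longrightarrow> d \<in> Obj D \<Longrightarrow> bij_betw (\<phi> c d) (Hom D (ob L c) d) (Hom C c (ob R d))" and
    natr: "\<And>c d d' k g. c \<in> Obj C \<Longrightarrow> d \<in> Obj D \<Longrightarrow> d' \<in> Obj D \<Longrightarrow> k \<in> Hom D d d' \<Longrightarrow> g \<in> Hom D (ob L c) d \<Longrightarrow>
      \<phi> c d' (Cmp D (ob L c) d d' k g) = Cmp C c (ob R d) (ob R d') (ar R d d' k) (\<phi> c d g)"
    by (rule adjointE[OF C D adj]) metis
  have x: "x \<in> Obj D" and \<pi>: "\<And>j. j \<in> Obj J \<Longrightarrow> \<pi> j \<in> Hom D x (ob \<Delta> j)"
    and \<pi>c: "\<And>j k u. j \<in> Obj J \<Longrightarrow> k \<in> Obj J \<Longrightarrow> u \<in> Hom J j k \<Longrightarrow> Cmp D x (ob \<Delta> j) (ob \<Delta> k) (ar \<Delta> j k u) (\<pi> j) = \<pi> k"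
    and uni: "\<And>y \<rho>. y \<in> Obj D \<Longrightarrow> \<forall>j\<in>Obj J. \<rho> j \<in> Hom D y (ob \<Delta> j) \<Longrightarrow>
      \<forall>j\<in>Obj J. \<forall>k\<in>Obj J. \<forall>u\<in>Hom J j k. Cmp D y (ob \<Delta> j) (ob \<Delta> k) (ar \<Delta> j k u) (\<rho> j) = \<rho> k \<Longrightarrow>
      \<exists>!f. f \<in> Hom D y x \<and> (\<forall>j\<in>Obj J. Cmp D y x (ob \<Delta> j) (\<pi> j) f = \<rho> j)"
    using lim unfolding limit_cone_def Let_def by blast+
  have \<Delta>o: "ob \<Delta> j \<in> Obj D" if "j \<in> Obj J" for j
    using \<Delta> that by (rule fun_ob)
  have Rx: "ob R x \<in> Obj C" using R x by (rule fun_ob)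
  show "limit_cone J C (comp_fctr R \<Delta>) (ob R x) (\<lambda>j. ar R x (ob \<Delta> j) (\<pi> j))"
    unfolding limit_cone_def Let_def ob_comp_fctr ar_comp_fctr
  proof (intro conjI ballI allI impI Rx; (elim conjE)?)
    fix j k u assume jk: "j \<in> Obj J" "k \<in> Obj J" "u \<in> Hom J j k"
    have "ar R x (ob \<Delta> k) (Cmp D x (ob \<Delta> j) (ob \<Delta> k) (ar \<Delta> j k u) (\<pi> j)) = ar R x (ob \<Delta> k) (\<pi> k)"
      using \<pi>c jk by simp
    then show "Cmp C (ob R x) (ob R (ob \<Delta> j)) (ob R (ob \<Delta> k)) (ar R (ob \<Delta> j) (ob \<Delta> k) (ar \<Delta> j k u))
        (ar R x (ob \<Delta> j) (\<pi> j)) = ar R x (ob \<Delta> k) (\<pi> k)"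
      using jk x \<Delta>o \<pi> by (simp add: fun_cmp[OF R] fun_ar[OF \<Delta>])
  next
    fix y \<rho> assume y: "y \<in> Obj C" and \<rho>: "\<forall>j\<in>Obj J. \<rho> j \<in> Hom C y (ob R (ob \<Delta> j))"
      and \<rho>c: "\<forall>j\<in>Obj J. \<forall>k\<in>Obj J. \<forall>u\<in>Hom J j k. Cmp C y (ob R (ob \<Delta> j)) (ob R (ob \<Delta> k)) (ar R (ob \<Delta> j) (ob \<Delta> k) (ar \<Delta> j k u)) (\<rho> j) = \<rho> k"
    have Ly: "ob L y \<in> Obj D" using L y by (rule fun_ob)
    \<comment> \<open>The transposed cone. That it is a cone again follows from naturality of
      \<open>\<phi>\<close> in the second variable and injectivity of transposition.\<close>
    define \<sigma> where "\<sigma> j = inv_into (Hom D (ob L y) (ob \<Delta> j)) (\<phi> y (ob \<Delta> j)) (\<rho> j)" for j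
    have \<sigma>: "\<sigma> j \<in> Hom D (ob L y) (ob \<Delta> j)" "\<phi> y (ob \<Delta> j) (\<sigma> j) = \<rho> j" if "j \<in> Obj J" for j
      using bij[OF y \<Delta>o[OF that]] \<rho> that unfolding \<sigma>_def bij_betw_def
      by (auto intro: inv_into_into f_inv_into_f)
    have "\<forall>j\<in>Obj J. \<forall>k\<in>Obj J. \<forall>u\<in>Hom J j k. Cmp D (ob L y) (ob \<Delta> j) (ob \<Delta> k) (ar \<Delta> j k u) (\<sigma> j) = \<sigma> k"
    proof (intro ballI)
      fix j k u assume jk: "j \<in> Obj J" "k \<in> Obj J" "u \<in> Hom J j k"
      have m: "ar \<Delta> j k u \<in> Hom D (ob \<Delta> j) (ob \<Delta> k)" using fun_ar[OF \<Delta>] jk by simp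
      have "\<phi> y (ob \<Delta> k) (Cmp D (ob L y) (ob \<Delta> j) (ob \<Delta> k) (ar \<Delta> j k u) (\<sigma> j)) = \<phi> y (ob \<Delta> k) (\<sigma> k)"
        using natr[OF y \<Delta>o[OF jk(1)] \<Delta>o[OF jk(2)] m \<sigma>(1)[OF jk(1)]] jk \<sigma>(2) \<rho>c by simp
      then show "Cmp D (ob L y) (ob \<Delta> j) (ob \<Delta> k) (ar \<Delta> j k u) (\<sigma> j) = \<sigma> k"
        using bij[OF y \<Delta>o[OF jk(2)]] jk \<sigma>(1) m Ly \<Delta>o
        by (auto simp: bij_betw_def inj_on_def cat_cmp[OF D])
    qed
    then obtain f where f: "f \<in> Hom D (ob L y) x" "\<And>j. j \<in> Obj J \<Longrightarrow> Cmp D (ob L y) x (ob \<Delta> j) (\<pi> j) f = \<sigma> j"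
      and funi: "\<And>g. g \<in> Hom D (ob L y) x \<Longrightarrow> \<forall>j\<in>Obj J. Cmp D (ob L y) x (ob \<Delta> j) (\<pi> j) g = \<sigma> j \<Longrightarrow> g = f"
      using uni[OF Ly, of \<sigma>] \<sigma>(1) by blast
    show "\<exists>!f. f \<in> Hom C y (ob R x) \<and>
        (\<forall>j\<in>Obj J. Cmp C y (ob R x) (ob R (ob \<Delta> j)) (ar R x (ob \<Delta> j) (\<pi> j)) f = \<rho> j)"
    proof (rule ex1I[of _ "\<phi> y x f"], intro conjI ballI)
      show "\<phi> y x f \<in> Hom C y (ob R x)"
        using bij[OF y x] f by (auto simp: bij_betw_def)
      show "Cmp C y (ob R x) (ob R (ob \<Delta> j)) (ar R x (ob \<Delta> j) (\<pi> j)) (\<phi> y x f) = \<rho> j" if "j \<in> Obj J" for j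
        using natr[OF y x \<Delta>o[OF that] \<pi>[OF that] f(1)] f(2) \<sigma>(2) that by simp
    next
      fix g assume g: "g \<in> Hom C y (ob R x) \<and>
        (\<forall>j\<in>Obj J. Cmp C y (ob R x) (ob R (ob \<Delta> j)) (ar R x (ob \<Delta> j) (\<pi> j)) g = \<rho> j)"
      then obtain g' where g': "g' \<in> Hom D (ob L y) x" "\<phi> y x g' = g"
        using bij_betw_imp_surj_on[OF bij[OF y x]] by (metis imageE)
      have "Cmp D (ob L y) x (ob \<Delta> j) (\<pi> j) g' = \<sigma> j" if j: "j \<in> Obj J" for j
      proof -
        have "\<phi> y (ob \<Delta> j) (Cmp D (ob L y) x (ob \<Delta> j) (\<pi> j) g') = \<phi> y (ob \<Delta> j) (\<sigma> j)"
          using natr[OF y x \<Delta>o[OF j] \<pi>[OF j] g'(1)] g' \<sigma>(2) j g by simp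
        then show ?thesis
          using bij[OF y \<Delta>o[OF j]] \<sigma>(1) j g'(1) Ly \<Delta>o x \<pi>
          by (auto simp: bij_betw_def inj_on_def cat_cmp[OF D])
      qed
      then show "g = \<phi> y x f"
        using funi[OF g'(1)] g'(2) by blast
    qed
  qed (use x \<Delta>o \<pi> in \<open>auto intro!: fun_ar[OF R]\<close>)
qed

lemma left_exact_comp:
  assumes "is_functor C D F" "left_exact C D F" "left_exact D E G"
  shows "left_exact C E (comp_fctr G F)"
  unfolding left_exact_def
proof (intro allI impI, elim conjE)
  fix J :: "(nat, nat) cat" and \<Delta> x \<pi>
  assume J: "finite_category J" and \<Delta>: "is_functor J C \<Delta>" and lim: "limit_cone J C \<Delta> x \<pi>"
  have "limit_cone J D (comp_fctr F \<Delta>) (ob F x) (\<lambda>j. ar F x (ob \<Delta> j) (\<pi> j))"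
    using assms(2) J \<Delta> lim unfolding left_exact_def by blast
  then have "limit_cone J E (comp_fctr G (comp_fctr F \<Delta>)) (ob G (ob F x))
      (\<lambda>j. ar G (ob F x) (ob (comp_fctr F \<Delta>) j) (ar F x (ob \<Delta> j) (\<pi> j)))"
    using assms(3) J is_functor_comp[OF \<Delta> assms(1)] unfolding left_exact_def by blast
  then show "limit_cone J E (comp_fctr (comp_fctr G F) \<Delta>) (ob (comp_fctr G F) x)
      (\<lambda>j. ar (comp_fctr G F) x (ob \<Delta> j) (\<pi> j))"
    by (simp add: comp_fctr_assoc)
qed

lemma adjoint_comp:
  assumes C: "is_category C" and D: "is_category D" and E: "is_category E"
    and adj: "adjoint C D L R" and adj': "adjoint D E L' R'"
  shows "adjoint C E (comp_fctr L' L) (comp_fctr R R')"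
proof -
  obtain \<phi> where L: "is_functor C D L" and R: "is_functor D C R" and
    bij: "\<And>c d. c \<in> Obj C \<Longrightarrow> d \<in> Obj D \<Longrightarrow> bij_betw (\<phi> c d) (Hom D (ob L c) d) (Hom C c (ob R d))" and
    nat: "\<And>c c' d d' h k g. c \<in> Obj C \<Longrightarrow> c' \<in> Obj C \<Longrightarrow> d \<in> Obj D \<Longrightarrow> d' \<in> Obj D \<Longrightarrow>
      h \<in> Hom C c' c \<Longrightarrow> k \<in> Hom D d d' \<Longrightarrow> g \<in> Hom D (ob L c) d \<Longrightarrow>
      \<phi> c' d' (Cmp D (ob L c') d d' k (Cmp D (ob L c') (ob L c) d g (ar L c' c h))) =
      Cmp C c' (ob R d) (ob R d') (ar R d d' k) (Cmp C c' c (ob R d) (\<phi> c d g) h)"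
    by (rule adjointE[OF C D adj]) metis
  obtain \<psi> where L': "is_functor D E L'" and R': "is_functor E D R'" and
    bij': "\<And>c d. c \<in> Obj D \<Longrightarrow> d \<in> Obj E \<Longrightarrow> bij_betw (\<psi> c d) (Hom E (ob L' c) d) (Hom D c (ob R' d))" and
    nat': "\<And>c c' d d' h k g. c \<in> Obj D \<Longrightarrow> c' \<in> Obj D \<Longrightarrow> d \<in> Obj E \<Longrightarrow> d' \<in> Obj E \<Longrightarrow>
      h \<in> Hom D c' c \<Longrightarrow> k \<in> Hom E d d' \<Longrightarrow> g \<in> Hom E (ob L' c) d \<Longrightarrow>
      \<psi> c' d' (Cmp E (ob L' c') d d' k (Cmp E (ob L' c') (ob L' c) d g (ar L' c' c h))) =
      Cmp D c' (ob R' d) (ob R' d') (ar R' d d' k) (Cmp D c' c (ob R' d) (\<psi> c d g) h)"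
    by (rule adjointE[OF D E adj']) metis
  have bb: "\<And>c d. c \<in> Obj C \<Longrightarrow> d \<in> Obj E \<Longrightarrow> bij_betw (\<lambda>g. \<phi> c (ob R' d) (\<psi> (ob L c) d g))
     (Hom E (ob L' (ob L c)) d) (Hom C c (ob R (ob R' d)))"
    using bij_betw_trans[OF bij' bij] L R' by (auto simp: fun_ob comp_def)
  show ?thesis
    unfolding adjoint_def ob_comp_fctr ar_comp_fctr
  proof (intro conjI exI[of _ "\<lambda>c e g. \<phi> c (ob R' e) (\<psi> (ob L c) e g)"] ballI)
    fix c c' d d' h k g
    assume o: "c \<in> Obj C" "c' \<in> Obj C" "d \<in> Obj E" "d' \<in> Obj E"
      and h: "h \<in> Hom C c' c" and k: "k \<in> Hom E d d'" and g: "g \<in> Hom E (ob L' (ob L c)) d"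
    have o': "ob L c \<in> Obj D" "ob L c' \<in> Obj D" "ob R' d \<in> Obj D" "ob R' d' \<in> Obj D"
      using o L R' by (auto simp: fun_ob)
    have Lh: "ar L c' c h \<in> Hom D (ob L c') (ob L c)" and Rk: "ar R' d d' k \<in> Hom D (ob R' d) (ob R' d')"
      using o h k fun_ar[OF L] fun_ar[OF R'] by auto
    have \<psi>g: "\<psi> (ob L c) d g \<in> Hom D (ob L c) (ob R' d)"
      using bij'[OF o'(1) o(3)] g by (auto simp: bij_betw_def)
    show "\<phi> c' (ob R' d') (\<psi> (ob L c') d' (Cmp E (ob L' (ob L c')) d d' k
          (Cmp E (ob L' (ob L c')) (ob L' (ob L c)) d g (ar L' (ob L c') (ob L c) (ar L c' c h))))) =
        Cmp C c' (ob R (ob R' d)) (ob R (ob R' d')) (ar R (ob R' d) (ob R' d') (ar R' d d' k))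
          (Cmp C c' c (ob R (ob R' d)) (\<phi> c (ob R' d) (\<psi> (ob L c) d g)) h)"
      using nat'[OF o'(1,2) o(3,4) Lh k g] nat[OF o(1,2) o'(3,4) h Rk \<psi>g] by simp
  qed (use is_functor_comp[OF L L'] is_functor_comp[OF R' R] bb in simp_all)
qed

text \<open>Arrows from \<open>L (K c)\<close> to \<open>d\<close> are arrows from
  \<open>K c\<close> to \<open>R d = K (R' d)\<close>, hence arrows from \<open>c\<close> to
  \<open>R' d\<close> because \<open>K\<close> is fully faithful. With \<open>K\<close> the
  inclusion of sheaves this restricts a sheafification to sheaves for a coarser topology; with
  \<open>K = base_sections\<close> it produces the left adjoint of the pushforward.\<close>

lemma adjoint_restrict:
  assumes C: "is_category C" and P: "is_category P" and D: "is_category D"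
    and K: "is_functor C P K" "fully_faithful C P K" and R': "is_functor D C R'"
    and adj: "adjoint P D L R" and KR: "comp_fctr K R' = R"
  shows "adjoint C D (comp_fctr L K) R'"
proof -
  obtain \<phi> where L: "is_functor P D L" and R: "is_functor D P R" and
    bij: "\<And>c d. c \<in> Obj P \<Longrightarrow> d \<in> Obj D \<Longrightarrow> bij_betw (\<phi> c d) (Hom D (ob L c) d) (Hom P c (ob R d))" and
    nat: "\<And>c c' d d' h k g. c \<in> Obj P \<Longrightarrow> c' \<in> Obj P \<Longrightarrow> d \<in> Obj D \<Longrightarrow> d' \<in> Obj D \<Longrightarrow>
      h \<in> Hom P c' c \<Longrightarrow> k \<in> Hom D d d' \<Longrightarrow> g \<in> Hom D (ob L c) d \<Longrightarrow>
      \<phi> c' d' (Cmp D (ob L c') d d' k (Cmp D (ob L c') (ob L c) d g (ar L c' c h))) =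
      Cmp P c' (ob R d) (ob R d') (ar R d d' k) (Cmp P c' c (ob R d) (\<phi> c d g) h)"
    by (rule adjointE[OF P D adj]) metis
  have Ro: "ob R d = ob K (ob R' d)" and Ra: "ar R d d' k = ar K (ob R' d) (ob R' d') (ar R' d d' k)" for d d' k
    using KR by auto
  define \<psi> where "\<psi> c d = inv_into (Hom C c (ob R' d)) (ar K c (ob R' d)) \<circ> \<phi> (ob K c) d" for c d
  have Kbij: "bij_betw (ar K c d) (Hom C c d) (Hom P (ob K c) (ob K d))" if "c \<in> Obj C" "d \<in> Obj C" for c d
    using K(2) that by (auto simp: fully_faithful_def)
  have \<psi>bij: "bij_betw (\<psi> c d) (Hom D (ob L (ob K c)) d) (Hom C c (ob R' d))" if "c \<in> Obj C" "d \<in> Obj D" for c d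
    unfolding \<psi>_def using that K R'
    by (intro bij_betw_trans[OF bij bij_betw_inv_into]) (auto simp: fun_ob Ro intro!: Kbij)
  have K\<psi>: "ar K c (ob R' d) (\<psi> c d g) = \<phi> (ob K c) d g"
    if "c \<in> Obj C" "d \<in> Obj D" "g \<in> Hom D (ob L (ob K c)) d" for c d g
    unfolding \<psi>_def comp_def
    using that K R' Kbij[of c "ob R' d"] bij[of "ob K c" d]
    by (intro f_inv_into_f) (auto simp: bij_betw_def fun_ob Ro)
  show ?thesis
    unfolding adjoint_def ob_comp_fctr ar_comp_fctr
  proof (intro conjI exI[of _ \<psi>] ballI)
    fix c c' d d' h k g
    assume o: "c \<in> Obj C" "c' \<in> Obj C" "d \<in> Obj D" "d' \<in> Obj D"
      and h: "h \<in> Hom C c' c" and k: "k \<in> Hom D d d'" and g: "g \<in> Hom D (ob L (ob K c)) d"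
    have o': "ob K c \<in> Obj P" "ob K c' \<in> Obj P" "ob R' d \<in> Obj C" "ob R' d' \<in> Obj C"
      "ob L (ob K c) \<in> Obj D" "ob L (ob K c') \<in> Obj D"
      using o K R' L by (auto simp: fun_ob)
    have Kh: "ar K c' c h \<in> Hom P (ob K c') (ob K c)" and Rk: "ar R' d d' k \<in> Hom C (ob R' d) (ob R' d')"
      using o h k fun_ar[OF K(1)] fun_ar[OF R'] by auto
    have LKh: "ar L (ob K c') (ob K c) (ar K c' c h) \<in> Hom D (ob L (ob K c')) (ob L (ob K c))"
      using fun_ar[OF L] Kh o' by auto
    have \<psi>g: "\<psi> c d g \<in> Hom C c (ob R' d)"
      using \<psi>bij[OF o(1,3)] g by (auto simp: bij_betw_def)
    let ?l = "Cmp D (ob L (ob K c')) d d' k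
          (Cmp D (ob L (ob K c')) (ob L (ob K c)) d g (ar L (ob K c') (ob K c) (ar K c' c h)))"
    let ?r = "Cmp C c' (ob R' d) (ob R' d') (ar R' d d' k) (Cmp C c' c (ob R' d) (\<psi> c d g) h)"
    have l: "?l \<in> Hom D (ob L (ob K c')) d'"
      using o o' k g LKh by (intro cat_cmp[OF D]) auto
    have r: "?r \<in> Hom C c' (ob R' d')" "Cmp C c' c (ob R' d) (\<psi> c d g) h \<in> Hom C c' (ob R' d)"
      using o o' h Rk \<psi>g by (auto intro!: cat_cmp[OF C])
    have "ar K c' (ob R' d') (\<psi> c' d' ?l) = ar K c' (ob R' d') ?r"
      using nat[OF o'(1,2) o(3,4) Kh k g] o o' h Rk \<psi>g r
      by (simp add: K\<psi>[OF o(2,4) l] fun_cmp[OF K(1)] K\<psi>[OF o(1,3) g] Ro Ra)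
    then show "\<psi> c' d' ?l = ?r"
      by (rule inj_onD[OF bij_betw_imp_inj_on[OF Kbij[OF o(2) o'(4)]]])
        (use r(1) bij_betw_apply[OF \<psi>bij[OF o(2,4)] l] in auto)
  qed (use is_functor_comp[OF K(1) L] R' \<psi>bij in simp_all)
qed

text \<open>The chosen isomorphisms \<open>\<eta> c\<close> are universal arrows, which makes
  \<open>G\<close> a left adjoint; since they are invertible, \<open>G\<close> is a right adjoint as
  well. Both adjunctions are wanted: one is the geometric morphism, the other makes its inverse
  image left exact.\<close>

lemma quasi_inverse:
  assumes C: "is_category C" and D: "is_category D" and F: "is_functor D C F" and ff: "fully_faithful D C F"
    and es: "\<And>c. c \<in> Obj C \<Longrightarrow> \<exists>d\<in>Obj D. \<exists>f. is_iso C c (ob F d) f"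
  obtains G where "adjoint D C F G" "adjoint C D G F"
    "isomorphic_functors C C (comp_fctr F G) id_fctr" "isomorphic_functors D D (comp_fctr G F) id_fctr"
proof -
  obtain L0 \<eta> where L0: "\<And>c. c \<in> Obj C \<Longrightarrow> L0 c \<in> Obj D" and \<eta>i: "\<And>c. c \<in> Obj C \<Longrightarrow> is_iso C c (ob F (L0 c)) (\<eta> c)"
    using es by metis
  then obtain \<epsilon> where \<eta>: "\<And>c. c \<in> Obj C \<Longrightarrow> \<eta> c \<in> Hom C c (ob F (L0 c))"
    and \<epsilon>: "\<And>c. c \<in> Obj C \<Longrightarrow> \<epsilon> c \<in> Hom C (ob F (L0 c)) c"
    and \<epsilon>\<eta>: "\<And>c. c \<in> Obj C \<Longrightarrow> Cmp C c (ob F (L0 c)) c (\<epsilon> c) (\<eta> c) = Idn C c"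
    and \<eta>\<epsilon>: "\<And>c. c \<in> Obj C \<Longrightarrow> Cmp C (ob F (L0 c)) c (ob F (L0 c)) (\<eta> c) (\<epsilon> c) = Idn C (ob F (L0 c))"
    unfolding is_iso_def by metis
  have Fo: "ob F d \<in> Obj C" if "d \<in> Obj D" for d
    using F that by (rule fun_ob)
  note Fa = fun_ar[OF F]
  \<comment> \<open>Arrows out of \<open>ob F (L0 c)\<close> are compared after precomposing with
    the isomorphism \<open>\<eta> c\<close>.\<close>
  have cancel: "h = k" if "c \<in> Obj C" "d \<in> Obj C" "h \<in> Hom C (ob F (L0 c)) d" "k \<in> Hom C (ob F (L0 c)) d"
    "Cmp C c (ob F (L0 c)) d h (\<eta> c) = Cmp C c (ob F (L0 c)) d k (\<eta> c)" for c d h k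
  proof -
    have *: "Cmp C (ob F (L0 c)) (ob F (L0 c)) d x (Cmp C (ob F (L0 c)) c (ob F (L0 c)) (\<eta> c) (\<epsilon> c)) =
        Cmp C (ob F (L0 c)) c d (Cmp C c (ob F (L0 c)) d x (\<eta> c)) (\<epsilon> c)" if "x \<in> {h, k}" for x
      using that \<open>h \<in> _\<close> \<open>k \<in> _\<close> \<open>c \<in> _\<close> \<open>d \<in> _\<close> by (auto simp: cat_assoc[OF C] Fo L0 \<eta> \<epsilon>)
    show ?thesis
      using *[of h] *[of k] that by (simp add: \<eta>\<epsilon> cat_idr[OF C] Fo L0)
  qed
  have pre: "Cmp C c (ob F (L0 c)) d (Cmp C (ob F (L0 c)) c d h (\<epsilon> c)) (\<eta> c) = h"
    if "c \<in> Obj C" "d \<in> Obj C" "h \<in> Hom C c d" for c d h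
    using that by (simp flip: cat_assoc[OF C] add: Fo L0 \<eta> \<epsilon> \<epsilon>\<eta> cat_idr[OF C])
  have univ: "\<exists>!k. k \<in> Hom D (L0 c) d \<and> Cmp C c (ob F (L0 c)) (ob F d) (ar F (L0 c) d k) (\<eta> c) = h"
    if *: "c \<in> Obj C" "d \<in> Obj D" "h \<in> Hom C c (ob F d)" for c d h
  proof -
    have "Cmp C (ob F (L0 c)) c (ob F d) h (\<epsilon> c) \<in> Hom C (ob F (L0 c)) (ob F d)"
      using * by (intro cat_cmp[OF C]) (auto simp: Fo L0 \<epsilon>)
    then obtain k where "k \<in> Hom D (L0 c) d" "ar F (L0 c) d k = Cmp C (ob F (L0 c)) c (ob F d) h (\<epsilon> c)"
      using fully_faithfulD(2)[OF ff L0[OF *(1)] *(2)] by metis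
    moreover have "k = k'" if "k \<in> Hom D (L0 c) d" "k' \<in> Hom D (L0 c) d"
      "Cmp C c (ob F (L0 c)) (ob F d) (ar F (L0 c) d k) (\<eta> c) = Cmp C c (ob F (L0 c)) (ob F d) (ar F (L0 c) d k') (\<eta> c)" for k k'
      using cancel[OF *(1) Fo[OF *(2)] _ _ that(3)] fully_faithfulD(1)[OF ff L0[OF *(1)] *(2)] that * Fa L0
      by (auto simp: inj_on_def)
    ultimately show ?thesis
      using pre[OF *(1) Fo[OF *(2)] *(3)] by metis
  qed
  have "\<exists>G. adjoint C D G F \<and> ob G = L0 \<and>
    (\<forall>c\<in>Obj C. \<forall>c'\<in>Obj C. \<forall>f\<in>Hom C c c'.
      Cmp C c (ob F (L0 c)) (ob F (L0 c')) (ar F (L0 c) (L0 c') (ar G c c' f)) (\<eta> c) = Cmp C c c' (ob F (L0 c')) (\<eta> c') f)"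
    by (rule adjoint_of_universal[OF C D F]) (fact L0 \<eta> univ)+
  then obtain G where adj: "adjoint C D G F" and G0: "ob G = L0" and
    nat: "\<And>c c' f. c \<in> Obj C \<Longrightarrow> c' \<in> Obj C \<Longrightarrow> f \<in> Hom C c c' \<Longrightarrow>
      Cmp C c (ob F (L0 c)) (ob F (L0 c')) (ar F (L0 c) (L0 c') (ar G c c' f)) (\<eta> c) = Cmp C c c' (ob F (L0 c')) (\<eta> c') f"
    by blast
  have G: "is_functor C D G"
    using adj by (simp add: adjoint_def)
  have Go: "L0 c \<in> Obj D" if "c \<in> Obj C" for c using L0 that .
  have Ga: "ar G c c' f \<in> Hom D (L0 c) (L0 c')" if "c \<in> Obj C" "c' \<in> Obj C" "f \<in> Hom C c c'" for c c' f
    using fun_ar[OF G] that by (simp add: G0)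
  have nat\<epsilon>: "Cmp C (ob F (L0 c)) (ob F (L0 c')) c' (\<epsilon> c') (ar F (L0 c) (L0 c') (ar G c c' f)) =
      Cmp C (ob F (L0 c)) c c' f (\<epsilon> c)" if *: "c \<in> Obj C" "c' \<in> Obj C" "f \<in> Hom C c c'" for c c' f
  proof (rule cancel)
    note m = Fa[OF L0[OF *(1)] L0[OF *(2)] Ga[OF *]] 
    have "Cmp C c (ob F (L0 c)) c' (Cmp C (ob F (L0 c)) (ob F (L0 c')) c' (\<epsilon> c') (ar F (L0 c) (L0 c') (ar G c c' f))) (\<eta> c) =
        Cmp C c (ob F (L0 c')) c' (\<epsilon> c') (Cmp C c c' (ob F (L0 c')) (\<eta> c') f)"
      using * m by (simp flip: cat_assoc[OF C] nat add: Fo L0 \<eta> \<epsilon>)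
    also have "\<dots> = f"
      using * by (simp add: cat_assoc[OF C] Fo L0 \<eta> \<epsilon> \<epsilon>\<eta> cat_idl[OF C])
    finally show "Cmp C c (ob F (L0 c)) c' (Cmp C (ob F (L0 c)) (ob F (L0 c')) c' (\<epsilon> c') (ar F (L0 c) (L0 c') (ar G c c' f))) (\<eta> c) =
        Cmp C c (ob F (L0 c)) c' (Cmp C (ob F (L0 c)) c c' f (\<epsilon> c)) (\<eta> c)"
      using * by (simp add: pre)
    show "Cmp C (ob F (L0 c)) (ob F (L0 c')) c' (\<epsilon> c') (ar F (L0 c) (L0 c') (ar G c c' f)) \<in> Hom C (ob F (L0 c)) c'"
      using * m by (intro cat_cmp[OF C]) (auto simp: Fo L0 \<epsilon>)
    show "Cmp C (ob F (L0 c)) c c' f (\<epsilon> c) \<in> Hom C (ob F (L0 c)) c'"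
      using * by (intro cat_cmp[OF C]) (auto simp: Fo L0 \<epsilon>)
  qed (use * in auto)
  have iso1: "isomorphic_functors C C (comp_fctr F G) id_fctr"
    unfolding isomorphic_functors_def is_nat_trans_def ob_comp_fctr ar_comp_fctr G0 ob_id_fctr ar_id_fctr
    by (rule exI[of _ "\<lambda>c\<in>Obj C. \<epsilon> c"]) (auto simp: \<epsilon> nat\<epsilon> is_iso_def \<epsilon>\<eta> \<eta>\<epsilon> intro!: bexI[OF _ \<eta>])
  \<comment> \<open>The second isomorphism lives in \<open>D\<close>, so \<open>\<epsilon>\<close>
    at \<open>ob F d\<close> has to be lifted along the fully faithful \<open>F\<close>; its
    equations are then checked after applying \<open>F\<close>.\<close>
  define \<theta> where "\<theta> d = inv_into (Hom D (L0 (ob F d)) d) (ar F (L0 (ob F d)) d) (\<epsilon> (ob F d))" for d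
  have \<theta>: "\<theta> d \<in> Hom D (L0 (ob F d)) d" "ar F (L0 (ob F d)) d (\<theta> d) = \<epsilon> (ob F d)" if d: "d \<in> Obj D" for d
  proof -
    have "\<epsilon> (ob F d) \<in> ar F (L0 (ob F d)) d ` Hom D (L0 (ob F d)) d"
      using fully_faithfulD(2)[OF ff L0[OF Fo[OF d]] d \<epsilon>[OF Fo[OF d]]] by (metis image_eqI)
    then show "\<theta> d \<in> Hom D (L0 (ob F d)) d" "ar F (L0 (ob F d)) d (\<theta> d) = \<epsilon> (ob F d)"
      unfolding \<theta>_def by (auto intro: inv_into_into f_inv_into_f)
  qed
  have Finj: "f = g" if "a \<in> Obj D" "b \<in> Obj D" "f \<in> Hom D a b" "g \<in> Hom D a b" "ar F a b f = ar F a b g" for a b f g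
    using fully_faithfulD(1)[OF ff that(1,2)] that by (auto simp: inj_on_def)
  have iso2: "isomorphic_functors D D (comp_fctr G F) id_fctr"
    unfolding isomorphic_functors_def is_nat_trans_def ob_comp_fctr ar_comp_fctr G0 ob_id_fctr ar_id_fctr
  proof (intro exI[of _ "\<lambda>d\<in>Obj D. \<theta> d"] conjI ballI)
    fix a b f assume *: "a \<in> Obj D" "b \<in> Obj D" "f \<in> Hom D a b"
    have Gf: "ar G (ob F a) (ob F b) (ar F a b f) \<in> Hom D (L0 (ob F a)) (L0 (ob F b))"
      using * by (intro Ga Fo Fa)
    have "Cmp D (L0 (ob F a)) (L0 (ob F b)) b (\<theta> b) (ar G (ob F a) (ob F b) (ar F a b f)) =
        Cmp D (L0 (ob F a)) a b f (\<theta> a)"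
    proof (rule Finj)
      show "ar F (L0 (ob F a)) b (Cmp D (L0 (ob F a)) (L0 (ob F b)) b (\<theta> b) (ar G (ob F a) (ob F b) (ar F a b f))) =
          ar F (L0 (ob F a)) b (Cmp D (L0 (ob F a)) a b f (\<theta> a))"
        using * Gf nat\<epsilon>[of "ob F a" "ob F b" "ar F a b f"] Fa[of a b f] by (simp add: fun_cmp[OF F] L0 Fo \<theta>)
    qed (use * Gf in \<open>auto intro!: cat_cmp[OF D] simp: L0 Fo \<theta>\<close>)
    then show "Cmp D (L0 (ob F a)) (L0 (ob F b)) b ((\<lambda>d\<in>Obj D. \<theta> d) b) (ar G (ob F a) (ob F b) (ar F a b f)) =
        Cmp D (L0 (ob F a)) a b f ((\<lambda>d\<in>Obj D. \<theta> d) a)"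
      using * by simp
  next
    fix d assume d: "d \<in> Obj D"
    note o = L0[OF Fo[OF d]]
    obtain g where g: "g \<in> Hom D d (L0 (ob F d))" "ar F d (L0 (ob F d)) g = \<eta> (ob F d)"
      using fully_faithfulD(2)[OF ff d o \<eta>[OF Fo[OF d]]] by auto
    have "Cmp D (L0 (ob F d)) d (L0 (ob F d)) g (\<theta> d) = Idn D (L0 (ob F d))"
      by (rule Finj[OF o o])
        (use d o g in \<open>auto intro!: cat_cmp[OF D] cat_id[OF D] simp: \<theta> fun_cmp[OF F] fun_id[OF F] Fo \<eta>\<epsilon>\<close>)
    moreover have "Cmp D d (L0 (ob F d)) d (\<theta> d) g = Idn D d"
      by (rule Finj[OF d d])
        (use d o g in \<open>auto intro!: cat_cmp[OF D] cat_id[OF D] simp: \<theta> fun_cmp[OF F] fun_id[OF F] Fo \<epsilon>\<eta>\<close>)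
    ultimately show "is_iso D (L0 (ob F d)) d ((\<lambda>d\<in>Obj D. \<theta> d) d)"
      using d g \<theta> by (auto simp: is_iso_def)
  qed (auto simp: \<theta>)
  \<comment> \<open>Transposition for the adjunction with \<open>F\<close> on the left: the lift
    along \<open>F\<close> of \<open>\<eta> c\<close> after \<open>g\<close>. It is invertible
    because composition with \<open>\<eta> c\<close> is.\<close>
  define \<psi> where "\<psi> d c g = inv_into (Hom D d (L0 c)) (ar F d (L0 c)) (Cmp C (ob F d) c (ob F (L0 c)) (\<eta> c) g)" for d c g
  have \<psi>: "\<psi> d c g \<in> Hom D d (L0 c)" "ar F d (L0 c) (\<psi> d c g) = Cmp C (ob F d) c (ob F (L0 c)) (\<eta> c) g"
    if *: "d \<in> Obj D" "c \<in> Obj C" "g \<in> Hom C (ob F d) c" for d c g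
  proof -
    have "Cmp C (ob F d) c (ob F (L0 c)) (\<eta> c) g \<in> Hom C (ob F d) (ob F (L0 c))"
      using * by (intro cat_cmp[OF C]) (auto simp: Fo L0 \<eta>)
    then have "Cmp C (ob F d) c (ob F (L0 c)) (\<eta> c) g \<in> ar F d (L0 c) ` Hom D d (L0 c)"
      using fully_faithfulD(2)[OF ff *(1) L0[OF *(2)]] by force
    then show "\<psi> d c g \<in> Hom D d (L0 c)" "ar F d (L0 c) (\<psi> d c g) = Cmp C (ob F d) c (ob F (L0 c)) (\<eta> c) g"
      unfolding \<psi>_def by (auto intro: inv_into_into f_inv_into_f)
  qed
  have post: "Cmp C d (ob F (L0 c)) c (\<epsilon> c) (Cmp C d c (ob F (L0 c)) (\<eta> c) g) = g"
    if "c \<in> Obj C" "d \<in> Obj C" "g \<in> Hom C d c" for c d g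
    using that by (simp add: cat_assoc[OF C] Fo L0 \<eta> \<epsilon> \<epsilon>\<eta> cat_idl[OF C])
  have post': "Cmp C d c (ob F (L0 c)) (\<eta> c) (Cmp C d (ob F (L0 c)) c (\<epsilon> c) g) = g"
    if "c \<in> Obj C" "d \<in> Obj C" "g \<in> Hom C d (ob F (L0 c))" for c d g
    using that by (simp add: cat_assoc[OF C] Fo L0 \<eta> \<epsilon> \<eta>\<epsilon> cat_idl[OF C])
  have "adjoint D C F G"
    unfolding adjoint_def G0
  proof (intro conjI F G exI[of _ \<psi>] ballI)
    fix d c assume *: "d \<in> Obj D" "c \<in> Obj C"
    show "bij_betw (\<psi> d c) (Hom C (ob F d) c) (Hom D d (L0 c))"
      unfolding bij_betw_def
    proof (intro conjI inj_onI equalityI subsetI)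
      fix g h assume gh: "g \<in> Hom C (ob F d) c" "h \<in> Hom C (ob F d) c" "\<psi> d c g = \<psi> d c h"
      then have "Cmp C (ob F d) c (ob F (L0 c)) (\<eta> c) g = Cmp C (ob F d) c (ob F (L0 c)) (\<eta> c) h"
        using \<psi>(2)[OF *] by metis
      then show "g = h"
        using post[OF *(2) Fo[OF *(1)]] gh by metis
    next
      fix k assume k: "k \<in> Hom D d (L0 c)"
      let ?g = "Cmp C (ob F d) (ob F (L0 c)) c (\<epsilon> c) (ar F d (L0 c) k)"
      have Fk: "ar F d (L0 c) k \<in> Hom C (ob F d) (ob F (L0 c))"
        using * k by (intro Fa L0)
      then have g: "?g \<in> Hom C (ob F d) c"
        using * by (intro cat_cmp[OF C]) (auto simp: Fo L0 \<epsilon>)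
      have "ar F d (L0 c) (\<psi> d c ?g) = ar F d (L0 c) k"
        using \<psi>(2)[OF * g] post'[OF *(2) Fo[OF *(1)] Fk] by simp
      then have "\<psi> d c ?g = k"
        using Finj[OF *(1) L0[OF *(2)] \<psi>(1)[OF * g] k] by blast
      then show "k \<in> \<psi> d c ` Hom C (ob F d) c"
        using g by (metis image_eqI)
    qed (use \<psi>(1)[OF *] in auto)
  next
    fix c c' d d' h k g
    assume o: "c \<in> Obj D" "c' \<in> Obj D" "d \<in> Obj C" "d' \<in> Obj C"
      and h: "h \<in> Hom D c' c" and k: "k \<in> Hom C d d'" and g: "g \<in> Hom C (ob F c) d"
    let ?l = "Cmp C (ob F c') d d' k (Cmp C (ob F c') (ob F c) d g (ar F c' c h))"
    have Fh: "ar F c' c h \<in> Hom C (ob F c') (ob F c)" using o h by (intro Fa)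
    have FGk: "ar F (L0 d) (L0 d') (ar G d d' k) \<in> Hom C (ob F (L0 d)) (ob F (L0 d'))"
      using o k by (intro Fa L0 Ga)
    have l: "?l \<in> Hom C (ob F c') d'"
      using o Fh k g by (intro cat_cmp[OF C]) (auto simp: Fo)
    show "\<psi> c' d' ?l = Cmp D c' (L0 d) (L0 d') (ar G d d' k) (Cmp D c' c (L0 d) (\<psi> c d g) h)"
    proof (rule Finj)
      have "ar F c' (L0 d') (\<psi> c' d' ?l) = Cmp C (ob F c') d (ob F (L0 d')) (Cmp C d d' (ob F (L0 d')) (\<eta> d') k) (Cmp C (ob F c') (ob F c) d g (ar F c' c h))"
        using o Fh k g l by (simp add: \<psi> cat_assoc[OF C] Fo L0 \<eta> cat_cmp[OF C])
      also have "\<dots> = Cmp C (ob F c') (ob F (L0 d)) (ob F (L0 d')) (ar F (L0 d) (L0 d') (ar G d d' k))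
           (Cmp C (ob F c') (ob F c) (ob F (L0 d)) (ar F c (L0 d) (\<psi> c d g)) (ar F c' c h))"
        using o Fh k g FGk by (simp flip: nat[OF o(3,4) k] add: \<psi> cat_assoc[OF C] Fo L0 \<eta> cat_cmp[OF C])
      also have "\<dots> = ar F c' (L0 d') (Cmp D c' (L0 d) (L0 d') (ar G d d' k) (Cmp D c' c (L0 d) (\<psi> c d g) h))"
        using o h k g \<psi>(1)[of c d g] by (simp add: fun_cmp[OF F] L0 Ga cat_cmp[OF D])
      finally show "ar F c' (L0 d') (\<psi> c' d' ?l) = ar F c' (L0 d') (Cmp D c' (L0 d) (L0 d') (ar G d d' k) (Cmp D c' c (L0 d) (\<psi> c d g) h))" .
    qed (use o h k g l \<psi>(1) in \<open>auto intro!: cat_cmp[OF D] simp: L0 Ga\<close>)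
  qed
  from that[OF this adj iso1 iso2] show thesis .
qed

section \<open>Small sets\<close>

lemma universe_lesspoll: "set_universe U \<Longrightarrow> A \<in> U \<Longrightarrow> B \<lesssim> A \<Longrightarrow> B \<in> U"
  unfolding set_universe_def by blast

lemma universe_subset: "set_universe U \<Longrightarrow> A \<in> U \<Longrightarrow> B \<subseteq> A \<Longrightarrow> B \<in> U"
  by (blast intro: universe_lesspoll subset_imp_lepoll)

lemma universe_pair:
  assumes "set_universe U"
  obtains a b where "a \<noteq> b" "{a, b} \<in> U"
proof -
  obtain A a b where "A \<in> U" "a \<in> A" "b \<in> A" "a \<noteq> b"
    using assms unfolding set_universe_def by blast
  then show thesis
    using universe_subset[OF assms, of A "{a, b}"] that by auto
qed

lemma universe_empty: "set_universe U \<Longrightarrow> {} \<in> U"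
  by (metis universe_pair universe_subset empty_subsetI)

lemma universe_singleton:
  assumes "set_universe U"
  shows "{a} \<in> U"
proof -
  obtain b c where "b \<noteq> c" "{b, c} \<in> U"
    using assms by (rule universe_pair)
  moreover have "{a} \<lesssim> {b, c}"
    unfolding lepoll_def by (rule exI[of _ "\<lambda>_. b"]) simp
  ultimately show ?thesis
    using universe_lesspoll[OF assms] by blast
qed

text \<open>A value and a flag at each place encode a partial function as an element of a countable product.\<close>

lemma universe_code:
  fixes P :: "nat \<Rightarrow> 'u set" and M :: "'a set"
  assumes U: "set_universe U" and P: "\<And>m. P m \<in> U"
    and f: "inj_on f M" "\<And>z m. z \<in> M \<Longrightarrow> f z m \<in> insert None (Some ` P m)"
  obtains e where "inj_on e M" "e ` M \<in> U"
proof -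
  obtain a b where ab: "a \<noteq> b" "{a, b} \<in> U"
    using U by (rule universe_pair)
  \<comment> \<open>An empty \<open>P m\<close> must not make the whole product empty, so it is
    replaced by \<open>{a}\<close>; the flag at the odd place tells the dummy entry from a genuine
    value.\<close>
  define Q where "Q k = (if even k then if P (k div 2) = {} then {a} else P (k div 2) else {a, b})" for k :: nat
  have "Q k \<in> U" for k
    using P ab universe_singleton[OF U] by (simp add: Q_def)
  then obtain B where B: "B \<in> U" "PiE UNIV Q \<lesssim> B"
    using U unfolding set_universe_def by metis
  define g where "g z k = (if even k then case f z (k div 2) of None \<Rightarrow> SOME x. x \<in> Q k | Some x \<Rightarrow> x
    else if f z (k div 2) = None then a else b)" for z k
  have ne: "(SOME x. x \<in> Q k) \<in> Q k" for k
    by (rule someI_ex) (auto simp: Q_def)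
  have "g z k \<in> Q k" if "z \<in> M" for z k
  proof (cases "even k \<and> f z (k div 2) = None")
    case True
    then show ?thesis
      using ne[of k] by (simp add: g_def)
  next
    case False
    then show ?thesis
      using f(2)[OF that, of "k div 2"] by (auto simp: g_def Q_def)
  qed
  then have "g ` M \<subseteq> PiE UNIV Q"
    by auto
  moreover have "inj_on g M"
  proof (rule inj_onI)
    fix z z' assume z: "z \<in> M" "z' \<in> M" "g z = g z'"
    have "f z m = f z' m" for m
      using fun_cong[OF z(3), of "2 * m"] fun_cong[OF z(3), of "2 * m + 1"] ab(1)
      by (auto simp: g_def split: if_splits option.splits)
    then show "z = z'"
      using f(1) z by (auto dest: inj_onD)
  qed
  ultimately have "M \<lesssim> B"
    using B(2) by (meson lepoll_def lepoll_trans)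
  then obtain e where "inj_on e M" "e ` M \<subseteq> B"
    by (auto simp: lepoll_def)
  then show thesis
    using that universe_subset[OF U B(1)] by blast
qed

text \<open>Testing against the one-element set \<open>{undefined}\<close> suffices, since functions
  out of it are elements of \<open>X\<close>.\<close>

lemma terminal_set_cat:
  fixes U :: "'u set set"
  assumes "set_universe U"
  shows "terminal (set_cat U) X \<longleftrightarrow> (\<exists>a. X = {a})"
proof
  assume t: "terminal (set_cat U) X"
  have "\<exists>!f. f \<in> {undefined :: 'u} \<rightarrow>\<^sub>E X"
    using t universe_singleton[OF assms, of undefined] unfolding terminal_def set_cat_def cat.simps
    by (elim conjE) (erule bspec)
  then obtain g where g: "g \<in> {undefined :: 'u} \<rightarrow>\<^sub>E X" "\<And>f. f \<in> {undefined} \<rightarrow>\<^sub>E X \<Longrightarrow> f = g"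
    by (elim ex1E) iprover
  have "x = g undefined" if "x \<in> X" for x
  proof -
    have "(\<lambda>y\<in>{undefined}. x) = g"
      by (rule g(2)) (use that in simp)
    from fun_cong[OF this, of undefined] show ?thesis
      by simp
  qed
  moreover have "g undefined \<in> X"
    using g(1) by auto
  ultimately show "\<exists>a. X = {a}"
    by blast
next
  assume "\<exists>a. X = {a}"
  then obtain a where X: "X = {a}" ..
  have "\<exists>!f. f \<in> A \<rightarrow>\<^sub>E {a}" for A :: "'u set"
  proof (rule ex1I)
    show "f = (\<lambda>x\<in>A. a)" if "f \<in> A \<rightarrow>\<^sub>E {a}" for f
      by (rule PiE_ext[OF that]) (use that in auto)
  qed auto
  then show "terminal (set_cat U) X"
    unfolding terminal_def set_cat_def X using universe_singleton[OF assms] by simp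
qed

lemma is_iso_set_cat: "is_iso (set_cat U) A B f \<longleftrightarrow> f \<in> A \<rightarrow>\<^sub>E B \<and> bij_betw f A B"
proof
  assume "is_iso (set_cat U) A B f"
  then obtain g where f: "f \<in> A \<rightarrow>\<^sub>E B" and g: "g \<in> B \<rightarrow>\<^sub>E A"
    and *: "compose A g f = (\<lambda>x\<in>A. x)" "compose B f g = (\<lambda>x\<in>B. x)"
    unfolding is_iso_def set_cat_def by auto
  have "g (f x) = x" if "x \<in> A" for x
    using fun_cong[OF *(1), of x] that by (simp add: compose_eq)
  moreover have "f (g x) = x" if "x \<in> B" for x
    using fun_cong[OF *(2), of x] that by (simp add: compose_eq)
  ultimately show "f \<in> A \<rightarrow>\<^sub>E B \<and> bij_betw f A B"
    using f g by (auto intro!: bij_betw_byWitness[of _ g])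
next
  assume *: "f \<in> A \<rightarrow>\<^sub>E B \<and> bij_betw f A B"
  let ?g = "\<lambda>y\<in>B. inv_into A f y"
  have "?g \<in> B \<rightarrow>\<^sub>E A"
    using * by (auto simp: bij_betw_def intro: inv_into_into)
  moreover have "compose A ?g f = (\<lambda>x\<in>A. x)" "compose B f ?g = (\<lambda>x\<in>B. x)"
    using * by (auto simp: compose_def bij_betw_def f_inv_into_f intro!: restrict_ext)
  ultimately show "is_iso (set_cat U) A B f"
    unfolding is_iso_def set_cat_def cat.simps using * by (intro conjI bexI[of _ ?g]) auto
qed

section \<open>Presheaves and sheaves on a poset\<close>

lemma Obj_big_cell [simp]: "Obj big_cell = {0<..}"
  by (simp add: big_cell_def poset_cat_def)

lemma arrow_to_big_cell: "arrow_to big_cell m n \<longleftrightarrow> m > 0 \<and> n > 0 \<and> n dvd m"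
  by (auto simp: arrow_to_def big_cell_def poset_cat_def)

lemma is_category_big_cell: "is_category big_cell"
  unfolding big_cell_def by (rule is_category_poset_cat) auto

lemma Obj_opens [simp]: "Obj (opens X) = {V. openin X V}"
  by (simp add: opens_def poset_cat_def)

lemma arrow_to_opens: "arrow_to (opens X) V W \<longleftrightarrow> openin X V \<and> openin X W \<and> V \<subseteq> W"
  by (auto simp: arrow_to_def opens_def poset_cat_def)

lemma is_category_opens: "is_category (opens X)"
  unfolding opens_def by (rule is_category_poset_cat) auto

lemma arrow_to_Obj: "arrow_to C b a \<Longrightarrow> a \<in> Obj C" "arrow_to C b a \<Longrightarrow> b \<in> Obj C"
  by (auto simp: arrow_to_def)

lemma arrow_to_refl: "is_category C \<Longrightarrow> a \<in> Obj C \<Longrightarrow> arrow_to C a a"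
  by (auto simp: arrow_to_def dest: cat_id)

lemma arrow_to_trans: "is_category C \<Longrightarrow> arrow_to C c b \<Longrightarrow> arrow_to C b a \<Longrightarrow> arrow_to C c a"
  unfolding arrow_to_def by (auto dest: cat_cmp)

lemma arrow_to_unit:
  fixes C :: "('c, unit) cat"
  shows "arrow_to C b a \<longleftrightarrow> b \<in> Obj C \<and> a \<in> Obj C \<and> () \<in> Hom C b a"
  by (auto simp: arrow_to_def)

text \<open>All later work with presheaves goes through this elementwise form. Equality of
  restriction maps may be tested on elements because arrows of \<open>set_cat\<close> are
  extensional functions.\<close>

lemma presheaf_iff:
  fixes C :: "('c, unit) cat"
  assumes C: "is_category C"
  shows "F \<in> Obj (presheaves U C) \<longleftrightarrow>
    (\<forall>a\<in>Obj C. ob F a \<in> U) \<and>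
    (\<forall>a b. arrow_to C b a \<longrightarrow> restr F a b \<in> ob F a \<rightarrow>\<^sub>E ob F b) \<and>
    (\<forall>a\<in>Obj C. \<forall>x\<in>ob F a. restr F a a x = x) \<and>
    (\<forall>a b c. arrow_to C b a \<longrightarrow> arrow_to C c b \<longrightarrow> (\<forall>x\<in>ob F a. restr F b c (restr F a b x) = restr F a c x))"
    (is "_ \<longleftrightarrow> ?O \<and> ?R \<and> ?I \<and> ?T")
proof -
  have ar: "ar F a b f = restr F a b" for a b f
    by (simp add: restr_def)
  have bex: "(\<exists>f\<in>A. f \<in> B) \<longleftrightarrow> () \<in> A \<and> () \<in> B" for A B :: "unit set"
    by auto
  have "F \<in> Obj (presheaves U C) \<longleftrightarrow>
    (\<forall>a\<in>Obj C. ob F a \<in> U) \<and>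
    (\<forall>a\<in>Obj C. \<forall>b\<in>Obj C. \<forall>f\<in>Hom C b a. restr F a b \<in> ob F a \<rightarrow>\<^sub>E ob F b) \<and>
    (\<forall>a\<in>Obj C. restr F a a = (\<lambda>x\<in>ob F a. x)) \<and>
    (\<forall>a\<in>Obj C. \<forall>b\<in>Obj C. \<forall>c\<in>Obj C. () \<in> Hom C b a \<longrightarrow> () \<in> Hom C c b \<longrightarrow>
       restr F a c = compose (ob F a) (restr F b c) (restr F a b))"
    unfolding presheaves_def functor_cat_def is_functor_def op_cat_def set_cat_def cat.simps mem_Collect_eq ar
    by (auto simp: Ball_def)
  also have "\<dots> \<longleftrightarrow> ?O \<and> ?R \<and> (\<forall>a\<in>Obj C. restr F a a = (\<lambda>x\<in>ob F a. x)) \<and>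
    (\<forall>a b c. arrow_to C b a \<longrightarrow> arrow_to C c b \<longrightarrow> restr F a c = compose (ob F a) (restr F b c) (restr F a b))"
    by (simp add: arrow_to_unit Ball_def bex) blast
  also have "\<dots> \<longleftrightarrow> ?O \<and> ?R \<and> ?I \<and> ?T"
  proof (intro conj_cong refl)
    assume R: ?R
    then have ext: "restr F a b \<in> extensional (ob F a)" if "arrow_to C b a" for a b
      using that by (auto simp: PiE_def)
    have "restr F a a = (\<lambda>x\<in>ob F a. x) \<longleftrightarrow> (\<forall>x\<in>ob F a. restr F a a x = x)" if "a \<in> Obj C" for a
      using ext[OF arrow_to_refl[OF C that]]
      by (auto intro!: extensionalityI[where A = "ob F a"])
    then show "(\<forall>a\<in>Obj C. restr F a a = (\<lambda>x\<in>ob F a. x)) \<longleftrightarrow> ?I"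
      by blast
    have "restr F a c = compose (ob F a) (restr F b c) (restr F a b) \<longleftrightarrow>
        (\<forall>x\<in>ob F a. restr F b c (restr F a b x) = restr F a c x)"
      if "arrow_to C b a" "arrow_to C c b" for a b c
      using ext[OF arrow_to_trans[OF C that(2,1)]]
      by (auto intro!: extensionalityI[where A = "ob F a"] simp: compose_eq)
    then show "(\<forall>a b c. arrow_to C b a \<longrightarrow> arrow_to C c b \<longrightarrow> restr F a c = compose (ob F a) (restr F b c) (restr F a b)) \<longleftrightarrow> ?T"
      by blast
  qed
  finally show ?thesis .
qed

context
  fixes C :: "('c, unit) cat"
  assumes C: "is_category C"
begin

lemma presheaf_ob: "F \<in> Obj (presheaves U C) \<Longrightarrow> a \<in> Obj C \<Longrightarrow> ob F a \<in> U"
  using presheaf_iff[OF C, of F U] by blast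

lemma restr_PiE: "F \<in> Obj (presheaves U C) \<Longrightarrow> arrow_to C b a \<Longrightarrow> restr F a b \<in> ob F a \<rightarrow>\<^sub>E ob F b"
  using presheaf_iff[OF C, of F U] by blast

lemma restr_in: "F \<in> Obj (presheaves U C) \<Longrightarrow> arrow_to C b a \<Longrightarrow> x \<in> ob F a \<Longrightarrow> restr F a b x \<in> ob F b"
  using restr_PiE by fastforce

lemma restr_id: "F \<in> Obj (presheaves U C) \<Longrightarrow> a \<in> Obj C \<Longrightarrow> x \<in> ob F a \<Longrightarrow> restr F a a x = x"
  using presheaf_iff[OF C, of F U] by blast

lemma restr_restr:
  "F \<in> Obj (presheaves U C) \<Longrightarrow> arrow_to C b a \<Longrightarrow> arrow_to C c b \<Longrightarrow> x \<in> ob F a \<Longrightarrow>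
    restr F b c (restr F a b x) = restr F a c x"
  using presheaf_iff[OF C, of F U] by blast

lemma is_category_presheaves: "is_category (presheaves U C)"
  unfolding presheaves_def
  by (intro is_category_functor_cat is_category_op_cat is_category_set_cat C)

lemma is_category_sheaves: "is_category (sheaves U C J)"
  unfolding sheaves_def by (intro is_category_full_subcat is_category_presheaves)

end

lemma Hom_sheaves [simp]: "Hom (sheaves U C J) = Hom (presheaves U C)"
  by (simp add: sheaves_def full_subcat_def)

lemma Cmp_sheaves [simp]: "Cmp (sheaves U C J) = Cmp (presheaves U C)"
  by (simp add: sheaves_def full_subcat_def)

lemma Idn_sheaves [simp]: "Idn (sheaves U C J) = Idn (presheaves U C)"
  by (simp add: sheaves_def full_subcat_def)

lemma Obj_sheaves: "F \<in> Obj (sheaves U C J) \<longleftrightarrow> F \<in> Obj (presheaves U C) \<and> is_sheaf C J F"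
  by (simp add: sheaves_def full_subcat_def)

lemma Idn_presheaves: "a \<in> Obj C \<Longrightarrow> Idn (presheaves U C) F a = (\<lambda>x\<in>ob F a. x)"
  by (simp add: presheaves_def functor_cat_def op_cat_def set_cat_def)

lemma Cmp_presheaves:
  "a \<in> Obj C \<Longrightarrow> Cmp (presheaves U C) F G H \<beta> \<alpha> a = compose (ob F a) (\<beta> a) (\<alpha> a)"
  by (simp add: presheaves_def functor_cat_def op_cat_def set_cat_def)

lemma Cmp_presheaves_apply:
  "a \<in> Obj C \<Longrightarrow> x \<in> ob F a \<Longrightarrow> Cmp (presheaves U C) F G H \<beta> \<alpha> a x = \<beta> a (\<alpha> a x)"
  by (simp add: Cmp_presheaves compose_eq)

lemma Cmp_set_cat_apply: "x \<in> A \<Longrightarrow> Cmp (set_cat U) A B D g f x = g (f x)"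
  by (simp add: set_cat_def compose_eq)

lemma hom_presheaves_iff:
  fixes C :: "('c, unit) cat"
  shows "\<alpha> \<in> Hom (presheaves U C) F G \<longleftrightarrow>
    \<alpha> \<in> extensional (Obj C) \<and> (\<forall>a\<in>Obj C. \<alpha> a \<in> ob F a \<rightarrow>\<^sub>E ob G a) \<and>
    (\<forall>a b. arrow_to C b a \<longrightarrow> (\<forall>x\<in>ob F a. \<alpha> b (restr F a b x) = restr G a b (\<alpha> a x)))"
proof -
  have ar: "ar F a b f = restr F a b" for F :: "('c, unit, 'a set, 'a \<Rightarrow> 'a) fctr" and a b f
    by (simp add: restr_def)
  have eq: "compose A f g = compose A f' g' \<longleftrightarrow> (\<forall>x\<in>A. f (g x) = f' (g' x))"
    for A :: "'a set" and f g f' g' :: "'a \<Rightarrow> 'a"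
    by (auto simp: compose_def restrict_def fun_eq_iff)
  show ?thesis
    unfolding presheaves_def functor_cat_def is_nat_trans_def op_cat_def set_cat_def cat.simps mem_Collect_eq ar eq
    by (simp add: arrow_to_unit Ball_def) blast
qed

lemma hom_in: "\<alpha> \<in> Hom (presheaves U C) F G \<Longrightarrow> a \<in> Obj C \<Longrightarrow> x \<in> ob F a \<Longrightarrow> \<alpha> a x \<in> ob G a"
  by (auto simp: hom_presheaves_iff)

lemma hom_PiE: "\<alpha> \<in> Hom (presheaves U C) F G \<Longrightarrow> a \<in> Obj C \<Longrightarrow> \<alpha> a \<in> ob F a \<rightarrow>\<^sub>E ob G a"
  by (auto simp: hom_presheaves_iff)

lemma hom_restr:
  "\<alpha> \<in> Hom (presheaves U C) F G \<Longrightarrow> arrow_to C b a \<Longrightarrow> x \<in> ob F a \<Longrightarrow>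
    \<alpha> b (restr F a b x) = restr G a b (\<alpha> a x)"
  by (auto simp: hom_presheaves_iff)

lemma hom_eqI:
  assumes "\<alpha> \<in> Hom (presheaves U C) F G" "\<beta> \<in> Hom (presheaves U C) F G"
    and "\<And>a x. a \<in> Obj C \<Longrightarrow> x \<in> ob F a \<Longrightarrow> \<alpha> a x = \<beta> a x"
  shows "\<alpha> = \<beta>"
proof (rule extensionalityI)
  show "\<alpha> a = \<beta> a" if "a \<in> Obj C" for a
    using hom_PiE[OF assms(1) that] hom_PiE[OF assms(2) that] assms(3)[OF that] by (rule PiE_ext)
qed (use assms(1,2) in \<open>auto simp: hom_presheaves_iff\<close>)

lemma hom_intro:
  fixes C :: "('c, unit) cat"
  assumes "\<And>a x. a \<in> Obj C \<Longrightarrow> x \<in> ob F a \<Longrightarrow> f a x \<in> ob G a"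
    and "\<And>a b x. arrow_to C b a \<Longrightarrow> x \<in> ob F a \<Longrightarrow> restr F a b x \<in> ob F b \<Longrightarrow> f b (restr F a b x) = restr G a b (f a x)"
    and "is_category C" "F \<in> Obj (presheaves U C)"
  shows "(\<lambda>a\<in>Obj C. \<lambda>x\<in>ob F a. f a x) \<in> Hom (presheaves U C) F G"
  using assms restr_in[OF assms(3,4)] by (auto simp: hom_presheaves_iff dest: arrow_to_Obj)

text \<open>The objectwise inverses commute with restriction because \<open>\<alpha>\<close> does
  and is injective.\<close>

lemma iso_of_bij:
  fixes C :: "('c, unit) cat"
  assumes C: "is_category C" and \<alpha>: "\<alpha> \<in> Hom (presheaves U C) F G"
    and F: "F \<in> Obj (presheaves U C)" and G: "G \<in> Obj (presheaves U C)"
    and bij: "\<And>a. a \<in> Obj C \<Longrightarrow> bij_betw (\<alpha> a) (ob F a) (ob G a)"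
  shows "is_iso (presheaves U C) F G \<alpha>"
proof -
  define \<beta> where "\<beta> a = inv_into (ob F a) (\<alpha> a)" for a
  have \<beta>: "\<beta> a y \<in> ob F a" "\<alpha> a (\<beta> a y) = y" if "a \<in> Obj C" "y \<in> ob G a" for a y
    using bij[OF that(1)] that(2) unfolding \<beta>_def
    by (auto simp: bij_betw_def f_inv_into_f inv_into_into)
  have \<beta>\<alpha>: "\<beta> a (\<alpha> a x) = x" if "a \<in> Obj C" "x \<in> ob F a" for a x
    using bij[OF that(1)] that(2) unfolding \<beta>_def by (simp add: bij_betw_def)
  let ?\<beta> = "\<lambda>a\<in>Obj C. \<lambda>y\<in>ob G a. \<beta> a y"
  have h: "?\<beta> \<in> Hom (presheaves U C) G F"
  proof (rule hom_intro[OF _ _ C G])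
    fix a b y assume *: "arrow_to C b a" "y \<in> ob G a"
    note o = arrow_to_Obj[OF *(1)]
    have "\<alpha> b (restr F a b (\<beta> a y)) = restr G a b y"
      using hom_restr[OF \<alpha> *(1)] \<beta>[OF o(1) *(2)] by simp
    then show "\<beta> b (restr G a b y) = restr F a b (\<beta> a y)"
      using \<beta>\<alpha>[OF o(2) restr_in[OF C F *(1)]] \<beta>[OF o(1) *(2)] by metis
  qed (rule \<beta>)
  have 1: "Cmp (presheaves U C) F G F ?\<beta> \<alpha> = Idn (presheaves U C) F"
    by (rule hom_eqI)
      (use \<alpha> h F G in \<open>auto intro!: cat_cmp[OF is_category_presheaves[OF C]] cat_id[OF is_category_presheaves[OF C]]
        simp: Cmp_presheaves_apply Idn_presheaves \<beta>\<alpha> hom_in\<close>)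
  have 2: "Cmp (presheaves U C) G F G \<alpha> ?\<beta> = Idn (presheaves U C) G"
    by (rule hom_eqI)
      (use \<alpha> h F G in \<open>auto intro!: cat_cmp[OF is_category_presheaves[OF C]] cat_id[OF is_category_presheaves[OF C]]
        simp: Cmp_presheaves_apply Idn_presheaves \<beta> hom_in\<close>)
  show ?thesis
    using \<alpha> h 1 2 by (auto simp: is_iso_def)
qed

lemma is_iso_sheaves: "is_iso (sheaves U C J) F G \<alpha> \<longleftrightarrow> is_iso (presheaves U C) F G \<alpha>"
  by (simp add: is_iso_def)

lemma sheaf_glue:
  fixes C :: "('c, unit) cat"
  assumes "F \<in> Obj (sheaves U C J)" "c \<in> Obj C" "L \<in> J c" "matching_family C F L x"
  obtains y where "y \<in> ob F c" "\<And>d. d \<in> L \<Longrightarrow> restr F c d y = x d"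
  using assms unfolding Obj_sheaves is_sheaf_def by metis

text \<open>The restrictions of \<open>y\<close> to \<open>L\<close> form a matching family, which
  both \<open>y\<close> and \<open>z\<close> glue.\<close>

lemma sheaf_separated:
  fixes C :: "('c, unit) cat"
  assumes C: "is_category C" and F: "F \<in> Obj (sheaves U C J)" and c: "c \<in> Obj C" "L \<in> J c" "is_sieve C c L"
    and y: "y \<in> ob F c" "z \<in> ob F c" "\<And>d. d \<in> L \<Longrightarrow> restr F c d y = restr F c d z"
  shows "y = z"
proof -
  have F': "F \<in> Obj (presheaves U C)"
    using F by (simp add: Obj_sheaves)
  have "matching_family C F L (\<lambda>d. restr F c d y)"
    using c(3) y(1) unfolding matching_family_def is_sieve_def
    by (auto simp: restr_in[OF C F'] restr_restr[OF C F'])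
  then have "\<exists>!y'. y' \<in> ob F c \<and> (\<forall>d\<in>L. restr F c d y' = restr F c d y)"
    using F c unfolding Obj_sheaves is_sheaf_def by blast
  then show ?thesis
    using y by metis
qed

text \<open>
  A sheaf whose sections are naturally elements of another type is re-encoded in the type of
  the universe.
\<close>

lemma coded_presheaf:
  fixes C :: "('c, unit) cat" and M :: "'c \<Rightarrow> 'a set" and U :: "'u set set"
  assumes C: "is_category C"
    and small: "\<And>c. c \<in> Obj C \<Longrightarrow> \<exists>e. inj_on e (M c) \<and> e ` M c \<in> U"
    and r: "\<And>c d x. arrow_to C d c \<Longrightarrow> x \<in> M c \<Longrightarrow> r c d x \<in> M d"
    and r_id: "\<And>c x. c \<in> Obj C \<Longrightarrow> x \<in> M c \<Longrightarrow> r c c x = x"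
    and r_r: "\<And>b c d x. arrow_to C c b \<Longrightarrow> arrow_to C d c \<Longrightarrow> x \<in> M b \<Longrightarrow> r c d (r b c x) = r b d x"
    and sieve: "\<And>c L. c \<in> Obj C \<Longrightarrow> L \<in> J c \<Longrightarrow> is_sieve C c L"
    and sheaf: "\<And>c L x. c \<in> Obj C \<Longrightarrow> L \<in> J c \<Longrightarrow>
      \<forall>d\<in>L. x d \<in> M d \<and> (\<forall>e. arrow_to C e d \<longrightarrow> r d e (x d) = x e) \<Longrightarrow>
      \<exists>!y. y \<in> M c \<and> (\<forall>d\<in>L. r c d y = x d)"
  obtains F :: "('c, 'u) presheaf" and e where "F \<in> Obj (sheaves U C J)"
    "\<And>c. c \<in> Obj C \<Longrightarrow> bij_betw (e c) (M c) (ob F c)"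
    "\<And>c d x. arrow_to C d c \<Longrightarrow> x \<in> M c \<Longrightarrow> restr F c d (e c x) = e d (r c d x)"
proof -
  obtain e where e: "\<And>c. c \<in> Obj C \<Longrightarrow> inj_on (e c) (M c) \<and> e c ` M c \<in> U"
    using small by metis
  define i where "i c = inv_into (M c) (e c)" for c
  have ie: "i c (e c x) = x" if "c \<in> Obj C" "x \<in> M c" for c x
    using e[OF that(1)] that(2) by (simp add: i_def)
  define F where "F = \<lparr>ob = \<lambda>c. e c ` M c, ar = \<lambda>c d (_ :: unit). \<lambda>x\<in>e c ` M c. e d (r c d (i c x))\<rparr>"
  have Fo: "ob F c = e c ` M c" for c
    by (simp add: F_def)
  have Fr: "restr F c d (e c x) = e d (r c d x)" if "arrow_to C d c" "x \<in> M c" for c d x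
    using that arrow_to_Obj[OF that(1)] by (simp add: F_def restr_def ie)
  have F: "F \<in> Obj (presheaves U C)"
    unfolding presheaf_iff[OF C] Fo
  proof (intro conjI ballI allI impI)
    show "restr F a b \<in> e a ` M a \<rightarrow>\<^sub>E e b ` M b" if "arrow_to C b a" for a b
      using that r Fr by (auto simp: F_def restr_def)
    show "restr F a a x = x" if "a \<in> Obj C" "x \<in> e a ` M a" for a x
      using that by (auto simp: Fr arrow_to_refl[OF C] r_id)
    show "restr F b c (restr F a b x) = restr F a c x"
      if "arrow_to C b a" "arrow_to C c b" "x \<in> e a ` M a" for a b c x
      using that by (auto simp: Fr arrow_to_trans[OF C that(2,1)] r_r r)
  qed (use e in auto)
  have "is_sheaf C J F"
    unfolding is_sheaf_def
  proof (intro ballI allI impI)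
    fix c L x assume c: "c \<in> Obj C" "L \<in> J c" and x: "matching_family C F L x"
    have L: "d \<in> Obj C" "arrow_to C d c" "\<And>k. arrow_to C k d \<Longrightarrow> k \<in> L" if "d \<in> L" for d
      using sieve[OF c] that unfolding is_sieve_def by (auto dest: arrow_to_Obj)
    have ix: "i d (x d) \<in> M d" "e d (i d (x d)) = x d" if "d \<in> L" for d
      using x that L ie unfolding matching_family_def Fo by auto
    have "r d k (i d (x d)) = i k (x k)" if "d \<in> L" "arrow_to C k d" for d k
    proof -
      have "e k (r d k (i d (x d))) = x k"
        using x that ix[OF that(1)] Fr[OF that(2) ix(1)[OF that(1)]] unfolding matching_family_def by metis
      then show ?thesis
        using ie[of k "r d k (i d (x d))"] r[OF that(2) ix(1)[OF that(1)]] arrow_to_Obj[OF that(2)] by metis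
    qed
    then have uni: "\<exists>!y. y \<in> M c \<and> (\<forall>d\<in>L. r c d y = i d (x d))"
      using ix by (intro sheaf c) auto
    have "r c d y = i d (x d) \<longleftrightarrow> restr F c d (e c y) = x d" if "y \<in> M c" "d \<in> L" for y d
      using Fr[OF L(2)[OF that(2)] that(1)] ix[OF that(2)] ie[OF L(1)[OF that(2)] r[OF L(2)[OF that(2)] that(1)]]
      by metis
    then have "\<exists>!y. y \<in> M c \<and> (\<forall>d\<in>L. restr F c d (e c y) = x d)"
      using uni by (metis (no_types, lifting))
    then show "\<exists>!y. y \<in> ob F c \<and> (\<forall>d\<in>L. restr F c d y = x d)"
      unfolding Fo by blast
  qed
  then have "F \<in> Obj (sheaves U C J)"
    using F by (simp add: Obj_sheaves)
  then show thesis
    using e by (intro that[OF _ _ Fr]) (auto simp: Fo bij_betw_def)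
qed

section \<open>Sites over the big cell\<close>

lemma is_sieve_big_cell:
  "is_sieve big_cell n L \<longleftrightarrow> (\<forall>m\<in>L. 0 < m \<and> 0 < n \<and> n dvd m \<and> (\<forall>k>0. m dvd k \<longrightarrow> k \<in> L))"
  by (auto simp: is_sieve_def arrow_to_big_cell)

lemma multiples_up: "m \<in> {m. 0 < m \<and> n dvd m} \<Longrightarrow> 0 < k \<Longrightarrow> m dvd k \<Longrightarrow> k \<in> {m. 0 < m \<and> n dvd m}" for n m k :: nat
  using dvd_trans[of n m k] by simp

locale big_cell_site =
  fixes U :: "'u set set" and J :: "nat \<Rightarrow> nat set set"
  assumes U: "set_universe U" and J: "grothendieck_topology big_cell J"
begin

abbreviation PSh :: "((nat, 'u) presheaf, nat \<Rightarrow> 'u \<Rightarrow> 'u) cat"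
  where "PSh \<equiv> presheaves U big_cell"

abbreviation Sh :: "((nat, 'u) presheaf, nat \<Rightarrow> 'u \<Rightarrow> 'u) cat"
  where "Sh \<equiv> sheaves U big_cell J"

text \<open>The local modality of Kripke-Joyal semantics: \<open>Q\<close> holds on a cover of
  \<open>n\<close>. Taking the whole set of multiples with \<open>Q\<close>, rather than some cover
  contained in it, makes \<open>stable n Q\<close> part of the statement, since members of
  \<open>J n\<close> are sieves.\<close>

definition locally :: "nat \<Rightarrow> (nat \<Rightarrow> bool) \<Rightarrow> bool" where
  "locally n Q \<longleftrightarrow> {m. m > 0 \<and> n dvd m \<and> Q m} \<in> J n"

definition stable :: "nat \<Rightarrow> (nat \<Rightarrow> bool) \<Rightarrow> bool" where
  "stable n Q \<longleftrightarrow> (\<forall>m k. m > 0 \<longrightarrow> n dvd m \<longrightarrow> Q m \<longrightarrow> k > 0 \<longrightarrow> m dvd k \<longrightarrow> Q k)"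

lemma J_conditions:
  assumes "n > 0"
  shows "(\<forall>L\<in>J n. is_sieve big_cell n L) \<and> {d. arrow_to big_cell d n} \<in> J n \<and>
    (\<forall>L\<in>J n. \<forall>d. arrow_to big_cell d n \<longrightarrow> pullback_sieve big_cell L d \<in> J d) \<and>
    (\<forall>L\<in>J n. \<forall>R. is_sieve big_cell n R \<and> (\<forall>d\<in>L. pullback_sieve big_cell R d \<in> J d) \<longrightarrow> R \<in> J n)"
  by (rule bspec[OF conjunct2[OF J[unfolded grothendieck_topology_def]]]) (use assms in simp)

lemma J_empty: "L \<in> J n \<Longrightarrow> n > 0"
  using conjunct1[OF J[unfolded grothendieck_topology_def], THEN spec, of n] by (cases "n = 0") simp_all

lemma J_sieve: "L \<in> J n \<Longrightarrow> is_sieve big_cell n L"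
  using J_conditions[OF J_empty] by blast

lemma J_sieveD: "L \<in> J n \<Longrightarrow> m \<in> L \<Longrightarrow> m > 0 \<and> n dvd m"
  using J_sieve by (auto simp: is_sieve_big_cell)

lemma J_max: "n > 0 \<Longrightarrow> {m. m > 0 \<and> n dvd m} \<in> J n"
  using J_conditions[of n] by (simp add: arrow_to_big_cell)

lemma J_pullback:
  assumes "L \<in> J n" "m > 0" "n dvd m"
  shows "{k \<in> L. m dvd k} \<in> J m"
proof -
  have "pullback_sieve big_cell L m \<in> J m"
    using J_conditions[OF J_empty[OF assms(1)]] assms J_empty[OF assms(1)]
    by (simp add: arrow_to_big_cell)
  moreover have "pullback_sieve big_cell L m = {k \<in> L. m dvd k}"
    using assms J_sieveD by (auto simp: pullback_sieve_def arrow_to_big_cell)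
  ultimately show ?thesis by simp
qed

lemma J_trans:
  assumes "L \<in> J n" "is_sieve big_cell n R" "\<And>m. m \<in> L \<Longrightarrow> {k \<in> R. m dvd k} \<in> J m"
  shows "R \<in> J n"
proof -
  have "pullback_sieve big_cell R m = {k \<in> R. m dvd k}" if "m \<in> L" for m
    using assms(2) J_sieveD[OF assms(1) that] by (auto simp: pullback_sieve_def arrow_to_big_cell is_sieve_big_cell)
  then have "\<forall>d\<in>L. pullback_sieve big_cell R d \<in> J d"
    using assms(3) by simp
  then show ?thesis
    using J_conditions[OF J_empty[OF assms(1)]] assms(1,2) by blast
qed

section \<open>Rules for reasoning locally on a site\<close>

lemma stableI: "(\<And>m k. m > 0 \<Longrightarrow> n dvd m \<Longrightarrow> Q m \<Longrightarrow> k > 0 \<Longrightarrow> m dvd k \<Longrightarrow> Q k) \<Longrightarrow> stable n Q"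
  by (simp add: stable_def)

lemma stableD: "stable n Q \<Longrightarrow> Q m \<Longrightarrow> m > 0 \<Longrightarrow> n dvd m \<Longrightarrow> k > 0 \<Longrightarrow> m dvd k \<Longrightarrow> Q k"
  unfolding stable_def by blast

lemma locally_stable: "locally n Q \<Longrightarrow> stable n Q"
proof (rule stableI)
  fix m k assume "locally n Q" "m > 0" "n dvd m" "Q m" "k > 0" "m dvd k"
  then have "k \<in> {m. m > 0 \<and> n dvd m \<and> Q m}"
    using bspec[OF J_sieve[of _ n, unfolded is_sieve_big_cell], of _ m] unfolding locally_def by blast
  then show "Q k"
    by simp
qed

lemma locally_pos: "locally n Q \<Longrightarrow> n > 0"
  unfolding locally_def by (rule J_empty)

lemma sieve_stable:
  assumes "n > 0" "stable n Q"
  shows "is_sieve big_cell n {m. m > 0 \<and> n dvd m \<and> Q m}"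
  unfolding is_sieve_big_cell
proof (intro ballI conjI allI impI)
  fix m k assume "m \<in> {m. m > 0 \<and> n dvd m \<and> Q m}" "0 < k" "m dvd k"
  then show "k \<in> {m. m > 0 \<and> n dvd m \<and> Q m}"
    using stableD[OF assms(2), of m k] dvd_trans[of n m k] by simp
qed (use assms(1) in simp_all)

lemma locally_restrict:
  assumes "locally n Q" "m > 0" "n dvd m"
  shows "locally m Q"
proof -
  have "{k \<in> {m. m > 0 \<and> n dvd m \<and> Q m}. m dvd k} = {k. k > 0 \<and> m dvd k \<and> Q k}"
    using dvd_trans[OF assms(3)] by auto
  then show ?thesis
    using J_pullback[OF assms(1)[unfolded locally_def] assms(2,3)] by (simp add: locally_def)
qed

text \<open>The local character axiom of \<open>J\<close>: what holds locally on each member of a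
  cover holds locally. Stability of \<open>Q\<close> is what turns the set of good multiples into a
  sieve, to which the axiom can be applied.\<close>

lemma locally_trans:
  assumes "locally n R" "stable n Q" "\<And>m. m > 0 \<Longrightarrow> n dvd m \<Longrightarrow> R m \<Longrightarrow> locally m Q"
  shows "locally n Q"
  unfolding locally_def
proof (rule J_trans)
  show "{m. m > 0 \<and> n dvd m \<and> R m} \<in> J n"
    using assms(1) by (simp add: locally_def)
  fix m assume m: "m \<in> {m. m > 0 \<and> n dvd m \<and> R m}"
  then have "{k. k > 0 \<and> m dvd k \<and> Q k} \<in> J m"
    using assms(3)[of m] by (simp add: locally_def)
  moreover have "{k \<in> {m. m > 0 \<and> n dvd m \<and> Q m}. m dvd k} = {k. k > 0 \<and> m dvd k \<and> Q k}"
    using m dvd_trans[of n m] by auto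
  ultimately show "{k \<in> {m. m > 0 \<and> n dvd m \<and> Q m}. m dvd k} \<in> J m"
    by simp
qed (use sieve_stable assms locally_pos in auto)

lemma locally_true: "n > 0 \<Longrightarrow> locally n (\<lambda>_. True)"
  using J_max by (simp add: locally_def)

lemma locally_here:
  assumes "n > 0" "stable n Q" "Q n"
  shows "locally n Q"
proof -
  have "{m. m > 0 \<and> n dvd m \<and> Q m} = {m. m > 0 \<and> n dvd m}"
    using stableD[OF assms(2,3)] assms(1) by auto
  then show ?thesis
    using J_max[OF assms(1)] by (simp add: locally_def)
qed

lemma stable_restrict:
  assumes "stable n Q" "n dvd m"
  shows "stable m Q"
proof (rule stableI)
  fix k l assume "k > 0" "m dvd k" "Q k" "l > 0" "k dvd l"
  then show "Q l"
    using stableD[OF assms(1), of k l] dvd_trans[OF assms(2), of k] by simp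
qed

lemma stable_conj:
  assumes "stable n Q" "stable n R"
  shows "stable n (\<lambda>m. Q m \<and> R m)"
proof (rule stableI)
  fix k l assume "k > 0" "n dvd k" "Q k \<and> R k" "l > 0" "k dvd l"
  then show "Q l \<and> R l"
    using stableD[OF assms(1), of k l] stableD[OF assms(2), of k l] by simp
qed

lemma stable_ball:
  assumes "\<And>i. i \<in> I \<Longrightarrow> stable n (Q i)"
  shows "stable n (\<lambda>m. \<forall>i\<in>I. Q i m)"
proof (rule stableI, rule ballI)
  fix k l i assume "k > 0" "n dvd k" "\<forall>i\<in>I. Q i k" "l > 0" "k dvd l" "i \<in> I"
  then show "Q i l"
    using stableD[OF assms, of i k l] by simp
qed

lemma locally_mono:
  assumes "locally n R" "stable n Q" "\<And>m. m > 0 \<Longrightarrow> n dvd m \<Longrightarrow> R m \<Longrightarrow> Q m"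
  shows "locally n Q"
proof (rule locally_trans[OF assms(1,2)])
  show "locally m Q" if "m > 0" "n dvd m" "R m" for m
    using that assms(3)[OF that] by (intro locally_here stable_restrict[OF assms(2)])
qed

lemma locally_conj:
  assumes "locally n Q" "locally n R"
  shows "locally n (\<lambda>m. Q m \<and> R m)"
proof (rule locally_trans[OF assms(1)])
  show s: "stable n (\<lambda>m. Q m \<and> R m)"
    by (rule stable_conj[OF locally_stable[OF assms(1)] locally_stable[OF assms(2)]])
  show "locally m (\<lambda>m. Q m \<and> R m)" if m: "m > 0" "n dvd m" "Q m" for m
  proof (rule locally_mono[OF locally_restrict[OF assms(2) m(1,2)]])
    show "stable m (\<lambda>m. Q m \<and> R m)"
      using s m(2) by (rule stable_restrict)
    show "Q k \<and> R k" if "k > 0" "m dvd k" "R k" for k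
      using that(3) stableD[OF locally_stable[OF assms(1)] m(3,1,2) that(1,2)] by simp
  qed
qed

text \<open>Covering sieves are closed under finite intersections, and in general not under infinite
  ones. This is the point at which finiteness of a diagram enters the exactness of
  sheafification.\<close>

lemma locally_ball:
  assumes "finite I" "n > 0" "\<And>i. i \<in> I \<Longrightarrow> locally n (Q i)"
  shows "locally n (\<lambda>m. \<forall>i\<in>I. Q i m)"
  using assms(1,3)
proof (induction I)
  case empty
  then show ?case
    using locally_true[OF assms(2)] by simp
next
  case (insert i I)
  then have "locally n (\<lambda>m. Q i m \<and> (\<forall>i\<in>I. Q i m))"
    by (auto intro: locally_conj)
  then show ?case
    by simp
qed

section \<open>Sections, restriction and gluing over the big cell\<close>

lemmas bc = is_category_big_cell

lemma Sh_PSh: "F \<in> Obj Sh \<Longrightarrow> F \<in> Obj PSh"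
  by (simp add: Obj_sheaves)

lemma p_in: "F \<in> Obj PSh \<Longrightarrow> x \<in> ob F n \<Longrightarrow> 0 < n \<Longrightarrow> 0 < m \<Longrightarrow> n dvd m \<Longrightarrow> restr F n m x \<in> ob F m"
  by (rule restr_in[OF bc]) (auto simp: arrow_to_big_cell)

lemma p_id: "F \<in> Obj PSh \<Longrightarrow> x \<in> ob F n \<Longrightarrow> 0 < n \<Longrightarrow> restr F n n x = x"
  by (rule restr_id[OF bc]) auto

lemma p_restr:
  "F \<in> Obj PSh \<Longrightarrow> x \<in> ob F n \<Longrightarrow> 0 < n \<Longrightarrow> 0 < m \<Longrightarrow> 0 < k \<Longrightarrow> n dvd m \<Longrightarrow> m dvd k \<Longrightarrow>
    restr F m k (restr F n m x) = restr F n k x"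
  by (rule restr_restr[OF bc]) (auto simp: arrow_to_big_cell)

lemma h_in: "\<alpha> \<in> Hom PSh F G \<Longrightarrow> x \<in> ob F n \<Longrightarrow> 0 < n \<Longrightarrow> \<alpha> n x \<in> ob G n"
  by (rule hom_in) auto

lemma h_restr:
  "\<alpha> \<in> Hom PSh F G \<Longrightarrow> x \<in> ob F n \<Longrightarrow> 0 < n \<Longrightarrow> 0 < m \<Longrightarrow> n dvd m \<Longrightarrow>
    \<alpha> m (restr F n m x) = restr G n m (\<alpha> n x)"
  by (rule hom_restr) (auto simp: arrow_to_big_cell)

lemma h_eqI:
  "\<alpha> \<in> Hom PSh F G \<Longrightarrow> \<beta> \<in> Hom PSh F G \<Longrightarrow> (\<And>n x. 0 < n \<Longrightarrow> x \<in> ob F n \<Longrightarrow> \<alpha> n x = \<beta> n x) \<Longrightarrow> \<alpha> = \<beta>"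
  by (rule hom_eqI[where C = big_cell]) auto

lemma h_intro:
  assumes "\<And>n x. 0 < n \<Longrightarrow> x \<in> ob F n \<Longrightarrow> f n x \<in> ob G n"
    and "\<And>n m x. 0 < n \<Longrightarrow> 0 < m \<Longrightarrow> n dvd m \<Longrightarrow> x \<in> ob F n \<Longrightarrow> restr F n m x \<in> ob F m \<Longrightarrow>
      f m (restr F n m x) = restr G n m (f n x)"
    and "F \<in> Obj PSh"
  shows "(\<lambda>n\<in>{0<..}. \<lambda>x\<in>ob F n. f n x) \<in> Hom PSh F G"
  using hom_intro[of big_cell F f G U] assms bc by (auto simp: arrow_to_big_cell)

lemma h_cmp: "F \<in> Obj PSh \<Longrightarrow> G \<in> Obj PSh \<Longrightarrow> H \<in> Obj PSh \<Longrightarrow> \<alpha> \<in> Hom PSh F G \<Longrightarrow> \<beta> \<in> Hom PSh G H \<Longrightarrow>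
    Cmp PSh F G H \<beta> \<alpha> \<in> Hom PSh F H"
  by (rule cat_cmp[OF is_category_presheaves[OF bc]])

lemma h_cmp_apply: "0 < n \<Longrightarrow> x \<in> ob F n \<Longrightarrow> Cmp PSh F G H \<beta> \<alpha> n x = \<beta> n (\<alpha> n x)"
  by (rule Cmp_presheaves_apply) auto

lemma stable_restr_eq:
  assumes "F \<in> Obj PSh" "x \<in> ob F n" "y \<in> ob F n" "n > 0"
  shows "stable n (\<lambda>m. restr F n m x = restr F n m y)"
proof (rule stableI)
  fix m k :: nat assume *: "m > 0" "n dvd m" "restr F n m x = restr F n m y" "k > 0" "m dvd k"
  then show "restr F n k x = restr F n k y"
    using p_restr[OF assms(1,2,4) *(1,4,2,5)] p_restr[OF assms(1,3,4) *(1,4,2,5)] by simp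
qed

lemma separated:
  assumes F: "F \<in> Obj Sh" and x: "x \<in> ob F n" "y \<in> ob F n" "locally n (\<lambda>m. restr F n m x = restr F n m y)"
  shows "x = y"
proof -
  let ?L = "{m. m > 0 \<and> n dvd m \<and> restr F n m x = restr F n m y}"
  have L: "?L \<in> J n"
    using x(3) by (simp add: locally_def)
  show ?thesis
    by (rule sheaf_separated[OF bc F _ L J_sieve[OF L] x(1,2)]) (use J_empty[OF L] in auto)
qed

lemma glue:
  assumes F: "F \<in> Obj Sh" and Q: "locally n Q"
    and x: "\<And>m. m > 0 \<Longrightarrow> n dvd m \<Longrightarrow> Q m \<Longrightarrow> x m \<in> ob F m"
    and m: "\<And>m k. m > 0 \<Longrightarrow> n dvd m \<Longrightarrow> Q m \<Longrightarrow> k > 0 \<Longrightarrow> m dvd k \<Longrightarrow> restr F m k (x m) = x k"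
  obtains y where "y \<in> ob F n" "\<And>m. m > 0 \<Longrightarrow> n dvd m \<Longrightarrow> Q m \<Longrightarrow> restr F n m y = x m"
proof -
  have "matching_family big_cell F {m. m > 0 \<and> n dvd m \<and> Q m} x"
    using x m by (auto simp: matching_family_def arrow_to_big_cell)
  then obtain y where "y \<in> ob F n" "\<And>m. m \<in> {m. m > 0 \<and> n dvd m \<and> Q m} \<Longrightarrow> restr F n m y = x m"
    using Q locally_pos[OF Q] sheaf_glue[OF F, of n "{m. m > 0 \<and> n dvd m \<and> Q m}" x]
    unfolding locally_def by (metis Obj_big_cell greaterThan_iff)
  then show thesis
    using that by auto
qed

text \<open>
  Gluing along a functional relation: in practice \<open>R m\<close> is the graph of a locally defined,
  locally unique section.
\<close>

lemma glue_rel: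
  assumes F: "F \<in> Obj Sh" and Q: "locally n (\<lambda>m. \<exists>x\<in>ob F m. R m x)"
    and uni: "\<And>m x y. m > 0 \<Longrightarrow> n dvd m \<Longrightarrow> x \<in> ob F m \<Longrightarrow> y \<in> ob F m \<Longrightarrow> R m x \<Longrightarrow> R m y \<Longrightarrow> x = y"
    and R: "\<And>m k x. m > 0 \<Longrightarrow> n dvd m \<Longrightarrow> x \<in> ob F m \<Longrightarrow> R m x \<Longrightarrow> k > 0 \<Longrightarrow> m dvd k \<Longrightarrow> R k (restr F m k x)"
  shows "\<exists>y\<in>ob F n. \<forall>m>0. \<forall>x\<in>ob F m. n dvd m \<longrightarrow> R m x \<longrightarrow> restr F n m y = x"
proof -
  define s where "s m = (SOME x. x \<in> ob F m \<and> R m x)" for m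
  have s: "s m \<in> ob F m \<and> R m (s m)" if "\<exists>x\<in>ob F m. R m x" for m
    unfolding s_def by (rule someI_ex) (use that in blast)
  obtain y where "y \<in> ob F n" "\<And>m. m > 0 \<Longrightarrow> n dvd m \<Longrightarrow> \<exists>x\<in>ob F m. R m x \<Longrightarrow> restr F n m y = s m"
  proof (rule glue[OF F Q, of s])
    fix m k :: nat assume *: "m > 0" "n dvd m" "\<exists>x\<in>ob F m. R m x" "k > 0" "m dvd k"
    have "restr F m k (s m) \<in> ob F k" "R k (restr F m k (s m))"
      using * s[OF *(3)] R p_in[OF Sh_PSh[OF F]] by auto
    moreover from this have "s k \<in> ob F k \<and> R k (s k)"
      by (intro s) blast
    ultimately show "restr F m k (s m) = s k"
      using uni[of k] * dvd_trans[OF *(2,5)] by metis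
  qed (use s in auto)
  then show ?thesis
    using s uni by (metis (no_types, lifting))
qed

subsection \<open>Closed sets, subterminal sheaves and the Yoneda lemma\<close>

text \<open>The sheafified representable presheaf of \<open>n\<close> is the subterminal sheaf of the closure of \<open>n\<close>.\<close>

definition subterm :: "nat set \<Rightarrow> (nat, 'u) presheaf" where
  "subterm W = \<lparr>ob = (\<lambda>m. if m \<in> W then {undefined} else {}),
     ar = (\<lambda>m k _. \<lambda>x\<in>(if m \<in> W then {undefined} else {}). x)\<rparr>"

definition J_closed :: "nat set \<Rightarrow> bool" where
  "J_closed W \<longleftrightarrow> W \<subseteq> {0<..} \<and> (\<forall>m\<in>W. \<forall>k>0. m dvd k \<longrightarrow> k \<in> W) \<and> (\<forall>m. locally m (\<lambda>k. k \<in> W) \<longrightarrow> m \<in> W)"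

definition clos :: "nat set \<Rightarrow> nat set" where
  "clos W = {m. locally m (\<lambda>k. k \<in> W)}"

definition yon :: "nat \<Rightarrow> (nat, 'u) presheaf" where
  "yon n = subterm (clos {m. m > 0 \<and> n dvd m})"

lemma J_closed_clos:
  assumes "\<And>m k. m \<in> W \<Longrightarrow> k > 0 \<Longrightarrow> m dvd k \<Longrightarrow> k \<in> W"
  shows "J_closed (clos W)"
  unfolding J_closed_def clos_def
proof (intro conjI ballI allI impI)
  fix m assume "locally m (\<lambda>k. k \<in> {m. locally m (\<lambda>k. k \<in> W)})"
  then have "locally m (\<lambda>k. k \<in> W)"
    by (rule locally_trans) (auto intro: stableI assms)
  then show "m \<in> {m. locally m (\<lambda>k. k \<in> W)}"
    by simp
qed (auto intro: locally_pos locally_restrict)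

lemma mem_clos: "m > 0 \<Longrightarrow> m \<in> W \<Longrightarrow> (\<And>m k. m \<in> W \<Longrightarrow> k > 0 \<Longrightarrow> m dvd k \<Longrightarrow> k \<in> W) \<Longrightarrow> m \<in> clos W"
  unfolding clos_def by (auto intro!: locally_here stableI)

lemma J_closedD:
  assumes "J_closed W"
  shows "m \<in> W \<Longrightarrow> m > 0" "m \<in> W \<Longrightarrow> k > 0 \<Longrightarrow> m dvd k \<Longrightarrow> k \<in> W"
    "locally m (\<lambda>k. k \<in> W) \<Longrightarrow> m \<in> W"
  using assms unfolding J_closed_def by blast+

lemma subterm_presheaf:
  assumes "W \<subseteq> {0<..}" "\<And>m k. m \<in> W \<Longrightarrow> k > 0 \<Longrightarrow> m dvd k \<Longrightarrow> k \<in> W"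
  shows "subterm W \<in> Obj PSh"
  unfolding presheaf_iff[OF bc]
  using assms universe_empty[OF U] universe_singleton[OF U, of undefined]
  by (auto simp: subterm_def restr_def arrow_to_big_cell)

text \<open>A family over a cover has only one possible value, \<open>undefined\<close>, so gluing
  it asks just that \<open>n\<close> lie in \<open>W\<close> when a cover of \<open>n\<close> does,
  which is closedness.\<close>

lemma subterm_sheaf:
  assumes W: "J_closed W"
  shows "subterm W \<in> Obj Sh"
  unfolding Obj_sheaves
proof (intro conjI)
  show "subterm W \<in> Obj PSh"
    by (rule subterm_presheaf) (use J_closedD(1)[OF W] in auto, rule J_closedD(2)[OF W])
  show "is_sheaf big_cell J (subterm W)"
    unfolding is_sheaf_def
  proof (intro ballI allI impI)
    fix n L x assume n: "n \<in> Obj big_cell" and L: "L \<in> J n" and x: "matching_family big_cell (subterm W) L x"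
    have LW: "x m = undefined" "m \<in> W" if "m \<in> L" for m
    proof -
      have "x m \<in> ob (subterm W) m"
        using x that unfolding matching_family_def by blast
      then show "x m = undefined" "m \<in> W"
        by (auto simp: subterm_def split: if_splits)
    qed
    have "{m. m > 0 \<and> n dvd m \<and> m \<in> L} = L"
      using J_sieveD[OF L] by auto
    then have "locally n (\<lambda>k. k \<in> L)"
      using L by (simp add: locally_def)
    then have "locally n (\<lambda>k. k \<in> W)"
      by (rule locally_mono) (rule stableI[OF J_closedD(2)[OF W]], assumption+, rule LW(2))
    then have "n \<in> W"
      by (rule J_closedD(3)[OF W])
    then show "\<exists>!y. y \<in> ob (subterm W) n \<and> (\<forall>d\<in>L. restr (subterm W) n d y = x d)"
      by (auto simp: subterm_def restr_def LW)
  qed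
qed

lemma yon_sheaf: "yon n \<in> Obj Sh"
  unfolding yon_def by (rule subterm_sheaf[OF J_closed_clos]) (rule multiples_up)

lemma yon_self: "n > 0 \<Longrightarrow> ob (yon n) n = {undefined}"
  unfolding yon_def subterm_def using mem_clos[of n "{m. m > 0 \<and> n dvd m}", OF _ _ multiples_up] by simp

lemma restr_subterm: "x \<in> ob (subterm W) n \<Longrightarrow> restr (subterm W) n m x = undefined"
  by (auto simp: subterm_def restr_def split: if_splits)

lemma ob_subterm: "x \<in> ob (subterm W) n \<longleftrightarrow> n \<in> W \<and> x = undefined"
  by (auto simp: subterm_def)

text \<open>Over an \<open>m\<close> in the closure, the multiples of \<open>n\<close> cover
  \<open>m\<close>, and on them the restrictions of \<open>x\<close> match; the glued section is the
  value of the transformation at \<open>m\<close>. In this way the Yoneda lemma for the sheafified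
  representable precedes any construction of sheafification.\<close>

lemma yoneda:
  assumes F: "F \<in> Obj Sh" and n: "n > 0" and x: "x \<in> ob F n"
  shows "\<exists>!\<tau>. \<tau> \<in> Hom PSh (yon n) F \<and> \<tau> n undefined = x"
proof -
  note F' = Sh_PSh[OF F]
  have ex: "\<exists>y\<in>ob F m. \<forall>k>0. m dvd k \<longrightarrow> n dvd k \<longrightarrow> restr F m k y = restr F n k x"
    if "m \<in> clos {m. m > 0 \<and> n dvd m}" for m
  proof -
    have "stable m (\<lambda>k. n dvd k)"
      by (rule stableI) (rule dvd_trans)
    then have l: "locally m (\<lambda>k. n dvd k)"
      using that unfolding clos_def by (auto elim: locally_mono)
    obtain y where "y \<in> ob F m" "\<And>k. k > 0 \<Longrightarrow> m dvd k \<Longrightarrow> n dvd k \<Longrightarrow> restr F m k y = restr F n k x"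
      by (rule glue[OF F l, of "\<lambda>k. restr F n k x"]) (use n x in \<open>auto simp: p_in[OF F'] p_restr[OF F']\<close>)
    then show ?thesis by blast
  qed
  \<comment> \<open>Sections over \<open>m\<close> are compared on the cover of \<open>m\<close> by
    common multiples of \<open>m\<close> and \<open>n\<close>. Existence above and this uniqueness
    determine \<open>t\<close>, its compatibility with restriction and its value at
    \<open>n\<close>.\<close>
  have uni: "y = z" if "m \<in> clos {m. m > 0 \<and> n dvd m}" "y \<in> ob F m" "z \<in> ob F m"
    "\<And>k. k > 0 \<Longrightarrow> m dvd k \<Longrightarrow> n dvd k \<Longrightarrow> restr F m k y = restr F m k z" for m y z
  proof (rule separated[OF F that(2,3)])
    show "locally m (\<lambda>k. restr F m k y = restr F m k z)"
      using that(1) unfolding clos_def mem_Collect_eq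
      by (rule locally_mono) (use that locally_pos[of m] in \<open>auto intro: stable_restr_eq[OF F'] simp: clos_def\<close>)
  qed
  obtain t where t: "\<And>m. m \<in> clos {m. m > 0 \<and> n dvd m} \<Longrightarrow> t m \<in> ob F m"
    and tr: "\<And>m k. m \<in> clos {m. m > 0 \<and> n dvd m} \<Longrightarrow> k > 0 \<Longrightarrow> m dvd k \<Longrightarrow> n dvd k \<Longrightarrow> restr F m k (t m) = restr F n k x"
    using bchoice[of "clos {m. m > 0 \<and> n dvd m}" "\<lambda>m y. y \<in> ob F m \<and> (\<forall>k>0. m dvd k \<longrightarrow> n dvd k \<longrightarrow> restr F m k y = restr F n k x)"] ex
    by blast
  have cl: "m > 0" if "m \<in> clos {m. m > 0 \<and> n dvd m}" for m
    using that locally_pos by (auto simp: clos_def)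
  have nn: "n \<in> clos {m. m > 0 \<and> n dvd m}"
    using n by (intro mem_clos[OF _ _ multiples_up]) auto
  have tres: "restr F m k (t m) = t k"
    if m: "m \<in> clos {m. m > 0 \<and> n dvd m}" "k > 0" "m dvd k" for m k
  proof (rule uni)
    show k: "k \<in> clos {m. m > 0 \<and> n dvd m}"
      using m locally_restrict by (auto simp: clos_def)
    show "restr F m k (t m) \<in> ob F k"
      using m cl t p_in[OF F'] by auto
    show "t k \<in> ob F k"
      using k t by auto
    show "restr F k l (restr F m k (t m)) = restr F k l (t k)" if l: "l > 0" "k dvd l" "n dvd l" for l
    proof -
      have "restr F m l (t m) = restr F k l (t k)"
        using tr[OF m(1) l(1) dvd_trans[OF m(3) l(2)] l(3)] tr[OF k l] by simp
      then show ?thesis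
        using m l cl[OF m(1)] t[OF m(1)] by (simp add: p_restr[OF F'])
    qed
  qed
  have tn: "t n = x"
    by (rule uni[OF nn]) (use nn n x t tr in auto)
  let ?\<tau> = "\<lambda>m\<in>{0<..}. \<lambda>u\<in>ob (yon n) m. t m"
  have "?\<tau> \<in> Hom PSh (yon n) F"
    by (rule h_intro[OF _ _ Sh_PSh[OF yon_sheaf]]) (auto simp: yon_def ob_subterm t tres)
  moreover have "?\<tau> n undefined = x"
    using n tn by (simp add: yon_self)
  moreover have "\<tau> = \<sigma>" if "\<tau> \<in> Hom PSh (yon n) F" "\<sigma> \<in> Hom PSh (yon n) F" "\<tau> n undefined = \<sigma> n undefined" for \<tau> \<sigma>
  proof (rule h_eqI[OF that(1,2)])
    fix m u assume m: "0 < m" and u: "u \<in> ob (yon n) m"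
    then have mc: "m \<in> clos {m. m > 0 \<and> n dvd m}"
      by (auto simp: yon_def ob_subterm)
    have *: "restr F m k (\<rho> m u) = restr F n k (\<rho> n undefined)"
      if "\<rho> \<in> Hom PSh (yon n) F" "k > 0" "m dvd k" "n dvd k" for \<rho> k
    proof -
      have "undefined \<in> ob (yon n) n"
        using n by (simp add: yon_self)
      then show ?thesis
        using h_restr[OF that(1) u m that(2,3)] h_restr[OF that(1) _ n that(2,4), of undefined] u
        by (simp add: yon_def restr_subterm)
    qed
    show "\<tau> m u = \<sigma> m u"
      by (rule uni[OF mc]) (use m u that * in \<open>auto intro: h_in\<close>)
  qed
  ultimately show ?thesis
    by metis
qed

end

section \<open>Sheafification\<close>

lemma nat_open_iff: "s \<in> nat_open L \<longleftrightarrow> (\<exists>n\<in>L. snat n sdvd s)"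
  by (simp add: nat_open_def)

lemma snat_dvd_mono: "n dvd m \<Longrightarrow> m > 0 \<Longrightarrow> snat n sdvd snat m"
  unfolding sdvd_def snat.rep_eq by (auto intro: dvd_imp_multiplicity_le)

lemma snat_sdvd_trans: "n dvd m \<Longrightarrow> m > 0 \<Longrightarrow> snat m sdvd s \<Longrightarrow> snat n sdvd s"
  by (blast intro: snat_dvd_mono sdvd_trans)

lemma K_top_iff: "L \<in> K_top S n \<longleftrightarrow> n > 0 \<and> is_sieve big_cell n L \<and> nat_open {n} \<inter> S \<subseteq> nat_open L"
  by (simp add: K_top_def)

lemma mem_K_top:
  assumes "n > 0" "is_sieve big_cell n L"
  shows "L \<in> K_top S n \<longleftrightarrow> (\<forall>s\<in>S. snat n sdvd s \<longrightarrow> (\<exists>m\<in>L. snat m sdvd s))"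
  using assms by (auto simp: K_top_iff nat_open_iff)

lemma K_topD: "L \<in> K_top S n \<Longrightarrow> s \<in> S \<Longrightarrow> snat n sdvd s \<Longrightarrow> \<exists>m\<in>L. snat m sdvd s"
  unfolding K_top_iff nat_open_def by blast

lemma is_sieve_multiples: "n > 0 \<Longrightarrow> is_sieve big_cell n {m. 0 < m \<and> n dvd m}"
  unfolding is_sieve_big_cell
  by (intro ballI conjI allI impI) (simp, simp, simp, rule multiples_up)

lemma sieve_big_cellD:
  assumes "is_sieve big_cell n L" "m \<in> L"
  shows "m > 0" "n > 0" "n dvd m" "k > 0 \<Longrightarrow> m dvd k \<Longrightarrow> k \<in> L"
  using assms unfolding is_sieve_big_cell by blast+

lemma grothendieck_K_top: "grothendieck_topology big_cell (K_top S)"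
  unfolding grothendieck_topology_def
proof (intro conjI allI impI ballI)
  fix n :: nat
  {
    assume "n \<notin> Obj big_cell"
    then show "K_top S n = {}"
      by (simp add: K_top_def)
  }
  assume "n \<in> Obj big_cell"
  then have n: "n > 0"
    by simp
  {
    fix L assume "L \<in> K_top S n"
    then show "is_sieve big_cell n L"
      by (simp add: K_top_iff)
  }
  have "is_sieve big_cell n {d. arrow_to big_cell d n}"
    using is_sieve_multiples[OF n] n by (simp add: arrow_to_big_cell)
  then show "{d. arrow_to big_cell d n} \<in> K_top S n"
    using n by (auto simp: mem_K_top arrow_to_big_cell)
  fix L assume L: "L \<in> K_top S n"
  then have sL: "is_sieve big_cell n L"
    by (simp add: K_top_iff)
  {
    fix d assume "arrow_to big_cell d n"
    then have d: "d > 0" "n dvd d"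
      by (auto simp: arrow_to_big_cell)
    have s: "is_sieve big_cell d (pullback_sieve big_cell L d)"
      unfolding is_sieve_def
    proof (intro ballI conjI allI impI)
      fix m assume m: "m \<in> pullback_sieve big_cell L d"
      then show md: "arrow_to big_cell m d"
        by (simp add: pullback_sieve_def)
      fix k assume k: "arrow_to big_cell k m"
      have "arrow_to big_cell k d"
        by (rule arrow_to_trans[OF is_category_big_cell k md])
      moreover have "k \<in> L"
        using m k sieve_big_cellD(4)[OF sL, of m k] by (simp add: pullback_sieve_def arrow_to_big_cell)
      ultimately show "k \<in> pullback_sieve big_cell L d"
        by (simp add: pullback_sieve_def)
    qed
    show "pullback_sieve big_cell L d \<in> K_top S d"
      unfolding mem_K_top[OF d(1) s]
    proof (intro ballI impI)
      fix s assume s: "s \<in> S" "snat d sdvd s"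
      then obtain m where m: "m \<in> L" "snat m sdvd s"
        using L snat_sdvd_trans[OF d(2,1)] unfolding mem_K_top[OF n sL] by blast
      \<comment> \<open>The member \<open>m\<close> of \<open>L\<close> need not be a multiple of
        \<open>d\<close>; its \<open>lcm\<close> with \<open>d\<close> lies in the pulled back sieve
        and still divides \<open>s\<close>, since both numbers do.\<close>
      have "lcm m d \<in> pullback_sieve big_cell L d"
        using sieve_big_cellD(1)[OF sL m(1)] sieve_big_cellD(4)[OF sL m(1), of "lcm m d"] d
        by (simp add: pullback_sieve_def arrow_to_big_cell lcm_pos_nat)
      moreover have "snat (lcm m d) sdvd s"
        using s m sieve_big_cellD(1)[OF sL m(1)] d snat_lcm_sdvd by simp
      ultimately show "\<exists>m\<in>pullback_sieve big_cell L d. snat m sdvd s" ..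
    qed
  }
  fix R assume R: "is_sieve big_cell n R \<and> (\<forall>d\<in>L. pullback_sieve big_cell R d \<in> K_top S d)"
  show "R \<in> K_top S n"
    unfolding mem_K_top[OF n conjunct1[OF R]]
  proof (intro ballI impI)
    fix s assume s: "s \<in> S" "snat n sdvd s"
    then obtain m where m: "m \<in> L" "snat m sdvd s"
      using L unfolding mem_K_top[OF n sL] by blast
    then have "pullback_sieve big_cell R m \<in> K_top S m"
      using R by blast
    then obtain k where "k \<in> pullback_sieve big_cell R m" "snat k sdvd s"
      using s m K_topD by blast
    then show "\<exists>k\<in>R. snat k sdvd s"
      by (auto simp: pullback_sieve_def)
  qed
qed

lemma big_cell_site_K_top: "set_universe U \<Longrightarrow> big_cell_site U (K_top S)"
  by (simp add: big_cell_site_def grothendieck_K_top)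

text \<open>The guard \<open>m > 0\<close> reflects that multiplicities of 0 are 0 by convention, so
  that \<open>snat 0\<close> divides everything.\<close>

lemma snat_sdvd_snat: "n > 0 \<Longrightarrow> snat m sdvd snat n \<longleftrightarrow> m > 0 \<longrightarrow> m dvd n"
proof
  assume n: "n > 0" and *: "snat m sdvd snat n"
  show "m > 0 \<longrightarrow> m dvd n"
  proof
    assume m: "m > 0"
    have "multiplicity p m \<le> multiplicity p n" if "prime p" for p
      using * that unfolding sdvd_def snat.rep_eq by (metis enat_ord_simps(1))
    then show "m dvd n"
      using m n by (intro multiplicity_le_imp_dvd) auto
  qed
next
  assume n: "n > 0" and *: "m > 0 \<longrightarrow> m dvd n"
  show "snat m sdvd snat n"
  proof (cases "m > 0")
    case False
    then show ?thesis
      by (simp add: sdvd_def snat.rep_eq flip: zero_enat_def)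
  qed (use n * snat_dvd_mono in auto)
qed

text \<open>Among the points is \<open>snat n\<close> itself. A cover of \<open>n\<close> must
  contain a divisor of \<open>n\<close>, and its members are multiples of \<open>n\<close>, so it
  contains \<open>n\<close> and is the maximal sieve: the topology is trivial.\<close>

lemma is_sheaf_K_top_UNIV:
  assumes F: "F \<in> Obj (presheaves U big_cell)"
  shows "is_sheaf big_cell (K_top UNIV) F"
  unfolding is_sheaf_def
proof (intro ballI allI impI)
  fix n L x assume "n \<in> Obj big_cell" and L: "L \<in> K_top UNIV n" and x: "matching_family big_cell F L x"
  then have n: "n > 0"
    by simp
  obtain m where m: "m \<in> L" "snat m sdvd snat n"
    using K_topD[OF L _ sdvd_refl] by auto
  have "is_sieve big_cell n L"
    using L by (simp add: K_top_iff)
  note sL = sieve_big_cellD[OF this]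
  have nL: "n \<in> L"
    using m n sL(1)[OF m(1)] sL(4)[OF m(1), of n] snat_sdvd_snat[OF n, of m] by simp
  show "\<exists>!y. y \<in> ob F n \<and> (\<forall>d\<in>L. restr F n d y = x d)"
  proof (rule ex1I)
    show "x n \<in> ob F n \<and> (\<forall>d\<in>L. restr F n d (x n) = x d)"
      using x nL sL(1,3) n by (auto simp: matching_family_def arrow_to_big_cell)
    show "y = x n" if "y \<in> ob F n \<and> (\<forall>d\<in>L. restr F n d y = x d)" for y
      using that nL n restr_id[OF is_category_big_cell F, of n y] by auto
  qed
qed

text \<open>An equality of categories, so that results proved for sheaves on an arbitrary site
  become results on presheaves by rewriting.\<close>

lemma presheaves_eq_sheaves: "presheaves U big_cell = sheaves U big_cell (K_top UNIV)"
proof -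
  have "{F \<in> Obj (presheaves U big_cell). is_sheaf big_cell (K_top UNIV) F} = Obj (presheaves U big_cell)"
    using is_sheaf_K_top_UNIV by blast
  then show ?thesis
    by (simp add: sheaves_def full_subcat_def)
qed

context big_cell_site
begin

text \<open>
  A section of the sheafification over \<open>n\<close> is a saturated set of compatible local sections
  \<open>(m, x)\<close>, with \<open>m\<close> a multiple of \<open>n\<close>.
\<close>

definition saturated :: "(nat, 'u) presheaf \<Rightarrow> nat \<Rightarrow> (nat \<times> 'u) set \<Rightarrow> bool" where
  "saturated P n z \<longleftrightarrow>
     (\<forall>m x. (m, x) \<in> z \<longrightarrow> m > 0 \<and> n dvd m \<and> x \<in> ob P m) \<and>
     (\<forall>m x k. (m, x) \<in> z \<longrightarrow> k > 0 \<longrightarrow> m dvd k \<longrightarrow> (k, restr P m k x) \<in> z) \<and>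
     (\<forall>m x y. (m, x) \<in> z \<longrightarrow> (m, y) \<in> z \<longrightarrow> locally m (\<lambda>k. restr P m k x = restr P m k y)) \<and>
     locally n (\<lambda>m. \<exists>x. (m, x) \<in> z) \<and>
     (\<forall>m x. m > 0 \<longrightarrow> n dvd m \<longrightarrow> x \<in> ob P m \<longrightarrow> locally m (\<lambda>k. (k, restr P m k x) \<in> z) \<longrightarrow> (m, x) \<in> z)"

text \<open>Local injectivity and local surjectivity into a sheaf characterise the unit of
  sheafification. The universal property, the exactness and the computation of stalks rest on this
  description alone, not on saturated sets.\<close>

definition local_iso :: "(nat, 'u) presheaf \<Rightarrow> (nat, 'u) presheaf \<Rightarrow> (nat \<Rightarrow> 'u \<Rightarrow> 'u) \<Rightarrow> bool" where
  "local_iso P F \<eta> \<longleftrightarrow> F \<in> Obj Sh \<and> \<eta> \<in> Hom PSh P F \<and>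
     (\<forall>n>0. \<forall>x\<in>ob P n. \<forall>y\<in>ob P n. \<eta> n x = \<eta> n y \<longrightarrow> locally n (\<lambda>m. restr P n m x = restr P n m y)) \<and>
     (\<forall>n>0. \<forall>z\<in>ob F n. locally n (\<lambda>m. \<exists>x\<in>ob P m. restr F n m z = \<eta> m x))"

lemma saturatedD:
  assumes "saturated P n z"
  shows "(m, x) \<in> z \<Longrightarrow> m > 0" "(m, x) \<in> z \<Longrightarrow> n dvd m" "(m, x) \<in> z \<Longrightarrow> x \<in> ob P m"
    and "(m, x) \<in> z \<Longrightarrow> k > 0 \<Longrightarrow> m dvd k \<Longrightarrow> (k, restr P m k x) \<in> z"
    and "(m, x) \<in> z \<Longrightarrow> (m, y) \<in> z \<Longrightarrow> locally m (\<lambda>k. restr P m k x = restr P m k y)"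
    and "locally n (\<lambda>m. \<exists>x. (m, x) \<in> z)"
    and "m > 0 \<Longrightarrow> n dvd m \<Longrightarrow> x \<in> ob P m \<Longrightarrow> locally m (\<lambda>k. (k, restr P m k x) \<in> z) \<Longrightarrow> (m, x) \<in> z"
proof -
  note c = assms[unfolded saturated_def]
  note c1 = c[THEN conjunct1, rule_format]
  note c2 = c[THEN conjunct2, THEN conjunct1, rule_format]
  note c3 = c[THEN conjunct2, THEN conjunct2, THEN conjunct1, rule_format]
  note c4 = c[THEN conjunct2, THEN conjunct2, THEN conjunct2, THEN conjunct1]
  note c5 = c[THEN conjunct2, THEN conjunct2, THEN conjunct2, THEN conjunct2, rule_format]
  show "(m, x) \<in> z \<Longrightarrow> m > 0" "(m, x) \<in> z \<Longrightarrow> n dvd m" "(m, x) \<in> z \<Longrightarrow> x \<in> ob P m"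
    using c1[of m x] by simp_all
  show "(m, x) \<in> z \<Longrightarrow> k > 0 \<Longrightarrow> m dvd k \<Longrightarrow> (k, restr P m k x) \<in> z"
    by (rule c2)
  show "(m, x) \<in> z \<Longrightarrow> (m, y) \<in> z \<Longrightarrow> locally m (\<lambda>k. restr P m k x = restr P m k y)"
    by (rule c3)
  show "locally n (\<lambda>m. \<exists>x. (m, x) \<in> z)"
    by (rule c4)
  show "m > 0 \<Longrightarrow> n dvd m \<Longrightarrow> x \<in> ob P m \<Longrightarrow> locally m (\<lambda>k. (k, restr P m k x) \<in> z) \<Longrightarrow> (m, x) \<in> z"
    by (rule c5)
qed

context
  fixes P assumes P: "P \<in> Obj PSh"
begin

lemma stable_mem:
  assumes z: "saturated P n z" and x: "m > 0" "x \<in> ob P m"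
  shows "stable m (\<lambda>k. (k, restr P m k x) \<in> z)"
proof (rule stableI)
  fix k l :: nat assume *: "k > 0" "m dvd k" "(k, restr P m k x) \<in> z" "l > 0" "k dvd l"
  then show "(l, restr P m l x) \<in> z"
    using saturatedD(4)[OF z *(3-5)] p_restr[OF P x(2,1) *(1,4,2,5)] by simp
qed

text \<open>Restriction to \<open>m\<close> of a section that is presented as a saturated
  set.\<close>

definition cut :: "nat \<Rightarrow> (nat \<times> 'u) set \<Rightarrow> (nat \<times> 'u) set" where
  "cut m z = {w \<in> z. m dvd fst w}"

lemma mem_cut: "(k, x) \<in> cut m z \<longleftrightarrow> (k, x) \<in> z \<and> m dvd k"
  by (simp add: cut_def)

lemma saturated_cut:
  assumes z: "saturated P n z" and m: "m > 0" "n dvd m"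
  shows "saturated P m (cut m z)"
  unfolding saturated_def mem_cut
proof (intro conjI allI impI; (elim conjE)?)
  fix k x assume k: "(k, x) \<in> z" "m dvd k"
  show "k > 0" "m dvd k" "x \<in> ob P k"
    using saturatedD(1,3)[OF z k(1)] k(2) by auto
  fix l :: nat assume l: "l > 0" "k dvd l"
  show "(l, restr P k l x) \<in> z" "m dvd l"
    using k l saturatedD(4)[OF z k(1) l] dvd_trans[OF k(2) l(2)] by auto
next
  fix k x y assume "(k, x) \<in> z" "(k, y) \<in> z"
  then show "locally k (\<lambda>l. restr P k l x = restr P k l y)"
    by (rule saturatedD(5)[OF z])
next
  have "locally m (\<lambda>k. \<exists>x. (k, x) \<in> z)"
    using saturatedD(6)[OF z] m by (rule locally_restrict)
  then show "locally m (\<lambda>k. \<exists>x. (k, x) \<in> z \<and> m dvd k)"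
  proof (rule locally_mono)
    show "stable m (\<lambda>k. \<exists>x. (k, x) \<in> z \<and> m dvd k)"
    proof (rule stableI)
      fix k l :: nat assume *: "m dvd k" "\<exists>x. (k, x) \<in> z \<and> m dvd k" "l > 0" "k dvd l"
      then show "\<exists>x. (l, x) \<in> z \<and> m dvd l"
        using saturatedD(4)[OF z _ *(3,4)] dvd_trans[OF *(1,4)] by blast
    qed
  qed auto
next
  fix k x assume k: "k > 0" "m dvd k" "x \<in> ob P k" "locally k (\<lambda>l. (l, restr P k l x) \<in> z \<and> m dvd l)"
  have "locally k (\<lambda>l. (l, restr P k l x) \<in> z)"
    using k(4) stable_mem[OF z k(1,3)] by (rule locally_mono) auto
  then show "(k, x) \<in> z"
    using k m dvd_trans[OF m(2) k(2)] by (intro saturatedD(7)[OF z])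
  show "m dvd k" by fact
qed

text \<open>The sheaf condition is reached in one stage, without iterating a plus construction,
  because a saturated set contains every section that belongs to it locally.\<close>

lemma saturated_glue:
  assumes n: "n > 0" and L: "L \<in> J n"
    and z: "\<And>d. d \<in> L \<Longrightarrow> saturated P d (z d)"
    and zz: "\<And>d e. d \<in> L \<Longrightarrow> e > 0 \<Longrightarrow> d dvd e \<Longrightarrow> cut e (z d) = z e"
  shows "\<exists>!y. saturated P n y \<and> (\<forall>d\<in>L. cut d y = z d)"
proof (rule ex1I)
  have L1: "d > 0" "n dvd d" if "d \<in> L" for d
    using J_sieveD[OF L that] by auto
  have L2: "k \<in> L" if "d \<in> L" "k > 0" "d dvd k" for d k
    using sieve_big_cellD(4)[OF J_sieve[OF L] that(1)] that by simp
  have locL: "locally n (\<lambda>k. k \<in> L)"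
  proof -
    have "{m. m > 0 \<and> n dvd m \<and> m \<in> L} = L"
      using L1 by auto
    then show ?thesis
      using L by (simp add: locally_def)
  qed
  \<comment> \<open>Membership is required only on a cover of \<open>m\<close>, which builds
    saturation in; that cutting down to a \<open>d\<close> in \<open>L\<close> returns
    \<open>z d\<close> and nothing more is due to \<open>z d\<close> being saturated itself.\<close>
  let ?y = "{(m, x). m > 0 \<and> n dvd m \<and> x \<in> ob P m \<and> locally m (\<lambda>k. k \<in> L \<and> (k, restr P m k x) \<in> z k)}"
  have st: "stable m (\<lambda>k. k \<in> L \<and> (k, restr P m k x) \<in> z k)" if "m > 0" "x \<in> ob P m" for m x
  proof (rule stableI)
    fix k l assume *: "k > 0" "m dvd k" "k \<in> L \<and> (k, restr P m k x) \<in> z k" "l > 0" "k dvd l"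
    then have "(l, restr P k l (restr P m k x)) \<in> z k"
      using saturatedD(4)[OF z[of k], of k "restr P m k x" l] by simp
    moreover have "restr P k l (restr P m k x) = restr P m l x"
      using p_restr[OF P that(2,1) *(1,4,2,5)] .
    ultimately have "(l, restr P m l x) \<in> cut l (z k)"
      by (simp add: mem_cut)
    then show "l \<in> L \<and> (l, restr P m l x) \<in> z l"
      using zz[of k l] L2[of k l] * by simp
  qed
  have zy: "(m, x) \<in> ?y" if d: "d \<in> L" and x: "(m, x) \<in> z d" for d m x
  proof -
    have m: "m > 0" "d dvd m" "x \<in> ob P m"
      using saturatedD(1-3)[OF z[OF d] x] .
    have "(k, restr P m k x) \<in> z k" "k \<in> L" if "k > 0" "m dvd k" for k
    proof -
      have "(k, restr P m k x) \<in> cut k (z d)"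
        using saturatedD(4)[OF z[OF d] x that] by (simp add: mem_cut)
      then show "(k, restr P m k x) \<in> z k" "k \<in> L"
        using zz[OF d that(1) dvd_trans[OF m(2) that(2)]] L2[OF d that(1) dvd_trans[OF m(2) that(2)]] by simp_all
    qed
    then have "locally m (\<lambda>k. k \<in> L \<and> (k, restr P m k x) \<in> z k)"
      using m by (intro locally_here st) auto
    then show ?thesis
      using m dvd_trans[OF L1(2)[OF d] m(2)] by simp
  qed
  have y: "saturated P n ?y"
    unfolding saturated_def mem_Collect_eq prod.case
  proof (intro conjI allI impI; (elim conjE)?)
    fix m x k assume *: "m > 0" "n dvd m" "x \<in> ob P m" "locally m (\<lambda>k. k \<in> L \<and> (k, restr P m k x) \<in> z k)" "k > 0" "m dvd k"
    show "n dvd k" "restr P m k x \<in> ob P k"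
      using * dvd_trans[of n m k] p_in[OF P] by auto
    show "locally k (\<lambda>l. l \<in> L \<and> (l, restr P k l (restr P m k x)) \<in> z l)"
    proof (rule locally_mono[OF locally_restrict[OF *(4-6)] st[OF *(5)]])
      show "restr P m k x \<in> ob P k" by fact
      show "l \<in> L \<and> (l, restr P k l (restr P m k x)) \<in> z l" if "l > 0" "k dvd l" "l \<in> L \<and> (l, restr P m l x) \<in> z l" for l
        using that p_restr[OF P *(3,1,5) that(1) *(6) that(2)] by simp
    qed
  next
    fix m x x' assume *: "m > 0" "n dvd m" "x \<in> ob P m" "locally m (\<lambda>k. k \<in> L \<and> (k, restr P m k x) \<in> z k)"
      "x' \<in> ob P m" "locally m (\<lambda>k. k \<in> L \<and> (k, restr P m k x') \<in> z k)"
    show "locally m (\<lambda>k. restr P m k x = restr P m k x')"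
    proof (rule locally_trans[OF locally_conj[OF *(4,6)] stable_restr_eq[OF P *(3,5,1)]])
      fix k assume k: "k > 0" "m dvd k"
        "(k \<in> L \<and> (k, restr P m k x) \<in> z k) \<and> (k \<in> L \<and> (k, restr P m k x') \<in> z k)"
      then have "locally k (\<lambda>l. restr P k l (restr P m k x) = restr P k l (restr P m k x'))"
        by (intro saturatedD(5)[OF z]) auto
      then show "locally k (\<lambda>l. restr P m l x = restr P m l x')"
      proof (rule locally_mono[OF _ stable_restrict[OF stable_restr_eq[OF P *(3,5,1)] k(2)]])
        fix l assume l: "l > 0" "k dvd l" "restr P k l (restr P m k x) = restr P k l (restr P m k x')"
        show "restr P m l x = restr P m l x'"
          using l(3) p_restr[OF P *(3,1) k(1) l(1) k(2) l(2)] p_restr[OF P *(5,1) k(1) l(1) k(2) l(2)] by simp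
      qed
    qed
  next
    show "locally n (\<lambda>m. \<exists>x. 0 < m \<and> n dvd m \<and> x \<in> ob P m \<and> locally m (\<lambda>k. k \<in> L \<and> (k, restr P m k x) \<in> z k))"
    proof (rule locally_trans[OF locL])
      let ?Q = "\<lambda>m. \<exists>x. 0 < m \<and> n dvd m \<and> x \<in> ob P m \<and> locally m (\<lambda>k. k \<in> L \<and> (k, restr P m k x) \<in> z k)"
      show sQ: "stable n ?Q"
      proof (rule stableI)
        fix m k assume *: "m > 0" "n dvd m" "?Q m" "k > 0" "m dvd k"
        then obtain x where x: "x \<in> ob P m" "locally m (\<lambda>k. k \<in> L \<and> (k, restr P m k x) \<in> z k)"
          by blast
        have "locally k (\<lambda>l. l \<in> L \<and> (l, restr P k l (restr P m k x)) \<in> z l)"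
        proof (rule locally_mono[OF locally_restrict[OF x(2) *(4,5)] st[OF *(4)]])
          show "restr P m k x \<in> ob P k"
            using p_in[OF P x(1)] * by simp
          show "l \<in> L \<and> (l, restr P k l (restr P m k x)) \<in> z l" if "l > 0" "k dvd l" "l \<in> L \<and> (l, restr P m l x) \<in> z l" for l
            using that p_restr[OF P x(1) *(1,4) that(1) *(5) that(2)] by simp
        qed
        then show "?Q k"
          using p_in[OF P x(1) *(1,4,5)] *(4) dvd_trans[OF *(2,5)] by blast
      qed
      fix m assume m: "m > 0" "n dvd m" "m \<in> L"
      show "locally m ?Q"
      proof (rule locally_mono[OF saturatedD(6)[OF z[OF m(3)]] stable_restrict[OF sQ m(2)]])
        show "?Q k" if "k > 0" "m dvd k" "\<exists>x. (k, x) \<in> z m" for k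
          using that zy[OF m(3)] by blast
      qed
    qed
  next
    fix m x assume *: "m > 0" "n dvd m" "x \<in> ob P m"
      and l: "locally m (\<lambda>k. 0 < k \<and> n dvd k \<and> restr P m k x \<in> ob P k \<and>
        locally k (\<lambda>l. l \<in> L \<and> (l, restr P k l (restr P m k x)) \<in> z l))"
    show "locally m (\<lambda>k. k \<in> L \<and> (k, restr P m k x) \<in> z k)"
    proof (rule locally_trans[OF l st[OF *(1,3)]], elim conjE)
      fix k assume k: "k > 0" "m dvd k" "locally k (\<lambda>l. l \<in> L \<and> (l, restr P k l (restr P m k x)) \<in> z l)"
      show "locally k (\<lambda>l. l \<in> L \<and> (l, restr P m l x) \<in> z l)"
      proof (rule locally_mono[OF k(3) stable_restrict[OF st[OF *(1,3)] k(2)]])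
        show "l \<in> L \<and> (l, restr P m l x) \<in> z l"
          if "l > 0" "k dvd l" "l \<in> L \<and> (l, restr P k l (restr P m k x)) \<in> z l" for l
          using that p_restr[OF P *(3,1) k(1) that(1) k(2) that(2)] by simp
      qed
    qed
  qed
  have cut_y: "cut d ?y = z d" if d: "d \<in> L" for d
  proof (intro equalityI subsetI)
    fix w assume "w \<in> cut d ?y"
    then obtain m x where w: "w = (m, x)" and m: "m > 0" "d dvd m" "x \<in> ob P m"
      and l: "locally m (\<lambda>k. k \<in> L \<and> (k, restr P m k x) \<in> z k)"
      by (auto simp: cut_def)
    have "locally m (\<lambda>k. (k, restr P m k x) \<in> z d)"
    proof (rule locally_mono[OF l stable_mem[OF z[OF d] m(1,3)]])
      fix k assume k: "k > 0" "m dvd k" "k \<in> L \<and> (k, restr P m k x) \<in> z k"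
      have "cut k (z d) = z k"
        using d k(1) dvd_trans[OF m(2) k(2)] by (rule zz)
      then show "(k, restr P m k x) \<in> z d"
        using k(3) mem_cut[of k "restr P m k x" k "z d"] by simp
    qed
    then show "w \<in> z d"
      unfolding w by (rule saturatedD(7)[OF z[OF d] m])
  next
    fix w assume w: "w \<in> z d"
    obtain m x where "w = (m, x)" by (cases w)
    then show "w \<in> cut d ?y"
      using zy[OF d, of m x] w saturatedD(2)[OF z[OF d], of m x] unfolding cut_def by simp
  qed
  show "saturated P n ?y \<and> (\<forall>d\<in>L. cut d ?y = z d)"
    using y cut_y by blast
  fix y' assume y': "saturated P n y' \<and> (\<forall>d\<in>L. cut d y' = z d)"
  \<comment> \<open>Membership in a saturated set is a local matter, so inclusion may be tested on
    the cover \<open>L\<close>, where both sets cut down to \<open>z d\<close>.\<close>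
  have sub: "a \<subseteq> b" if a: "saturated P n a" "\<forall>d\<in>L. cut d a = z d" and b: "saturated P n b" "\<forall>d\<in>L. cut d b = z d" for a b
  proof
    fix w assume w: "w \<in> a"
    obtain m x where mx: "w = (m, x)" by (cases w)
    have m: "m > 0" "n dvd m" "x \<in> ob P m"
      using saturatedD(1-3)[OF a(1)] w mx by auto
    have "locally m (\<lambda>k. (k, restr P m k x) \<in> b)"
    proof (rule locally_mono[OF locally_restrict[OF locL m(1,2)] stable_mem[OF b(1) m(1,3)]])
      fix k assume k: "k > 0" "m dvd k" "k \<in> L"
      have "(k, restr P m k x) \<in> cut k a"
        using saturatedD(4)[OF a(1) _ k(1,2)] w mx by (simp add: mem_cut)
      then show "(k, restr P m k x) \<in> b"
        using a(2) b(2) k(3) by (metis mem_cut)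
    qed
    then show "w \<in> b"
      unfolding mx by (rule saturatedD(7)[OF b(1) m])
  qed
  show "y' = ?y"
    using sub[of y' ?y] sub[of ?y y'] y y' cut_y by blast
qed

text \<open>One chosen section over each \<open>m\<close> where the set has any determines it: all
  its sections over \<open>m\<close> are locally equal, and local equality with a member implies
  membership. So saturated sets embed into the partial functions sending \<open>m\<close> into
  \<open>ob P m\<close>, which \<open>universe_code\<close> handles.\<close>

lemma saturated_small: "\<exists>e. inj_on e {z. saturated P n z} \<and> e ` {z. saturated P n z} \<in> U"
proof -
  define f where "f z m = (if \<exists>x. (m, x) \<in> z then Some (SOME x. (m, x) \<in> z) else None)" for z :: "(nat \<times> 'u) set" and m
  have f: "(m, x) \<in> z" if "f z m = Some x" for z m x
    using that unfolding f_def by (auto split: if_splits intro: someI_ex)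
  have fdom: "\<exists>x. f z m = Some x" if "(m, x) \<in> z" for z m x
    using that unfolding f_def by auto
  have sub: "a \<subseteq> b" if a: "saturated P n a" and b: "saturated P n b" and "f a = f b" for a b
  proof
    fix w assume w: "w \<in> a"
    obtain m x where mx: "w = (m, x)" by (cases w)
    have m: "m > 0" "n dvd m" "x \<in> ob P m"
      using saturatedD(1-3)[OF a] w mx by auto
    have "locally m (\<lambda>k. (k, restr P m k x) \<in> b)"
    proof (rule locally_here[OF m(1) stable_mem[OF b m(1,3)]])
      obtain y where y: "f a m = Some y"
        using fdom w mx by blast
      then have ya: "(m, y) \<in> a" and yb: "(m, y) \<in> b"
        using f \<open>f a = f b\<close> by auto
      have "locally m (\<lambda>k. (k, restr P m k x) \<in> b)"
      proof (rule locally_mono[OF saturatedD(5)[OF a _ ya] stable_mem[OF b m(1,3)]])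
        show "(m, x) \<in> a" using w mx by simp
        show "(k, restr P m k x) \<in> b" if "k > 0" "m dvd k" "restr P m k x = restr P m k y" for k
          using that saturatedD(4)[OF b yb that(1,2)] by simp
      qed
      then have "(m, x) \<in> b"
        by (rule saturatedD(7)[OF b m])
      then show "(m, restr P m m x) \<in> b"
        using p_id[OF P m(3,1)] by simp
    qed
    then show "w \<in> b"
      unfolding mx by (rule saturatedD(7)[OF b m])
  qed
  have "inj_on f {z. saturated P n z}"
  proof (rule inj_onI)
    fix a b assume "a \<in> {z. saturated P n z}" "b \<in> {z. saturated P n z}" "f a = f b"
    then show "a = b"
      using sub[of a b] sub[of b a] by auto
  qed
  moreover have "f z m \<in> insert None (Some ` (if m = 0 then {} else ob P m))" if "z \<in> {z. saturated P n z}" for z m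
    using that f[of z m] saturatedD(1,3)[of P n z m] by (cases "f z m") auto
  moreover have "(if m = 0 then {} else ob P m) \<in> U" for m
    using presheaf_ob[OF bc P, of m] universe_empty[OF U] by simp
  ultimately show ?thesis
    using universe_code[OF U, of "\<lambda>m. if m = 0 then {} else ob P m" f "{z. saturated P n z}"] by metis
qed

text \<open>The image of \<open>x\<close> under the unit of sheafification. The restrictions of
  \<open>x\<close> alone need not be saturated, so every section that agrees with them locally is
  included.\<close>

definition germ :: "nat \<Rightarrow> 'u \<Rightarrow> (nat \<times> 'u) set" where
  "germ n x = {(m, y). m > 0 \<and> n dvd m \<and> y \<in> ob P m \<and> locally m (\<lambda>k. restr P m k y = restr P n k x)}"

lemma mem_germ:
  "(m, y) \<in> germ n x \<longleftrightarrow> m > 0 \<and> n dvd m \<and> y \<in> ob P m \<and> locally m (\<lambda>k. restr P m k y = restr P n k x)"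
  by (simp add: germ_def)

lemma stable_eq2:
  assumes "n > 0" "x \<in> ob P n" "m > 0" "n dvd m" "y \<in> ob P m"
  shows "stable m (\<lambda>k. restr P m k y = restr P n k x)"
proof (rule stableI)
  fix k l assume *: "k > 0" "m dvd k" "restr P m k y = restr P n k x" "l > 0" "k dvd l"
  show "restr P m l y = restr P n l x"
    using *(3) p_restr[OF P assms(5,3) *(1,4,2,5)] p_restr[OF P assms(2,1) *(1,4) dvd_trans[OF assms(4) *(2)] *(5)]
    by metis
qed

lemma saturated_germ:
  assumes n: "n > 0" and x: "x \<in> ob P n"
  shows "saturated P n (germ n x)"
  unfolding saturated_def mem_germ
proof (intro conjI allI impI; (elim conjE)?)
  fix m y k assume *: "m > 0" "n dvd m" "y \<in> ob P m" "locally m (\<lambda>k. restr P m k y = restr P n k x)" "k > 0" "m dvd k"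
  show nk: "n dvd k" using *(2,6) by (rule dvd_trans)
  show yk: "restr P m k y \<in> ob P k" using * p_in[OF P] by simp
  show "locally k (\<lambda>l. restr P k l (restr P m k y) = restr P n l x)"
  proof (rule locally_mono[OF locally_restrict[OF *(4-6)] stable_eq2[OF n x *(5) nk yk]])
    show "restr P k l (restr P m k y) = restr P n l x" if "l > 0" "k dvd l" "restr P m l y = restr P n l x" for l
      using that p_restr[OF P *(3,1,5) that(1) *(6) that(2)] by simp
  qed
next
  fix m y y' assume *: "m > 0" "n dvd m" "y \<in> ob P m" "locally m (\<lambda>k. restr P m k y = restr P n k x)"
    "y' \<in> ob P m" "locally m (\<lambda>k. restr P m k y' = restr P n k x)"
  show "locally m (\<lambda>k. restr P m k y = restr P m k y')"
    by (rule locally_mono[OF locally_conj[OF *(4,6)] stable_restr_eq[OF P *(3,5,1)]]) simp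
next
  have "locally n (\<lambda>k. restr P n k x = restr P n k x)"
    using locally_true[OF n] by simp
  then have gn: "(n, x) \<in> germ n x"
    using n x by (simp add: mem_germ)
  show "locally n (\<lambda>m. \<exists>y. 0 < m \<and> n dvd m \<and> y \<in> ob P m \<and> locally m (\<lambda>k. restr P m k y = restr P n k x))"
  proof (rule locally_mono[OF locally_true[OF n]])
    have *: "\<exists>y. 0 < m \<and> n dvd m \<and> y \<in> ob P m \<and> locally m (\<lambda>k. restr P m k y = restr P n k x)" if m: "m > 0" "n dvd m" for m
    proof (intro exI conjI m)
      show "restr P n m x \<in> ob P m" using p_in[OF P x n m] .
      then show "locally m (\<lambda>k. restr P m k (restr P n m x) = restr P n k x)"
        using m p_restr[OF P x n m(1) _ m(2)]
        by (intro locally_mono[OF locally_true[OF m(1)] stable_eq2[OF n x m]]) auto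
    qed
    show "stable n (\<lambda>m. \<exists>y. 0 < m \<and> n dvd m \<and> y \<in> ob P m \<and> locally m (\<lambda>k. restr P m k y = restr P n k x))"
    proof (rule stableI)
      fix m k :: nat assume "n dvd m" "0 < k" "m dvd k"
      then show "\<exists>y. 0 < k \<and> n dvd k \<and> y \<in> ob P k \<and> locally k (\<lambda>l. restr P k l y = restr P n l x)"
        using *[of k] dvd_trans[of n m k] by blast
    qed
    show "\<exists>y. 0 < m \<and> n dvd m \<and> y \<in> ob P m \<and> locally m (\<lambda>k. restr P m k y = restr P n k x)" if "m > 0" "n dvd m" for m
      using that by (rule *)
  qed
next
  fix m y assume *: "m > 0" "n dvd m" "y \<in> ob P m"
    and l: "locally m (\<lambda>k. 0 < k \<and> n dvd k \<and> restr P m k y \<in> ob P k \<and>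
      locally k (\<lambda>l. restr P k l (restr P m k y) = restr P n l x))"
  show "locally m (\<lambda>k. restr P m k y = restr P n k x)"
  proof (rule locally_trans[OF l stable_eq2[OF n x *]], elim conjE)
    fix k assume k: "k > 0" "m dvd k" "locally k (\<lambda>l. restr P k l (restr P m k y) = restr P n l x)"
    show "locally k (\<lambda>l. restr P m l y = restr P n l x)"
    proof (rule locally_mono[OF k(3) stable_restrict[OF stable_eq2[OF n x *] k(2)]])
      show "restr P m l y = restr P n l x" if "l > 0" "k dvd l" "restr P k l (restr P m k y) = restr P n l x" for l
        using that p_restr[OF P *(3,1) k(1) that(1) k(2) that(2)] by simp
    qed
  qed
qed

lemma cut_germ:
  assumes "n > 0" "x \<in> ob P n" "m > 0" "n dvd m"
  shows "cut m (germ n x) = germ m (restr P n m x)"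
proof -
  have "locally k (\<lambda>l. restr P k l y = restr P n l x) \<longleftrightarrow> locally k (\<lambda>l. restr P k l y = restr P m l (restr P n m x))"
    if k: "k > 0" "m dvd k" for k y
  proof -
    have "restr P m l (restr P n m x) = restr P n l x" if "l > 0" "k dvd l" for l
      using p_restr[OF P assms(2,1,3) that(1) assms(4) dvd_trans[OF k(2) that(2)]] .
    then have "{l. l > 0 \<and> k dvd l \<and> restr P k l y = restr P n l x} =
        {l. l > 0 \<and> k dvd l \<and> restr P k l y = restr P m l (restr P n m x)}"
      by auto
    then show ?thesis
      by (simp add: locally_def)
  qed
  then show ?thesis
    using dvd_trans[OF assms(4)] by (auto simp: cut_def germ_def)
qed

text \<open>A section of the sheafification becomes the image of a presheaf section wherever it has
  a representative, and representatives exist on a cover: this is local surjectivity of the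
  unit.\<close>

lemma cut_eq_germ:
  assumes z: "saturated P n z" and x: "(m, x) \<in> z"
  shows "cut m z = germ m x"
proof -
  note m = saturatedD(1-3)[OF z x]
  have "(k, y) \<in> z \<longleftrightarrow> y \<in> ob P k \<and> locally k (\<lambda>l. restr P k l y = restr P m l x)"
    if k: "k > 0" "m dvd k" for k y
  proof
    assume y: "(k, y) \<in> z"
    have xk: "(k, restr P m k x) \<in> z"
      using saturatedD(4)[OF z x k] .
    have "locally k (\<lambda>l. restr P k l y = restr P m l x)"
    proof (rule locally_mono[OF saturatedD(5)[OF z y xk] stable_eq2[OF m(1,3) k saturatedD(3)[OF z y]]])
      show "restr P k l y = restr P m l x" if "l > 0" "k dvd l" "restr P k l y = restr P k l (restr P m k x)" for l
        using that p_restr[OF P m(3,1) k(1) that(1) k(2) that(2)] by simp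
    qed
    then show "y \<in> ob P k \<and> locally k (\<lambda>l. restr P k l y = restr P m l x)"
      using saturatedD(3)[OF z y] by simp
  next
    assume y: "y \<in> ob P k \<and> locally k (\<lambda>l. restr P k l y = restr P m l x)"
    show "(k, y) \<in> z"
    proof (rule saturatedD(7)[OF z k(1) dvd_trans[OF m(2) k(2)] conjunct1[OF y]])
      show "locally k (\<lambda>l. (l, restr P k l y) \<in> z)"
      proof (rule locally_mono[OF conjunct2[OF y] stable_mem[OF z k(1) conjunct1[OF y]]])
        show "(l, restr P k l y) \<in> z" if "l > 0" "k dvd l" "restr P k l y = restr P m l x" for l
          using that saturatedD(4)[OF z x that(1) dvd_trans[OF k(2) that(2)]] by simp
      qed
    qed
  qed
  then have "(k, y) \<in> cut m z \<longleftrightarrow> (k, y) \<in> germ m x" for k y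
    unfolding mem_cut mem_germ using saturatedD(1)[OF z, of k y] by blast
  then show ?thesis
    by (simp add: set_eq_iff)
qed

lemma sheafification_exists: "\<exists>F \<eta>. local_iso P F \<eta>"
proof -
  obtain F e where F: "F \<in> Obj Sh"
    and e: "\<And>c. c \<in> Obj big_cell \<Longrightarrow> bij_betw (e c) {z. saturated P c z} (ob F c)"
    and re: "\<And>c d x. arrow_to big_cell d c \<Longrightarrow> x \<in> {z. saturated P c z} \<Longrightarrow> restr F c d (e c x) = e d (cut d x)"
  proof (rule coded_presheaf[OF bc, of "\<lambda>n. {z. saturated P n z}" U "\<lambda>_. cut" J])
    fix n L z assume n: "n \<in> Obj big_cell" and L: "L \<in> J n"
      and z: "\<forall>d\<in>L. z d \<in> {z. saturated P d z} \<and> (\<forall>e. arrow_to big_cell e d \<longrightarrow> cut e (z d) = z e)"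
    have "\<exists>!y. saturated P n y \<and> (\<forall>d\<in>L. cut d y = z d)"
      by (rule saturated_glue) (use n L z J_sieveD[OF L] in \<open>auto simp: arrow_to_big_cell\<close>)
    then show "\<exists>!y. y \<in> {z. saturated P n z} \<and> (\<forall>d\<in>L. cut d y = z d)"
      by simp
  next
    show "cut c x = x" if "c \<in> Obj big_cell" "x \<in> {z. saturated P c z}" for c x
      using that saturatedD(2)[of P c x] by (auto simp: cut_def)
    show "cut d (cut c x) = cut d x" if "arrow_to big_cell c b" "arrow_to big_cell d c" for b c d x
      using that dvd_trans[of c d] by (auto simp: cut_def arrow_to_big_cell)
  qed (auto simp: saturated_small arrow_to_big_cell J_sieve intro: saturated_cut)
  let ?\<eta> = "\<lambda>n\<in>{0<..}. \<lambda>x\<in>ob P n. e n (germ n x)"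
  have inj: "a = b" if "n > 0" "saturated P n a" "saturated P n b" "e n a = e n b" for n a b
    using e[of n] that by (auto simp: bij_betw_def inj_on_def)
  have \<eta>: "?\<eta> \<in> Hom PSh P F"
  proof (rule h_intro[OF _ _ P])
    show "e n (germ n x) \<in> ob F n" if "n > 0" "x \<in> ob P n" for n x
      using e[of n] saturated_germ[OF that] that by (auto simp: bij_betw_def)
    show "e m (germ m (restr P n m x)) = restr F n m (e n (germ n x))" if "n > 0" "m > 0" "n dvd m" "x \<in> ob P n" for n m x
      using that re[of m n "germ n x"] saturated_germ[OF that(1,4)] by (simp add: arrow_to_big_cell cut_germ)
  qed
  have "local_iso P F ?\<eta>"
    unfolding local_iso_def
  proof (intro conjI allI impI ballI F \<eta>)
    fix n x y assume n: "n > 0" and x: "x \<in> ob P n" and y: "y \<in> ob P n" and eq: "?\<eta> n x = ?\<eta> n y"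
    then have "germ n x = germ n y"
      using inj[OF n saturated_germ[OF n x] saturated_germ[OF n y]] by simp
    moreover have "(n, x) \<in> germ n x"
      using n x locally_true[OF n] by (simp add: mem_germ)
    ultimately show "locally n (\<lambda>m. restr P n m x = restr P n m y)"
      by (simp add: mem_germ)
  next
    fix n y assume n: "n > 0" and y: "y \<in> ob F n"
    then obtain z where z: "saturated P n z" "y = e n z"
      using e[of n] by (auto simp: bij_betw_def)
    show "locally n (\<lambda>m. \<exists>x\<in>ob P m. restr F n m y = ?\<eta> m x)"
    proof (rule locally_mono[OF saturatedD(6)[OF z(1)]])
      show "stable n (\<lambda>m. \<exists>x\<in>ob P m. restr F n m y = ?\<eta> m x)"
      proof (rule stableI)
        fix m k assume *: "m > 0" "n dvd m" "\<exists>x\<in>ob P m. restr F n m y = ?\<eta> m x" "k > 0" "m dvd k"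
        then obtain x where x: "x \<in> ob P m" "restr F n m y = ?\<eta> m x"
          by blast
        have "restr F n k y = ?\<eta> k (restr P m k x)"
          using h_restr[OF \<eta> x(1) *(1,4,5)] p_restr[OF Sh_PSh[OF F] y n *(1,4,2,5)] x(2) by simp
        then show "\<exists>x\<in>ob P k. restr F n k y = ?\<eta> k x"
          using p_in[OF P x(1) *(1,4,5)] by blast
      qed
      fix m assume m: "m > 0" "n dvd m" "\<exists>x. (m, x) \<in> z"
      then obtain x where x: "(m, x) \<in> z" by blast
      have "restr F n m y = e m (germ m x)"
        using re[of m n z] n m z cut_eq_germ[OF z(1) x] by (simp add: arrow_to_big_cell)
      then show "\<exists>x\<in>ob P m. restr F n m y = ?\<eta> m x"
        using saturatedD(3)[OF z(1) x] m by (auto intro!: bexI[of _ x])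
    qed
  qed
  then show ?thesis
    by blast
qed

end

section \<open>The universal property of a locally bijective map into a sheaf\<close>

lemma local_isoD:
  assumes "local_iso P F \<eta>"
  shows "F \<in> Obj Sh" "\<eta> \<in> Hom PSh P F"
    and "n > 0 \<Longrightarrow> x \<in> ob P n \<Longrightarrow> y \<in> ob P n \<Longrightarrow> \<eta> n x = \<eta> n y \<Longrightarrow> locally n (\<lambda>m. restr P n m x = restr P n m y)"
    and "n > 0 \<Longrightarrow> z \<in> ob F n \<Longrightarrow> locally n (\<lambda>m. \<exists>x\<in>ob P m. restr F n m z = \<eta> m x)"
  using assms unfolding local_iso_def by blast+

lemma stable_image:
  assumes P: "P \<in> Obj PSh" and F: "F \<in> Obj PSh" and \<eta>: "\<eta> \<in> Hom PSh P F" and n: "n > 0" and z: "z \<in> ob F n"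
  shows "stable n (\<lambda>m. \<exists>x\<in>ob P m. restr F n m z = \<eta> m x)"
proof (rule stableI)
  fix m k assume *: "m > 0" "n dvd m" "\<exists>x\<in>ob P m. restr F n m z = \<eta> m x" "k > 0" "m dvd k"
  then obtain x where x: "x \<in> ob P m" "restr F n m z = \<eta> m x"
    by blast
  have "restr F n k z = \<eta> k (restr P m k x)"
    using p_restr[OF F z n *(1,4,2,5)] h_restr[OF \<eta> x(1) *(1,4,5)] x(2) by simp
  then show "\<exists>x\<in>ob P k. restr F n k z = \<eta> k x"
    using p_in[OF P x(1) *(1,4,5)] by blast
qed

text \<open>Elements identified by \<open>\<eta>\<close> agree locally in \<open>P\<close>, hence
  have locally equal images under \<open>h\<close>, and the sheaf \<open>G\<close> is
  separated.\<close>

lemma local_iso_extend: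
  assumes \<eta>: "local_iso P F \<eta>" and P: "P \<in> Obj PSh" and G: "G \<in> Obj Sh" and h: "h \<in> Hom PSh P G"
    and x: "m > 0" "x \<in> ob P m" "x' \<in> ob P m" "\<eta> m x = \<eta> m x'"
  shows "h m x = h m x'"
proof (rule separated[OF G h_in[OF h x(2,1)] h_in[OF h x(3,1)]])
  note G' = Sh_PSh[OF G]
  show "locally m (\<lambda>k. restr G m k (h m x) = restr G m k (h m x'))"
  proof (rule locally_mono[OF local_isoD(3)[OF \<eta> x] stable_restr_eq[OF G' h_in[OF h x(2,1)] h_in[OF h x(3,1)] x(1)]])
    show "restr G m k (h m x) = restr G m k (h m x')" if "k > 0" "m dvd k" "restr P m k x = restr P m k x'" for k
      using h_restr[OF h x(2,1) that(1,2)] h_restr[OF h x(3,1) that(1,2)] that(3) by simp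
  qed
qed

text \<open>The value at \<open>z\<close> has to agree with \<open>h\<close> on all local preimages
  of \<open>z\<close> under \<open>\<eta>\<close>. Such preimages exist on a cover, and by
  \<open>local_iso_extend\<close> their images under \<open>h\<close> depend only on
  \<open>z\<close>, so they glue to a unique value; this is the relation \<open>R\<close>.\<close>

lemma local_iso_universal:
  assumes \<eta>: "local_iso P F \<eta>" and P: "P \<in> Obj PSh" and G: "G \<in> Obj Sh" and h: "h \<in> Hom PSh P G"
  shows "\<exists>!k. k \<in> Hom PSh F G \<and> Cmp PSh P F G k \<eta> = h"
proof -
  note F = local_isoD(1)[OF \<eta>] and \<eta>h = local_isoD(2)[OF \<eta>]
  note F' = Sh_PSh[OF F] and G' = Sh_PSh[OF G]
  define R where "R n z y \<longleftrightarrow> y \<in> ob G n \<and>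
    (\<forall>m x. m > 0 \<longrightarrow> n dvd m \<longrightarrow> x \<in> ob P m \<longrightarrow> restr F n m z = \<eta> m x \<longrightarrow> restr G n m y = h m x)" for n z y
  have Rex: "\<exists>y. R n z y" if n: "n > 0" and z: "z \<in> ob F n" for n z
  proof -
    have "\<exists>y\<in>ob G n. \<forall>m>0. \<forall>w\<in>ob G m. n dvd m \<longrightarrow>
        (\<exists>x\<in>ob P m. restr F n m z = \<eta> m x \<and> w = h m x) \<longrightarrow> restr G n m y = w"
    proof (rule glue_rel[OF G, of n "\<lambda>m w. \<exists>x\<in>ob P m. restr F n m z = \<eta> m x \<and> w = h m x"])
      have st: "\<exists>w\<in>ob G k. \<exists>x\<in>ob P k. restr F n k z = \<eta> k x \<and> w = h k x"
        if "k > 0" "\<exists>x\<in>ob P k. restr F n k z = \<eta> k x" for k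
        using that h_in[OF h] by blast
      show "locally n (\<lambda>m. \<exists>w\<in>ob G m. \<exists>x\<in>ob P m. restr F n m z = \<eta> m x \<and> w = h m x)"
      proof (rule locally_mono[OF local_isoD(4)[OF \<eta> n z]])
        show "stable n (\<lambda>m. \<exists>w\<in>ob G m. \<exists>x\<in>ob P m. restr F n m z = \<eta> m x \<and> w = h m x)"
        proof (rule stableI)
          fix m k assume *: "m > 0" "n dvd m" "\<exists>w\<in>ob G m. \<exists>x\<in>ob P m. restr F n m z = \<eta> m x \<and> w = h m x" "k > 0" "m dvd k"
          then have "\<exists>x\<in>ob P m. restr F n m z = \<eta> m x"
            by blast
          then have "\<exists>x\<in>ob P k. restr F n k z = \<eta> k x"
            using stableD[OF stable_image[OF P F' \<eta>h n z] _ *(1,2,4,5)] by blast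
          then show "\<exists>w\<in>ob G k. \<exists>x\<in>ob P k. restr F n k z = \<eta> k x \<and> w = h k x"
            using st *(4) by blast
        qed
      qed (rule st)
    next
      fix m w w' assume "m > 0" "\<exists>x\<in>ob P m. restr F n m z = \<eta> m x \<and> w = h m x" "\<exists>x\<in>ob P m. restr F n m z = \<eta> m x \<and> w' = h m x"
      then show "w = w'"
        using local_iso_extend[OF \<eta> P G h] by metis
    next
      fix m k w assume *: "m > 0" "n dvd m" "\<exists>x\<in>ob P m. restr F n m z = \<eta> m x \<and> w = h m x" "k > 0" "m dvd k"
      then obtain x where x: "x \<in> ob P m" "restr F n m z = \<eta> m x" "w = h m x"
        by blast
      have "restr F n k z = \<eta> k (restr P m k x)"
        using p_restr[OF F' z n *(1,4,2,5)] h_restr[OF \<eta>h x(1) *(1,4,5)] x(2) by simp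
      moreover have "restr G m k w = h k (restr P m k x)"
        using h_restr[OF h x(1) *(1,4,5)] x(3) by simp
      ultimately show "\<exists>x\<in>ob P k. restr F n k z = \<eta> k x \<and> restr G m k w = h k x"
        using p_in[OF P x(1) *(1,4,5)] by blast
    qed
    then obtain y where "y \<in> ob G n" and y: "\<forall>m>0. \<forall>w\<in>ob G m. n dvd m \<longrightarrow>
        (\<exists>x\<in>ob P m. restr F n m z = \<eta> m x \<and> w = h m x) \<longrightarrow> restr G n m y = w"
      by blast
    moreover have "restr G n m y = h m x" if "m > 0" "n dvd m" "x \<in> ob P m" "restr F n m z = \<eta> m x" for m x
      using y[rule_format, OF that(1) h_in[OF h that(3,1)] that(2)] that by blast
    ultimately show ?thesis
      unfolding R_def by blast
  qed
  have Runi: "y = y'" if n: "n > 0" and z: "z \<in> ob F n" and y: "R n z y" "R n z y'" for n z y y'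
  proof (rule separated[OF G])
    show yG: "y \<in> ob G n" "y' \<in> ob G n"
      using y by (auto simp: R_def)
    show "locally n (\<lambda>m. restr G n m y = restr G n m y')"
    proof (rule locally_mono[OF local_isoD(4)[OF \<eta> n z] stable_restr_eq[OF G' yG n]])
      show "restr G n m y = restr G n m y'" if "m > 0" "n dvd m" "\<exists>x\<in>ob P m. restr F n m z = \<eta> m x" for m
        using that y unfolding R_def by metis
    qed
  qed
  define k where "k n z = (SOME y. R n z y)" for n z
  have k: "R n z (k n z)" if "n > 0" "z \<in> ob F n" for n z
    unfolding k_def by (rule someI_ex[OF Rex[OF that]])
  let ?k = "\<lambda>n\<in>{0<..}. \<lambda>z\<in>ob F n. k n z"
  have kh: "?k \<in> Hom PSh F G"
  proof (rule h_intro[OF _ _ F'])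
    show "k n z \<in> ob G n" if "n > 0" "z \<in> ob F n" for n z
      using k[OF that] by (simp add: R_def)
    fix n m z assume *: "n > 0" "m > 0" "n dvd m" "z \<in> ob F n" "restr F n m z \<in> ob F m"
    have "R m (restr F n m z) (restr G n m (k n z))"
      unfolding R_def
    proof (intro conjI allI impI)
      show "restr G n m (k n z) \<in> ob G m"
        using k[OF *(1,4)] p_in[OF G' _ *(1-3)] by (simp add: R_def)
      fix l x assume l: "l > 0" "m dvd l" "x \<in> ob P l" "restr F m l (restr F n m z) = \<eta> l x"
      then have "restr F n l z = \<eta> l x"
        using p_restr[OF F' *(4,1,2) l(1) *(3) l(2)] by simp
      then show "restr G m l (restr G n m (k n z)) = h l x"
        using k[OF *(1,4)] l dvd_trans[OF *(3) l(2)] p_restr[OF G' _ *(1,2) l(1) *(3) l(2)] by (simp add: R_def)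
    qed
    then show "k m (restr F n m z) = restr G n m (k n z)"
      using Runi[OF *(2,5)] k[OF *(2,5)] by blast
  qed
  have keta: "Cmp PSh P F G ?k \<eta> = h"
  proof (rule h_eqI[OF h_cmp[OF P F' G' \<eta>h kh] h])
    fix n x assume n: "n > 0" and x: "x \<in> ob P n"
    have "R n (\<eta> n x) (h n x)"
      unfolding R_def
    proof (intro conjI allI impI)
      show "h n x \<in> ob G n" by (rule h_in[OF h x n])
      fix m x' assume m: "m > 0" "n dvd m" "x' \<in> ob P m" "restr F n m (\<eta> n x) = \<eta> m x'"
      then have "\<eta> m (restr P n m x) = \<eta> m x'"
        using h_restr[OF \<eta>h x n m(1,2)] by simp
      then show "restr G n m (h n x) = h m x'"
        using local_iso_extend[OF \<eta> P G h m(1) p_in[OF P x n m(1,2)] m(3)] h_restr[OF h x n m(1,2)] by simp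
    qed
    then have "k n (\<eta> n x) = h n x"
      using Runi[OF n h_in[OF \<eta>h x n]] k[OF n h_in[OF \<eta>h x n]] by blast
    then show "Cmp PSh P F G ?k \<eta> n x = h n x"
      using n x h_in[OF \<eta>h x n] by (simp add: h_cmp_apply)
  qed
  have uni: "k' = ?k" if k': "k' \<in> Hom PSh F G" "Cmp PSh P F G k' \<eta> = h" for k'
  proof (rule h_eqI[OF k'(1) kh])
    fix n z assume n: "n > 0" and z: "z \<in> ob F n"
    have "R n z (k' n z)"
      unfolding R_def
    proof (intro conjI allI impI)
      show "k' n z \<in> ob G n" by (rule h_in[OF k'(1) z n])
      fix m x assume m: "m > 0" "n dvd m" "x \<in> ob P m" "restr F n m z = \<eta> m x"
      have "restr G n m (k' n z) = k' m (\<eta> m x)"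
        using h_restr[OF k'(1) z n m(1,2)] m(4) by simp
      also have "\<dots> = h m x"
        using k'(2) h_cmp_apply[OF m(1,3), of F G k' \<eta>] by simp
      finally show "restr G n m (k' n z) = h m x" .
    qed
    then show "k' n z = ?k n z"
      using Runi[OF n z] k[OF n z] n z by simp
  qed
  show ?thesis
    by (rule ex1I[of _ ?k]) (use kh keta uni in blast)+
qed

text \<open>The right adjoint is the literal inclusion \<open>id_fctr\<close>. The local
  isomorphisms and the elementwise naturality of the unit are carried along because exactness and
  stalks are computed with them rather than with the adjunction.\<close>

definition sheafification ::
  "((nat, 'u) presheaf, nat \<Rightarrow> 'u \<Rightarrow> 'u, (nat, 'u) presheaf, nat \<Rightarrow> 'u \<Rightarrow> 'u) fctr \<Rightarrow>
    ((nat, 'u) presheaf \<Rightarrow> nat \<Rightarrow> 'u \<Rightarrow> 'u) \<Rightarrow> bool" where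
  "sheafification a \<eta> \<longleftrightarrow> adjoint PSh Sh a id_fctr \<and> (\<forall>P\<in>Obj PSh. local_iso P (ob a P) (\<eta> P)) \<and>
     (\<forall>P\<in>Obj PSh. \<forall>Q\<in>Obj PSh. \<forall>f\<in>Hom PSh P Q. \<forall>n>0. \<forall>x\<in>ob P n. ar a P Q f n (\<eta> P n x) = \<eta> Q n (f n x))"

lemma cat_PSh: "is_category PSh"
  by (rule is_category_presheaves[OF bc])

lemma cat_Sh: "is_category Sh"
  by (rule is_category_sheaves[OF bc])

lemma inclusion_functor: "is_functor Sh PSh id_fctr"
  by (simp add: is_functor_def Sh_PSh)

lemma inclusion_fully_faithful: "fully_faithful Sh PSh id_fctr"
  unfolding fully_faithful_def by (simp add: bij_betw_def inj_on_def)

lemma sheafification_functor: "\<exists>a \<eta>. sheafification a \<eta>"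
proof -
  obtain L \<eta> where L: "\<And>P. P \<in> Obj PSh \<Longrightarrow> local_iso P (L P) (\<eta> P)"
    using sheafification_exists by metis
  have "\<exists>a. adjoint PSh Sh a id_fctr \<and> ob a = L \<and> (\<forall>P\<in>Obj PSh. \<forall>Q\<in>Obj PSh. \<forall>f\<in>Hom PSh P Q.
      Cmp PSh P (L P) (L Q) (ar a P Q f) (\<eta> P) = Cmp PSh P Q (L Q) (\<eta> Q) f)"
  proof (rule adjoint_of_universal[OF cat_PSh cat_Sh inclusion_functor, unfolded ob_id_fctr ar_id_fctr])
    show "\<exists>!k. k \<in> Hom Sh (L P) G \<and> Cmp PSh P (L P) G k (\<eta> P) = h"
      if "P \<in> Obj PSh" "G \<in> Obj Sh" "h \<in> Hom PSh P G" for P G h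
      using local_iso_universal[OF L[OF that(1)] that(1,2)] that(3) by simp
  qed (use local_isoD(1,2)[OF L] in auto)
  then obtain a where a: "adjoint PSh Sh a id_fctr" "ob a = L"
    and nat: "\<And>P Q f. P \<in> Obj PSh \<Longrightarrow> Q \<in> Obj PSh \<Longrightarrow> f \<in> Hom PSh P Q \<Longrightarrow>
      Cmp PSh P (L P) (L Q) (ar a P Q f) (\<eta> P) = Cmp PSh P Q (L Q) (\<eta> Q) f"
    by auto
  have "ar a P Q f n (\<eta> P n x) = \<eta> Q n (f n x)"
    if "P \<in> Obj PSh" "Q \<in> Obj PSh" "f \<in> Hom PSh P Q" "n > 0" "x \<in> ob P n" for P Q f n x
    using fun_cong[OF fun_cong[OF nat[OF that(1-3)], of n], of x] that(4,5) by (simp add: h_cmp_apply)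
  then have "sheafification a \<eta>"
    unfolding sheafification_def using a L by simp
  then show ?thesis
    by blast
qed

subsection \<open>Finite limits of sheaves\<close>

text \<open>The sections over each \<open>n\<close> form a limit of sets, phrased with compatible
  families so that limits are handled by elements.\<close>

definition pointwise_limit ::
  "(nat, nat) cat \<Rightarrow> (nat, nat, (nat, 'u) presheaf, nat \<Rightarrow> 'u \<Rightarrow> 'u) fctr \<Rightarrow> (nat, 'u) presheaf \<Rightarrow>
    (nat \<Rightarrow> nat \<Rightarrow> 'u \<Rightarrow> 'u) \<Rightarrow> bool" where
  "pointwise_limit K \<Delta> x \<pi> \<longleftrightarrow> (\<forall>n>0. \<forall>y. (\<forall>j\<in>Obj K. y j \<in> ob (ob \<Delta> j) n) \<and>
     (\<forall>j\<in>Obj K. \<forall>k\<in>Obj K. \<forall>u\<in>Hom K j k. ar \<Delta> j k u n (y j) = y k) \<longrightarrow>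
     (\<exists>!z. z \<in> ob x n \<and> (\<forall>j\<in>Obj K. \<pi> j n z = y j)))"

lemma limit_coneD:
  assumes "limit_cone K C \<Delta> x \<pi>"
  shows "x \<in> Obj C" "j \<in> Obj K \<Longrightarrow> \<pi> j \<in> Hom C x (ob \<Delta> j)"
    "j \<in> Obj K \<Longrightarrow> k \<in> Obj K \<Longrightarrow> u \<in> Hom K j k \<Longrightarrow> Cmp C x (ob \<Delta> j) (ob \<Delta> k) (ar \<Delta> j k u) (\<pi> j) = \<pi> k"
    "y \<in> Obj C \<Longrightarrow> (\<And>j. j \<in> Obj K \<Longrightarrow> \<rho> j \<in> Hom C y (ob \<Delta> j)) \<Longrightarrow>
      (\<And>j k u. j \<in> Obj K \<Longrightarrow> k \<in> Obj K \<Longrightarrow> u \<in> Hom K j k \<Longrightarrow> Cmp C y (ob \<Delta> j) (ob \<Delta> k) (ar \<Delta> j k u) (\<rho> j) = \<rho> k) \<Longrightarrow>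
      \<exists>!f. f \<in> Hom C y x \<and> (\<forall>j\<in>Obj K. Cmp C y x (ob \<Delta> j) (\<pi> j) f = \<rho> j)"
  using assms unfolding limit_cone_def Let_def by blast+

text \<open>Sections over \<open>n\<close> are arrows from \<open>yon n\<close>, so a compatible
  family of sections over \<open>n\<close> is a cone with vertex \<open>yon n\<close>, and its
  mediating arrow is a section of the limit.\<close>

lemma pointwise_limit_of_limit:
  assumes \<Delta>: "is_functor K Sh \<Delta>" and lim: "limit_cone K Sh \<Delta> x \<pi>"
  shows "pointwise_limit K \<Delta> x \<pi>"
  unfolding pointwise_limit_def
proof (intro allI impI, elim conjE)
  fix n y assume n: "n > (0 :: nat)" and y: "\<forall>j\<in>Obj K. y j \<in> ob (ob \<Delta> j) n"
    and yc: "\<forall>j\<in>Obj K. \<forall>k\<in>Obj K. \<forall>u\<in>Hom K j k. ar \<Delta> j k u n (y j) = y k"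
  have \<Delta>o: "ob \<Delta> j \<in> Obj Sh" if "j \<in> Obj K" for j
    using \<Delta> that by (rule fun_ob)
  note x = limit_coneD(1)[OF lim]
  have u: "undefined \<in> ob (yon n) n"
    using n by (simp add: yon_self)
  define \<rho> where "\<rho> j = (THE \<tau>. \<tau> \<in> Hom PSh (yon n) (ob \<Delta> j) \<and> \<tau> n undefined = y j)" for j
  have \<rho>: "\<rho> j \<in> Hom PSh (yon n) (ob \<Delta> j) \<and> \<rho> j n undefined = y j" if "j \<in> Obj K" for j
    unfolding \<rho>_def by (rule theI'[OF yoneda[OF \<Delta>o[OF that] n bspec[OF y that]]])
  have yonI: "\<tau> = \<sigma>" if "F \<in> Obj Sh" "\<tau> \<in> Hom PSh (yon n) F" "\<sigma> \<in> Hom PSh (yon n) F" "\<tau> n undefined = \<sigma> n undefined" for F \<tau> \<sigma>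
    using yoneda[OF that(1) n h_in[OF that(2) u n]] that by metis
  have cmp: "Cmp PSh (yon n) F G \<beta> \<alpha> \<in> Hom PSh (yon n) G" "Cmp PSh (yon n) F G \<beta> \<alpha> n undefined = \<beta> n (\<alpha> n undefined)"
    if "F \<in> Obj Sh" "G \<in> Obj Sh" "\<alpha> \<in> Hom PSh (yon n) F" "\<beta> \<in> Hom PSh F G" for F G \<alpha> \<beta>
    using that h_cmp[OF Sh_PSh[OF yon_sheaf] Sh_PSh Sh_PSh] h_cmp_apply[OF n u] by auto
  have "\<exists>!f. f \<in> Hom Sh (yon n) x \<and> (\<forall>j\<in>Obj K. Cmp Sh (yon n) x (ob \<Delta> j) (\<pi> j) f = \<rho> j)"
  proof (rule limit_coneD(4)[OF lim yon_sheaf])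
    fix j k u assume jk: "j \<in> Obj K" "k \<in> Obj K" "u \<in> Hom K j k"
    have m: "ar \<Delta> j k u \<in> Hom PSh (ob \<Delta> j) (ob \<Delta> k)"
      using fun_ar[OF \<Delta> jk] by simp
    show "Cmp Sh (yon n) (ob \<Delta> j) (ob \<Delta> k) (ar \<Delta> j k u) (\<rho> j) = \<rho> k"
      by (rule yonI[OF \<Delta>o[OF jk(2)]]) (use \<rho> jk m \<Delta>o cmp yc in auto)
  qed (use \<rho> in auto)
  then obtain f where f: "f \<in> Hom PSh (yon n) x" "\<forall>j\<in>Obj K. Cmp PSh (yon n) x (ob \<Delta> j) (\<pi> j) f = \<rho> j"
    and funi: "\<And>g. g \<in> Hom PSh (yon n) x \<Longrightarrow> \<forall>j\<in>Obj K. Cmp PSh (yon n) x (ob \<Delta> j) (\<pi> j) g = \<rho> j \<Longrightarrow> g = f"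
    by auto
  have \<pi>: "\<pi> j \<in> Hom PSh x (ob \<Delta> j)" if "j \<in> Obj K" for j
    using limit_coneD(2)[OF lim that] by simp
  show "\<exists>!z. z \<in> ob x n \<and> (\<forall>j\<in>Obj K. \<pi> j n z = y j)"
  proof (rule ex1I[of _ "f n undefined"], intro conjI ballI)
    show "f n undefined \<in> ob x n"
      by (rule h_in[OF f(1) u n])
    show "\<pi> j n (f n undefined) = y j" if "j \<in> Obj K" for j
      using cmp(2)[OF x \<Delta>o[OF that] f(1) \<pi>[OF that]] f(2) \<rho>[OF that] that by simp
    fix z assume z: "z \<in> ob x n \<and> (\<forall>j\<in>Obj K. \<pi> j n z = y j)"
    obtain g where g: "g \<in> Hom PSh (yon n) x" "g n undefined = z"
      using yoneda[OF x n, of z] z by blast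
    have "Cmp PSh (yon n) x (ob \<Delta> j) (\<pi> j) g = \<rho> j" if "j \<in> Obj K" for j
      by (rule yonI[OF \<Delta>o[OF that]])
        (use cmp[OF x \<Delta>o[OF that] g(1) \<pi>[OF that]] \<rho>[OF that] z g(2) that in auto)
    then show "z = f n undefined"
      using funi[OF g(1)] g(2) by blast
  qed
qed

text \<open>The mediating arrow is chosen section by section; it commutes with restriction because
  of uniqueness in the pointwise limit.\<close>

lemma limit_of_pointwise_limit:
  assumes \<Delta>: "is_functor K Sh \<Delta>" and x: "x \<in> Obj Sh"
    and \<pi>: "\<And>j. j \<in> Obj K \<Longrightarrow> \<pi> j \<in> Hom PSh x (ob \<Delta> j)"
    and \<pi>c: "\<And>j k u n z. j \<in> Obj K \<Longrightarrow> k \<in> Obj K \<Longrightarrow> u \<in> Hom K j k \<Longrightarrow> n > 0 \<Longrightarrow> z \<in> ob x n \<Longrightarrow> ar \<Delta> j k u n (\<pi> j n z) = \<pi> k n z"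
    and lim: "pointwise_limit K \<Delta> x \<pi>"
  shows "limit_cone K Sh \<Delta> x \<pi>"
  unfolding limit_cone_def Let_def
proof (intro conjI allI impI ballI; (elim conjE)?)
  have \<Delta>o: "ob \<Delta> j \<in> Obj Sh" if "j \<in> Obj K" for j
    using \<Delta> that by (rule fun_ob)
  have \<Delta>a: "ar \<Delta> j k u \<in> Hom PSh (ob \<Delta> j) (ob \<Delta> k)" if "j \<in> Obj K" "k \<in> Obj K" "u \<in> Hom K j k" for j k u
    using fun_ar[OF \<Delta> that] by simp
  note o = Sh_PSh[OF x] Sh_PSh[OF \<Delta>o]
  show "x \<in> Obj Sh" by fact
  show "\<pi> j \<in> Hom Sh x (ob \<Delta> j)" if "j \<in> Obj K" for j
    using \<pi>[OF that] by simp
  show "Cmp Sh x (ob \<Delta> j) (ob \<Delta> k) (ar \<Delta> j k u) (\<pi> j) = \<pi> k" if "j \<in> Obj K" "k \<in> Obj K" "u \<in> Hom K j k" for j k u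
    unfolding Cmp_sheaves
    by (rule h_eqI[OF h_cmp[OF o(1) o(2)[OF that(1)] o(2)[OF that(2)] \<pi>[OF that(1)] \<Delta>a[OF that]] \<pi>[OF that(2)]])
      (use \<pi>c[OF that] in \<open>simp add: h_cmp_apply\<close>)
  fix y \<rho> assume y: "y \<in> Obj Sh" and \<rho>: "\<forall>j\<in>Obj K. \<rho> j \<in> Hom Sh y (ob \<Delta> j)"
    and \<rho>c: "\<forall>j\<in>Obj K. \<forall>k\<in>Obj K. \<forall>u\<in>Hom K j k. Cmp Sh y (ob \<Delta> j) (ob \<Delta> k) (ar \<Delta> j k u) (\<rho> j) = \<rho> k"
  note y' = Sh_PSh[OF y]
  have \<rho>h: "\<rho> j \<in> Hom PSh y (ob \<Delta> j)" if "j \<in> Obj K" for j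
    using \<rho> that by simp
  have uni: "\<exists>!z. z \<in> ob x n \<and> (\<forall>j\<in>Obj K. \<pi> j n z = \<rho> j n t)" if n: "n > 0" and t: "t \<in> ob y n" for n t
  proof -
    have "ar \<Delta> j k u n (\<rho> j n t) = \<rho> k n t" if "j \<in> Obj K" "k \<in> Obj K" "u \<in> Hom K j k" for j k u
      using \<rho>c that h_cmp_apply[OF n t, of "ob \<Delta> j" "ob \<Delta> k" "ar \<Delta> j k u" "\<rho> j"] by (metis Cmp_sheaves)
    moreover have "\<rho> j n t \<in> ob (ob \<Delta> j) n" if "j \<in> Obj K" for j
      by (rule h_in[OF \<rho>h[OF that] t n])
    ultimately show ?thesis
      using lim[unfolded pointwise_limit_def, rule_format, of n "\<lambda>j. \<rho> j n t"] n by blast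
  qed
  define f where "f n t = (THE z. z \<in> ob x n \<and> (\<forall>j\<in>Obj K. \<pi> j n z = \<rho> j n t))" for n t
  have f: "f n t \<in> ob x n \<and> (\<forall>j\<in>Obj K. \<pi> j n (f n t) = \<rho> j n t)" if "n > 0" "t \<in> ob y n" for n t
    unfolding f_def by (rule theI'[OF uni[OF that]])
  have feq: "z = f n t" if "n > 0" "t \<in> ob y n" "z \<in> ob x n" "\<forall>j\<in>Obj K. \<pi> j n z = \<rho> j n t" for n t z
    using uni[OF that(1,2)] f[OF that(1,2)] that(3,4) by blast
  let ?f = "\<lambda>n\<in>{0<..}. \<lambda>t\<in>ob y n. f n t"
  have fh: "?f \<in> Hom PSh y x"
  proof (rule h_intro[OF _ _ y'])
    fix n m t assume *: "n > 0" "m > 0" "n dvd m" "t \<in> ob y n" "restr y n m t \<in> ob y m"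
    note ft = f[OF *(1,4)]
    have "\<pi> j m (restr x n m (f n t)) = \<rho> j m (restr y n m t)" if j: "j \<in> Obj K" for j
      using h_restr[OF \<pi>[OF j] conjunct1[OF ft] *(1-3)] h_restr[OF \<rho>h[OF j] *(4,1-3)] ft j by simp
    then show "f m (restr y n m t) = restr x n m (f n t)"
      using feq[OF *(2,5) p_in[OF Sh_PSh[OF x] conjunct1[OF ft] *(1-3)]] by simp
  qed (use f in blast)
  show "\<exists>!f. f \<in> Hom Sh y x \<and> (\<forall>j\<in>Obj K. Cmp Sh y x (ob \<Delta> j) (\<pi> j) f = \<rho> j)"
    unfolding Hom_sheaves Cmp_sheaves
  proof (rule ex1I[of _ ?f], intro conjI ballI fh)
    fix j assume j: "j \<in> Obj K"
    show "Cmp PSh y x (ob \<Delta> j) (\<pi> j) ?f = \<rho> j"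
      by (rule h_eqI[OF h_cmp[OF y' o(1) o(2)[OF j] fh \<pi>[OF j]] \<rho>h[OF j]])
        (use f j in \<open>simp add: h_cmp_apply\<close>)
  next
    fix g assume g: "g \<in> Hom PSh y x \<and> (\<forall>j\<in>Obj K. Cmp PSh y x (ob \<Delta> j) (\<pi> j) g = \<rho> j)"
    show "g = ?f"
    proof (rule h_eqI[OF conjunct1[OF g] fh])
      fix n t assume n: "n > 0" and t: "t \<in> ob y n"
      have "\<pi> j n (g n t) = \<rho> j n t" if "j \<in> Obj K" for j
        using g h_cmp_apply[OF n t, of x "ob \<Delta> j" "\<pi> j" g] that by metis
      then have "g n t = f n t"
        using feq[OF n t h_in[OF conjunct1[OF g] t n]] by blast
      then show "g n t = ?f n t"
        using n t by simp
    qed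
  qed
qed

text \<open>Exactness is reduced to pointwise limits on both sides. A compatible family of sections
  of the sheafified diagram has presheaf representatives on one common cover, and these are
  compatible after one further refinement, since the diagram has finitely many objects and arrows.
  Over that refinement they come from a section of \<open>x\<close>; the resulting local solutions
  are unique and glue.\<close>

lemma sheafification_left_exact:
  assumes a: "sheafification a \<eta>"
  shows "left_exact PSh Sh a"
  unfolding left_exact_def
proof (intro allI impI, elim conjE)
  fix K :: "(nat, nat) cat" and \<Delta> x \<pi>
  assume K: "finite_category K" and \<Delta>: "is_functor K PSh \<Delta>" and lim: "limit_cone K PSh \<Delta> x \<pi>"
  have af: "is_functor PSh Sh a"
    using a by (simp add: sheafification_def adjoint_def)
  have \<eta>: "local_iso P (ob a P) (\<eta> P)" if "P \<in> Obj PSh" for P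
    using a that by (simp add: sheafification_def)
  have nat: "ar a P Q f n (\<eta> P n t) = \<eta> Q n (f n t)"
    if "P \<in> Obj PSh" "Q \<in> Obj PSh" "f \<in> Hom PSh P Q" "n > 0" "t \<in> ob P n" for P Q f n t
    using a that by (simp add: sheafification_def)
  \<comment> \<open>Presheaves are the sheaves for \<open>K_top UNIV\<close>, so the given limit of
    presheaves is pointwise.\<close>
  interpret triv: big_cell_site U "K_top UNIV"
    using U by (rule big_cell_site_K_top)
  have plim: "pointwise_limit K \<Delta> x \<pi>"
    using triv.pointwise_limit_of_limit[of K \<Delta> x \<pi>] \<Delta> lim by (simp flip: presheaves_eq_sheaves)
  have fin: "finite (Obj K)" "\<And>j k. j \<in> Obj K \<Longrightarrow> k \<in> Obj K \<Longrightarrow> finite (Hom K j k)"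
    using K by (auto simp: finite_category_def)
  have \<Delta>o: "ob \<Delta> j \<in> Obj PSh" if "j \<in> Obj K" for j
    using \<Delta> that by (rule fun_ob)
  have \<Delta>a: "ar \<Delta> j k u \<in> Hom PSh (ob \<Delta> j) (ob \<Delta> k)" if "j \<in> Obj K" "k \<in> Obj K" "u \<in> Hom K j k" for j k u
    by (rule fun_ar[OF \<Delta> that])
  note x = limit_coneD(1)[OF lim] and \<pi> = limit_coneD(2)[OF lim]
  have \<pi>c: "ar \<Delta> j k u n (\<pi> j n z) = \<pi> k n z"
    if "j \<in> Obj K" "k \<in> Obj K" "u \<in> Hom K j k" "n > 0" "z \<in> ob x n" for j k u n z
    using limit_coneD(3)[OF lim that(1-3)] h_cmp_apply[OF that(4,5), of "ob \<Delta> j" "ob \<Delta> k" "ar \<Delta> j k u" "\<pi> j"] by simp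
  have aS: "ob a P \<in> Obj Sh" "ob a P \<in> Obj PSh" if "P \<in> Obj PSh" for P
    using fun_ob[OF af that] Sh_PSh by auto
  have aa: "ar a P Q f \<in> Hom PSh (ob a P) (ob a Q)" if "P \<in> Obj PSh" "Q \<in> Obj PSh" "f \<in> Hom PSh P Q" for P Q f
    using fun_ar[OF af that] by simp
  have \<eta>h: "\<eta> P \<in> Hom PSh P (ob a P)" if "P \<in> Obj PSh" for P
    using local_isoD(2)[OF \<eta>[OF that]] .
  define \<rho> where "\<rho> j = ar a x (ob \<Delta> j) (\<pi> j)" for j
  have \<rho>: "\<rho> j \<in> Hom PSh (ob a x) (ob a (ob \<Delta> j))" if "j \<in> Obj K" for j
    unfolding \<rho>_def by (rule aa[OF x \<Delta>o[OF that] \<pi>[OF that]])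
  have \<rho>\<eta>: "\<rho> j n (\<eta> x n v) = \<eta> (ob \<Delta> j) n (\<pi> j n v)" if "j \<in> Obj K" "n > 0" "v \<in> ob x n" for j n v
    unfolding \<rho>_def by (rule nat[OF x \<Delta>o[OF that(1)] \<pi>[OF that(1)] that(2,3)])
  have stab_fam: "stable n (\<lambda>m. \<forall>j\<in>Obj K. restr (ob \<Delta> j) n m (s j) = restr (ob \<Delta> j) n m (t j))"
    if "n > 0" "\<And>j. j \<in> Obj K \<Longrightarrow> s j \<in> ob (ob \<Delta> j) n" "\<And>j. j \<in> Obj K \<Longrightarrow> t j \<in> ob (ob \<Delta> j) n" for n s t
    by (rule stable_ball) (rule stable_restr_eq[OF \<Delta>o that(2,3,1)])
  \<comment> \<open>Joint injectivity of the projections, first for sections that come from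
    \<open>x\<close>: equality after sheafification is local equality in the diagram of presheaves,
    and where it holds the pointwise limit \<open>x\<close> identifies the sections. Arbitrary
    sections are of this kind on a cover, which gives \<open>inj\<close>.\<close>
  have inj1: "\<eta> x n v = \<eta> x n v'"
    if n: "n > 0" and v: "v \<in> ob x n" "v' \<in> ob x n" and eq: "\<And>j. j \<in> Obj K \<Longrightarrow> \<rho> j n (\<eta> x n v) = \<rho> j n (\<eta> x n v')" for n v v'
  proof (rule separated[OF aS(1)[OF x] h_in[OF \<eta>h[OF x] v(1) n] h_in[OF \<eta>h[OF x] v(2) n]])
    have "locally n (\<lambda>m. \<forall>j\<in>Obj K. restr (ob \<Delta> j) n m (\<pi> j n v) = restr (ob \<Delta> j) n m (\<pi> j n v'))"
    proof (rule locally_ball[OF fin(1) n])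
      fix j assume j: "j \<in> Obj K"
      show "locally n (\<lambda>m. restr (ob \<Delta> j) n m (\<pi> j n v) = restr (ob \<Delta> j) n m (\<pi> j n v'))"
        by (rule local_isoD(3)[OF \<eta>[OF \<Delta>o[OF j]] n h_in[OF \<pi>[OF j] v(1) n] h_in[OF \<pi>[OF j] v(2) n]])
          (use eq[OF j] \<rho>\<eta>[OF j n] v in simp)
    qed
    then show "locally n (\<lambda>m. restr (ob a x) n m (\<eta> x n v) = restr (ob a x) n m (\<eta> x n v'))"
    proof (rule locally_mono[OF _ stable_restr_eq[OF aS(2)[OF x] h_in[OF \<eta>h[OF x] v(1) n] h_in[OF \<eta>h[OF x] v(2) n] n]])
      fix m assume m: "m > 0" "n dvd m" "\<forall>j\<in>Obj K. restr (ob \<Delta> j) n m (\<pi> j n v) = restr (ob \<Delta> j) n m (\<pi> j n v')"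
      note vm = p_in[OF x v(1) n m(1,2)] p_in[OF x v(2) n m(1,2)]
      have "\<pi> j m (restr x n m v) = \<pi> j m (restr x n m v')" if j: "j \<in> Obj K" for j
        using h_restr[OF \<pi>[OF j] v(1) n m(1,2)] h_restr[OF \<pi>[OF j] v(2) n m(1,2)] m(3) j by simp
      moreover have "\<exists>!z. z \<in> ob x m \<and> (\<forall>j\<in>Obj K. \<pi> j m z = \<pi> j m (restr x n m v))"
        using plim[unfolded pointwise_limit_def, rule_format, OF m(1), of "\<lambda>j. \<pi> j m (restr x n m v)"]
          h_in[OF \<pi> vm(1) m(1)] \<pi>c[OF _ _ _ m(1) vm(1)] by blast
      ultimately have "restr x n m v = restr x n m v'"
        using vm by metis
      then show "restr (ob a x) n m (\<eta> x n v) = restr (ob a x) n m (\<eta> x n v')"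
        using h_restr[OF \<eta>h[OF x] v(1) n m(1,2)] h_restr[OF \<eta>h[OF x] v(2) n m(1,2)] by simp
    qed
  qed
  have inj: "w = w'"
    if n: "n > 0" and w: "w \<in> ob (ob a x) n" "w' \<in> ob (ob a x) n" and eq: "\<And>j. j \<in> Obj K \<Longrightarrow> \<rho> j n w = \<rho> j n w'" for n w w'
  proof (rule separated[OF aS(1)[OF x] w])
    have "locally n (\<lambda>m. (\<exists>v\<in>ob x m. restr (ob a x) n m w = \<eta> x m v) \<and> (\<exists>v\<in>ob x m. restr (ob a x) n m w' = \<eta> x m v))"
      by (rule locally_conj[OF local_isoD(4)[OF \<eta>[OF x] n w(1)] local_isoD(4)[OF \<eta>[OF x] n w(2)]])
    then show "locally n (\<lambda>m. restr (ob a x) n m w = restr (ob a x) n m w')"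
    proof (rule locally_mono[OF _ stable_restr_eq[OF aS(2)[OF x] w n]])
      fix m assume m: "m > 0" "n dvd m"
        and "(\<exists>v\<in>ob x m. restr (ob a x) n m w = \<eta> x m v) \<and> (\<exists>v\<in>ob x m. restr (ob a x) n m w' = \<eta> x m v)"
      then obtain v v' where v: "v \<in> ob x m" "restr (ob a x) n m w = \<eta> x m v" "v' \<in> ob x m" "restr (ob a x) n m w' = \<eta> x m v'"
        by blast
      have "\<rho> j m (\<eta> x m v) = \<rho> j m (\<eta> x m v')" if j: "j \<in> Obj K" for j
        using h_restr[OF \<rho>[OF j] w(1) n m] h_restr[OF \<rho>[OF j] w(2) n m] eq[OF j] v by simp
      then show "restr (ob a x) n m w = restr (ob a x) n m w'"
        using inj1[OF m(1) v(1,3)] v by simp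
    qed
  qed
  have pl: "pointwise_limit K (comp_fctr a \<Delta>) (ob a x) \<rho>"
    unfolding pointwise_limit_def ob_comp_fctr ar_comp_fctr
  proof (intro allI impI, elim conjE)
    fix n y assume n: "n > (0 :: nat)" and "\<forall>j\<in>Obj K. y j \<in> ob (ob a (ob \<Delta> j)) n"
      and yc: "\<forall>j\<in>Obj K. \<forall>k\<in>Obj K. \<forall>u\<in>Hom K j k. ar a (ob \<Delta> j) (ob \<Delta> k) (ar \<Delta> j k u) n (y j) = y k"
    then have y: "\<And>j. j \<in> Obj K \<Longrightarrow> y j \<in> ob (ob a (ob \<Delta> j)) n"
      by blast
    \<comment> \<open>\<open>w\<close> solves the problem over \<open>m\<close>. By
      \<open>inj\<close> there is at most one solution, so it is enough to find solutions on a cover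
      of \<open>n\<close>.\<close>
    define R where "R m w \<longleftrightarrow> w \<in> ob (ob a x) m \<and> (\<forall>j\<in>Obj K. \<rho> j m w = restr (ob a (ob \<Delta> j)) n m (y j))" for m w
    have Rres: "R k (restr (ob a x) m k w)" if "m > 0" "n dvd m" "R m w" "k > 0" "m dvd k" for m k w
    proof -
      have w: "w \<in> ob (ob a x) m" using that(3) by (simp add: R_def)
      have "\<rho> j k (restr (ob a x) m k w) = restr (ob a (ob \<Delta> j)) n k (y j)" if j: "j \<in> Obj K" for j
        using h_restr[OF \<rho>[OF j] w \<open>m > 0\<close> \<open>k > 0\<close> \<open>m dvd k\<close>] \<open>R m w\<close> j
          p_restr[OF aS(2)[OF \<Delta>o[OF j]] y[OF j] n \<open>m > 0\<close> \<open>k > 0\<close> \<open>n dvd m\<close> \<open>m dvd k\<close>]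
        by (simp add: R_def)
      then show ?thesis
        unfolding R_def using p_in[OF aS(2)[OF x] w that(1,4,5)] by blast
    qed
    have stR: "stable m (\<lambda>k. \<exists>w\<in>ob (ob a x) k. R k w)" if "n dvd m" for m
    proof (rule stableI)
      fix k l assume *: "k > 0" "m dvd k" "\<exists>w\<in>ob (ob a x) k. R k w" "l > 0" "k dvd l"
      then obtain w where "R k w" by blast
      from Rres[OF *(1) dvd_trans[OF that *(2)] this *(4,5)]
      show "\<exists>w\<in>ob (ob a x) l. R l w"
        unfolding R_def by blast
    qed
    have "locally n (\<lambda>m. \<forall>j\<in>Obj K. \<exists>v\<in>ob (ob \<Delta> j) m. restr (ob a (ob \<Delta> j)) n m (y j) = \<eta> (ob \<Delta> j) m v)"
      by (rule locally_ball[OF fin(1) n]) (rule local_isoD(4)[OF \<eta>[OF \<Delta>o] n y])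
    then have "locally n (\<lambda>m. \<exists>w\<in>ob (ob a x) m. R m w)"
    proof (rule locally_trans[OF _ stR[OF dvd_refl]])
      fix m assume m: "m > 0" "n dvd m"
        and "\<forall>j\<in>Obj K. \<exists>v\<in>ob (ob \<Delta> j) m. restr (ob a (ob \<Delta> j)) n m (y j) = \<eta> (ob \<Delta> j) m v"
      then obtain v where v: "\<And>j. j \<in> Obj K \<Longrightarrow> v j \<in> ob (ob \<Delta> j) m"
        and yv: "\<And>j. j \<in> Obj K \<Longrightarrow> restr (ob a (ob \<Delta> j)) n m (y j) = \<eta> (ob \<Delta> j) m (v j)"
        by metis
      \<comment> \<open>The representatives \<open>v j\<close> are known to be compatible only after
        applying the unit; in the presheaves each compatibility equation \<open>?C\<close> therefore
        holds merely on a cover of \<open>m\<close>.\<close>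
      let ?C = "\<lambda>j k u l. restr (ob \<Delta> k) m l (ar \<Delta> j k u m (v j)) = restr (ob \<Delta> k) m l (v k)"
      have c1: "locally m (?C j k u)" if jk: "j \<in> Obj K" "k \<in> Obj K" "u \<in> Hom K j k" for j k u
      proof (rule local_isoD(3)[OF \<eta>[OF \<Delta>o[OF jk(2)]] m(1) h_in[OF \<Delta>a[OF jk] v[OF jk(1)] m(1)] v[OF jk(2)]])
        have "\<eta> (ob \<Delta> k) m (ar \<Delta> j k u m (v j)) = ar a (ob \<Delta> j) (ob \<Delta> k) (ar \<Delta> j k u) m (\<eta> (ob \<Delta> j) m (v j))"
          using nat[OF \<Delta>o[OF jk(1)] \<Delta>o[OF jk(2)] \<Delta>a[OF jk] m(1) v[OF jk(1)]] by simp
        also have "\<dots> = restr (ob a (ob \<Delta> k)) n m (y k)"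
          using h_restr[OF aa[OF \<Delta>o[OF jk(1)] \<Delta>o[OF jk(2)] \<Delta>a[OF jk]] y[OF jk(1)] n m] yc jk yv[OF jk(1)] by simp
        finally show "\<eta> (ob \<Delta> k) m (ar \<Delta> j k u m (v j)) = \<eta> (ob \<Delta> k) m (v k)"
          using yv[OF jk(2)] by simp
      qed
      have "locally m (\<lambda>l. \<forall>j\<in>Obj K. \<forall>k\<in>Obj K. \<forall>u\<in>Hom K j k. ?C j k u l)"
        by (rule locally_ball[OF fin(1) m(1)], rule locally_ball[OF fin(1) m(1)], rule locally_ball[OF fin(2) m(1)])
          (assumption+, rule c1)
      then show "locally m (\<lambda>k. \<exists>w\<in>ob (ob a x) k. R k w)"
      proof (rule locally_mono[OF _ stR[OF m(2)]])
        fix l assume l: "l > 0" "m dvd l" and C: "\<forall>j\<in>Obj K. \<forall>k\<in>Obj K. \<forall>u\<in>Hom K j k. ?C j k u l"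
        let ?v = "\<lambda>j. restr (ob \<Delta> j) m l (v j)"
        have "?v j \<in> ob (ob \<Delta> j) l" if "j \<in> Obj K" for j
          by (rule p_in[OF \<Delta>o[OF that] v[OF that] m(1) l])
        moreover have "ar \<Delta> j k u l (?v j) = ?v k" if "j \<in> Obj K" "k \<in> Obj K" "u \<in> Hom K j k" for j k u
          using h_restr[OF \<Delta>a[OF that] v[OF that(1)] m(1) l] C that by simp
        ultimately obtain t where t: "t \<in> ob x l" "\<And>j. j \<in> Obj K \<Longrightarrow> \<pi> j l t = ?v j"
          using plim[unfolded pointwise_limit_def, rule_format, OF l(1), of ?v] by blast
        have "\<rho> j l (\<eta> x l t) = restr (ob a (ob \<Delta> j)) n l (y j)" if j: "j \<in> Obj K" for j
          using \<rho>\<eta>[OF j l(1) t(1)] t(2)[OF j] h_restr[OF \<eta>h[OF \<Delta>o[OF j]] v[OF j] m(1) l] yv[OF j]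
            p_restr[OF aS(2)[OF \<Delta>o[OF j]] y[OF j] n m(1) l(1) m(2) l(2)] by simp
        then show "\<exists>w\<in>ob (ob a x) l. R l w"
          unfolding R_def using h_in[OF \<eta>h[OF x] t(1) l(1)] by blast
      qed
    qed
    note loc = this
    have "\<exists>z\<in>ob (ob a x) n. \<forall>m>0. \<forall>w\<in>ob (ob a x) m. n dvd m \<longrightarrow> R m w \<longrightarrow> restr (ob a x) n m z = w"
    proof (rule glue_rel[OF aS(1)[OF x] loc])
      fix m w w' assume *: "m > 0" "w \<in> ob (ob a x) m" "w' \<in> ob (ob a x) m" "R m w" "R m w'"
      show "w = w'"
        by (rule inj[OF *(1-3)]) (use *(4,5) in \<open>simp add: R_def\<close>)
    qed (rule Rres)
    then obtain z where z: "z \<in> ob (ob a x) n"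
      "\<And>m w. m > 0 \<Longrightarrow> n dvd m \<Longrightarrow> w \<in> ob (ob a x) m \<Longrightarrow> R m w \<Longrightarrow> restr (ob a x) n m z = w"
      by blast
    have zj: "\<rho> j n z = y j" if j: "j \<in> Obj K" for j
    proof (rule separated[OF aS(1)[OF \<Delta>o[OF j]] h_in[OF \<rho>[OF j] z(1) n] y[OF j]])
      show "locally n (\<lambda>m. restr (ob a (ob \<Delta> j)) n m (\<rho> j n z) = restr (ob a (ob \<Delta> j)) n m (y j))"
      proof (rule locally_mono[OF loc stable_restr_eq[OF aS(2)[OF \<Delta>o[OF j]] h_in[OF \<rho>[OF j] z(1) n] y[OF j] n]])
        fix m assume m: "m > 0" "n dvd m" "\<exists>w\<in>ob (ob a x) m. R m w"
        then obtain w where w: "w \<in> ob (ob a x) m" "R m w" by blast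
        then show "restr (ob a (ob \<Delta> j)) n m (\<rho> j n z) = restr (ob a (ob \<Delta> j)) n m (y j)"
          using z(2)[OF m(1,2) w] h_restr[OF \<rho>[OF j] z(1) n m(1,2)] j by (simp add: R_def)
      qed
    qed
    show "\<exists>!z. z \<in> ob (ob a x) n \<and> (\<forall>j\<in>Obj K. \<rho> j n z = y j)"
    proof (rule ex1I[of _ z])
      fix z' assume z': "z' \<in> ob (ob a x) n \<and> (\<forall>j\<in>Obj K. \<rho> j n z' = y j)"
      show "z' = z"
        by (rule inj[OF n conjunct1[OF z'] z(1)]) (use z' zj in simp)
    qed (use z(1) zj in blast)
  qed
  show "limit_cone K Sh (comp_fctr a \<Delta>) (ob a x) (\<lambda>j. ar a x (ob \<Delta> j) (\<pi> j))"
  proof (rule limit_of_pointwise_limit[OF is_functor_comp[OF \<Delta> af] aS(1)[OF x]])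
    show "ar a x (ob \<Delta> j) (\<pi> j) \<in> Hom PSh (ob a x) (ob (comp_fctr a \<Delta>) j)" if "j \<in> Obj K" for j
      using \<rho>[OF that] by (simp add: \<rho>_def)
    show "pointwise_limit K (comp_fctr a \<Delta>) (ob a x) (\<lambda>j. ar a x (ob \<Delta> j) (\<pi> j))"
      using pl unfolding \<rho>_def .
    fix j k u n z assume jk: "j \<in> Obj K" "k \<in> Obj K" "u \<in> Hom K j k" and n: "n > 0" and z: "z \<in> ob (ob a x) n"
    have "Cmp PSh (ob a x) (ob a (ob \<Delta> j)) (ob a (ob \<Delta> k)) (ar a (ob \<Delta> j) (ob \<Delta> k) (ar \<Delta> j k u)) (ar a x (ob \<Delta> j) (\<pi> j)) =
        ar a x (ob \<Delta> k) (\<pi> k)"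
      using fun_cmp[OF af x \<Delta>o[OF jk(1)] \<Delta>o[OF jk(2)] \<pi>[OF jk(1)] \<Delta>a[OF jk]] limit_coneD(3)[OF lim jk] by simp
    then show "ar (comp_fctr a \<Delta>) j k u n (ar a x (ob \<Delta> j) (\<pi> j) n z) = ar a x (ob \<Delta> k) (\<pi> k) n z"
      using h_cmp_apply[OF n z, of "ob a (ob \<Delta> j)" "ob a (ob \<Delta> k)" "ar a (ob \<Delta> j) (ob \<Delta> k) (ar \<Delta> j k u)" "ar a x (ob \<Delta> j) (\<pi> j)"]
      by simp
  qed
qed

end

section \<open>Stalks and points\<close>

definition stalk_cocone :: "supernat \<Rightarrow> (nat, 'u) presheaf \<Rightarrow> 'u set \<Rightarrow> (nat \<Rightarrow> 'u \<Rightarrow> 'u) \<Rightarrow> bool" where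
  "stalk_cocone s F X \<gamma> \<longleftrightarrow> (\<forall>n>0. snat n sdvd s \<longrightarrow> \<gamma> n \<in> ob F n \<rightarrow>\<^sub>E X) \<and>
     (\<forall>n>0. \<forall>m>0. n dvd m \<longrightarrow> snat m sdvd s \<longrightarrow> (\<forall>x\<in>ob F n. \<gamma> m (restr F n m x) = \<gamma> n x))"

lemma stalk_coconeD:
  assumes "stalk_cocone s F X \<gamma>"
  shows "n > 0 \<Longrightarrow> snat n sdvd s \<Longrightarrow> \<gamma> n \<in> ob F n \<rightarrow>\<^sub>E X"
    and "n > 0 \<Longrightarrow> snat n sdvd s \<Longrightarrow> x \<in> ob F n \<Longrightarrow> \<gamma> n x \<in> X"
    and "m > 0 \<Longrightarrow> n dvd m \<Longrightarrow> snat m sdvd s \<Longrightarrow> x \<in> ob F n \<Longrightarrow> \<gamma> m (restr F n m x) = \<gamma> n x"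
proof -
  show "n > 0 \<Longrightarrow> snat n sdvd s \<Longrightarrow> \<gamma> n \<in> ob F n \<rightarrow>\<^sub>E X"
    using assms unfolding stalk_cocone_def by blast
  then show "n > 0 \<Longrightarrow> snat n sdvd s \<Longrightarrow> x \<in> ob F n \<Longrightarrow> \<gamma> n x \<in> X"
    by auto
  show "m > 0 \<Longrightarrow> n dvd m \<Longrightarrow> snat m sdvd s \<Longrightarrow> x \<in> ob F n \<Longrightarrow> \<gamma> m (restr F n m x) = \<gamma> n x"
    using assms dvd_pos_nat[of m n] unfolding stalk_cocone_def by blast
qed

text \<open>Translates \<open>colimit_cocone\<close> into statements about elements; stalks are
  handled in this form from here on.\<close>

lemma colimit_stalk_iff:
  assumes F: "F \<in> Obj (presheaves U big_cell)"
  shows "colimit_cocone (full_subcat (op_cat big_cell) (\<lambda>n. snat n sdvd s)) (set_cat U) F X \<gamma> \<longleftrightarrow>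
    X \<in> U \<and> stalk_cocone s F X \<gamma> \<and>
    (\<forall>Y\<in>U. \<forall>\<rho>. stalk_cocone s F Y \<rho> \<longrightarrow>
      (\<exists>!f. f \<in> X \<rightarrow>\<^sub>E Y \<and> (\<forall>n>0. snat n sdvd s \<longrightarrow> (\<forall>x\<in>ob F n. f (\<gamma> n x) = \<rho> n x))))"
proof -
  let ?D = "full_subcat (op_cat big_cell) (\<lambda>n. snat n sdvd s)"
  have O: "Obj ?D = {n. n > 0 \<and> snat n sdvd s}"
    by (simp add: full_subcat_def op_cat_def)
  have H: "Hom ?D n m = (if n dvd m then {()} else {})" for n m
    by (simp add: full_subcat_def op_cat_def big_cell_def poset_cat_def)
  have ar: "ar F n m u = restr F n m" for n m u
    by (simp add: restr_def)
  have cocone: "Y \<in> Obj (set_cat U) \<and> (\<forall>j\<in>Obj ?D. \<rho> j \<in> Hom (set_cat U) (ob F j) Y) \<and>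
      (\<forall>j\<in>Obj ?D. \<forall>k\<in>Obj ?D. \<forall>u\<in>Hom ?D j k. Cmp (set_cat U) (ob F j) (ob F k) Y (\<rho> k) (ar F j k u) = \<rho> j) \<longleftrightarrow>
      Y \<in> U \<and> stalk_cocone s F Y \<rho>" for Y \<rho>
  proof -
    have *: "Cmp (set_cat U) (ob F j) (ob F k) Y (\<rho> k) (restr F j k) = \<rho> j \<longleftrightarrow> (\<forall>x\<in>ob F j. \<rho> k (restr F j k x) = \<rho> j x)"
      if "\<rho> j \<in> ob F j \<rightarrow>\<^sub>E Y" for j k
    proof
      assume "Cmp (set_cat U) (ob F j) (ob F k) Y (\<rho> k) (restr F j k) = \<rho> j"
      then show "\<forall>x\<in>ob F j. \<rho> k (restr F j k x) = \<rho> j x"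
        by (metis Cmp_set_cat_apply)
    next
      assume "\<forall>x\<in>ob F j. \<rho> k (restr F j k x) = \<rho> j x"
      then show "Cmp (set_cat U) (ob F j) (ob F k) Y (\<rho> k) (restr F j k) = \<rho> j"
        using that by (auto simp: set_cat_def PiE_def compose_eq intro!: extensionalityI[where A = "ob F j"])
    qed
    show ?thesis
      unfolding O H ar stalk_cocone_def
    proof (intro iffI conjI ballI allI impI; (elim conjE)?)
      assume "Y \<in> Obj (set_cat U)" then show "Y \<in> U" by (simp add: set_cat_def)
    next
      assume "Y \<in> U" then show "Y \<in> Obj (set_cat U)" by (simp add: set_cat_def)
    next
      fix n assume "\<forall>j\<in>{n. 0 < n \<and> snat n sdvd s}. \<rho> j \<in> Hom (set_cat U) (ob F j) Y" "0 < n" "snat n sdvd s"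
      then show "\<rho> n \<in> ob F n \<rightarrow>\<^sub>E Y" by (simp add: set_cat_def)
    next
      fix n m x
      assume a: "\<forall>j\<in>{n. 0 < n \<and> snat n sdvd s}. \<rho> j \<in> Hom (set_cat U) (ob F j) Y"
        and b: "\<forall>j\<in>{n. 0 < n \<and> snat n sdvd s}. \<forall>k\<in>{n. 0 < n \<and> snat n sdvd s}. \<forall>u\<in>if j dvd k then {()} else {}.
          Cmp (set_cat U) (ob F j) (ob F k) Y (\<rho> k) (restr F j k) = \<rho> j"
        and n: "0 < n" "0 < m" "n dvd m" "snat m sdvd s" and x: "x \<in> ob F n"
      have ns: "snat n sdvd s"
        using snat_sdvd_trans[OF n(3,2,4)] .
      then have "\<rho> n \<in> ob F n \<rightarrow>\<^sub>E Y"
        using a n by (simp add: set_cat_def)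
      moreover have "Cmp (set_cat U) (ob F n) (ob F m) Y (\<rho> m) (restr F n m) = \<rho> n"
        using b n ns by simp
      ultimately show "\<rho> m (restr F n m x) = \<rho> n x"
        using * x by blast
    next
      fix j assume "\<forall>n>0. snat n sdvd s \<longrightarrow> \<rho> n \<in> ob F n \<rightarrow>\<^sub>E Y" "j \<in> {n. 0 < n \<and> snat n sdvd s}"
      then show "\<rho> j \<in> Hom (set_cat U) (ob F j) Y" by (simp add: set_cat_def)
    next
      fix j k u assume a: "\<forall>n>0. snat n sdvd s \<longrightarrow> \<rho> n \<in> ob F n \<rightarrow>\<^sub>E Y"
        and b: "\<forall>n>0. \<forall>m>0. n dvd m \<longrightarrow> snat m sdvd s \<longrightarrow> (\<forall>x\<in>ob F n. \<rho> m (restr F n m x) = \<rho> n x)"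
        and jk: "j \<in> {n. 0 < n \<and> snat n sdvd s}" "k \<in> {n. 0 < n \<and> snat n sdvd s}" "u \<in> (if j dvd k then {()} else {})"
      have "j dvd k"
        using jk(3) by (cases "j dvd k") simp_all
      then have "\<forall>x\<in>ob F j. \<rho> k (restr F j k x) = \<rho> j x"
        using b jk by simp
      then show "Cmp (set_cat U) (ob F j) (ob F k) Y (\<rho> k) (restr F j k) = \<rho> j"
        using * a jk by simp
    qed
  qed
  have med: "f \<in> Hom (set_cat U) X Y \<and> (\<forall>j\<in>Obj ?D. Cmp (set_cat U) (ob F j) X Y f (\<gamma> j) = \<rho> j) \<longleftrightarrow>
      f \<in> X \<rightarrow>\<^sub>E Y \<and> (\<forall>n>0. snat n sdvd s \<longrightarrow> (\<forall>x\<in>ob F n. f (\<gamma> n x) = \<rho> n x))"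
    if \<rho>: "stalk_cocone s F Y \<rho>" for Y \<rho> f
  proof -
    have "Cmp (set_cat U) (ob F n) X Y f (\<gamma> n) = \<rho> n \<longleftrightarrow> (\<forall>x\<in>ob F n. f (\<gamma> n x) = \<rho> n x)"
      if n: "n > 0" "snat n sdvd s" for n
    proof
      assume "Cmp (set_cat U) (ob F n) X Y f (\<gamma> n) = \<rho> n"
      then show "\<forall>x\<in>ob F n. f (\<gamma> n x) = \<rho> n x"
        by (metis Cmp_set_cat_apply)
    next
      assume "\<forall>x\<in>ob F n. f (\<gamma> n x) = \<rho> n x"
      then show "Cmp (set_cat U) (ob F n) X Y f (\<gamma> n) = \<rho> n"
        using stalk_coconeD(1)[OF \<rho> n]
        by (auto simp: set_cat_def PiE_def compose_eq intro!: extensionalityI[where A = "ob F n"])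
    qed
    then show ?thesis
      unfolding O by (auto simp: set_cat_def)
  qed
  show ?thesis
    unfolding colimit_cocone_def Let_def cocone
    using med by (auto 0 0) metis+
qed

text \<open>The concrete description of a directed colimit of sets: every element is a germ, and two
  germs are equal only if the sections agree over a common multiple that still divides
  \<open>s\<close>.\<close>

definition germ_cocone :: "supernat \<Rightarrow> (nat, 'u) presheaf \<Rightarrow> 'u set \<Rightarrow> (nat \<Rightarrow> 'u \<Rightarrow> 'u) \<Rightarrow> bool" where
  "germ_cocone s F X \<gamma> \<longleftrightarrow> stalk_cocone s F X \<gamma> \<and>
     (\<forall>z\<in>X. \<exists>n>0. snat n sdvd s \<and> (\<exists>x\<in>ob F n. z = \<gamma> n x)) \<and>
     (\<forall>n>0. \<forall>m>0. \<forall>x\<in>ob F n. \<forall>y\<in>ob F m. snat n sdvd s \<longrightarrow> snat m sdvd s \<longrightarrow> \<gamma> n x = \<gamma> m y \<longrightarrow>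
        (\<exists>k>0. n dvd k \<and> m dvd k \<and> snat k sdvd s \<and> restr F n k x = restr F m k y))"

lemma germ_coconeD:
  assumes "germ_cocone s F X \<gamma>"
  shows "stalk_cocone s F X \<gamma>"
    and "z \<in> X \<Longrightarrow> \<exists>n>0. snat n sdvd s \<and> (\<exists>x\<in>ob F n. z = \<gamma> n x)"
    and "n > 0 \<Longrightarrow> m > 0 \<Longrightarrow> snat n sdvd s \<Longrightarrow> snat m sdvd s \<Longrightarrow> x \<in> ob F n \<Longrightarrow> y \<in> ob F m \<Longrightarrow>
      \<gamma> n x = \<gamma> m y \<Longrightarrow> \<exists>k>0. n dvd k \<and> m dvd k \<and> snat k sdvd s \<and> restr F n k x = restr F m k y"
proof -
  note c = assms[unfolded germ_cocone_def]
  show "stalk_cocone s F X \<gamma>"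
    using c ..
  show "z \<in> X \<Longrightarrow> \<exists>n>0. snat n sdvd s \<and> (\<exists>x\<in>ob F n. z = \<gamma> n x)"
    by (rule c[THEN conjunct2, THEN conjunct1, THEN bspec])
  show "n > 0 \<Longrightarrow> m > 0 \<Longrightarrow> snat n sdvd s \<Longrightarrow> snat m sdvd s \<Longrightarrow> x \<in> ob F n \<Longrightarrow> y \<in> ob F m \<Longrightarrow>
      \<gamma> n x = \<gamma> m y \<Longrightarrow> \<exists>k>0. n dvd k \<and> m dvd k \<and> snat k sdvd s \<and> restr F n k x = restr F m k y"
    by (rule c[THEN conjunct2, THEN conjunct2, rule_format])
qed

text \<open>The mediating map sends a germ to the image of any representative; this is well defined
  because equal germs have representatives that agree over a common \<open>k\<close>.\<close>

lemma stalk_of_germs: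
  assumes F: "F \<in> Obj (presheaves U big_cell)" and X: "X \<in> U" and germs: "germ_cocone s F X \<gamma>"
  shows "colimit_cocone (full_subcat (op_cat big_cell) (\<lambda>n. snat n sdvd s)) (set_cat U) F X \<gamma>"
  unfolding colimit_stalk_iff[OF F]
proof (intro conjI X germ_coconeD(1)[OF germs] ballI allI impI)
  note \<gamma> = germ_coconeD(1)[OF germs] and surj = germ_coconeD(2)[OF germs] and inj = germ_coconeD(3)[OF germs]
  fix Y \<rho> assume \<rho>: "stalk_cocone s F Y \<rho>"
  define R where "R z y \<longleftrightarrow> (\<exists>n>0. snat n sdvd s \<and> (\<exists>x\<in>ob F n. z = \<gamma> n x \<and> y = \<rho> n x))" for z y
  have Rex: "\<exists>y. R z y" if "z \<in> X" for z
    using surj[OF that] unfolding R_def by blast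
  have Runi: "y = y'" if R: "R z y" "R z y'" for z y y'
  proof -
    obtain n x m x' where n: "n > 0" "snat n sdvd s" "x \<in> ob F n" "z = \<gamma> n x" "y = \<rho> n x"
      and m: "m > 0" "snat m sdvd s" "x' \<in> ob F m" "z = \<gamma> m x'" "y' = \<rho> m x'"
      using R unfolding R_def by blast
    obtain k where k: "k > 0" "n dvd k" "m dvd k" "snat k sdvd s" "restr F n k x = restr F m k x'"
      using inj[OF n(1) m(1) n(2) m(2) n(3) m(3)] n(4) m(4) by auto
    show ?thesis
      using stalk_coconeD(3)[OF \<rho> k(1,2,4) n(3)] stalk_coconeD(3)[OF \<rho> k(1,3,4) m(3)] k(5) n(5) m(5) by simp
  qed
  define f where "f z = (SOME y. R z y)" for z
  have f: "R z (f z)" if "z \<in> X" for z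
    unfolding f_def by (rule someI_ex[OF Rex[OF that]])
  have feq: "f (\<gamma> n x) = \<rho> n x" if "n > 0" "snat n sdvd s" "x \<in> ob F n" for n x
    by (rule Runi[OF f[OF stalk_coconeD(2)[OF \<gamma> that]]]) (use that in \<open>auto simp: R_def\<close>)
  show "\<exists>!f. f \<in> X \<rightarrow>\<^sub>E Y \<and> (\<forall>n>0. snat n sdvd s \<longrightarrow> (\<forall>x\<in>ob F n. f (\<gamma> n x) = \<rho> n x))"
  proof (rule ex1I[of _ "\<lambda>z\<in>X. f z"], intro conjI allI impI ballI)
    have "f z \<in> Y" if z: "z \<in> X" for z
    proof -
      obtain n x where "n > 0" "snat n sdvd s" "x \<in> ob F n" "f z = \<rho> n x"
        using f[OF z] unfolding R_def by blast
      then show ?thesis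
        using stalk_coconeD(2)[OF \<rho>] by simp
    qed
    then show "(\<lambda>z\<in>X. f z) \<in> X \<rightarrow>\<^sub>E Y"
      by auto
    show "(\<lambda>z\<in>X. f z) (\<gamma> n x) = \<rho> n x" if "n > 0" "snat n sdvd s" "x \<in> ob F n" for n x
      using feq[OF that] stalk_coconeD(2)[OF \<gamma> that] by simp
    fix g assume g: "g \<in> X \<rightarrow>\<^sub>E Y \<and> (\<forall>n>0. snat n sdvd s \<longrightarrow> (\<forall>x\<in>ob F n. g (\<gamma> n x) = \<rho> n x))"
    show "g = (\<lambda>z\<in>X. f z)"
    proof (rule PiE_ext[OF conjunct1[OF g]])
      show "(\<lambda>z\<in>X. f z) \<in> X \<rightarrow>\<^sub>E Y" by fact
      fix z assume z: "z \<in> X"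
      obtain n x where n: "n > 0" "snat n sdvd s" "x \<in> ob F n" "z = \<gamma> n x"
        using surj[OF z] by blast
      show "g z = (\<lambda>z\<in>X. f z) z"
        using g n feq[OF n(1-3)] z by simp
    qed
  qed
qed

text \<open>An element outside the joint image could be sent anywhere: the constant map to a
  two-element set and its modification at that element would both mediate for the same
  cocone.\<close>

lemma stalk_jointly_surjective:
  assumes U: "set_universe U" and F: "F \<in> Obj (presheaves U big_cell)"
    and col: "colimit_cocone (full_subcat (op_cat big_cell) (\<lambda>n. snat n sdvd s)) (set_cat U) F X \<gamma>" and z: "z \<in> X"
  shows "\<exists>n>0. snat n sdvd s \<and> (\<exists>x\<in>ob F n. z = \<gamma> n x)"
proof (rule ccontr)
  assume no: "\<not> ?thesis"
  obtain a b where ab: "a \<noteq> b" "{a, b} \<in> U"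
    using U by (rule universe_pair)
  note c = col[unfolded colimit_stalk_iff[OF F]]
  let ?\<rho> = "\<lambda>n. \<lambda>x\<in>ob F n. a"
  have "stalk_cocone s F {a, b} ?\<rho>"
    unfolding stalk_cocone_def using restr_in[OF is_category_big_cell F] by (auto simp: arrow_to_big_cell)
  then have "\<exists>!f. f \<in> X \<rightarrow>\<^sub>E {a, b} \<and> (\<forall>n>0. snat n sdvd s \<longrightarrow> (\<forall>x\<in>ob F n. f (\<gamma> n x) = ?\<rho> n x))"
    using c ab(2) by blast
  then obtain g where g: "\<And>f. f \<in> X \<rightarrow>\<^sub>E {a, b} \<and> (\<forall>n>0. snat n sdvd s \<longrightarrow> (\<forall>x\<in>ob F n. f (\<gamma> n x) = ?\<rho> n x)) \<Longrightarrow> f = g"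
    by (elim ex1E) iprover
  have \<gamma>: "\<gamma> n x \<in> X" if "n > 0" "snat n sdvd s" "x \<in> ob F n" for n x
    using stalk_coconeD(2)[of s F X \<gamma>] c that by blast
  have "(\<lambda>w\<in>X. a) = g"
    by (rule g) (use \<gamma> in auto)
  moreover have "(\<lambda>w\<in>X. if w = z then b else a) = g"
    by (rule g) (use \<gamma> no in auto)
  ultimately have "(\<lambda>w\<in>X. a) = (\<lambda>w\<in>X. if w = z then b else a)"
    by simp
  from fun_cong[OF this, of z] show False
    using z ab(1) by simp
qed

lemma snat_1_dvd: "snat (Suc 0) sdvd s"
  using snat_one_sdvd by simp

lemma (in big_cell_site) locally_K_top:
  assumes J: "J = K_top S"
  shows "locally n Q \<longleftrightarrow> n > 0 \<and> stable n Q \<and>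
    (\<forall>s\<in>S. snat n sdvd s \<longrightarrow> (\<exists>m>0. n dvd m \<and> Q m \<and> snat m sdvd s))"
proof
  assume l: "locally n Q"
  have c: "{m. m > 0 \<and> n dvd m \<and> Q m} \<in> K_top S n"
    using l[unfolded locally_def] unfolding J .
  have "\<exists>m\<in>{m. m > 0 \<and> n dvd m \<and> Q m}. snat m sdvd s" if "s \<in> S" "snat n sdvd s" for s
    by (rule K_topD[OF c that])
  then show "n > 0 \<and> stable n Q \<and> (\<forall>s\<in>S. snat n sdvd s \<longrightarrow> (\<exists>m>0. n dvd m \<and> Q m \<and> snat m sdvd s))"
    using locally_pos[OF l] locally_stable[OF l] by blast
next
  assume *: "n > 0 \<and> stable n Q \<and> (\<forall>s\<in>S. snat n sdvd s \<longrightarrow> (\<exists>m>0. n dvd m \<and> Q m \<and> snat m sdvd s))"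
  then show "locally n Q"
    unfolding locally_def unfolding J using mem_K_top[of n "{m. m > 0 \<and> n dvd m \<and> Q m}" S] sieve_stable[of n Q] by auto
qed

text \<open>
  Sheaves for the topology of a single supernatural number \<open>s\<close> are sets, placed at the divisors of
  \<open>s\<close>; composing with sheafification, this exhibits the stalk at \<open>s\<close> as a geometric morphism.
\<close>

locale supernatural_point =
  fixes U :: "'u set set" and s :: supernat
  assumes U: "set_universe U"
begin

sublocale big_cell_site U "K_top {s}"
  using U by (rule big_cell_site_K_top)

lemma locally_iff: "locally n Q \<longleftrightarrow> n > 0 \<and> stable n Q \<and> (snat n sdvd s \<longrightarrow> (\<exists>m>0. n dvd m \<and> Q m \<and> snat m sdvd s))"
  using locally_K_top[OF refl, of n Q] by simp

text \<open>When \<open>n\<close> does not divide \<open>s\<close>, the empty sieve covers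
  \<open>n\<close>.\<close>

lemma off_singleton:
  assumes F: "F \<in> Obj Sh" and n: "n > 0" "\<not> snat n sdvd s"
  shows "\<exists>!x. x \<in> ob F n"
proof -
  have l: "locally n (\<lambda>_. False)"
    using n by (simp add: locally_iff stable_def)
  obtain y where "y \<in> ob F n"
    by (rule glue[OF F l]) auto
  moreover have "x = y" if "x \<in> ob F n" "y \<in> ob F n" for x y
  proof (rule separated[OF F that])
    show "locally n (\<lambda>m. restr F n m x = restr F n m y)"
      by (rule locally_mono[OF l stable_restr_eq[OF Sh_PSh[OF F] that n(1)]]) simp
  qed
  ultimately show ?thesis
    by blast
qed

text \<open>When \<open>n\<close> divides \<open>s\<close>, the multiples of \<open>n\<close> cover
  1, so sections over 1 are the same as sections over \<open>n\<close>. Together with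
  \<open>off_singleton\<close> this shows that a sheaf for \<open>K_top {s}\<close> is determined by
  its set of sections over 1.\<close>

lemma on_bij:
  assumes F: "F \<in> Obj Sh" and n: "n > 0" "snat n sdvd s"
  shows "bij_betw (restr F 1 n) (ob F 1) (ob F n)"
proof -
  note F' = Sh_PSh[OF F]
  have st: "stable 1 (\<lambda>m. n dvd m)"
    by (rule stableI) (rule dvd_trans)
  have l: "locally 1 (\<lambda>m. n dvd m)"
    using n st by (auto simp: locally_iff)
  have "inj_on (restr F 1 n) (ob F 1)"
  proof (rule inj_onI)
    fix x y assume xy: "x \<in> ob F 1" "y \<in> ob F 1" "restr F 1 n x = restr F 1 n y"
    show "x = y"
    proof (rule separated[OF F xy(1,2)])
      show "locally 1 (\<lambda>m. restr F 1 m x = restr F 1 m y)"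
      proof (rule locally_mono[OF l stable_restr_eq[OF F' xy(1,2)]])
        show "restr F 1 m x = restr F 1 m y" if "m > 0" "n dvd m" for m
          using p_restr[OF F' xy(1) _ n(1) that(1) _ that(2)] p_restr[OF F' xy(2) _ n(1) that(1) _ that(2)] xy(3) by simp
      qed simp
    qed
  qed
  moreover have "y \<in> restr F 1 n ` ob F 1" if y: "y \<in> ob F n" for y
  proof -
    obtain z where "z \<in> ob F 1" "\<And>m. m > 0 \<Longrightarrow> 1 dvd m \<Longrightarrow> n dvd m \<Longrightarrow> restr F 1 m z = restr F n m y"
      by (rule glue[OF F l, of "\<lambda>m. restr F n m y"]) (use y n in \<open>auto simp: p_in[OF F'] p_restr[OF F']\<close>)
    then have "restr F 1 n z = y" "z \<in> ob F 1"
      using n p_id[OF F' y n(1)] by auto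
    then show ?thesis
      by blast
  qed
  ultimately show ?thesis
    unfolding bij_betw_def using p_in[OF F' _ _ n(1)] by auto
qed

text \<open>Global sections, as 1 is the terminal object of the big cell.\<close>

definition ev :: "((nat, 'u) presheaf, nat \<Rightarrow> 'u \<Rightarrow> 'u, 'u set, 'u \<Rightarrow> 'u) fctr" where
  "ev = \<lparr>ob = \<lambda>F. ob F 1, ar = \<lambda>F G \<alpha>. \<alpha> 1\<rparr>"

lemma ev_functor: "is_functor Sh (set_cat U) ev"
  unfolding is_functor_def ev_def fctr.simps
proof (intro conjI ballI)
  show "ob F 1 \<in> Obj (set_cat U)" if "F \<in> Obj Sh" for F
    using presheaf_ob[OF bc Sh_PSh[OF that], of 1] by (simp add: set_cat_def)
  show "\<alpha> 1 \<in> Hom (set_cat U) (ob F 1) (ob G 1)" if "\<alpha> \<in> Hom Sh F G" for F G \<alpha>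
    using hom_PiE[of \<alpha> U big_cell F G 1] that by (simp add: set_cat_def)
  show "Idn Sh F 1 = Idn (set_cat U) (ob F 1)" for F
    using Idn_presheaves[of 1 big_cell U F] by (simp add: set_cat_def)
  show "Cmp Sh F G H \<beta> \<alpha> 1 = Cmp (set_cat U) (ob F 1) (ob G 1) (ob H 1) (\<beta> 1) (\<alpha> 1)" for F G H \<alpha> \<beta>
    using Cmp_presheaves[of 1 big_cell U F G H \<beta> \<alpha>] by (simp add: set_cat_def)
qed

lemma ev_fully_faithful: "fully_faithful Sh (set_cat U) ev"
  unfolding fully_faithful_def
proof (intro ballI)
  fix F G assume F: "F \<in> Obj Sh" and G: "G \<in> Obj Sh"
  note F' = Sh_PSh[OF F] and G' = Sh_PSh[OF G]
  have "bij_betw (\<lambda>\<alpha>. \<alpha> 1) (Hom PSh F G) (ob F 1 \<rightarrow>\<^sub>E ob G 1)"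
    unfolding bij_betw_def
  proof (intro conjI inj_onI equalityI subsetI)
    fix \<alpha> \<beta> assume \<alpha>: "\<alpha> \<in> Hom PSh F G" and \<beta>: "\<beta> \<in> Hom PSh F G" and eq: "\<alpha> 1 = \<beta> 1"
    show "\<alpha> = \<beta>"
    proof (rule h_eqI[OF \<alpha> \<beta>])
      fix n x assume n: "n > 0" and x: "x \<in> ob F n"
      show "\<alpha> n x = \<beta> n x"
      proof (cases "snat n sdvd s")
        case True
        then obtain y where y: "y \<in> ob F 1" "x = restr F 1 n y"
          using on_bij[OF F n] x by (auto simp: bij_betw_def)
        then show ?thesis
          using h_restr[OF \<alpha> y(1) _ n] h_restr[OF \<beta> y(1) _ n] eq by simp
      next
        case False
        then show ?thesis
          using off_singleton[OF G n] h_in[OF \<alpha> x n] h_in[OF \<beta> x n] by blast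
      qed
    qed
  next
    fix g assume "g \<in> (\<lambda>\<alpha>. \<alpha> 1) ` Hom PSh F G"
    then show "g \<in> ob F 1 \<rightarrow>\<^sub>E ob G 1"
      using hom_PiE[of _ U big_cell F G 1] by auto
  next
    fix g assume g: "g \<in> ob F 1 \<rightarrow>\<^sub>E ob G 1"
    \<comment> \<open>Over a divisor of \<open>s\<close> the element \<open>x\<close> comes from a
      unique \<open>t\<close> over 1, which fixes the value \<open>y\<close>; over other
      \<open>n\<close> there is a single candidate \<open>y\<close> and the condition is
      automatic.\<close>
    define R where "R n x y \<longleftrightarrow> y \<in> ob G n \<and> (\<forall>t\<in>ob F 1. restr F 1 n t = x \<longrightarrow> restr G 1 n (g t) = y)" for n x y
    have Rex: "\<exists>y. R n x y" if n: "n > 0" and x: "x \<in> ob F n" for n x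
    proof (cases "snat n sdvd s")
      case True
      then obtain t where t: "t \<in> ob F 1" "x = restr F 1 n t"
        using on_bij[OF F n] x by (auto simp: bij_betw_def)
      have "t' = t" if "t' \<in> ob F 1" "restr F 1 n t' = x" for t'
        using on_bij[OF F n True] t that by (auto simp: bij_betw_def inj_on_def)
      then have "R n x (restr G 1 n (g t))"
        unfolding R_def using p_in[OF G' _ _ n, of "g t" 1] g t(1) by auto
      then show ?thesis by blast
    next
      case False
      then obtain y where y: "y \<in> ob G n" "\<And>y'. y' \<in> ob G n \<Longrightarrow> y' = y"
        using off_singleton[OF G n] by blast
      have "restr G 1 n (g t) = y" if t: "t \<in> ob F 1" for t
      proof -
        have "g t \<in> ob G 1" using g t by auto
        then show ?thesis
          using y(2)[OF p_in[OF G' _ _ n]] by simp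
      qed
      then have "R n x y"
        unfolding R_def using y(1) by simp
      then show ?thesis by blast
    qed
    have Runi: "y = y'" if n: "n > 0" and x: "x \<in> ob F n" and R: "R n x y" "R n x y'" for n x y y'
    proof (cases "snat n sdvd s")
      case True
      then obtain t where t: "t \<in> ob F 1" "x = restr F 1 n t"
        using on_bij[OF F n] x by (auto simp: bij_betw_def)
      then show ?thesis
        using R unfolding R_def by auto
    next
      case False
      then show ?thesis
        using off_singleton[OF G n] R unfolding R_def by blast
    qed
    define k where "k n x = (SOME y. R n x y)" for n x
    have k: "R n x (k n x)" if "n > 0" "x \<in> ob F n" for n x
      unfolding k_def by (rule someI_ex[OF Rex[OF that]])
    let ?k = "\<lambda>n\<in>{0<..}. \<lambda>x\<in>ob F n. k n x"
    have kh: "?k \<in> Hom PSh F G"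
    proof (rule h_intro[OF _ _ F'])
      show "k n x \<in> ob G n" if "n > 0" "x \<in> ob F n" for n x
        using k[OF that] by (simp add: R_def)
      fix n m x assume *: "n > 0" "m > 0" "n dvd m" "x \<in> ob F n" "restr F n m x \<in> ob F m"
      have yG: "k n x \<in> ob G n"
        using k[OF *(1,4)] by (simp add: R_def)
      have "R m (restr F n m x) (restr G n m (k n x))"
        unfolding R_def
      proof (intro conjI ballI impI)
        show rG: "restr G n m (k n x) \<in> ob G m"
          by (rule p_in[OF G' yG *(1-3)])
        fix t assume t: "t \<in> ob F 1" "restr F 1 m t = restr F n m x"
        have gt: "g t \<in> ob G 1" using g t by auto
        show "restr G 1 m (g t) = restr G n m (k n x)"
        proof (cases "snat m sdvd s")
          case True
          then have ns: "snat n sdvd s"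
            using snat_sdvd_trans *(2,3) by blast
          then obtain t' where t': "t' \<in> ob F 1" "x = restr F 1 n t'"
            using on_bij[OF F *(1)] *(4) by (auto simp: bij_betw_def)
          have "restr F 1 m t = restr F 1 m t'"
            using t t' p_restr[OF F' t'(1) _ *(1,2) _ *(3)] by simp
          then have "t = t'"
            using on_bij[OF F *(2) True] t t' by (auto simp: bij_betw_def inj_on_def)
          then have "restr G 1 n (g t) = k n x"
            using k[OF *(1,4)] t t' unfolding R_def by simp
          then show ?thesis
            using p_restr[OF G' gt _ *(1,2) _ *(3)] by simp
        next
          case False
          then show ?thesis
            using off_singleton[OF G *(2)] rG p_in[OF G' gt _ *(2)] by auto
        qed
      qed
      then show "k m (restr F n m x) = restr G n m (k n x)"
        using Runi[OF *(2,5)] k[OF *(2,5)] by blast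
    qed
    have k1: "?k 1 = g"
    proof (rule PiE_ext[OF _ g])
      show "?k 1 \<in> ob F 1 \<rightarrow>\<^sub>E ob G 1"
        using hom_PiE[OF kh, of 1] by simp
      fix t assume t: "t \<in> ob F 1"
      then have "restr G 1 1 (g t) = k 1 t"
        using k[of 1 t] p_id[OF F' t] unfolding R_def by simp
      then show "?k 1 t = g t"
        using t p_id[OF G', of "g t" 1] g by auto
    qed
    show "g \<in> (\<lambda>\<alpha>. \<alpha> 1) ` Hom PSh F G"
      using imageI[OF kh, of "\<lambda>\<alpha>. \<alpha> 1"] by (simp only: k1)
  qed
  then show "bij_betw (ar ev F G) (Hom Sh F G) (Hom (set_cat U) (ob ev F) (ob ev G))"
    by (simp add: ev_def set_cat_def)
qed

text \<open>The skyscraper at \<open>s\<close>. Off the divisors of \<open>s\<close> the value has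
  to be a singleton, by \<open>off_singleton\<close>, not the empty set.\<close>

definition sky :: "'u set \<Rightarrow> (nat, 'u) presheaf" where
  "sky X = \<lparr>ob = \<lambda>n. if snat n sdvd s then X else {undefined},
     ar = \<lambda>n m _. \<lambda>x\<in>(if snat n sdvd s then X else {undefined}). if snat m sdvd s then x else undefined\<rparr>"

lemma sky_sheaf:
  assumes X: "X \<in> U"
  shows "sky X \<in> Obj Sh"
  unfolding Obj_sheaves
proof
  have ob: "ob (sky X) n = (if snat n sdvd s then X else {undefined})" for n
    by (simp add: sky_def)
  have re: "restr (sky X) n m x = (if snat m sdvd s then x else undefined)" if "x \<in> ob (sky X) n" for n m x
    using that by (simp add: sky_def restr_def)
  have down: "snat n sdvd s" if "n dvd m" "m > 0" "snat m sdvd s" for n m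
    using snat_sdvd_trans that by blast
  show "sky X \<in> Obj PSh"
    unfolding presheaf_iff[OF bc]
  proof (intro conjI ballI allI impI)
    show "ob (sky X) n \<in> U" for n
      using X universe_singleton[OF U] by (simp add: ob)
    show "restr (sky X) n m \<in> ob (sky X) n \<rightarrow>\<^sub>E ob (sky X) m" if "arrow_to big_cell m n" for n m
      using that down[of n m] by (auto simp: sky_def restr_def arrow_to_big_cell)
    show "restr (sky X) n n x = x" if "x \<in> ob (sky X) n" for n x
      using that by (auto simp: re ob split: if_splits)
    show "restr (sky X) b c (restr (sky X) a b x) = restr (sky X) a c x"
      if "arrow_to big_cell b a" "arrow_to big_cell c b" "x \<in> ob (sky X) a" for a b c x
    proof -
      have "restr (sky X) a b x \<in> ob (sky X) b"
        using that down[of a b] by (auto simp: re ob arrow_to_big_cell split: if_splits)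
      then show ?thesis
        using that down[of b c] by (auto simp: re arrow_to_big_cell)
    qed
  qed
  show "is_sheaf big_cell (K_top {s}) (sky X)"
    unfolding is_sheaf_def
  proof (intro ballI allI impI)
    fix n L x assume n: "n \<in> Obj big_cell" and L: "L \<in> K_top {s} n" and x: "matching_family big_cell (sky X) L x"
    have sL: "is_sieve big_cell n L"
      using L by (simp add: K_top_iff)
    have xo: "x d \<in> ob (sky X) d" if "d \<in> L" for d
      using x that unfolding matching_family_def by blast
    have xr: "restr (sky X) d e (x d) = x e" if "d \<in> L" "e > 0" "d dvd e" for d e
      using x that sieve_big_cellD(1)[OF sL that(1)] unfolding matching_family_def by (auto simp: arrow_to_big_cell)
    show "\<exists>!y. y \<in> ob (sky X) n \<and> (\<forall>d\<in>L. restr (sky X) n d y = x d)"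
    proof (cases "snat n sdvd s")
      case True
      then obtain m where m: "m \<in> L" "snat m sdvd s"
        using K_topD[OF L] by auto
      note m0 = sieve_big_cellD(1)[OF sL m(1)]
      have xm: "x m \<in> ob (sky X) n"
        using xo[OF m(1)] m True by (simp add: ob)
      have "restr (sky X) n d (x m) = x d" if d: "d \<in> L" for d
      proof (cases "snat d sdvd s")
        case ds: True
        have d0: "d > 0" by (rule sieve_big_cellD(1)[OF sL d])
        have l: "snat (lcm m d) sdvd s" "lcm m d > 0"
          using m m0 d0 ds snat_lcm_sdvd by (auto simp: lcm_pos_nat)
        have "x m = x (lcm m d)" "x d = x (lcm m d)"
          using xr[OF m(1) l(2)] xr[OF d l(2)] re[OF xo[OF m(1)], of "lcm m d"] re[OF xo[OF d], of "lcm m d"] l by auto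
        then show ?thesis
          using re[OF xm, of d] ds by simp
      next
        case False
        then show ?thesis
          using re[OF xm, of d] xo[OF d] by (simp add: ob)
      qed
      moreover have "y = x m" if "y \<in> ob (sky X) n" "restr (sky X) n m y = x m" for y
        using that re[OF that(1), of m] m by simp
      ultimately show ?thesis
        using xm m(1) by blast
    next
      case False
      have "restr (sky X) n d undefined = x d" if d: "d \<in> L" for d
        using xo[OF d] re[of undefined n d] False down[OF sieve_big_cellD(3,1)[OF sL d]] by (auto simp: ob split: if_splits)
      then show ?thesis
        using False by (auto simp: ob)
    qed
  qed
qed

lemma ev_essentially_surjective:
  assumes "X \<in> Obj (set_cat U)"
  shows "\<exists>F\<in>Obj Sh. \<exists>f. is_iso (set_cat U) X (ob ev F) f"
proof (intro bexI exI)
  have "ob ev (sky X) = X"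
    by (simp add: ev_def sky_def snat_1_dvd)
  then show "is_iso (set_cat U) X (ob ev (sky X)) (\<lambda>x\<in>X. x)"
    by (auto simp: is_iso_set_cat bij_betw_def inj_on_def)
  show "sky X \<in> Obj Sh"
    using assms by (intro sky_sheaf) (simp add: set_cat_def)
qed

text \<open>Through the bijection \<open>on_bij\<close>, the unit at a divisor \<open>n\<close> of
  \<open>s\<close> becomes a map from sections over \<open>n\<close> to global sections of the
  sheafification. Local surjectivity of the unit at 1 then says that every global section is a germ,
  and local injectivity says that equal germs agree over some multiple dividing
  \<open>s\<close>.\<close>

lemma sheafification_germs:
  assumes a: "sheafification a \<eta>"
  shows "\<exists>\<gamma>. (\<forall>P\<in>Obj PSh. germ_cocone s P (ob (ob a P) 1) (\<gamma> P)) \<and>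
    (\<forall>P\<in>Obj PSh. \<forall>Q\<in>Obj PSh. \<forall>\<alpha>\<in>Hom PSh P Q. \<forall>n>0. snat n sdvd s \<longrightarrow>
      compose (ob P n) (ar a P Q \<alpha> 1) (\<gamma> P n) = compose (ob P n) (\<gamma> Q n) (\<alpha> n))"
proof -
  have af: "is_functor PSh Sh a"
    using a by (simp add: sheafification_def adjoint_def)
  have \<eta>: "local_iso P (ob a P) (\<eta> P)" if "P \<in> Obj PSh" for P
    using a that by (simp add: sheafification_def)
  have nat: "ar a P Q f n (\<eta> P n t) = \<eta> Q n (f n t)"
    if "P \<in> Obj PSh" "Q \<in> Obj PSh" "f \<in> Hom PSh P Q" "n > 0" "t \<in> ob P n" for P Q f n t
    using a that by (simp add: sheafification_def)
  have aS: "ob a P \<in> Obj Sh" if "P \<in> Obj PSh" for P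
    using fun_ob[OF af that] by auto
  note aP = Sh_PSh[OF aS]
  have \<eta>h: "\<eta> P \<in> Hom PSh P (ob a P)" if "P \<in> Obj PSh" for P
    using local_isoD(2)[OF \<eta>[OF that]] .
  have bij: "bij_betw (restr (ob a P) 1 n) (ob (ob a P) 1) (ob (ob a P) n)" if "P \<in> Obj PSh" "n > 0" "snat n sdvd s" for P n
    by (rule on_bij[OF aS[OF that(1)] that(2,3)])
  define \<gamma> where "\<gamma> P n = (\<lambda>x\<in>ob P n. inv_into (ob (ob a P) 1) (restr (ob a P) 1 n) (\<eta> P n x))" for P n
  have \<gamma>: "\<gamma> P n x \<in> ob (ob a P) 1" "restr (ob a P) 1 n (\<gamma> P n x) = \<eta> P n x"
    if "P \<in> Obj PSh" "n > 0" "snat n sdvd s" "x \<in> ob P n" for P n x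
    using bij[OF that(1-3)] h_in[OF \<eta>h[OF that(1)] that(4,2)] that(4)
    by (auto simp: \<gamma>_def bij_betw_def inv_into_into f_inv_into_f)
  have \<gamma>I: "z = \<gamma> P n x"
    if "P \<in> Obj PSh" "n > 0" "snat n sdvd s" "x \<in> ob P n" "z \<in> ob (ob a P) 1" "restr (ob a P) 1 n z = \<eta> P n x" for P n x z
    using bij[OF that(1-3)] \<gamma>[OF that(1-4)] that(5,6) by (auto simp: bij_betw_def inj_on_def)
  have co: "stalk_cocone s P (ob (ob a P) 1) (\<gamma> P)" if P: "P \<in> Obj PSh" for P
    unfolding stalk_cocone_def
  proof (intro conjI allI impI ballI)
    show "\<gamma> P n \<in> ob P n \<rightarrow>\<^sub>E ob (ob a P) 1" if "n > 0" "snat n sdvd s" for n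
      using \<gamma>(1)[OF P that] by (auto simp: \<gamma>_def)
    fix n m x assume *: "n > 0" "m > 0" "n dvd m" "snat m sdvd s" "x \<in> ob P n"
    have ns: "snat n sdvd s"
      using snat_sdvd_trans[OF *(3,2,4)] .
    have "restr (ob a P) 1 m (\<gamma> P n x) = \<eta> P m (restr P n m x)"
      using p_restr[OF aP[OF P] \<gamma>(1)[OF P *(1) ns *(5)] _ *(1,2) _ *(3)] \<gamma>(2)[OF P *(1) ns *(5)]
        h_restr[OF \<eta>h[OF P] *(5,1-3)] by simp
    then show "\<gamma> P m (restr P n m x) = \<gamma> P n x"
      using \<gamma>I[OF P *(2,4) p_in[OF P *(5,1-3)] \<gamma>(1)[OF P *(1) ns *(5)]] by simp
  qed
  have surj: "\<exists>n>0. snat n sdvd s \<and> (\<exists>x\<in>ob P n. z = \<gamma> P n x)" if P: "P \<in> Obj PSh" and z: "z \<in> ob (ob a P) 1" for P z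
  proof -
    obtain n where n: "n > 0" "snat n sdvd s" and "\<exists>x\<in>ob P n. restr (ob a P) 1 n z = \<eta> P n x"
      using local_isoD(4)[OF \<eta>[OF P] _ z] snat_1_dvd by (auto simp: locally_iff)
    then obtain x where "x \<in> ob P n" "restr (ob a P) 1 n z = \<eta> P n x"
      by blast
    then show "\<exists>n>0. snat n sdvd s \<and> (\<exists>x\<in>ob P n. z = \<gamma> P n x)"
      using \<gamma>I[OF P n _ z] n by blast
  qed
  have inj: "\<exists>k>0. n dvd k \<and> m dvd k \<and> snat k sdvd s \<and> restr P n k x = restr P m k y"
    if P: "P \<in> Obj PSh" and *: "n > 0" "m > 0" "snat n sdvd s" "snat m sdvd s" "x \<in> ob P n" "y \<in> ob P m" "\<gamma> P n x = \<gamma> P m y"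
    for P n m x y
  proof -
    let ?k = "lcm n m"
    have k: "?k > 0" "snat ?k sdvd s" "n dvd ?k" "m dvd ?k"
      using * snat_lcm_sdvd by (auto simp: lcm_pos_nat)
    have xk: "restr P n ?k x \<in> ob P ?k" "restr P m ?k y \<in> ob P ?k"
      using p_in[OF P *(5,1) k(1,3)] p_in[OF P *(6,2) k(1,4)] .
    have "\<eta> P ?k (restr P n ?k x) = \<eta> P ?k (restr P m ?k y)"
      using h_restr[OF \<eta>h[OF P] *(5,1) k(1,3)] h_restr[OF \<eta>h[OF P] *(6,2) k(1,4)]
        p_restr[OF aP[OF P] \<gamma>(1)[OF P *(1,3,5)] _ *(1) k(1) _ k(3)] \<gamma>(2)[OF P *(1,3,5)]
        p_restr[OF aP[OF P] \<gamma>(1)[OF P *(2,4,6)] _ *(2) k(1) _ k(4)] \<gamma>(2)[OF P *(2,4,6)] *(7) by simp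
    then have "locally ?k (\<lambda>l. restr P ?k l (restr P n ?k x) = restr P ?k l (restr P m ?k y))"
      by (rule local_isoD(3)[OF \<eta>[OF P] k(1) xk])
    then obtain l where l: "l > 0" "?k dvd l" "snat l sdvd s"
      and eq: "restr P ?k l (restr P n ?k x) = restr P ?k l (restr P m ?k y)"
      using k(2) unfolding locally_iff by blast
    have "restr P n l x = restr P m l y"
      using eq p_restr[OF P *(5,1) k(1) l(1) k(3) l(2)] p_restr[OF P *(6,2) k(1) l(1) k(4) l(2)] by simp
    then show "\<exists>k>0. n dvd k \<and> m dvd k \<and> snat k sdvd s \<and> restr P n k x = restr P m k y"
      using l dvd_trans[OF k(3) l(2)] dvd_trans[OF k(4) l(2)] by blast
  qed
  have sq: "compose (ob P n) (ar a P Q \<alpha> 1) (\<gamma> P n) = compose (ob P n) (\<gamma> Q n) (\<alpha> n)"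
    if P: "P \<in> Obj PSh" and Q: "Q \<in> Obj PSh" and \<alpha>: "\<alpha> \<in> Hom PSh P Q" and n: "n > 0" "snat n sdvd s" for P Q \<alpha> n
    unfolding compose_def
  proof (rule restrict_ext)
    fix x assume x: "x \<in> ob P n"
    have aa: "ar a P Q \<alpha> \<in> Hom PSh (ob a P) (ob a Q)"
      using fun_ar[OF af P Q \<alpha>] by simp
    have "restr (ob a Q) 1 n (ar a P Q \<alpha> 1 (\<gamma> P n x)) = \<eta> Q n (\<alpha> n x)"
      using h_restr[OF aa \<gamma>(1)[OF P n x] _ n(1)] \<gamma>(2)[OF P n x] nat[OF P Q \<alpha> n(1) x] by simp
    then show "ar a P Q \<alpha> 1 (\<gamma> P n x) = \<gamma> Q n (\<alpha> n x)"
      using \<gamma>I[OF Q n h_in[OF \<alpha> x n(1)] h_in[OF aa \<gamma>(1)[OF P n x]]] by simp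
  qed
  show ?thesis
    unfolding germ_cocone_def by (intro exI[of _ \<gamma>] conjI ballI allI impI co surj inj sq)
qed

text \<open>\<open>E\<close> is left open so that it can be a category of sheaves for another
  topology: stalks of sheaves are stalks of the underlying presheaves.\<close>

lemma stalk_of_sheafification:
  assumes a: "sheafification a \<eta>" and E: "Obj E \<subseteq> Obj PSh" "Hom E = Hom PSh"
    and Pf: "is_functor E (set_cat U) (comp_fctr ev a)"
  shows "is_stalk_functor U E s (comp_fctr ev a)"
proof -
  obtain \<gamma> where germs: "\<And>P. P \<in> Obj PSh \<Longrightarrow> germ_cocone s P (ob (ob a P) 1) (\<gamma> P)"
    and sq: "\<And>P Q \<alpha> n. P \<in> Obj PSh \<Longrightarrow> Q \<in> Obj PSh \<Longrightarrow> \<alpha> \<in> Hom PSh P Q \<Longrightarrow> n > 0 \<Longrightarrow> snat n sdvd s \<Longrightarrow>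
      compose (ob P n) (ar a P Q \<alpha> 1) (\<gamma> P n) = compose (ob P n) (\<gamma> Q n) (\<alpha> n)"
    using sheafification_germs[OF a] by metis
  have aP: "ob a P \<in> Obj PSh" if "P \<in> Obj PSh" for P
    using a fun_ob[OF _ that, of Sh a] Sh_PSh by (simp add: sheafification_def adjoint_def)
  have col: "colimit_cocone (full_subcat (op_cat big_cell) (\<lambda>n. snat n sdvd s)) (set_cat U) P (ob (ob a P) 1) (\<gamma> P)"
    if P: "P \<in> Obj PSh" for P
    by (rule stalk_of_germs[OF P _ germs[OF P]]) (use presheaf_ob[OF bc aP[OF P], of 1] in simp)
  show ?thesis
    unfolding is_stalk_functor_def
  proof (intro conjI Pf exI[of _ \<gamma>] ballI allI impI)
    show "colimit_cocone (full_subcat (op_cat big_cell) (\<lambda>n. snat n sdvd s)) (set_cat U) F (ob (comp_fctr ev a) F) (\<gamma> F)"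
      if "F \<in> Obj E" for F
      using col[of F] E(1) that by (auto simp: ev_def)
    show "compose (ob F n) (ar (comp_fctr ev a) F G \<alpha>) (\<gamma> F n) = compose (ob F n) (\<gamma> G n) (\<alpha> n)"
      if "F \<in> Obj E" "G \<in> Obj E" "\<alpha> \<in> Hom E F G" "n > 0" "snat n sdvd s" for F G \<alpha> n
      using sq[of F G \<alpha> n] E that by (auto simp: ev_def)
  qed
qed

text \<open>An arbitrary colimit maps to the concrete one given by sheafification for
  \<open>K_top {s}\<close>, compatibly with the cocones; equality of germs is carried along and can
  be analysed there.\<close>

lemma germs_eventually_equal:
  assumes F: "F \<in> Obj PSh"
    and col: "colimit_cocone (full_subcat (op_cat big_cell) (\<lambda>n. snat n sdvd s)) (set_cat U) F X \<gamma>"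
    and n: "n > 0" "snat n sdvd s" "x \<in> ob F n" and m: "m > 0" "snat m sdvd s" "y \<in> ob F m" and eq: "\<gamma> n x = \<gamma> m y"
  shows "\<exists>k>0. n dvd k \<and> m dvd k \<and> snat k sdvd s \<and> restr F n k x = restr F m k y"
proof -
  obtain a \<eta> where a: "sheafification a \<eta>"
    using sheafification_functor by blast
  then have "ob a F \<in> Obj PSh"
    using fun_ob[OF _ F, of Sh a] Sh_PSh by (simp add: sheafification_def adjoint_def)
  then have aU: "ob (ob a F) 1 \<in> U"
    using presheaf_ob[OF bc, of "ob a F" U 1] by simp
  obtain \<gamma>' where germs: "germ_cocone s F (ob (ob a F) 1) (\<gamma>' F)"
    using sheafification_germs[OF a] F by blast
  have "\<exists>!f. f \<in> X \<rightarrow>\<^sub>E ob (ob a F) 1 \<and> (\<forall>n>0. snat n sdvd s \<longrightarrow> (\<forall>x\<in>ob F n. f (\<gamma> n x) = \<gamma>' F n x))"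
    using col[unfolded colimit_stalk_iff[OF F]] germ_coconeD(1)[OF germs] aU by blast
  then obtain f where f: "\<forall>n>0. snat n sdvd s \<longrightarrow> (\<forall>x\<in>ob F n. f (\<gamma> n x) = \<gamma>' F n x)"
    by (elim ex1E conjE)
  have "\<gamma>' F n x = \<gamma>' F m y"
    using f[rule_format, OF n] f[rule_format, OF m] eq by simp
  then show ?thesis
    by (rule germ_coconeD(3)[OF germs n(1) m(1) n(2) m(2) n(3) m(3)])
qed

end

text \<open>The direct image sends a set to its skyscraper, which is a \<open>J\<close>-sheaf by the
  hypothesis on \<open>s\<close>. The inverse image is \<open>pt.ev\<close> after sheafification for
  \<open>K_top {s}\<close>; it is exact as a composite of the inclusion into presheaves,
  sheafification and an equivalence.\<close>

lemma (in big_cell_site) stalk_point_exists: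
  assumes s: "\<And>n L. L \<in> J n \<Longrightarrow> snat n sdvd s \<Longrightarrow> \<exists>m\<in>L. snat m sdvd s"
  shows "point_at U Sh s \<noteq> {}"
proof -
  interpret pt: supernatural_point U s
    by unfold_locales (rule U)
  obtain a \<eta> where a: "pt.sheafification a \<eta>"
    using pt.sheafification_functor by blast
  have adj: "adjoint PSh pt.Sh a id_fctr"
    using a by (simp add: pt.sheafification_def)
  then have af: "is_functor PSh pt.Sh a"
    by (simp add: adjoint_def)
  \<comment> \<open>The hypothesis says that every \<open>J\<close>-cover is a cover for
    \<open>K_top {s}\<close>, so sheaves for \<open>K_top {s}\<close> are in particular
    \<open>J\<close>-sheaves.\<close>
  have "L \<in> K_top {s} n" if "L \<in> J n" for n L
    using mem_K_top[OF J_empty[OF that] J_sieve[OF that], of "{s}"] s[OF that] by simp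
  then have "Obj pt.Sh \<subseteq> Obj Sh"
    unfolding Obj_sheaves subset_iff is_sheaf_def by blast
  then have R': "is_functor pt.Sh Sh id_fctr"
    by (auto simp: is_functor_def)
  note set = is_category_set_cat[of U]
  obtain sk where sk: "adjoint pt.Sh (set_cat U) pt.ev sk" "adjoint (set_cat U) pt.Sh sk pt.ev"
    by (rule quasi_inverse[OF set pt.cat_Sh pt.ev_functor pt.ev_fully_faithful pt.ev_essentially_surjective])
  have "adjoint Sh pt.Sh (comp_fctr a id_fctr) id_fctr"
    by (rule adjoint_restrict[OF cat_Sh cat_PSh pt.cat_Sh inclusion_functor inclusion_fully_faithful R' adj]) simp
  then have A: "adjoint Sh pt.Sh a id_fctr"
    by simp
  define p where "p = \<lparr>inv_im = comp_fctr pt.ev a, dir_im = comp_fctr id_fctr sk\<rparr>"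
  have 1: "adjoint Sh (set_cat U) (inv_im p) (dir_im p)"
    unfolding p_def geom.simps by (rule adjoint_comp[OF cat_Sh pt.cat_Sh set A sk(1)])
  obtain b \<theta> where b: "sheafification b \<theta>"
    using sheafification_functor by blast
  have "left_exact Sh PSh id_fctr"
    using b by (intro right_adjoint_left_exact[OF cat_PSh cat_Sh, of b]) (simp add: sheafification_def)
  from left_exact_comp[OF inclusion_functor this pt.sheafification_left_exact[OF a]]
  have "left_exact Sh pt.Sh a"
    by simp
  moreover have "is_functor Sh pt.Sh a"
    using A by (simp add: adjoint_def)
  ultimately have 2: "left_exact Sh (set_cat U) (inv_im p)"
    unfolding p_def geom.simps
    using left_exact_comp right_adjoint_left_exact[OF set pt.cat_Sh sk(2)] by blast
  have "is_functor Sh (set_cat U) (inv_im p)"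
    using 1 by (simp add: adjoint_def)
  then have "is_stalk_functor U Sh s (inv_im p)"
    unfolding p_def geom.simps by (intro pt.stalk_of_sheafification[OF a]) (auto simp: Obj_sheaves)
  then have "p \<in> point_at U Sh s"
    using 1 2 by (simp add: point_at_def points_def geometric_morphism_def)
  then show ?thesis
    by blast
qed

subsection \<open>Supernatural numbers and their natural divisors\<close>

lemma snat_prime_power: "prime p \<Longrightarrow> snat (p ^ k) sdvd s \<longleftrightarrow> enat k \<le> expo s p"
proof -
  assume p: "prime p"
  have "expo (snat (p ^ k)) q = (if q = p then enat k else 0)" for q
    using p by (auto simp: snat.rep_eq zero_enat_def multiplicity_distinct_prime_power)
  then show ?thesis
    unfolding sdvd_def by auto
qed

lemma expo_not_prime: "\<not> prime p \<Longrightarrow> expo s p = 0"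
  using expo[of s] by simp

lemma enat_le_iff: "a \<le> b \<longleftrightarrow> (\<forall>k. enat k \<le> a \<longrightarrow> enat k \<le> b)"
proof (intro iffI allI impI)
  assume *: "\<forall>k. enat k \<le> a \<longrightarrow> enat k \<le> b"
  show "a \<le> b"
  proof (cases a)
    case (enat n)
    then show ?thesis using * by auto
  next
    case infinity
    then have "enat k \<le> b" for k using * by simp
    then have "b = \<infinity>"
      by (metis enat_ord_simps(1) not_less_eq_eq order_refl not_enat_eq)
    then show ?thesis by simp
  qed
qed (use order_trans in blast)

text \<open>Prime powers suffice: \<open>p ^ k\<close> divides \<open>s\<close> exactly when
  \<open>k\<close> is at most the exponent at \<open>p\<close>, and an element of
  \<open>enat\<close>, infinity included, is determined by the finite numbers below it.\<close>

lemma sdvd_iff_divisors: "s sdvd t \<longleftrightarrow> (\<forall>n>0. snat n sdvd s \<longrightarrow> snat n sdvd t)"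
proof
  assume *: "\<forall>n>0. snat n sdvd s \<longrightarrow> snat n sdvd t"
  show "s sdvd t"
    unfolding sdvd_def
  proof
    fix p
    show "expo s p \<le> expo t p"
    proof (cases "prime p")
      case True
      have "p ^ k > 0" for k
        using True prime_gt_0_nat by simp
      then show ?thesis
        unfolding enat_le_iff[of "expo s p"] using * snat_prime_power[OF True] by blast
    qed (simp add: expo_not_prime)
  qed
qed (blast intro: sdvd_trans)

lemma supernat_eqI:
  assumes "\<And>n. n > 0 \<Longrightarrow> snat n sdvd s \<longleftrightarrow> snat n sdvd t"
  shows "s = t"
proof -
  have "s sdvd t" "t sdvd s"
    by (rule sdvd_iff_divisors[THEN iffD2], simp add: assms)+
  then have "expo s = expo t"
    by (intro ext order_antisym) (simp_all add: sdvd_def)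
  then show ?thesis
    by (simp add: expo_inject)
qed

text \<open>The exponent at \<open>p\<close> is the supremum of the multiplicities of
  \<open>p\<close> in members of \<open>D\<close>, infinite when they are unbounded. If
  \<open>n\<close> divides the resulting number, each prime power exactly dividing \<open>n\<close>
  divides a member of \<open>D\<close> and so lies in \<open>D\<close>; closure under
  \<open>lcm\<close> then puts \<open>n\<close> in \<open>D\<close>.\<close>

lemma supernat_of_divisors:
  assumes D: "D \<subseteq> {0<..}" "1 \<in> D" and down: "\<And>m n. m \<in> D \<Longrightarrow> n dvd m \<Longrightarrow> n \<in> D"
    and lcm: "\<And>m n. m \<in> D \<Longrightarrow> n \<in> D \<Longrightarrow> lcm m n \<in> D"
  shows "\<exists>s. \<forall>n>0. snat n sdvd s \<longleftrightarrow> n \<in> D"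
proof -
  define e where "e p = (if prime p then SUP n\<in>D. enat (multiplicity p n) else 0)" for p :: nat
  define s where "s = Abs_supernat e"
  have s: "expo s = e"
    unfolding s_def by (rule Abs_supernat_inverse) (simp add: e_def)
  have "n \<in> D" if n: "n > 0" and ns: "snat n sdvd s" for n
  proof -
    have pp: "p ^ multiplicity p n \<in> D" if p: "prime p" for p
    proof (cases "multiplicity p n")
      case 0
      then show ?thesis using D(2) by simp
    next
      case (Suc k)
      have "enat (Suc k) \<le> (SUP m\<in>D. enat (multiplicity p m))"
        using ns[unfolded sdvd_def, rule_format, of p] p Suc by (simp add: s snat.rep_eq e_def)
      \<comment> \<open>The supremum may be infinite and not attained; the strict bound passes to a
        member of \<open>D\<close>, whose multiplicity is then at least
        \<open>Suc k\<close>.\<close>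
      then have "enat k < (SUP m\<in>D. enat (multiplicity p m))"
        by (metis enat_ord_simps(2) lessI less_le_trans)
      then obtain m where m: "m \<in> D" "enat k < enat (multiplicity p m)"
        by (auto simp: less_SUP_iff)
      then have "p ^ Suc k dvd m"
        by (intro multiplicity_dvd') simp
      then show ?thesis
        using down[OF m(1)] Suc by simp
    qed
    have Lcm: "finite A \<Longrightarrow> A \<subseteq> D \<Longrightarrow> Lcm A \<in> D" for A
      by (induction A rule: finite_induct) (use D(2) lcm in auto)
    let ?A = "(\<lambda>p. p ^ multiplicity p n) ` prime_factors n"
    have L: "Lcm ?A \<in> D"
      by (rule Lcm) (use pp in auto)
    have "n dvd Lcm ?A"
    proof (rule multiplicity_le_imp_dvd)
      fix p :: nat assume p: "prime p"
      show "multiplicity p n \<le> multiplicity p (Lcm ?A)"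
      proof (cases "p \<in> prime_factors n")
        case True
        then have "p ^ multiplicity p n dvd Lcm ?A"
          by (intro dvd_Lcm) auto
        then show ?thesis
          using L D(1) p by (intro multiplicity_geI) (auto simp: not_prime_unit)
      next
        case False
        then have "\<not> p dvd n"
          using p n by (simp add: prime_factors_dvd)
        then show ?thesis
          by (simp add: not_dvd_imp_multiplicity_0)
      qed
    qed (use n in simp)
    then show ?thesis
      using down[OF L] by blast
  qed
  moreover have "snat n sdvd s" if "n \<in> D" for n
    unfolding sdvd_def s snat.rep_eq e_def using that by (auto intro: SUP_upper)
  ultimately show ?thesis
    by blast
qed

subsection \<open>Points of the topos of sheaves\<close>

lemma set_cat_hom: "Hom (set_cat U) A B = A \<rightarrow>\<^sub>E B"
  by (simp add: set_cat_def)

context big_cell_site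
begin

text \<open>The largest set \<open>S\<close> such that every \<open>J\<close>-cover is a
  \<open>K_top S\<close>-cover.\<close>

definition spec :: "supernat set" where
  "spec = {s. \<forall>n. \<forall>L\<in>J n. snat n sdvd s \<longrightarrow> (\<exists>m\<in>L. snat m sdvd s)}"

lemma u_yon: "n > 0 \<Longrightarrow> undefined \<in> ob (yon n) n"
  by (simp add: yon_self)

lemma yon_mem: "x \<in> ob (yon n) k \<longleftrightarrow> x = undefined \<and> locally k (\<lambda>l. l > 0 \<and> n dvd l)"
  by (auto simp: yon_def ob_subterm clos_def)

lemma yon_sub: "n dvd m \<Longrightarrow> m > 0 \<Longrightarrow> undefined \<in> ob (yon n) m"
  using dvd_pos_nat[of m n] unfolding yon_mem
  by (auto intro!: locally_here stableI intro: dvd_trans)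

definition hat :: "nat \<Rightarrow> (nat, 'u) presheaf \<Rightarrow> 'u \<Rightarrow> nat \<Rightarrow> 'u \<Rightarrow> 'u" where
  "hat n F x = (THE \<tau>. \<tau> \<in> Hom PSh (yon n) F \<and> \<tau> n undefined = x)"

lemma hat:
  assumes "F \<in> Obj Sh" "n > 0" "x \<in> ob F n"
  shows "hat n F x \<in> Hom PSh (yon n) F" "hat n F x n undefined = x"
  using theI'[OF yoneda[OF assms]] unfolding hat_def by auto

lemma yon_hom_eqI:
  assumes F: "F \<in> Obj Sh" and n: "n > 0" and h: "\<tau> \<in> Hom PSh (yon n) F" "\<sigma> \<in> Hom PSh (yon n) F"
    and eq: "\<tau> n undefined = \<sigma> n undefined"
  shows "\<tau> = \<sigma>"
  using yoneda[OF F n h_in[OF h(1) u_yon[OF n] n]] h eq by metis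

lemma hat_cmp:
  assumes F: "F \<in> Obj Sh" and G: "G \<in> Obj Sh" and n: "n > 0" and x: "x \<in> ob F n" and \<alpha>: "\<alpha> \<in> Hom PSh F G"
  shows "Cmp PSh (yon n) F G \<alpha> (hat n F x) = hat n G (\<alpha> n x)"
proof (rule yon_hom_eqI[OF G n])
  note y = Sh_PSh[OF yon_sheaf]
  show "Cmp PSh (yon n) F G \<alpha> (hat n F x) \<in> Hom PSh (yon n) G"
    by (rule h_cmp[OF y Sh_PSh[OF F] Sh_PSh[OF G] hat(1)[OF F n x] \<alpha>])
  show "hat n G (\<alpha> n x) \<in> Hom PSh (yon n) G"
    by (rule hat(1)[OF G n h_in[OF \<alpha> x n]])
  show "Cmp PSh (yon n) F G \<alpha> (hat n F x) n undefined = hat n G (\<alpha> n x) n undefined"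
    using h_cmp_apply[OF n u_yon[OF n], of F G \<alpha> "hat n F x"] hat(2)[OF F n x] hat(2)[OF G n h_in[OF \<alpha> x n]] by simp
qed

abbreviation yarr :: "nat \<Rightarrow> nat \<Rightarrow> nat \<Rightarrow> 'u \<Rightarrow> 'u" where
  "yarr m n \<equiv> hat m (yon n) undefined"

lemma yarr: "n dvd m \<Longrightarrow> m > 0 \<Longrightarrow> yarr m n \<in> Hom PSh (yon m) (yon n)"
  by (rule hat(1)[OF yon_sheaf _ yon_sub])

lemma hat_yarr:
  assumes F: "F \<in> Obj Sh" and x: "n > 0" "x \<in> ob F n" and m: "m > 0" "n dvd m" and \<tau>: "\<tau> \<in> Hom PSh (yon n) F"
  shows "Cmp PSh (yon m) (yon n) F \<tau> (yarr m n) m undefined = restr F n m (\<tau> n undefined)"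
proof -
  have "restr (yon n) n m undefined = undefined"
    using u_yon[OF x(1)] by (simp add: yon_def restr_subterm)
  then show ?thesis
    using h_cmp_apply[OF m(1) u_yon[OF m(1)], of "yon n" F \<tau> "yarr m n"] hat(2)[OF yon_sheaf m(1) yon_sub[OF m(2,1)]]
      h_restr[OF \<tau> u_yon[OF x(1)] x(1) m] by simp
qed

section \<open>Uniqueness and transport of stalk functors\<close>

lemma stalk_coneD:
  assumes P: "is_stalk_functor U Sh s P"
  obtains \<gamma> where "\<And>F. F \<in> Obj Sh \<Longrightarrow> colimit_cocone (full_subcat (op_cat big_cell) (\<lambda>n. snat n sdvd s)) (set_cat U) F (ob P F) (\<gamma> F)"
    "\<And>F G \<alpha> n x. F \<in> Obj Sh \<Longrightarrow> G \<in> Obj Sh \<Longrightarrow> \<alpha> \<in> Hom PSh F G \<Longrightarrow> n > 0 \<Longrightarrow> snat n sdvd s \<Longrightarrow> x \<in> ob F n \<Longrightarrow>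
      ar P F G \<alpha> (\<gamma> F n x) = \<gamma> G n (\<alpha> n x)"
proof -
  obtain \<gamma> where c: "\<And>F. F \<in> Obj Sh \<Longrightarrow> colimit_cocone (full_subcat (op_cat big_cell) (\<lambda>n. snat n sdvd s)) (set_cat U) F (ob P F) (\<gamma> F)"
    and n: "\<forall>F\<in>Obj Sh. \<forall>G\<in>Obj Sh. \<forall>\<alpha>\<in>Hom Sh F G. \<forall>n>0. snat n sdvd s \<longrightarrow>
      compose (ob F n) (ar P F G \<alpha>) (\<gamma> F n) = compose (ob F n) (\<gamma> G n) (\<alpha> n)"
    using P unfolding is_stalk_functor_def by blast
  have "ar P F G \<alpha> (\<gamma> F n x) = \<gamma> G n (\<alpha> n x)"
    if "F \<in> Obj Sh" "G \<in> Obj Sh" "\<alpha> \<in> Hom PSh F G" "n > 0" "snat n sdvd s" "x \<in> ob F n" for F G \<alpha> n x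
  proof -
    have "compose (ob F n) (ar P F G \<alpha>) (\<gamma> F n) = compose (ob F n) (\<gamma> G n) (\<alpha> n)"
      using n that by simp
    from fun_cong[OF this, of x] show ?thesis
      using that(6) by (simp add: compose_eq)
  qed
  from that[OF c this] show thesis .
qed

text \<open>Two colimits of the same diagrams are compared by mediating maps; the comparison is
  natural because every element of a stalk is a germ.\<close>

lemma stalk_isomorphic:
  assumes P: "is_stalk_functor U Sh s P" and Q: "is_stalk_functor U Sh s Q"
  shows "isomorphic_functors Sh (set_cat U) P Q"
proof -
  let ?D = "full_subcat (op_cat big_cell) (\<lambda>n. snat n sdvd s)"
  obtain \<gamma> where c: "\<And>F. F \<in> Obj Sh \<Longrightarrow> colimit_cocone ?D (set_cat U) F (ob P F) (\<gamma> F)"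
    and nat: "\<And>F G \<alpha> n x. F \<in> Obj Sh \<Longrightarrow> G \<in> Obj Sh \<Longrightarrow> \<alpha> \<in> Hom PSh F G \<Longrightarrow> n > 0 \<Longrightarrow> snat n sdvd s \<Longrightarrow> x \<in> ob F n \<Longrightarrow>
      ar P F G \<alpha> (\<gamma> F n x) = \<gamma> G n (\<alpha> n x)"
    using P by (rule stalk_coneD) blast
  obtain \<delta> where d: "\<And>F. F \<in> Obj Sh \<Longrightarrow> colimit_cocone ?D (set_cat U) F (ob Q F) (\<delta> F)"
    and nat': "\<And>F G \<alpha> n x. F \<in> Obj Sh \<Longrightarrow> G \<in> Obj Sh \<Longrightarrow> \<alpha> \<in> Hom PSh F G \<Longrightarrow> n > 0 \<Longrightarrow> snat n sdvd s \<Longrightarrow> x \<in> ob F n \<Longrightarrow>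
      ar Q F G \<alpha> (\<delta> F n x) = \<delta> G n (\<alpha> n x)"
    using Q by (rule stalk_coneD) blast
  have map: "\<exists>f. f \<in> X \<rightarrow>\<^sub>E Y \<and> (\<forall>n>0. snat n sdvd s \<longrightarrow> (\<forall>x\<in>ob F n. f (\<mu> n x) = \<nu> n x))"
    if "F \<in> Obj Sh" "colimit_cocone ?D (set_cat U) F X \<mu>" "colimit_cocone ?D (set_cat U) F Y \<nu>" for F X Y \<mu> \<nu>
  proof -
    have Y: "Y \<in> U" "stalk_cocone s F Y \<nu>"
      using that(3) unfolding colimit_stalk_iff[OF Sh_PSh[OF that(1)]] by simp_all
    have "\<exists>!f. f \<in> X \<rightarrow>\<^sub>E Y \<and> (\<forall>n>0. snat n sdvd s \<longrightarrow> (\<forall>x\<in>ob F n. f (\<mu> n x) = \<nu> n x))"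
      by (rule that(2)[unfolded colimit_stalk_iff[OF Sh_PSh[OF that(1)]], THEN conjunct2, THEN conjunct2, rule_format, OF Y])
    then show ?thesis
      by (rule ex1_implies_ex)
  qed
  have surj: "\<exists>n>0. snat n sdvd s \<and> (\<exists>x\<in>ob F n. z = \<mu> n x)"
    if "F \<in> Obj Sh" "colimit_cocone ?D (set_cat U) F X \<mu>" "z \<in> X" for F X z \<mu>
    by (rule stalk_jointly_surjective[OF U Sh_PSh[OF that(1)] that(2,3)])
  define \<theta> where "\<theta> F = (SOME f. f \<in> ob P F \<rightarrow>\<^sub>E ob Q F \<and> (\<forall>n>0. snat n sdvd s \<longrightarrow> (\<forall>x\<in>ob F n. f (\<gamma> F n x) = \<delta> F n x)))" for F
  have \<theta>: "\<theta> F \<in> ob P F \<rightarrow>\<^sub>E ob Q F" "\<And>n x. n > 0 \<Longrightarrow> snat n sdvd s \<Longrightarrow> x \<in> ob F n \<Longrightarrow> \<theta> F (\<gamma> F n x) = \<delta> F n x"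
    if F: "F \<in> Obj Sh" for F
  proof -
    have *: "\<theta> F \<in> ob P F \<rightarrow>\<^sub>E ob Q F \<and> (\<forall>n>0. snat n sdvd s \<longrightarrow> (\<forall>x\<in>ob F n. \<theta> F (\<gamma> F n x) = \<delta> F n x))"
      unfolding \<theta>_def by (rule someI_ex[OF map[OF F c[OF F] d[OF F]]])
    then show "\<theta> F \<in> ob P F \<rightarrow>\<^sub>E ob Q F" ..
    show "\<theta> F (\<gamma> F n x) = \<delta> F n x" if "n > 0" "snat n sdvd s" "x \<in> ob F n" for n x
      using * that by blast
  qed
  have bij: "bij_betw (\<theta> F) (ob P F) (ob Q F)" if F: "F \<in> Obj Sh" for F
  proof -
    obtain g where g: "g \<in> ob Q F \<rightarrow>\<^sub>E ob P F" "\<forall>n>0. snat n sdvd s \<longrightarrow> (\<forall>x\<in>ob F n. g (\<delta> F n x) = \<gamma> F n x)"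
      using map[OF F d[OF F] c[OF F]] by blast
    show ?thesis
    proof (rule bij_betw_byWitness[of _ g])
      show "\<forall>z\<in>ob P F. g (\<theta> F z) = z"
      proof
        fix z assume "z \<in> ob P F"
        then obtain n x where "n > 0" "snat n sdvd s" "x \<in> ob F n" "z = \<gamma> F n x"
          using surj[OF F c[OF F]] by blast
        then show "g (\<theta> F z) = z"
          using \<theta>(2)[OF F] g(2) by simp
      qed
      show "\<forall>z\<in>ob Q F. \<theta> F (g z) = z"
      proof
        fix z assume "z \<in> ob Q F"
        then obtain n x where "n > 0" "snat n sdvd s" "x \<in> ob F n" "z = \<delta> F n x"
          using surj[OF F d[OF F]] by blast
        then show "\<theta> F (g z) = z"
          using \<theta>(2)[OF F] g(2) by simp
      qed
    qed (use \<theta>(1)[OF F] g(1) in auto)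
  qed
  have Pf: "is_functor Sh (set_cat U) P" and Qf: "is_functor Sh (set_cat U) Q"
    using P Q by (auto simp: is_stalk_functor_def)
  have sq: "Cmp (set_cat U) (ob P F) (ob P G) (ob Q G) (\<theta> G) (ar P F G \<alpha>) = Cmp (set_cat U) (ob P F) (ob Q F) (ob Q G) (ar Q F G \<alpha>) (\<theta> F)"
    if F: "F \<in> Obj Sh" and G: "G \<in> Obj Sh" and \<alpha>: "\<alpha> \<in> Hom Sh F G" for F G \<alpha>
    unfolding set_cat_def cat.simps compose_def
  proof (rule restrict_ext)
    fix z assume z: "z \<in> ob P F"
    then obtain n x where x: "n > 0" "snat n sdvd s" "x \<in> ob F n" "z = \<gamma> F n x"
      using surj[OF F c[OF F]] by blast
    have \<alpha>': "\<alpha> \<in> Hom PSh F G" using \<alpha> by simp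
    have "\<theta> G (ar P F G \<alpha> z) = \<delta> G n (\<alpha> n x)"
      using nat[OF F G \<alpha>' x(1-3)] \<theta>(2)[OF G x(1,2) h_in[OF \<alpha>' x(3,1)]] x(4) by simp
    moreover have "ar Q F G \<alpha> (\<theta> F z) = \<delta> G n (\<alpha> n x)"
      using nat'[OF F G \<alpha>' x(1-3)] \<theta>(2)[OF F x(1-3)] x(4) by simp
    ultimately show "\<theta> G (ar P F G \<alpha> z) = ar Q F G \<alpha> (\<theta> F z)"
      by simp
  qed
  show ?thesis
    unfolding isomorphic_functors_def is_nat_trans_def
    by (rule exI[of _ "\<lambda>F\<in>Obj Sh. \<theta> F"])
      (use \<theta>(1) bij sq in \<open>simp add: is_iso_set_cat set_cat_hom\<close>)
qed

text \<open>The cocone is transported along the isomorphism. This closes \<open>point_at\<close>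
  under isomorphism, so that it is a whole isomorphism class of points.\<close>

lemma stalk_functor_transfer:
  assumes P: "is_stalk_functor U Sh s P" and Q: "is_functor Sh (set_cat U) Q"
    and iso: "isomorphic_functors Sh (set_cat U) P Q"
  shows "is_stalk_functor U Sh s Q"
proof -
  let ?D = "full_subcat (op_cat big_cell) (\<lambda>n. snat n sdvd s)"
  obtain \<gamma> where c: "\<And>F. F \<in> Obj Sh \<Longrightarrow> colimit_cocone ?D (set_cat U) F (ob P F) (\<gamma> F)"
    and nat: "\<And>F G \<alpha> n x. F \<in> Obj Sh \<Longrightarrow> G \<in> Obj Sh \<Longrightarrow> \<alpha> \<in> Hom PSh F G \<Longrightarrow> n > 0 \<Longrightarrow> snat n sdvd s \<Longrightarrow> x \<in> ob F n \<Longrightarrow>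
      ar P F G \<alpha> (\<gamma> F n x) = \<gamma> G n (\<alpha> n x)"
    using P by (rule stalk_coneD) blast
  obtain \<theta> where \<theta>: "is_nat_trans Sh (set_cat U) P Q \<theta>" "\<And>F. F \<in> Obj Sh \<Longrightarrow> is_iso (set_cat U) (ob P F) (ob Q F) (\<theta> F)"
    using iso by (auto simp: isomorphic_functors_def)
  have bij: "bij_betw (\<theta> F) (ob P F) (ob Q F)" and \<theta>h: "\<theta> F \<in> ob P F \<rightarrow>\<^sub>E ob Q F" if "F \<in> Obj Sh" for F
    using \<theta>(2)[OF that] by (auto simp: is_iso_set_cat)
  define \<delta> where "\<delta> F n = (\<lambda>x\<in>ob F n. \<theta> F (\<gamma> F n x))" for F n
  have col: "colimit_cocone ?D (set_cat U) F (ob Q F) (\<delta> F)" if F: "F \<in> Obj Sh" for F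
    unfolding colimit_stalk_iff[OF Sh_PSh[OF F]]
  proof (intro conjI ballI allI impI)
    have co: "stalk_cocone s F (ob P F) (\<gamma> F)"
      and uni: "\<And>Y \<rho>. Y \<in> U \<Longrightarrow> stalk_cocone s F Y \<rho> \<Longrightarrow>
        \<exists>!f. f \<in> ob P F \<rightarrow>\<^sub>E Y \<and> (\<forall>n>0. snat n sdvd s \<longrightarrow> (\<forall>x\<in>ob F n. f (\<gamma> F n x) = \<rho> n x))"
      using c[OF F] unfolding colimit_stalk_iff[OF Sh_PSh[OF F]] by blast+
    show "ob Q F \<in> U"
      using fun_ob[OF Q F] by (simp add: set_cat_def)
    show "stalk_cocone s F (ob Q F) (\<delta> F)"
      unfolding stalk_cocone_def
    proof (intro conjI allI impI ballI)
      show "\<delta> F n \<in> ob F n \<rightarrow>\<^sub>E ob Q F" if "n > 0" "snat n sdvd s" for n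
        using stalk_coconeD(2)[OF co that] \<theta>h[OF F] by (auto simp: \<delta>_def)
      show "\<delta> F m (restr F n m x) = \<delta> F n x" if "n > 0" "m > 0" "n dvd m" "snat m sdvd s" "x \<in> ob F n" for n m x
        using stalk_coconeD(3)[OF co that(2-5)] that p_in[OF Sh_PSh[OF F] that(5,1-3)] by (simp add: \<delta>_def)
    qed
    fix Y \<rho> assume Y: "Y \<in> U" "stalk_cocone s F Y \<rho>"
    obtain g where g: "g \<in> ob P F \<rightarrow>\<^sub>E Y" "\<And>n x. n > 0 \<Longrightarrow> snat n sdvd s \<Longrightarrow> x \<in> ob F n \<Longrightarrow> g (\<gamma> F n x) = \<rho> n x"
      using uni[OF Y] by blast
    define i where "i = inv_into (ob P F) (\<theta> F)"
    have i\<theta>: "i (\<theta> F w) = w" if "w \<in> ob P F" for w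
      using bij[OF F] that by (simp add: i_def bij_betw_def)
    have i: "i w \<in> ob P F" if "w \<in> ob Q F" for w
      using bij[OF F] that by (auto simp: i_def bij_betw_def inv_into_into)
    show "\<exists>!f. f \<in> ob Q F \<rightarrow>\<^sub>E Y \<and> (\<forall>n>0. snat n sdvd s \<longrightarrow> (\<forall>x\<in>ob F n. f (\<delta> F n x) = \<rho> n x))"
    proof (rule ex1I[of _ "\<lambda>w\<in>ob Q F. g (i w)"], intro conjI allI impI ballI)
      show "(\<lambda>w\<in>ob Q F. g (i w)) \<in> ob Q F \<rightarrow>\<^sub>E Y"
        using g(1) i by auto
      show "(\<lambda>w\<in>ob Q F. g (i w)) (\<delta> F n x) = \<rho> n x" if "n > 0" "snat n sdvd s" "x \<in> ob F n" for n x
        using g(2)[OF that] that(3) stalk_coconeD(2)[OF co that] \<theta>h[OF F] i\<theta> by (auto simp: \<delta>_def)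
      fix f assume f: "f \<in> ob Q F \<rightarrow>\<^sub>E Y \<and> (\<forall>n>0. snat n sdvd s \<longrightarrow> (\<forall>x\<in>ob F n. f (\<delta> F n x) = \<rho> n x))"
      show "f = (\<lambda>w\<in>ob Q F. g (i w))"
      proof (rule PiE_ext[OF conjunct1[OF f]])
        show "(\<lambda>w\<in>ob Q F. g (i w)) \<in> ob Q F \<rightarrow>\<^sub>E Y"
          using g(1) i by auto
        fix w assume w: "w \<in> ob Q F"
        obtain n x where x: "n > 0" "snat n sdvd s" "x \<in> ob F n" "i w = \<gamma> F n x"
          using stalk_jointly_surjective[OF U Sh_PSh[OF F] c[OF F] i[OF w]] by blast
        have "\<theta> F (i w) = w"
          using bij[OF F] w by (auto simp: i_def bij_betw_def f_inv_into_f)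
        then have "w = \<delta> F n x"
          using x by (simp add: \<delta>_def)
        then show "f w = (\<lambda>w\<in>ob Q F. g (i w)) w"
          using f g(2)[OF x(1-3)] x w by simp
      qed
    qed
  qed
  have nat': "ar Q F G \<alpha> (\<delta> F n x) = \<delta> G n (\<alpha> n x)"
    if F: "F \<in> Obj Sh" and G: "G \<in> Obj Sh" and \<alpha>: "\<alpha> \<in> Hom Sh F G" and x: "n > 0" "snat n sdvd s" "x \<in> ob F n" for F G \<alpha> n x
  proof -
    have \<gamma>P: "\<gamma> F n x \<in> ob P F"
      using c[OF F] stalk_coconeD(2)[OF _ x] unfolding colimit_stalk_iff[OF Sh_PSh[OF F]] by blast
    have \<alpha>': "\<alpha> \<in> Hom PSh F G" using \<alpha> by simp
    have "\<theta> G (ar P F G \<alpha> (\<gamma> F n x)) = ar Q F G \<alpha> (\<theta> F (\<gamma> F n x))"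
      using fun_cong[OF nat_trans_nat[OF \<theta>(1) F G \<alpha>], of "\<gamma> F n x"] \<gamma>P by (simp add: Cmp_set_cat_apply)
    then show ?thesis
      using nat[OF F G \<alpha>' x] x(3) h_in[OF \<alpha>' x(3,1)] by (simp add: \<delta>_def)
  qed
  show ?thesis
    unfolding is_stalk_functor_def
  proof (intro conjI Q exI[of _ \<delta>] ballI allI impI col)
    fix F G \<alpha> n assume *: "F \<in> Obj Sh" "G \<in> Obj Sh" "\<alpha> \<in> Hom Sh F G" "n > 0" "snat n sdvd s"
    show "compose (ob F n) (ar Q F G \<alpha>) (\<delta> F n) = compose (ob F n) (\<delta> G n) (\<alpha> n)"
      unfolding compose_def by (rule restrict_ext) (rule nat'[OF *])
  qed
qed

text \<open>Two germs can be represented over a common multiple, where the sheaf has at most one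
  section; the stalk is thus a singleton as soon as it is inhabited.\<close>

lemma stalk_terminal:
  assumes P: "is_stalk_functor U Sh s P" and u: "u \<in> Obj Sh" and sub: "\<And>n x y. n > 0 \<Longrightarrow> x \<in> ob u n \<Longrightarrow> y \<in> ob u n \<Longrightarrow> x = y"
  shows "terminal (set_cat U) (ob P u) \<longleftrightarrow> (\<exists>n>0. snat n sdvd s \<and> ob u n \<noteq> {})"
proof -
  let ?D = "full_subcat (op_cat big_cell) (\<lambda>n. snat n sdvd s)"
  obtain \<gamma> where "\<And>F. F \<in> Obj Sh \<Longrightarrow> colimit_cocone ?D (set_cat U) F (ob P F) (\<gamma> F)"
    using P by (rule stalk_coneD) blast
  then have c: "colimit_cocone ?D (set_cat U) u (ob P u) (\<gamma> u)"
    using u by blast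
  then have co: "stalk_cocone s u (ob P u) (\<gamma> u)"
    unfolding colimit_stalk_iff[OF Sh_PSh[OF u]] by blast
  note surj = stalk_jointly_surjective[OF U Sh_PSh[OF u] c]
  have eq: "z = z'" if z: "z \<in> ob P u" "z' \<in> ob P u" for z z'
  proof -
    obtain n x where x: "n > 0" "snat n sdvd s" "x \<in> ob u n" "z = \<gamma> u n x"
      using surj[OF z(1)] by blast
    obtain m y where y: "m > 0" "snat m sdvd s" "y \<in> ob u m" "z' = \<gamma> u m y"
      using surj[OF z(2)] by blast
    let ?k = "lcm n m"
    have k: "?k > 0" "snat ?k sdvd s" "n dvd ?k" "m dvd ?k"
      using x y snat_lcm_sdvd by (auto simp: lcm_pos_nat)
    have "restr u n ?k x = restr u m ?k y"
      by (rule sub[OF k(1) p_in[OF Sh_PSh[OF u] x(3,1) k(1,3)] p_in[OF Sh_PSh[OF u] y(3,1) k(1,4)]])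
    then show ?thesis
      using stalk_coconeD(3)[OF co k(1,3,2) x(3)] stalk_coconeD(3)[OF co k(1,4,2) y(3)] x(4) y(4) by simp
  qed
  have "ob P u \<noteq> {} \<longleftrightarrow> (\<exists>n>0. snat n sdvd s \<and> ob u n \<noteq> {})"
    using surj stalk_coconeD(2)[OF co] by blast
  then show ?thesis
    unfolding terminal_set_cat[OF U] using eq by blast
qed

text \<open>This shape and the next give terminal objects and binary products, the limits through
  which exactness of an inverse image identifies its supernatural number.\<close>

definition empty_shape :: "(nat, nat) cat" where
  "empty_shape = \<lparr>Obj = {}, Hom = \<lambda>_ _. {}, Idn = \<lambda>_. 0, Cmp = \<lambda>_ _ _ _ _. 0\<rparr>"

definition pair_shape :: "(nat, nat) cat" where
  "pair_shape = \<lparr>Obj = {0, 1}, Hom = \<lambda>i j. if i = j then {0} else {}, Idn = \<lambda>_. 0, Cmp = \<lambda>_ _ _ _ _. 0\<rparr>"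

lemma finite_empty_shape: "finite_category empty_shape"
  by (simp add: finite_category_def is_category_def empty_shape_def)

lemma finite_pair_shape: "finite_category pair_shape"
  by (auto simp: finite_category_def is_category_def pair_shape_def split: if_splits)

lemma yon_terminal_preserved:
  assumes lex: "left_exact Sh (set_cat U) f"
  shows "ob f (yon 1) \<noteq> {}"
proof -
  define \<Delta> :: "(nat, nat, (nat, 'u) presheaf, nat \<Rightarrow> 'u \<Rightarrow> 'u) fctr" where "\<Delta> = \<lparr>ob = \<lambda>_. yon 1, ar = \<lambda>_ _ _. undefined\<rparr>"
  have \<Delta>: "is_functor empty_shape Sh \<Delta>"
    by (simp add: is_functor_def empty_shape_def)
  have "undefined \<in> ob (yon 1) n" if "n > 0" for n
    using that by (intro yon_sub) auto
  then have "pointwise_limit empty_shape \<Delta> (yon 1) (\<lambda>_. undefined)"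
    unfolding pointwise_limit_def by (auto simp: yon_mem empty_shape_def)
  then have "limit_cone empty_shape Sh \<Delta> (yon 1) (\<lambda>_. undefined)"
    by (intro limit_of_pointwise_limit[OF \<Delta> yon_sheaf]) (auto simp: empty_shape_def)
  then have l: "limit_cone empty_shape (set_cat U) (comp_fctr f \<Delta>) (ob f (yon 1)) (\<lambda>j. ar f (yon 1) (ob \<Delta> j) undefined)"
    using lex finite_empty_shape \<Delta> unfolding left_exact_def by blast
  \<comment> \<open>The image of the terminal object is tested against a one-element set, which
    yields an element of it.\<close>
  have "\<exists>!h. h \<in> Hom (set_cat U) {undefined} (ob f (yon 1)) \<and>
      (\<forall>j\<in>Obj empty_shape. Cmp (set_cat U) {undefined} (ob f (yon 1)) (ob (comp_fctr f \<Delta>) j) (ar f (yon 1) (ob \<Delta> j) undefined) h = undefined)"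
    by (rule limit_coneD(4)[OF l]) (auto simp: empty_shape_def set_cat_def universe_singleton[OF U])
  then obtain h where "h \<in> Hom (set_cat U) {undefined} (ob f (yon 1))"
    by blast
  then have "h \<in> {undefined} \<rightarrow>\<^sub>E ob f (yon 1)"
    by (simp add: set_cat_hom)
  then have "h undefined \<in> ob f (yon 1)"
    by (rule PiE_mem) simp
  then show ?thesis
    by blast
qed

text \<open>\<open>yon (lcm m n)\<close> is the product of \<open>yon m\<close> and
  \<open>yon n\<close>, since being locally a multiple of both numbers is being locally a multiple
  of their \<open>lcm\<close>. The preserved product is tested against a one-element set carrying
  \<open>a\<close> and \<open>b\<close>.\<close>

lemma yon_product_preserved:
  assumes f: "is_functor Sh (set_cat U) f" and lex: "left_exact Sh (set_cat U) f"
    and mn: "m > 0" "n > 0" and a: "a \<in> ob f (yon m)" and b: "b \<in> ob f (yon n)"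
  shows "\<exists>c\<in>ob f (yon (lcm m n)). ar f (yon (lcm m n)) (yon m) (yarr (lcm m n) m) c = a \<and>
    ar f (yon (lcm m n)) (yon n) (yarr (lcm m n) n) c = b"
proof -
  let ?l = "lcm m n"
  have l: "?l > 0" using mn by (simp add: lcm_pos_nat)
  define Y where "Y i = (if i = 0 then yon m else yon n)" for i :: nat
  define \<pi> where "\<pi> i = (if i = 0 then yarr ?l m else yarr ?l n)" for i :: nat
  define \<Delta> :: "(nat, nat, (nat, 'u) presheaf, nat \<Rightarrow> 'u \<Rightarrow> 'u) fctr" where "\<Delta> = \<lparr>ob = Y, ar = \<lambda>i _ _. Idn PSh (Y i)\<rparr>"
  have Y: "Y i \<in> Obj Sh" for i
    by (simp add: Y_def yon_sheaf)
  have Yid: "Idn PSh (Y i) \<in> Hom PSh (Y i) (Y i)" for i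
    using cat_id[OF cat_PSh Sh_PSh[OF Y]] .
  have \<pi>: "\<pi> i \<in> Hom PSh (yon ?l) (Y i)" for i
    unfolding \<pi>_def Y_def using yarr[OF _ l] by simp
  have \<Delta>: "is_functor pair_shape Sh \<Delta>"
    using Y Yid cat_idl[OF cat_PSh Sh_PSh[OF Y] Sh_PSh[OF Y] Yid]
    by (auto simp: is_functor_def pair_shape_def \<Delta>_def split: if_splits)
  have Yu: "x = undefined" if "x \<in> ob (Y i) k" for x i k
    using that by (auto simp: Y_def yon_mem split: if_splits)
  have pw: "pointwise_limit pair_shape \<Delta> (yon ?l) \<pi>"
    unfolding pointwise_limit_def
  proof (intro allI impI, elim conjE)
    fix k and y :: "nat \<Rightarrow> 'u" assume k: "k > (0 :: nat)" and y: "\<forall>j\<in>Obj pair_shape. y j \<in> ob (ob \<Delta> j) k"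
    have "y 0 \<in> ob (yon m) k" "y 1 \<in> ob (yon n) k"
      using y by (auto simp: pair_shape_def \<Delta>_def Y_def)
    then have "locally k (\<lambda>j. j > 0 \<and> m dvd j)" "locally k (\<lambda>j. j > 0 \<and> n dvd j)"
      by (auto simp: yon_mem)
    then have "locally k (\<lambda>j. (j > 0 \<and> m dvd j) \<and> (j > 0 \<and> n dvd j))"
      by (rule locally_conj)
    then have "locally k (\<lambda>j. j > 0 \<and> ?l dvd j)"
      by (simp add: conj_ac)
    then have u: "undefined \<in> ob (yon ?l) k"
      by (simp add: yon_mem)
    have "\<pi> j k undefined = y j" if "j \<in> Obj pair_shape" for j
      using Yu[OF h_in[OF \<pi>[of j] u k]] Yu[of "y j" j k] y that by (simp add: \<Delta>_def)
    then show "\<exists>!z. z \<in> ob (yon ?l) k \<and> (\<forall>j\<in>Obj pair_shape. \<pi> j k z = y j)"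
      using u by (auto simp: yon_mem)
  qed
  have "limit_cone pair_shape Sh \<Delta> (yon ?l) \<pi>"
  proof (rule limit_of_pointwise_limit[OF \<Delta> yon_sheaf _ _ pw])
    show "\<pi> j \<in> Hom PSh (yon ?l) (ob \<Delta> j)" for j
      using \<pi> by (simp add: \<Delta>_def)
    show "ar \<Delta> j k u n (\<pi> j n z) = \<pi> k n z"
      if "u \<in> Hom pair_shape j k" "n > 0" "z \<in> ob (yon ?l) n" for j k u n z
      using that h_in[OF \<pi>[of j] that(3,2)] Idn_presheaves[of n big_cell U "Y j"]
      by (auto simp: \<Delta>_def pair_shape_def split: if_splits)
  qed
  then have lim: "limit_cone pair_shape (set_cat U) (comp_fctr f \<Delta>) (ob f (yon ?l)) (\<lambda>j. ar f (yon ?l) (ob \<Delta> j) (\<pi> j))"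
    using lex finite_pair_shape \<Delta> unfolding left_exact_def by blast
  define \<rho> where "\<rho> i = (\<lambda>x\<in>{undefined :: 'u}. if i = 0 then a else b)" for i :: nat
  have \<rho>: "\<rho> i \<in> Hom (set_cat U) {undefined} (ob f (Y i))" for i
    using a b by (auto simp: \<rho>_def Y_def set_cat_def)
  have o: "{undefined} \<in> Obj (set_cat U)" "ob f (Y i) \<in> Obj (set_cat U)" for i
    using universe_singleton[OF U] fun_ob[OF f Y] by (auto simp: set_cat_def)
  have "\<exists>!h. h \<in> Hom (set_cat U) {undefined} (ob f (yon ?l)) \<and>
      (\<forall>j\<in>Obj pair_shape. Cmp (set_cat U) {undefined} (ob f (yon ?l)) (ob (comp_fctr f \<Delta>) j) (ar f (yon ?l) (ob \<Delta> j) (\<pi> j)) h = \<rho> j)"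
  proof (rule limit_coneD(4)[OF lim o(1)])
    show "\<rho> j \<in> Hom (set_cat U) {undefined} (ob (comp_fctr f \<Delta>) j)" for j
      using \<rho> by (simp add: \<Delta>_def)
    fix j k u assume "u \<in> Hom pair_shape j k"
    then have k: "k = j" by (simp add: pair_shape_def split: if_splits)
    have "ar f (Y j) (Y j) (Idn PSh (Y j)) = Idn (set_cat U) (ob f (Y j))"
      using fun_id[OF f Y[of j]] by simp
    then show "Cmp (set_cat U) {undefined} (ob (comp_fctr f \<Delta>) j) (ob (comp_fctr f \<Delta>) k) (ar (comp_fctr f \<Delta>) j k u) (\<rho> j) = \<rho> k"
      using cat_idl[OF is_category_set_cat o \<rho>[of j]] by (simp add: k \<Delta>_def)
  qed
  then obtain h where h: "h \<in> Hom (set_cat U) {undefined} (ob f (yon ?l))"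
    and hj: "\<And>j. j \<in> Obj pair_shape \<Longrightarrow> Cmp (set_cat U) {undefined} (ob f (yon ?l)) (ob (comp_fctr f \<Delta>) j) (ar f (yon ?l) (ob \<Delta> j) (\<pi> j)) h = \<rho> j"
    by blast
  have hu: "h undefined \<in> ob f (yon ?l)"
    using h by (auto simp: set_cat_def)
  have "ar f (yon ?l) (yon m) (yarr ?l m) (h undefined) = a"
    using fun_cong[OF hj[of 0], of undefined] by (simp add: pair_shape_def \<Delta>_def Y_def \<pi>_def \<rho>_def Cmp_set_cat_apply)
  moreover have "ar f (yon ?l) (yon n) (yarr ?l n) (h undefined) = b"
    using fun_cong[OF hj[of 1], of undefined] by (simp add: pair_shape_def \<Delta>_def Y_def \<pi>_def \<rho>_def Cmp_set_cat_apply)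
  ultimately show ?thesis
    using hu by blast
qed

text \<open>
  A point with inverse image \<open>f\<close> and direct image \<open>g\<close> is the stalk at the \<open>s\<close> whose natural divisors are
  the \<open>n\<close> for which \<open>f\<close> does not kill the representable sheaf of \<open>n\<close>: by the Yoneda lemma the sections of \<open>g X\<close>
  over \<open>n\<close> are the maps from \<open>f (yon n)\<close> to \<open>X\<close>, so that \<open>g X\<close> is the skyscraper of \<open>X\<close> at \<open>s\<close>.
\<close>

lemma point_is_stalk:
  assumes p: "p \<in> points U Sh"
  shows "\<exists>s\<in>spec. is_stalk_functor U Sh s (inv_im p)"
proof -
  define f where "f = inv_im p"
  define g where "g = dir_im p"
  have adj: "adjoint Sh (set_cat U) f g" and lex: "left_exact Sh (set_cat U) f"
    using p by (auto simp: points_def geometric_morphism_def f_def g_def)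
  obtain \<phi> where fF: "is_functor Sh (set_cat U) f" and gF: "is_functor (set_cat U) Sh g"
    and bij: "\<And>c d. c \<in> Obj Sh \<Longrightarrow> d \<in> Obj (set_cat U) \<Longrightarrow> bij_betw (\<phi> c d) (Hom (set_cat U) (ob f c) d) (Hom Sh c (ob g d))"
    and natl: "\<And>c c' d h k. c \<in> Obj Sh \<Longrightarrow> c' \<in> Obj Sh \<Longrightarrow> d \<in> Obj (set_cat U) \<Longrightarrow> h \<in> Hom Sh c' c \<Longrightarrow> k \<in> Hom (set_cat U) (ob f c) d \<Longrightarrow>
      \<phi> c' d (Cmp (set_cat U) (ob f c') (ob f c) d k (ar f c' c h)) = Cmp Sh c' c (ob g d) (\<phi> c d k) h"
    by (rule adjointE[OF cat_Sh is_category_set_cat adj]) metis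
  have OU: "Obj (set_cat U) = U"
    by (simp add: set_cat_def)
  have gS: "ob g X \<in> Obj Sh" if "X \<in> U" for X
    using fun_ob[OF gF, of X] that by (simp add: OU)
  have fh: "ar f F G \<alpha> \<in> ob f F \<rightarrow>\<^sub>E ob f G" if "F \<in> Obj Sh" "G \<in> Obj Sh" "\<alpha> \<in> Hom PSh F G" for F G \<alpha>
    using fun_ar[OF fF that(1,2), of \<alpha>] that(3) by (simp add: set_cat_hom)
  have fcmp: "ar f F H (Cmp PSh F G H \<beta> \<alpha>) z = ar f G H \<beta> (ar f F G \<alpha> z)"
    if "F \<in> Obj Sh" "G \<in> Obj Sh" "H \<in> Obj Sh" "\<alpha> \<in> Hom PSh F G" "\<beta> \<in> Hom PSh G H" "z \<in> ob f F" for F G H \<alpha> \<beta> z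
    using fun_cmp[OF fF that(1-3), of \<alpha> \<beta>] that(4-6) Cmp_set_cat_apply[of z "ob f F" U] by simp
  have \<phi>h: "\<phi> F X h \<in> Hom PSh F (ob g X)" if "F \<in> Obj Sh" "X \<in> U" "h \<in> ob f F \<rightarrow>\<^sub>E X" for F X h
    using bij_betw_apply[OF bij[OF that(1), of X], of h] that by (simp add: OU set_cat_hom)
  have \<phi>inj: "h = h'" if "F \<in> Obj Sh" "X \<in> U" "h \<in> ob f F \<rightarrow>\<^sub>E X" "h' \<in> ob f F \<rightarrow>\<^sub>E X" "\<phi> F X h = \<phi> F X h'" for F X h h'
    using bij[OF that(1), of X] that by (auto simp: OU set_cat_hom bij_betw_def inj_on_def)
  have \<phi>surj: "\<exists>h\<in>ob f F \<rightarrow>\<^sub>E X. \<phi> F X h = \<beta>" if "F \<in> Obj Sh" "X \<in> U" "\<beta> \<in> Hom PSh F (ob g X)" for F X \<beta>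
  proof -
    have "\<beta> \<in> \<phi> F X ` (ob f F \<rightarrow>\<^sub>E X)"
      using bij[OF that(1), of X] that by (simp add: OU set_cat_hom bij_betw_def)
    then show ?thesis by auto
  qed
  have \<phi>nat: "\<phi> F X (compose (ob f F) k (ar f F G \<alpha>)) = Cmp PSh F G (ob g X) (\<phi> G X k) \<alpha>"
    if "F \<in> Obj Sh" "G \<in> Obj Sh" "X \<in> U" "\<alpha> \<in> Hom PSh F G" "k \<in> ob f G \<rightarrow>\<^sub>E X" for F G X \<alpha> k
    using natl[OF that(2,1), of X \<alpha> k] that by (simp add: OU set_cat_hom) (simp add: set_cat_def)
  \<comment> \<open>By the adjunction and the Yoneda lemma, \<open>e X n\<close> identifies
    functions from \<open>f (yon n)\<close> to \<open>X\<close> with sections of \<open>g X\<close>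
    over \<open>n\<close>; by \<open>e_restr\<close>, restriction is precomposition with
    \<open>?t\<close>.\<close>
  define e where "e X n h = \<phi> (yon n) X h n undefined" for X n h
  have e_in: "e X n h \<in> ob (ob g X) n" if "X \<in> U" "n > 0" "h \<in> ob f (yon n) \<rightarrow>\<^sub>E X" for X n h
    unfolding e_def by (rule h_in[OF \<phi>h[OF yon_sheaf that(1,3)] u_yon[OF that(2)] that(2)])
  have e_inj: "h = h'" if "X \<in> U" "n > 0" "h \<in> ob f (yon n) \<rightarrow>\<^sub>E X" "h' \<in> ob f (yon n) \<rightarrow>\<^sub>E X" "e X n h = e X n h'" for X n h h'
    by (rule \<phi>inj[OF yon_sheaf that(1,3,4) yon_hom_eqI[OF gS[OF that(1)] that(2) \<phi>h[OF yon_sheaf that(1,3)] \<phi>h[OF yon_sheaf that(1,4)]]])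
      (use that(5) in \<open>simp add: e_def\<close>)
  have e_surj: "\<exists>h\<in>ob f (yon n) \<rightarrow>\<^sub>E X. e X n h = y" if X: "X \<in> U" and n: "n > 0" and y: "y \<in> ob (ob g X) n" for X n y
  proof -
    obtain h where "h \<in> ob f (yon n) \<rightarrow>\<^sub>E X" "\<phi> (yon n) X h = hat n (ob g X) y"
      using \<phi>surj[OF yon_sheaf X hat(1)[OF gS[OF X] n y]] by blast
    then show ?thesis
      using hat(2)[OF gS[OF X] n y] by (intro bexI[of _ h]) (simp_all add: e_def)
  qed
  let ?t = "\<lambda>m n. ar f (yon m) (yon n) (yarr m n)"
  have th: "?t m n \<in> ob f (yon m) \<rightarrow>\<^sub>E ob f (yon n)" if "n dvd m" "m > 0" for m n
    by (rule fh[OF yon_sheaf yon_sheaf yarr[OF that]])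
  have e_restr: "restr (ob g X) n m (e X n h) = e X m (compose (ob f (yon m)) h (?t m n))"
    if "X \<in> U" "n > 0" "m > 0" "n dvd m" "h \<in> ob f (yon n) \<rightarrow>\<^sub>E X" for X n m h
    unfolding e_def \<phi>nat[OF yon_sheaf yon_sheaf that(1) yarr[OF that(4,3)] that(5)]
    using hat_yarr[OF gS[OF that(1)] that(2) h_in[OF \<phi>h[OF yon_sheaf that(1,5)] u_yon[OF that(2)] that(2)] that(3,4) \<phi>h[OF yon_sheaf that(1,5)]]
    by simp
  \<comment> \<open>For \<open>m = n\<close> the product of \<open>yon n\<close> with itself is
    \<open>yon n\<close> again, with equal projections, so any two elements of
    \<open>f (yon n)\<close> coincide.\<close>
  have sub: "a = b" if "n > 0" "a \<in> ob f (yon n)" "b \<in> ob f (yon n)" for n a b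
    using yon_product_preserved[OF fF lex that(1,1,2,3)] by auto
  define D where "D = {n. n > 0 \<and> ob f (yon n) \<noteq> {}}"
  have D_down: "n \<in> D" if "m \<in> D" "n dvd m" for m n
    using that th[of n m] dvd_pos_nat[of m n] by (auto simp: D_def)
  obtain s where s: "\<And>n. n > 0 \<Longrightarrow> snat n sdvd s \<longleftrightarrow> n \<in> D"
  proof -
    have "\<exists>s. \<forall>n>0. snat n sdvd s \<longleftrightarrow> n \<in> D"
    proof (rule supernat_of_divisors)
      show "1 \<in> D"
        using yon_terminal_preserved[OF lex] by (simp add: D_def)
      show "lcm m n \<in> D" if mnD: "m \<in> D" "n \<in> D" for m n
      proof -
        have mn: "m > 0" "n > 0"
          using mnD by (simp_all add: D_def)
        obtain a b where "a \<in> ob f (yon m)" "b \<in> ob f (yon n)"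
          using mnD by (auto simp: D_def)
        then have "ob f (yon (lcm m n)) \<noteq> {}"
          using yon_product_preserved[OF fF lex mn] by blast
        then show ?thesis
          using mn by (simp add: D_def lcm_pos_nat)
      qed
      show "n \<in> D" if "m \<in> D" "n dvd m" for m n
        using that by (rule D_down)
    qed (auto simp: D_def)
    then show thesis
      using that by blast
  qed
  have "s \<in> spec"
    unfolding spec_def mem_Collect_eq
  proof (intro allI ballI impI, rule ccontr)
    fix n L assume L: "L \<in> J n" and ns: "snat n sdvd s" and no: "\<not> (\<exists>m\<in>L. snat m sdvd s)"
    have n: "n > 0" using J_empty[OF L] .
    \<comment> \<open>The direct image of the empty set detects covers: if \<open>f\<close> kills
      every member of \<open>L\<close>, there is exactly one function from each
      \<open>f (yon m)\<close> to the empty set. The corresponding sections of \<open>g {}\<close>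
      match and glue to a section over \<open>n\<close>, that is, a function from
      \<open>f (yon n)\<close> to the empty set, so \<open>f\<close> kills \<open>n\<close> as
      well.\<close>
    note E = universe_empty[OF U]
    have fm: "ob f (yon m) = {}" if "m \<in> L" for m
      using no s[of m] that J_sieveD[OF L that] by (auto simp: D_def)
    have subE: "x = y" if xy: "k > 0" "x \<in> ob (ob g {}) k" "y \<in> ob (ob g {}) k" for k x y
    proof -
      obtain h h' where h: "h \<in> ob f (yon k) \<rightarrow>\<^sub>E {}" "h' \<in> ob f (yon k) \<rightarrow>\<^sub>E {}" and "e {} k h = x" "e {} k h' = y"
        using e_surj[OF E xy(1,2)] e_surj[OF E xy(1,3)] by blast
      moreover have "h = h'"
        by (rule PiE_ext[OF h]) (use h in auto)
      ultimately show ?thesis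
        by simp
    qed
    have x: "e {} m (\<lambda>_. undefined) \<in> ob (ob g {}) m" if "m \<in> L" for m
      using e_in[OF E, of m] fm[OF that] J_sieveD[OF L that] by simp
    have "{m. m > 0 \<and> n dvd m \<and> m \<in> L} = L"
      using J_sieveD[OF L] by auto
    then have l: "locally n (\<lambda>m. m \<in> L)"
      using L by (simp add: locally_def)
    obtain y where y: "y \<in> ob (ob g {}) n"
    proof (rule glue[OF gS[OF E] l, of "\<lambda>m. e {} m (\<lambda>_. undefined)"])
      fix m k assume mk: "m > 0" "m \<in> L" "k > 0" "m dvd k"
      have kL: "k \<in> L"
        by (rule sieve_big_cellD(4)[OF J_sieve[OF L] mk(2-4)])
      show "restr (ob g {}) m k (e {} m (\<lambda>_. undefined)) = e {} k (\<lambda>_. undefined)"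
        by (rule subE[OF mk(3) p_in[OF Sh_PSh[OF gS[OF E]] x[OF mk(2)] mk(1,3,4)] x[OF kL]])
    qed (use x in blast)+
    obtain h where h: "h \<in> ob f (yon n) \<rightarrow>\<^sub>E ({} :: 'u set)"
      using e_surj[OF E n y] by blast
    have "False" if "w \<in> ob f (yon n)" for w
      using PiE_mem[OF h that] by simp
    then have "ob f (yon n) = {}"
      by blast
    then show False
      using s[OF n] ns by (simp add: D_def)
  qed
  define pt where "pt n = (SOME a. a \<in> ob f (yon n))" for n
  have pt: "pt n \<in> ob f (yon n)" if "n > 0" "snat n sdvd s" for n
    unfolding pt_def by (rule someI_ex) (use s that in \<open>auto simp: D_def\<close>)
  have fy: "snat n sdvd s" "w = pt n" if "n > 0" "w \<in> ob f (yon n)" for n w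
  proof -
    show ns: "snat n sdvd s"
      using s that by (auto simp: D_def)
    show "w = pt n"
      by (rule sub[OF that(1,2) pt[OF that(1) ns]])
  qed
  \<comment> \<open>The germ of \<open>x\<close> is the image of the single element
    \<open>pt n\<close> of \<open>f (yon n)\<close> under \<open>f\<close> applied to the arrow
    named by \<open>x\<close>.\<close>
  define \<gamma> where "\<gamma> F n = (\<lambda>x\<in>ob F n. ar f (yon n) F (hat n F x) (pt n))" for F n
  have co: "stalk_cocone s F (ob f F) (\<gamma> F)" if F: "F \<in> Obj Sh" for F
    unfolding stalk_cocone_def
  proof (intro conjI allI impI ballI)
    show "\<gamma> F n \<in> ob F n \<rightarrow>\<^sub>E ob f F" if n: "n > 0" "snat n sdvd s" for n
      using fh[OF yon_sheaf F hat(1)[OF F n(1)]] pt[OF n] by (auto simp: \<gamma>_def)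
    fix n m x assume *: "n > 0" "m > 0" "n dvd m" "snat m sdvd s" "x \<in> ob F n"
    have xm: "restr F n m x \<in> ob F m"
      by (rule p_in[OF Sh_PSh[OF F] *(5,1-3)])
    have "hat m F (restr F n m x) = Cmp PSh (yon m) (yon n) F (hat n F x) (yarr m n)"
    proof (rule yon_hom_eqI[OF F *(2) hat(1)[OF F *(2) xm]])
      show "Cmp PSh (yon m) (yon n) F (hat n F x) (yarr m n) \<in> Hom PSh (yon m) F"
        by (rule h_cmp[OF Sh_PSh[OF yon_sheaf] Sh_PSh[OF yon_sheaf] Sh_PSh[OF F] yarr[OF *(3,2)] hat(1)[OF F *(1,5)]])
      show "hat m F (restr F n m x) m undefined = Cmp PSh (yon m) (yon n) F (hat n F x) (yarr m n) m undefined"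
        using hat(2)[OF F *(2) xm] hat(2)[OF F *(1,5)] hat_yarr[OF F *(1,5,2,3) hat(1)[OF F *(1,5)]] by simp
    qed
    then have "ar f (yon m) F (hat m F (restr F n m x)) (pt m) = ar f (yon n) F (hat n F x) (?t m n (pt m))"
      using fcmp[OF yon_sheaf yon_sheaf F yarr[OF *(3,2)] hat(1)[OF F *(1,5)] pt[OF *(2,4)]] by simp
    also have "?t m n (pt m) = pt n"
      by (rule fy(2)[OF *(1)]) (use th[OF *(3,2)] pt[OF *(2,4)] in auto)
    finally show "\<gamma> F m (restr F n m x) = \<gamma> F n x"
      using xm *(5) by (simp add: \<gamma>_def)
  qed
  have \<phi>val: "\<phi> F X k n x = e X n (compose (ob f (yon n)) k (ar f (yon n) F (hat n F x)))"
    if "F \<in> Obj Sh" "X \<in> U" "k \<in> ob f F \<rightarrow>\<^sub>E X" "n > 0" "x \<in> ob F n" for F X k n x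
    unfolding e_def \<phi>nat[OF yon_sheaf that(1,2) hat(1)[OF that(1,4,5)] that(3)]
    using h_cmp_apply[OF that(4) u_yon[OF that(4)]] hat(2)[OF that(1,4,5)] by simp
  have col: "colimit_cocone (full_subcat (op_cat big_cell) (\<lambda>n. snat n sdvd s)) (set_cat U) F (ob f F) (\<gamma> F)" if F: "F \<in> Obj Sh" for F
    unfolding colimit_stalk_iff[OF Sh_PSh[OF F]]
  proof (intro conjI co[OF F] ballI allI impI)
    show "ob f F \<in> U"
      using fun_ob[OF fF F] by (simp add: OU)
    fix X \<rho> assume X: "X \<in> U" and \<rho>: "stalk_cocone s F X \<rho>"
    \<comment> \<open>A cocone value \<open>\<rho> n x\<close> becomes a constant function on
      \<open>f (yon n)\<close>, which is a singleton or empty, and hence a section of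
      \<open>g X\<close>. These sections form an arrow from \<open>F\<close> to
      \<open>g X\<close>.\<close>
    define c where "c n x = (\<lambda>w\<in>ob f (yon n). \<rho> n x)" for n x
    have c: "c n x \<in> ob f (yon n) \<rightarrow>\<^sub>E X" if "n > 0" "x \<in> ob F n" for n x
      using stalk_coconeD(2)[OF \<rho> that(1) fy(1)[OF that(1)] that(2)] by (auto simp: c_def)
    let ?\<beta> = "\<lambda>n\<in>{0<..}. \<lambda>x\<in>ob F n. e X n (c n x)"
    have \<beta>: "?\<beta> \<in> Hom PSh F (ob g X)"
    proof (rule h_intro[OF _ _ Sh_PSh[OF F]])
      show "e X n (c n x) \<in> ob (ob g X) n" if "n > 0" "x \<in> ob F n" for n x
        by (rule e_in[OF X that(1) c[OF that]])
      fix n m x assume *: "n > 0" "m > 0" "n dvd m" "x \<in> ob F n" "restr F n m x \<in> ob F m"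
      have "compose (ob f (yon m)) (c n x) (?t m n) = c m (restr F n m x)"
        unfolding compose_def c_def
      proof (rule restrict_ext)
        fix w assume w: "w \<in> ob f (yon m)"
        then have "?t m n w \<in> ob f (yon n)"
          using th[OF *(3,2)] by auto
        then show "(\<lambda>w\<in>ob f (yon n). \<rho> n x) (?t m n w) = \<rho> m (restr F n m x)"
          using stalk_coconeD(3)[OF \<rho> *(2,3) fy(1)[OF *(2) w] *(4)] by simp
      qed
      then show "e X m (c m (restr F n m x)) = restr (ob g X) n m (e X n (c n x))"
        using e_restr[OF X *(1-3) c[OF *(1,4)]] by simp
    qed
    \<comment> \<open>A map mediates for \<open>\<rho>\<close> exactly when its transpose is the
      arrow just built, so the universal property of the colimit is that of the adjunction.\<close>
    have iff: "\<phi> F X k = ?\<beta> \<longleftrightarrow> (\<forall>n>0. snat n sdvd s \<longrightarrow> (\<forall>x\<in>ob F n. k (\<gamma> F n x) = \<rho> n x))"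
      if k: "k \<in> ob f F \<rightarrow>\<^sub>E X" for k
    proof
      assume eq: "\<phi> F X k = ?\<beta>"
      show "\<forall>n>0. snat n sdvd s \<longrightarrow> (\<forall>x\<in>ob F n. k (\<gamma> F n x) = \<rho> n x)"
      proof (intro allI impI ballI)
        fix n x assume n: "n > 0" "snat n sdvd s" and x: "x \<in> ob F n"
        have kf: "compose (ob f (yon n)) k (ar f (yon n) F (hat n F x)) \<in> ob f (yon n) \<rightarrow>\<^sub>E X"
          using fh[OF yon_sheaf F hat(1)[OF F n(1) x]] k by (auto simp: compose_def)
        have "e X n (compose (ob f (yon n)) k (ar f (yon n) F (hat n F x))) = e X n (c n x)"
          using \<phi>val[OF F X k n(1) x] eq n(1) x by simp
        then have "compose (ob f (yon n)) k (ar f (yon n) F (hat n F x)) = c n x"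
          by (rule e_inj[OF X n(1) kf c[OF n(1) x]])
        from fun_cong[OF this, of "pt n"] show "k (\<gamma> F n x) = \<rho> n x"
          using pt[OF n] x by (simp add: compose_eq c_def \<gamma>_def)
      qed
    next
      assume kr: "\<forall>n>0. snat n sdvd s \<longrightarrow> (\<forall>x\<in>ob F n. k (\<gamma> F n x) = \<rho> n x)"
      show "\<phi> F X k = ?\<beta>"
      proof (rule h_eqI[OF \<phi>h[OF F X k] \<beta>])
        fix n x assume n: "n > 0" and x: "x \<in> ob F n"
        have "compose (ob f (yon n)) k (ar f (yon n) F (hat n F x)) = c n x"
          unfolding compose_def c_def
        proof (rule restrict_ext)
          fix w assume w: "w \<in> ob f (yon n)"
          show "k (ar f (yon n) F (hat n F x) w) = \<rho> n x"
            using kr n fy[OF n w] x by (simp add: \<gamma>_def)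
        qed
        then show "\<phi> F X k n x = ?\<beta> n x"
          using \<phi>val[OF F X k n x] n x by simp
      qed
    qed
    obtain k where k: "k \<in> ob f F \<rightarrow>\<^sub>E X" "\<phi> F X k = ?\<beta>"
      using \<phi>surj[OF F X \<beta>] by blast
    show "\<exists>!k. k \<in> ob f F \<rightarrow>\<^sub>E X \<and> (\<forall>n>0. snat n sdvd s \<longrightarrow> (\<forall>x\<in>ob F n. k (\<gamma> F n x) = \<rho> n x))"
    proof (rule ex1I[of _ k])
      show "k \<in> ob f F \<rightarrow>\<^sub>E X \<and> (\<forall>n>0. snat n sdvd s \<longrightarrow> (\<forall>x\<in>ob F n. k (\<gamma> F n x) = \<rho> n x))"
        using k iff[OF k(1)] by blast
      fix k' assume k': "k' \<in> ob f F \<rightarrow>\<^sub>E X \<and> (\<forall>n>0. snat n sdvd s \<longrightarrow> (\<forall>x\<in>ob F n. k' (\<gamma> F n x) = \<rho> n x))"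
      then have "\<phi> F X k' = ?\<beta>"
        using iff[of k'] by blast
      then show "k' = k"
        using \<phi>inj[OF F X conjunct1[OF k'] k(1)] k(2) by simp
    qed
  qed
  have "is_stalk_functor U Sh s f"
    unfolding is_stalk_functor_def
  proof (intro conjI fF exI[of _ \<gamma>] ballI allI impI col)
    fix F G \<alpha> n assume F: "F \<in> Obj Sh" and G: "G \<in> Obj Sh" and "\<alpha> \<in> Hom Sh F G" and n: "n > 0" "snat n sdvd s"
    then have \<alpha>: "\<alpha> \<in> Hom PSh F G" by simp
    show "compose (ob F n) (ar f F G \<alpha>) (\<gamma> F n) = compose (ob F n) (\<gamma> G n) (\<alpha> n)"
      unfolding compose_def
    proof (rule restrict_ext)
      fix x assume x: "x \<in> ob F n"
      show "ar f F G \<alpha> (\<gamma> F n x) = \<gamma> G n (\<alpha> n x)"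
        using fcmp[OF yon_sheaf F G hat(1)[OF F n(1) x] \<alpha> pt[OF n]] hat_cmp[OF F G n(1) x \<alpha>] x h_in[OF \<alpha> x n(1)]
        by (simp add: \<gamma>_def)
    qed
  qed
  then show ?thesis
    using \<open>s \<in> spec\<close> unfolding f_def by blast
qed

section \<open>Isomorphism classes of points, and the set of supernatural numbers they come
  from\<close>

lemma point_isomorphic_iff:
  assumes p: "p \<in> point_at U Sh s" and q: "q \<in> points U Sh"
  shows "isomorphic_geom (set_cat U) Sh p q \<longleftrightarrow> q \<in> point_at U Sh s"
proof
  have P: "is_stalk_functor U Sh s (inv_im p)"
    using p by (simp add: point_at_def)
  {
    assume "isomorphic_geom (set_cat U) Sh p q"
    moreover have "is_functor Sh (set_cat U) (inv_im q)"
      using q by (simp add: points_def geometric_morphism_def adjoint_def)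
    ultimately show "q \<in> point_at U Sh s"
      using stalk_functor_transfer[OF P] q by (simp add: isomorphic_geom_def point_at_def)
  }
  assume "q \<in> point_at U Sh s"
  then show "isomorphic_geom (set_cat U) Sh p q"
    using stalk_isomorphic[OF P] by (simp add: isomorphic_geom_def point_at_def)
qed

lemma specD: "s \<in> spec \<Longrightarrow> L \<in> J n \<Longrightarrow> snat n sdvd s \<Longrightarrow> \<exists>m\<in>L. snat m sdvd s"
  by (simp add: spec_def)

lemma point_at_nonempty: "s \<in> spec \<Longrightarrow> point_at U Sh s \<noteq> {}"
  by (rule stalk_point_exists) (rule specD)

lemma point_classes_eq: "point_classes U Sh = point_at U Sh ` spec"
proof -
  let ?r = "{(p, q). p \<in> points U Sh \<and> q \<in> points U Sh \<and> isomorphic_geom (set_cat U) Sh p q}"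
  have cl: "?r `` {p} = point_at U Sh s" if p: "p \<in> point_at U Sh s" for p s
  proof -
    have "q \<in> points U Sh \<and> isomorphic_geom (set_cat U) Sh p q \<longleftrightarrow> q \<in> point_at U Sh s" for q
      using point_isomorphic_iff[OF p] by (auto simp: point_at_def)
    moreover have "p \<in> points U Sh"
      using p by (simp add: point_at_def)
    ultimately show ?thesis
      by auto
  qed
  show ?thesis
    unfolding point_classes_def
  proof (intro equalityI subsetI)
    fix c assume "c \<in> points U Sh // ?r"
    then obtain p where p: "p \<in> points U Sh" "c = ?r `` {p}"
      by (rule quotientE)
    obtain s where s: "s \<in> spec" "is_stalk_functor U Sh s (inv_im p)"
      using point_is_stalk[OF p(1)] by blast
    then have "c = point_at U Sh s"
      unfolding p(2) using p(1) by (intro cl) (simp add: point_at_def)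
    then show "c \<in> point_at U Sh ` spec"
      using s(1) by blast
  next
    fix c assume "c \<in> point_at U Sh ` spec"
    then obtain s where s: "s \<in> spec" "c = point_at U Sh s"
      by blast
    then obtain p where p: "p \<in> point_at U Sh s"
      using point_at_nonempty by blast
    then have "p \<in> points U Sh"
      by (simp add: point_at_def)
    then have "?r `` {p} \<in> points U Sh // ?r"
      by (rule quotientI)
    then show "c \<in> points U Sh // ?r"
      using cl[OF p] s(2) by simp
  qed
qed

lemma locally_spec:
  assumes "locally n Q" "s \<in> spec" "snat n sdvd s"
  shows "\<exists>m>0. n dvd m \<and> Q m \<and> snat m sdvd s"
  using specD[OF assms(2) assms(1)[unfolded locally_def] assms(3)] by blast

lemma subterm_sub: "x \<in> ob (subterm W) n \<Longrightarrow> y \<in> ob (subterm W) n \<Longrightarrow> x = y"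
  by (simp add: ob_subterm)

lemma subterm_nonempty: "ob (subterm W) n \<noteq> {} \<longleftrightarrow> n \<in> W"
  by (simp add: subterm_def)

text \<open>Passing from \<open>W\<close> to its closure does not affect the stalk: if a cover of a
  divisor of \<open>s\<close> lies in \<open>W\<close>, then, \<open>s\<close> being in
  \<open>spec\<close>, some member of that cover divides \<open>s\<close>.\<close>

lemma stalk_subterm:
  assumes P: "is_stalk_functor U Sh s P" and s: "s \<in> spec" and W: "W \<subseteq> {0<..}" "\<And>m k. m \<in> W \<Longrightarrow> k > 0 \<Longrightarrow> m dvd k \<Longrightarrow> k \<in> W"
  shows "terminal (set_cat U) (ob P (subterm (clos W))) \<longleftrightarrow> s \<in> nat_open W"
proof -
  have "terminal (set_cat U) (ob P (subterm (clos W))) \<longleftrightarrow> (\<exists>n>0. snat n sdvd s \<and> ob (subterm (clos W)) n \<noteq> {})"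
    by (rule stalk_terminal[OF P subterm_sheaf[OF J_closed_clos[OF W(2)]]]) (assumption | rule subterm_sub)+
  also have "\<dots> \<longleftrightarrow> (\<exists>n>0. snat n sdvd s \<and> n \<in> clos W)"
    by (simp only: subterm_nonempty)
  also have "\<dots> \<longleftrightarrow> s \<in> nat_open W"
  proof
    assume "\<exists>n>0. snat n sdvd s \<and> n \<in> clos W"
    then obtain n where "snat n sdvd s" "locally n (\<lambda>k. k \<in> W)"
      by (auto simp: clos_def)
    then show "s \<in> nat_open W"
      using locally_spec[OF _ s] unfolding nat_open_iff by blast
  next
    assume "s \<in> nat_open W"
    then obtain n where n: "n \<in> W" "snat n sdvd s"
      by (auto simp: nat_open_iff)
    then have "n > 0" using W(1) by auto
    moreover have "n \<in> clos W"
      by (rule mem_clos[OF \<open>n > 0\<close> n(1)]) (rule W(2))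
    ultimately show "\<exists>n>0. snat n sdvd s \<and> n \<in> clos W"
      using n(2) by blast
  qed
  finally show ?thesis .
qed

lemma nat_open_multiples:
  assumes "n > 0"
  shows "nat_open {m. m > 0 \<and> n dvd m} = nat_open {n}"
proof (intro equalityI subsetI)
  fix s assume "s \<in> nat_open {m. m > 0 \<and> n dvd m}"
  then obtain m where "m > 0" "n dvd m" "snat m sdvd s"
    by (auto simp: nat_open_iff)
  then show "s \<in> nat_open {n}"
    using snat_sdvd_trans[of n m s] by (simp add: nat_open_iff)
next
  fix s assume "s \<in> nat_open {n}"
  then have "snat n sdvd s"
    by (simp add: nat_open_iff)
  then show "s \<in> nat_open {m. m > 0 \<and> n dvd m}"
    unfolding nat_open_iff using assms by (intro bexI[of _ n]) simp_all
qed

lemma stalk_yon: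
  assumes P: "is_stalk_functor U Sh s P" and s: "s \<in> spec" and n: "n > 0"
  shows "terminal (set_cat U) (ob P (yon n)) \<longleftrightarrow> snat n sdvd s"
proof -
  have "terminal (set_cat U) (ob P (yon n)) \<longleftrightarrow> s \<in> nat_open {m. m > 0 \<and> n dvd m}"
    unfolding yon_def by (rule stalk_subterm[OF P s]) (blast, rule multiples_up)
  then show ?thesis
    by (simp add: nat_open_multiples[OF n] nat_open_iff)
qed

text \<open>A point in both classes has one inverse image, and by \<open>stalk_yon\<close> that
  functor tells which natural numbers divide the supernatural number.\<close>

lemma inj_point_at: "inj_on (point_at U Sh) spec"
proof (rule inj_onI)
  fix s t assume s: "s \<in> spec" and t: "t \<in> spec" and eq: "point_at U Sh s = point_at U Sh t"
  obtain p where p: "p \<in> point_at U Sh s"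
    using point_at_nonempty[OF s] by blast
  have ps: "is_stalk_functor U Sh s (inv_im p)" "is_stalk_functor U Sh t (inv_im p)"
    using p p[unfolded eq] by (simp_all add: point_at_def)
  show "s = t"
    by (rule supernat_eqI) (use stalk_yon[OF ps(1) s] stalk_yon[OF ps(2) t] in simp)
qed

text \<open>If \<open>L\<close> covers \<open>n\<close>, \<open>n\<close> divides \<open>s\<close>,
  and no member of \<open>L\<close> divides \<open>s\<close>, then no member of \<open>L\<close>
  divides any \<open>t\<close> dividing \<open>s\<close>. So the basic neighbourhood of
  \<open>s\<close> given by \<open>n\<close> and the closure of \<open>s\<close> avoids
  \<open>spec\<close>.\<close>

lemma spec_closed: "closedin pcfb spec"
proof -
  have "\<exists>B. (\<exists>n t. n > 0 \<and> snat n sdvd t \<and> B = nat_open {n} \<inter> localic closure_of {t}) \<and> s \<in> B \<and> B \<subseteq> - spec"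
    if s: "s \<in> - spec" for s
  proof -
    obtain n L where L: "L \<in> J n" "snat n sdvd s" "\<not> (\<exists>m\<in>L. snat m sdvd s)"
      using s unfolding spec_def by blast
    have "t \<notin> spec" if t: "t \<in> nat_open {n}" "t \<in> localic closure_of {s}" for t
    proof
      assume "t \<in> spec"
      then obtain m where m: "m \<in> L" "snat m sdvd t"
        using L(1) t(1) by (auto simp: spec_def nat_open_iff)
      have "openin localic (nat_open {m})"
        unfolding openin_localic using J_sieveD[OF L(1) m(1)] by (intro exI[of _ "{m}"]) simp
      moreover have "\<forall>T. t \<in> T \<and> openin localic T \<longrightarrow> s \<in> T"
        using t(2) unfolding in_closure_of by blast
      moreover have "t \<in> nat_open {m}"
        using m(2) by (simp add: nat_open_iff)
      ultimately have "s \<in> nat_open {m}"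
        by blast
      then show False
        using L(3) m(1) by (auto simp: nat_open_iff)
    qed
    moreover have "s \<in> nat_open {n} \<inter> localic closure_of {s}"
      using L(2) closure_of_subset[of "{s}" localic] by (auto simp: nat_open_iff topspace_localic)
    ultimately show ?thesis
      using L(2) J_empty[OF L(1)] by blast
  qed
  then have "openin pcfb (- spec)"
    unfolding openin_pcfb arbitrary_union_of_alt by blast
  moreover have "topspace pcfb = UNIV"
  proof -
    have "openin pcfb UNIV"
      unfolding openin_pcfb arbitrary_union_of_alt
    proof (intro ballI)
      fix s :: supernat
      have "s \<in> nat_open {1} \<inter> localic closure_of {s}"
        using snat_one_sdvd closure_of_subset[of "{s}" localic] by (auto simp: nat_open_iff topspace_localic)
      then show "\<exists>B. (\<exists>n t. n > 0 \<and> snat n sdvd t \<and> B = nat_open {n} \<inter> localic closure_of {t}) \<and> s \<in> B \<and> B \<subseteq> UNIV"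
        using snat_one_sdvd by (intro exI[of _ "nat_open {1} \<inter> localic closure_of {s}"]) auto
    qed
    then show ?thesis
      using openin_subset by blast
  qed
  ultimately show ?thesis
    by (simp add: closedin_def Compl_eq_Diff_UNIV)
qed

text \<open>
  With enough points, a sieve on \<open>n\<close> containing all points of \<open>n\<close> is a cover: the inclusion of the
  subterminal sheaf of its closure in that of \<open>n\<close> is an isomorphism at every point.
\<close>

lemma K_top_spec:
  assumes en: "has_enough_points U Sh"
  shows "K_top spec = J"
proof (intro ext equalityI subsetI)
  fix n L assume L: "L \<in> J n"
  then show "L \<in> K_top spec n"
    unfolding mem_K_top[OF J_empty[OF L] J_sieve[OF L]] by (auto simp: spec_def)
next
  fix n L assume "L \<in> K_top spec n"
  then have n: "n > 0" and sL: "is_sieve big_cell n L"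
    by (auto simp: K_top_iff)
  have cover: "\<exists>m\<in>L. snat m sdvd s" if "s \<in> spec" "snat n sdvd s" for s
    by (rule K_topD[OF \<open>L \<in> K_top spec n\<close> that])
  let ?M = "{m. m > 0 \<and> n dvd m}"
  have L: "L \<subseteq> {0<..}" "\<And>m k. m \<in> L \<Longrightarrow> k > 0 \<Longrightarrow> m dvd k \<Longrightarrow> k \<in> L"
    using sieve_big_cellD(1)[OF sL] sieve_big_cellD(4)[OF sL] by blast+
  have M: "?M \<subseteq> {0<..}" "\<And>m k. m \<in> ?M \<Longrightarrow> k > 0 \<Longrightarrow> m dvd k \<Longrightarrow> k \<in> ?M"
    by (blast, rule multiples_up)
  have LM: "locally k (\<lambda>l. l \<in> ?M)" if "locally k (\<lambda>l. l \<in> L)" for k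
    using that
  proof (rule locally_mono)
    show "stable k (\<lambda>l. l \<in> ?M)"
      by (rule stableI) (rule M(2))
    show "m \<in> ?M" if "m \<in> L" for m
      using sieve_big_cellD(1,3)[OF sL that] by simp
  qed
  have cl: "clos L \<subseteq> clos ?M"
    using LM by (auto simp: clos_def)
  let ?i = "\<lambda>k\<in>{0<..}. \<lambda>x\<in>ob (subterm (clos L)) k. undefined :: 'u"
  note SL = subterm_sheaf[OF J_closed_clos[OF L(2)]] and SM = subterm_sheaf[OF J_closed_clos[OF M(2)]]
  have i: "?i \<in> Hom PSh (subterm (clos L)) (subterm (clos ?M))"
  proof (rule h_intro[OF _ _ Sh_PSh[OF SL]])
    show "undefined \<in> ob (subterm (clos ?M)) k" if "x \<in> ob (subterm (clos L)) k" for k x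
      using cl that by (auto simp: ob_subterm)
    show "undefined = restr (subterm (clos ?M)) k l undefined" if "x \<in> ob (subterm (clos L)) k" for k l x
      using cl that by (auto simp: ob_subterm restr_subterm)
  qed
  have "is_iso (set_cat U) (ob (inv_im p) (subterm (clos L))) (ob (inv_im p) (subterm (clos ?M)))
      (ar (inv_im p) (subterm (clos L)) (subterm (clos ?M)) ?i)" if p: "p \<in> points U Sh" for p
  proof -
    obtain s where s: "s \<in> spec" and P: "is_stalk_functor U Sh s (inv_im p)"
      using point_is_stalk[OF p] by blast
    have fi: "ar (inv_im p) (subterm (clos L)) (subterm (clos ?M)) ?i \<in>
        ob (inv_im p) (subterm (clos L)) \<rightarrow>\<^sub>E ob (inv_im p) (subterm (clos ?M))"
    proof -
      have "is_functor Sh (set_cat U) (inv_im p)"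
        using P by (simp add: is_stalk_functor_def)
      from fun_ar[OF this SL SM] show ?thesis
        using i by (simp add: set_cat_hom)
    qed
    have tL: "terminal (set_cat U) (ob (inv_im p) (subterm (clos L))) \<longleftrightarrow> s \<in> nat_open L"
      by (rule stalk_subterm[OF P s L(1)]) (rule L(2))
    have tM: "terminal (set_cat U) (ob (inv_im p) (subterm (clos ?M))) \<longleftrightarrow> s \<in> nat_open ?M"
      by (rule stalk_subterm[OF P s M(1)]) (rule M(2))
    have ne: "ob (inv_im p) (subterm (clos W)) = {}"
      if "s \<notin> nat_open W" "W \<subseteq> {0<..}" and up: "\<And>m k. m \<in> W \<Longrightarrow> k > 0 \<Longrightarrow> m dvd k \<Longrightarrow> k \<in> W" for W
    proof -
      have SW: "subterm (clos W) \<in> Obj Sh"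
        by (rule subterm_sheaf[OF J_closed_clos]) (rule up)
      obtain \<gamma> where "\<And>F. F \<in> Obj Sh \<Longrightarrow> colimit_cocone (full_subcat (op_cat big_cell) (\<lambda>n. snat n sdvd s)) (set_cat U) F (ob (inv_im p) F) (\<gamma> F)"
        using P by (rule stalk_coneD) blast
      then have c: "colimit_cocone (full_subcat (op_cat big_cell) (\<lambda>n. snat n sdvd s)) (set_cat U) (subterm (clos W))
          (ob (inv_im p) (subterm (clos W))) (\<gamma> (subterm (clos W)))"
        using SW by blast
      have "False" if z: "z \<in> ob (inv_im p) (subterm (clos W))" for z
      proof -
        obtain k x where "k > 0" "snat k sdvd s" "x \<in> ob (subterm (clos W)) k"
          using stalk_jointly_surjective[OF U Sh_PSh[OF SW] c z] by blast
        then have "locally k (\<lambda>l. l \<in> W)"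
          by (simp add: ob_subterm clos_def)
        then show False
          using locally_spec[OF _ s \<open>snat k sdvd s\<close>] \<open>s \<notin> nat_open W\<close> unfolding nat_open_iff by blast
      qed
      then show ?thesis by blast
    qed
    have iff: "s \<in> nat_open L \<longleftrightarrow> s \<in> nat_open ?M"
    proof
      assume "s \<in> nat_open L"
      then show "s \<in> nat_open ?M"
        using sieve_big_cellD(1,3)[OF sL] by (auto simp: nat_open_iff)
    next
      assume "s \<in> nat_open ?M"
      then have "snat n sdvd s"
        by (simp add: nat_open_multiples[OF n] nat_open_iff)
      then show "s \<in> nat_open L"
        using cover[OF s] by (simp add: nat_open_iff)
    qed
    show ?thesis
    proof (cases "s \<in> nat_open L")
      case True
      then obtain a b where "ob (inv_im p) (subterm (clos L)) = {a}" "ob (inv_im p) (subterm (clos ?M)) = {b}"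
        using tL tM iff by (auto simp: terminal_set_cat[OF U])
      then show ?thesis
        using fi by (auto simp: is_iso_set_cat bij_betw_def)
    next
      case False
      have "ob (inv_im p) (subterm (clos L)) = {}"
        by (rule ne[OF False L(1)]) (rule L(2))
      moreover have "ob (inv_im p) (subterm (clos ?M)) = {}"
        by (rule ne[OF _ M(1)]) (use False iff in blast, rule M(2))
      ultimately show ?thesis
        using fi by (auto simp: is_iso_set_cat bij_betw_def)
    qed
  qed
  then have "is_iso Sh (subterm (clos L)) (subterm (clos ?M)) ?i"
    using en SL SM i unfolding has_enough_points_def by simp
  \<comment> \<open>An arrow back is all that is needed: its value over \<open>n\<close> puts
    \<open>n\<close> in the closure of \<open>L\<close>, which is to say that \<open>L\<close>
    covers \<open>n\<close>.\<close>
  then obtain j where j: "j \<in> Hom PSh (subterm (clos ?M)) (subterm (clos L))"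
    by (auto simp: is_iso_def)
  have "n \<in> clos ?M"
    by (rule mem_clos[OF n _ M(2)]) (use n in auto)
  then have "undefined \<in> ob (subterm (clos ?M)) n"
    by (simp add: ob_subterm)
  from h_in[OF j this n] have "locally n (\<lambda>l. l \<in> L)"
    by (simp add: ob_subterm clos_def)
  moreover have "{m. m > 0 \<and> n dvd m \<and> m \<in> L} = L"
    using sieve_big_cellD(1,3)[OF sL] by auto
  ultimately show "L \<in> J n"
    by (simp add: locally_def)
qed

text \<open>A statement that holds at the germs of every \<open>s\<close> in \<open>S\<close> holds
  on a \<open>K_top S\<close>-cover, by \<open>locally_K_top\<close>. Bijectivity of
  \<open>\<alpha>\<close> on stalks therefore gives local, and by the sheaf conditions actual,
  bijectivity on sections.\<close>

lemma enough_points: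
  assumes JS: "J = K_top S"
  shows "has_enough_points U Sh"
  unfolding has_enough_points_def
proof (intro ballI impI)
  fix F G \<alpha> assume F: "F \<in> Obj Sh" and G: "G \<in> Obj Sh" and "\<alpha> \<in> Hom Sh F G"
    and iso: "\<forall>p\<in>points U Sh. is_iso (set_cat U) (ob (inv_im p) F) (ob (inv_im p) G) (ar (inv_im p) F G \<alpha>)"
  then have \<alpha>: "\<alpha> \<in> Hom PSh F G" by simp
  note F' = Sh_PSh[OF F] and G' = Sh_PSh[OF G]
  let ?D = "\<lambda>s. full_subcat (op_cat big_cell) (\<lambda>n. snat n sdvd s)"
  \<comment> \<open>The points used are the stalks at members of \<open>S\<close>; that these are
    points of the topos is the inclusion of \<open>S\<close> in \<open>spec\<close>.\<close>
  have Sspec: "S \<subseteq> spec"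
    unfolding spec_def unfolding JS using K_topD by blast
  have stalk: "\<exists>p \<gamma> \<delta>. p \<in> points U Sh \<and> colimit_cocone (?D s) (set_cat U) F (ob (inv_im p) F) \<gamma> \<and>
      colimit_cocone (?D s) (set_cat U) G (ob (inv_im p) G) \<delta> \<and>
      (\<forall>n>0. snat n sdvd s \<longrightarrow> (\<forall>x\<in>ob F n. ar (inv_im p) F G \<alpha> (\<gamma> n x) = \<delta> n (\<alpha> n x)))" if s: "s \<in> S" for s
  proof -
    obtain p where p: "p \<in> point_at U Sh s"
      using point_at_nonempty Sspec s by blast
    then have P: "is_stalk_functor U Sh s (inv_im p)" "p \<in> points U Sh"
      by (simp_all add: point_at_def)
    obtain \<gamma> where "\<And>F. F \<in> Obj Sh \<Longrightarrow> colimit_cocone (?D s) (set_cat U) F (ob (inv_im p) F) (\<gamma> F)"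
      "\<And>F G \<alpha> n x. F \<in> Obj Sh \<Longrightarrow> G \<in> Obj Sh \<Longrightarrow> \<alpha> \<in> Hom PSh F G \<Longrightarrow> n > 0 \<Longrightarrow> snat n sdvd s \<Longrightarrow> x \<in> ob F n \<Longrightarrow>
        ar (inv_im p) F G \<alpha> (\<gamma> F n x) = \<gamma> G n (\<alpha> n x)"
      using P(1) by (rule stalk_coneD) blast
    then show ?thesis
      using P(2) F G \<alpha> by blast
  qed
  have ev_eq: "\<exists>k>0. n dvd k \<and> m dvd k \<and> snat k sdvd s \<and> restr H n k x = restr H m k y"
    if "H \<in> Obj Sh" "colimit_cocone (?D s) (set_cat U) H X \<gamma>" "n > 0" "snat n sdvd s" "x \<in> ob H n"
      "m > 0" "snat m sdvd s" "y \<in> ob H m" "\<gamma> n x = \<gamma> m y" for H s X \<gamma> n m x y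
  proof -
    interpret pt: supernatural_point U s
      by unfold_locales (rule U)
    show ?thesis
      by (rule pt.germs_eventually_equal[OF Sh_PSh[OF that(1)] that(2-9)])
  qed
  have inj: "x = y" if n: "n > 0" and x: "x \<in> ob F n" and y: "y \<in> ob F n" and eq: "\<alpha> n x = \<alpha> n y" for n x y
  proof (rule separated[OF F x y])
    show "locally n (\<lambda>m. restr F n m x = restr F n m y)"
      unfolding locally_K_top[OF JS]
    proof (intro conjI n stable_restr_eq[OF F' x y n] ballI impI)
      fix s assume s: "s \<in> S" "snat n sdvd s"
      obtain p \<gamma> \<delta> where p: "p \<in> points U Sh" and cF: "colimit_cocone (?D s) (set_cat U) F (ob (inv_im p) F) \<gamma>"
        and nat: "\<forall>n>0. snat n sdvd s \<longrightarrow> (\<forall>x\<in>ob F n. ar (inv_im p) F G \<alpha> (\<gamma> n x) = \<delta> n (\<alpha> n x))"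
        using stalk[OF s(1)] by blast
      have "stalk_cocone s F (ob (inv_im p) F) \<gamma>"
        using cF unfolding colimit_stalk_iff[OF F'] by blast
      note \<gamma> = stalk_coconeD(2)[OF this n s(2)]
      have "bij_betw (ar (inv_im p) F G \<alpha>) (ob (inv_im p) F) (ob (inv_im p) G)"
        using iso p by (simp add: is_iso_set_cat)
      moreover have "ar (inv_im p) F G \<alpha> (\<gamma> n x) = ar (inv_im p) F G \<alpha> (\<gamma> n y)"
        using nat n s(2) x y eq by simp
      ultimately have "\<gamma> n x = \<gamma> n y"
        using \<gamma>[OF x] \<gamma>[OF y] by (auto simp: bij_betw_def inj_on_def)
      from ev_eq[OF F cF n s(2) x n s(2) y this]
      show "\<exists>m>0. n dvd m \<and> restr F n m x = restr F n m y \<and> snat m sdvd s"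
        by blast
    qed
  qed
  have surj: "\<exists>x\<in>ob F n. \<alpha> n x = y" if n: "n > 0" and y: "y \<in> ob G n" for n y
  proof -
    have l: "locally n (\<lambda>m. \<exists>x\<in>ob F m. restr G n m y = \<alpha> m x)"
      unfolding locally_K_top[OF JS]
    proof (intro conjI n stable_image[OF F' G' \<alpha> n y] ballI impI)
      fix s assume s: "s \<in> S" "snat n sdvd s"
      obtain p \<gamma> \<delta> where p: "p \<in> points U Sh" and cF: "colimit_cocone (?D s) (set_cat U) F (ob (inv_im p) F) \<gamma>"
        and cG: "colimit_cocone (?D s) (set_cat U) G (ob (inv_im p) G) \<delta>"
        and nat: "\<forall>n>0. snat n sdvd s \<longrightarrow> (\<forall>x\<in>ob F n. ar (inv_im p) F G \<alpha> (\<gamma> n x) = \<delta> n (\<alpha> n x))"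
        using stalk[OF s(1)] by blast
      have "stalk_cocone s G (ob (inv_im p) G) \<delta>"
        using cG unfolding colimit_stalk_iff[OF G'] by blast
      note \<delta>y = stalk_coconeD(2)[OF this n s(2) y]
      have "bij_betw (ar (inv_im p) F G \<alpha>) (ob (inv_im p) F) (ob (inv_im p) G)"
        using iso p by (simp add: is_iso_set_cat)
      then obtain z where z: "z \<in> ob (inv_im p) F" "\<delta> n y = ar (inv_im p) F G \<alpha> z"
        using \<delta>y by (auto simp: bij_betw_def)
      obtain m x where x: "m > 0" "snat m sdvd s" "x \<in> ob F m" "z = \<gamma> m x"
        using stalk_jointly_surjective[OF U F' cF z(1)] by blast
      have "\<delta> n y = \<delta> m (\<alpha> m x)"
        using nat x z by simp
      from ev_eq[OF G cG n s(2) y x(1,2) h_in[OF \<alpha> x(3,1)] this]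
      obtain k where k: "k > 0" "n dvd k" "m dvd k" "snat k sdvd s" "restr G n k y = restr G m k (\<alpha> m x)"
        by blast
      have "restr G n k y = \<alpha> k (restr F m k x)"
        using h_restr[OF \<alpha> x(3,1) k(1,3)] k(5) by simp
      then show "\<exists>k>0. n dvd k \<and> (\<exists>x\<in>ob F k. restr G n k y = \<alpha> k x) \<and> snat k sdvd s"
        using k p_in[OF F' x(3,1) k(1,3)] by blast
    qed
    \<comment> \<open>Preimages of \<open>y\<close> exist locally, and by \<open>inj\<close> they
      are unique wherever they exist, so they glue.\<close>
    have "\<exists>x\<in>ob F n. \<forall>m>0. \<forall>w\<in>ob F m. n dvd m \<longrightarrow> restr G n m y = \<alpha> m w \<longrightarrow> restr F n m x = w"
    proof (rule glue_rel[OF F l])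
      fix m w w' assume "m > 0" "w \<in> ob F m" "w' \<in> ob F m" "restr G n m y = \<alpha> m w" "restr G n m y = \<alpha> m w'"
      then show "w = w'"
        using inj[of m w w'] by simp
    next
      fix m k w assume *: "m > 0" "n dvd m" "w \<in> ob F m" "restr G n m y = \<alpha> m w" "k > 0" "m dvd k"
      show "restr G n k y = \<alpha> k (restr F m k w)"
        using p_restr[OF G' y n *(1,5,2,6)] h_restr[OF \<alpha> *(3,1,5,6)] *(4) by simp
    qed
    then obtain x where x: "x \<in> ob F n" and xm: "\<forall>m>0. \<forall>w\<in>ob F m. n dvd m \<longrightarrow> restr G n m y = \<alpha> m w \<longrightarrow> restr F n m x = w"
      by blast
    have "\<alpha> n x = y"
    proof (rule separated[OF G h_in[OF \<alpha> x n] y])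
      show "locally n (\<lambda>m. restr G n m (\<alpha> n x) = restr G n m y)"
      proof (rule locally_mono[OF l stable_restr_eq[OF G' h_in[OF \<alpha> x n] y n]])
        fix m assume m: "m > 0" "n dvd m" "\<exists>x\<in>ob F m. restr G n m y = \<alpha> m x"
        then obtain w where w: "w \<in> ob F m" "restr G n m y = \<alpha> m w" by blast
        then have "restr F n m x = w"
          using xm m by blast
        then show "restr G n m (\<alpha> n x) = restr G n m y"
          using h_restr[OF \<alpha> x n m(1,2)] w(2) by simp
      qed
    qed
    then show ?thesis
      using x by blast
  qed
  show "is_iso Sh F G \<alpha>"
    unfolding is_iso_sheaves
  proof (rule iso_of_bij[OF bc \<alpha> F' G'])
    fix n assume "n \<in> Obj big_cell"
    then have n: "n > 0" by simp
    show "bij_betw (\<alpha> n) (ob F n) (ob G n)"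
      unfolding bij_betw_def using inj[OF n] surj[OF n] h_in[OF \<alpha> _ n]
      by (auto intro!: inj_onI) (metis image_eqI)
  qed
qed

end

section \<open>The space of points\<close>

lemma homeomorphic_map_generated:
  assumes bij: "bij_betw f (topspace X) C" and B: "B = (\<lambda>V. f ` V) ` {V. openin X V}"
  shows "homeomorphic_map X (topology_generated_by B) f"
proof -
  have inj: "inj_on f (topspace X)"
    using bij by (simp add: bij_betw_def)
  \<comment> \<open>The generating family is the image of a topology under an injection, so it is
    closed under unions and finite intersections and generating adds no open sets.\<close>
  have gen: "\<exists>V. openin X V \<and> T = f ` V" if "generate_topology_on B T" for T
    using that
  proof (induction rule: generate_topology_on.induct)
    case Empty
    then show ?case by (intro exI[of _ "{}"]) simp
  next
    case (Int a b)
    then obtain V W where VW: "openin X V" "a = f ` V" "openin X W" "b = f ` W" by blast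
    then have "a \<inter> b = f ` (V \<inter> W)"
      using inj_on_image_Int[OF inj, of V W] openin_subset by blast
    then show ?case
      using VW by (intro exI[of _ "V \<inter> W"]) (simp add: openin_Int)
  next
    case (UN K)
    then obtain V where V: "\<And>k. k \<in> K \<Longrightarrow> openin X (V k) \<and> k = f ` V k"
      by metis
    then have "\<Union>K = f ` (\<Union>k\<in>K. V k)"
      by blast
    then show ?case
      using V by (intro exI[of _ "\<Union>k\<in>K. V k"]) auto
  next
    case (Basis s)
    then show ?case using B by blast
  qed
  have op: "openin (topology_generated_by B) T \<longleftrightarrow> (\<exists>V. openin X V \<and> T = f ` V)" for T
  proof
    assume "openin (topology_generated_by B) T"
    then show "\<exists>V. openin X V \<and> T = f ` V"
      by (intro gen) (simp add: openin_topology_generated_by)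
  next
    assume "\<exists>V. openin X V \<and> T = f ` V"
    then show "openin (topology_generated_by B) T"
      unfolding B by (auto intro: topology_generated_by_Basis)
  qed
  have top: "topspace (topology_generated_by B) = f ` topspace X"
    unfolding topology_generated_by_topspace B using openin_subset by auto
  show ?thesis
  proof (rule bijective_open_imp_homeomorphic_map)
    show "continuous_map X (topology_generated_by B) f"
      unfolding continuous_map_def top
    proof (intro conjI allI impI)
      fix T assume "openin (topology_generated_by B) T"
      then obtain V where V: "openin X V" "T = f ` V"
        using op by blast
      then have "{x \<in> topspace X. f x \<in> T} = V"
        using inj openin_subset[OF V(1)] by (auto simp: inj_on_def)
      then show "openin X {x \<in> topspace X. f x \<in> T}"
        using V(1) by simp
    qed auto
    show "open_map X (topology_generated_by B) f"
      unfolding open_map_def using op by blast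
  qed (use top inj in auto)
qed

text \<open>Two sections over \<open>n\<close> name two arrows from \<open>yon n\<close>.\<close>

lemma (in big_cell_site) subterminal_unique:
  assumes u: "subterminal Sh u" and n: "n > 0" and x: "x \<in> ob u n" "y \<in> ob u n"
  shows "x = y"
proof -
  have uS: "u \<in> Obj Sh"
    using u by (simp add: subterminal_def)
  have "hat n u x = hat n u y"
    using u yon_sheaf[of n] hat(1)[OF uS n x(1)] hat(1)[OF uS n x(2)] unfolding subterminal_def by simp
  then show ?thesis
    using hat(2)[OF uS n x(1)] hat(2)[OF uS n x(2)] by metis
qed

text \<open>Subterminal sheaves match open sets: \<open>u\<close> becomes terminal at
  \<open>s\<close> exactly when it has a section over some divisor of \<open>s\<close>, and the set
  of all such \<open>s\<close> is open. Conversely the open set of \<open>I\<close> is cut out by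
  the subterminal sheaf generated by \<open>I\<close>.\<close>

lemma (in big_cell_site) space_of_points_homeomorphic:
  "homeomorphic_map (subtopology localic spec) (space_of_points U Sh) (point_at U Sh)"
  unfolding space_of_points_def
proof (rule homeomorphic_map_generated)
  have ts: "topspace (subtopology localic spec) = spec"
    by (simp add: topspace_localic)
  show "bij_betw (point_at U Sh) (topspace (subtopology localic spec)) (point_classes U Sh)"
    unfolding ts using inj_point_at by (simp add: bij_betw_def point_classes_eq)
  let ?B = "\<lambda>u. {c \<in> point_classes U Sh. \<exists>p\<in>c. terminal (set_cat U) (ob (inv_im p) u)}"
  have B: "?B u = point_at U Sh ` {s \<in> spec. Q s}"
    if Q: "\<And>s P. s \<in> spec \<Longrightarrow> is_stalk_functor U Sh s P \<Longrightarrow> terminal (set_cat U) (ob P u) \<longleftrightarrow> Q s" for u Q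
  proof -
    have "(\<exists>p\<in>point_at U Sh s. terminal (set_cat U) (ob (inv_im p) u)) \<longleftrightarrow> Q s" if s: "s \<in> spec" for s
      using point_at_nonempty[OF s] Q[OF s] by (auto simp: point_at_def)
    then show ?thesis
      unfolding point_classes_eq by auto
  qed
  show "{?B u |u. subterminal Sh u} = (\<lambda>V. point_at U Sh ` V) ` {V. openin (subtopology localic spec) V}"
  proof (intro equalityI subsetI)
    fix T assume "T \<in> {?B u |u. subterminal Sh u}"
    then obtain u where u: "subterminal Sh u" "T = ?B u"
      by blast
    then have uS: "u \<in> Obj Sh"
      by (simp add: subterminal_def)
    let ?I = "{n. n > 0 \<and> ob u n \<noteq> {}}"
    have "T = point_at U Sh ` {s \<in> spec. s \<in> nat_open ?I}"
      unfolding u(2)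
    proof (rule B)
      fix s P assume "s \<in> spec" and P: "is_stalk_functor U Sh s P"
      have "terminal (set_cat U) (ob P u) \<longleftrightarrow> (\<exists>n>0. snat n sdvd s \<and> ob u n \<noteq> {})"
        by (rule stalk_terminal[OF P uS]) (rule subterminal_unique[OF u(1)])
      then show "terminal (set_cat U) (ob P u) \<longleftrightarrow> s \<in> nat_open ?I"
        unfolding nat_open_iff by blast
    qed
    moreover have "{s \<in> spec. s \<in> nat_open ?I} = nat_open ?I \<inter> spec"
      by blast
    moreover have "openin localic (nat_open ?I)"
      unfolding openin_localic by (intro exI[of _ ?I]) auto
    then have "openin (subtopology localic spec) (nat_open ?I \<inter> spec)"
      by (auto simp: openin_subtopology)
    ultimately show "T \<in> (\<lambda>V. point_at U Sh ` V) ` {V. openin (subtopology localic spec) V}"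
      by blast
  next
    fix T assume "T \<in> (\<lambda>V. point_at U Sh ` V) ` {V. openin (subtopology localic spec) V}"
    then obtain I where I: "I \<subseteq> {0<..}" "T = point_at U Sh ` (nat_open I \<inter> spec)"
      by (auto simp: openin_subtopology openin_localic)
    \<comment> \<open>Closing \<open>I\<close> under multiples leaves \<open>nat_open I\<close>
      unchanged and gives a set whose \<open>clos\<close> defines a sheaf.\<close>
    define W where "W = {m. m > 0 \<and> (\<exists>n\<in>I. n dvd m)}"
    have W: "W \<subseteq> {0<..}" "\<And>m k. m \<in> W \<Longrightarrow> k > 0 \<Longrightarrow> m dvd k \<Longrightarrow> k \<in> W"
    proof -
      fix m k assume "m \<in> W" "k > 0" "m dvd k"
      then show "k \<in> W"
        unfolding W_def by (auto dest: dvd_trans)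
    qed (auto simp: W_def)
    have "s \<in> nat_open W \<longleftrightarrow> s \<in> nat_open I" for s
      unfolding nat_open_iff
    proof
      assume "\<exists>m\<in>W. snat m sdvd s"
      then obtain m n where "m > 0" "n \<in> I" "n dvd m" "snat m sdvd s"
        by (auto simp: W_def)
      then show "\<exists>n\<in>I. snat n sdvd s"
        using snat_sdvd_trans by blast
    next
      assume "\<exists>n\<in>I. snat n sdvd s"
      moreover have "I \<subseteq> W"
        unfolding W_def using I(1) dvd_refl by blast
      ultimately show "\<exists>m\<in>W. snat m sdvd s"
        by blast
    qed
    then have eq: "{s \<in> spec. s \<in> nat_open W} = nat_open I \<inter> spec"
      by blast
    let ?u = "subterm (clos W)"
    have uS: "?u \<in> Obj Sh"
      by (rule subterm_sheaf[OF J_closed_clos]) (rule W(2))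
    have "subterminal Sh ?u"
      unfolding subterminal_def
    proof (intro conjI uS ballI)
      fix F \<alpha> \<beta> assume "\<alpha> \<in> Hom Sh F ?u" "\<beta> \<in> Hom Sh F ?u"
      then have h: "\<alpha> \<in> Hom PSh F ?u" "\<beta> \<in> Hom PSh F ?u" by simp_all
      show "\<alpha> = \<beta>"
        by (rule h_eqI[OF h]) (rule subterm_sub, rule h_in[OF h(1)], assumption+, rule h_in[OF h(2)])
    qed
    moreover have "?B ?u = point_at U Sh ` {s \<in> spec. s \<in> nat_open W}"
      by (rule B) (rule stalk_subterm[OF _ _ W], assumption+)
    ultimately show "T \<in> {?B u |u. subterminal Sh u}"
      unfolding I(2) eq[symmetric] by (intro CollectI exI[of _ ?u]) simp
  qed
qed

subsection \<open>The correspondence with pcfb-closed sets\<close>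

lemma localic_closure_of_singleton: "x \<in> localic closure_of {s} \<longleftrightarrow> x sdvd s"
proof -
  have o: "openin localic (nat_open {n})" if "n > 0" for n
    unfolding openin_localic using that by (intro exI[of _ "{n}"]) simp
  have "x \<in> localic closure_of {s} \<longleftrightarrow> (\<forall>T. x \<in> T \<and> openin localic T \<longrightarrow> s \<in> T)"
    by (auto simp: in_closure_of topspace_localic)
  also have "\<dots> \<longleftrightarrow> (\<forall>n>0. snat n sdvd x \<longrightarrow> snat n sdvd s)"
  proof (intro iffI allI impI)
    fix n :: nat assume a: "\<forall>T. x \<in> T \<and> openin localic T \<longrightarrow> s \<in> T" and n: "0 < n" "snat n sdvd x"
    then have "s \<in> nat_open {n}"
      using a[THEN spec, of "nat_open {n}"] o[OF n(1)] by (simp add: nat_open_iff)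
    then show "snat n sdvd s"
      by (simp add: nat_open_iff)
  next
    fix T assume a: "\<forall>n>0. snat n sdvd x \<longrightarrow> snat n sdvd s" and "x \<in> T \<and> openin localic T"
    then obtain I where "I \<subseteq> {0<..}" "T = nat_open I" "x \<in> T"
      by (auto simp: openin_localic)
    then show "s \<in> T"
      using a by (auto simp: nat_open_iff)
  qed
  also have "\<dots> \<longleftrightarrow> x sdvd s"
    by (rule sdvd_iff_divisors[symmetric])
  finally show ?thesis .
qed

text \<open>A basic neighbourhood of \<open>s\<close> is given by some \<open>n\<close> and some
  multiple \<open>t\<close> of \<open>s\<close>; replacing \<open>t\<close> by \<open>s\<close>
  shrinks it, so it may be described by \<open>s\<close> alone.\<close>

lemma closedin_pcfbD:
  assumes S: "closedin pcfb S" and s: "s \<notin> S"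
  shows "\<exists>n>0. snat n sdvd s \<and> (\<forall>t\<in>S. snat n sdvd t \<longrightarrow> \<not> t sdvd s)"
proof -
  let ?P = "\<lambda>B. \<exists>n t. n > 0 \<and> snat n sdvd t \<and> B = nat_open {n} \<inter> localic closure_of {t}"
  have "openin pcfb UNIV"
    unfolding openin_pcfb arbitrary_union_of_alt
  proof (intro ballI exI conjI)
    fix x :: supernat
    show "(1 :: nat) > 0" by simp
    show "snat 1 sdvd x" by (rule snat_one_sdvd)
    then show "x \<in> nat_open {1} \<inter> localic closure_of {x}"
      by (simp add: nat_open_iff localic_closure_of_singleton sdvd_refl)
  qed auto
  then have "topspace pcfb = UNIV"
    using openin_subset by blast
  then have "openin pcfb (- S)"
    using S by (simp add: closedin_def Compl_eq_Diff_UNIV)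
  then obtain B where "?P B" "s \<in> B" "B \<subseteq> - S"
    using s unfolding openin_pcfb arbitrary_union_of_alt by blast
  then obtain n t where n: "n > 0" "snat n sdvd s" "s sdvd t" "nat_open {n} \<inter> localic closure_of {t} \<subseteq> - S"
    by (auto simp: nat_open_iff localic_closure_of_singleton)
  have "\<not> x sdvd s" if "x \<in> S" "snat n sdvd x" for x
    using n(4) that sdvd_trans[OF _ n(3)] by (auto simp: nat_open_iff localic_closure_of_singleton)
  then show ?thesis
    using n(1,2) by blast
qed

text \<open>For \<open>s\<close> outside \<open>S\<close>, closedness gives an \<open>n\<close>
  dividing \<open>s\<close> such that no \<open>t\<close> in \<open>S\<close> over \<open>n\<close>
  divides \<open>s\<close>. Hence each such \<open>t\<close> has a natural divisor not dividing
  \<open>s\<close>, and the multiples of \<open>n\<close> not dividing \<open>s\<close> cover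
  \<open>n\<close> for \<open>K_top S\<close>. No member of this cover divides \<open>s\<close>, so
  \<open>s\<close> is not in \<open>spec\<close>.\<close>

lemma (in big_cell_site) spec_K_top:
  assumes J: "J = K_top S" and S: "closedin pcfb S"
  shows "spec = S"
proof (intro equalityI subsetI)
  fix s assume s: "s \<in> S"
  show "s \<in> spec"
    unfolding spec_def unfolding J mem_Collect_eq by (intro allI ballI impI) (rule K_topD[OF _ s])
next
  fix s assume s: "s \<in> spec"
  show "s \<in> S"
  proof (rule ccontr)
    assume "s \<notin> S"
    then obtain n where n: "n > 0" "snat n sdvd s" and no: "\<And>t. t \<in> S \<Longrightarrow> snat n sdvd t \<Longrightarrow> \<not> t sdvd s"
      using closedin_pcfbD[OF S] by blast
    let ?L = "{m. m > 0 \<and> n dvd m \<and> \<not> snat m sdvd s}"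
    have "stable n (\<lambda>m. \<not> snat m sdvd s)"
      by (rule stableI) (use snat_sdvd_trans in blast)
    then have sL: "is_sieve big_cell n ?L"
      by (rule sieve_stable[OF n(1)])
    have LK: "?L \<in> K_top S n"
      unfolding mem_K_top[OF n(1) sL]
    proof (intro ballI impI)
      fix t assume t: "t \<in> S" "snat n sdvd t"
      then obtain m where m: "m > 0" "snat m sdvd t" "\<not> snat m sdvd s"
        using no[OF t] sdvd_iff_divisors[of t s] by blast
      have "snat (lcm n m) sdvd t" "\<not> snat (lcm n m) sdvd s" "lcm n m > 0"
        using snat_lcm_sdvd[OF n(1) m(1)] t m n(1) by (auto simp: lcm_pos_nat)
      then show "\<exists>m\<in>?L. snat m sdvd t"
        by (intro bexI[of _ "lcm n m"]) auto
    qed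
    have "\<forall>n. \<forall>L\<in>K_top S n. snat n sdvd s \<longrightarrow> (\<exists>m\<in>L. snat m sdvd s)"
      using s[unfolded spec_def mem_Collect_eq] unfolding J .
    from this[rule_format, OF LK n(2)] show False
      by blast
  qed
qed

section \<open>Sheaves on subspaces\<close>

lemma space_sheaf_presheaf: "F \<in> Obj (space_sheaves U X) \<Longrightarrow> F \<in> Obj (presheaves U (opens X))"
  by (simp add: space_sheaves_def Obj_sheaves)

lemma open_coversD:
  assumes "L \<in> open_covers X V"
  shows "openin X V" "is_sieve (opens X) V L" "\<Union>L = V"
    "d \<in> L \<Longrightarrow> openin X d" "d \<in> L \<Longrightarrow> openin X e \<Longrightarrow> e \<subseteq> d \<Longrightarrow> e \<in> L"
proof -
  show *: "openin X V" "is_sieve (opens X) V L" "\<Union>L = V"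
    using assms by (auto simp: open_covers_def split: if_splits)
  show d: "openin X d" if "d \<in> L"
    using *(2) that unfolding is_sieve_def arrow_to_opens by blast
  show "e \<in> L" if "d \<in> L" "openin X e" "e \<subseteq> d"
    using *(2) that d[OF that(1)] unfolding is_sieve_def arrow_to_opens by blast
qed

text \<open>The familiar sheaf condition, with agreement on pairwise intersections, extracted from
  the one for covering sieves: the family is extended to the sieve of all opens contained in some
  \<open>B i\<close>.\<close>

lemma space_glue:
  assumes F: "F \<in> Obj (space_sheaves U X)" and B: "\<And>i. i \<in> I \<Longrightarrow> openin X (B i)" and x: "\<And>i. i \<in> I \<Longrightarrow> x i \<in> ob F (B i)"
    and agree: "\<And>i j. i \<in> I \<Longrightarrow> j \<in> I \<Longrightarrow> restr F (B i) (B i \<inter> B j) (x i) = restr F (B j) (B i \<inter> B j) (x j)"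
    and V: "V = (\<Union>i\<in>I. B i)"
  shows "\<exists>!y. y \<in> ob F V \<and> (\<forall>i\<in>I. restr F V (B i) y = x i)"
proof -
  note F' = space_sheaf_presheaf[OF F] and C = is_category_opens[of X]
  have oV: "openin X V"
    unfolding V using B by blast
  define L where "L = {W. openin X W \<and> (\<exists>i\<in>I. W \<subseteq> B i)}"
  define k where "k W = (SOME i. i \<in> I \<and> W \<subseteq> B i)" for W
  have k: "k W \<in> I" "W \<subseteq> B (k W)" if "W \<in> L" for W
    using someI_ex[of "\<lambda>i. i \<in> I \<and> W \<subseteq> B i"] that unfolding k_def L_def by blast+
  define x' where "x' W = restr F (B (k W)) W (x (k W))" for W
  have x': "restr F (B i) W (x i) = x' W" if i: "i \<in> I" and W: "openin X W" "W \<subseteq> B i" for i W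
  proof -
    have WL: "W \<in> L"
      using i W unfolding L_def by blast
    note j = k[OF WL]
    have o: "openin X (B i \<inter> B (k W))"
      using B[OF i] B[OF j(1)] by (rule openin_Int)
    have "restr F (B i) W (x i) = restr F (B i \<inter> B (k W)) W (restr F (B i) (B i \<inter> B (k W)) (x i))"
      by (rule restr_restr[OF C F' _ _ x[OF i], symmetric]) (use W j o B i in \<open>auto simp: arrow_to_opens\<close>)
    also have "\<dots> = restr F (B i \<inter> B (k W)) W (restr F (B (k W)) (B i \<inter> B (k W)) (x (k W)))"
      using agree[OF i j(1)] by simp
    also have "\<dots> = x' W"
      unfolding x'_def by (rule restr_restr[OF C F' _ _ x[OF j(1)]]) (use W j o B in \<open>auto simp: arrow_to_opens\<close>)
    finally show ?thesis .
  qed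
  have x'_in: "x' W \<in> ob F W" if "W \<in> L" for W
    unfolding x'_def by (rule restr_in[OF C F' _ x[OF k(1)[OF that]]])
      (use k[OF that] B that in \<open>auto simp: arrow_to_opens L_def\<close>)
  have L: "L \<in> open_covers X V"
  proof -
    have "is_sieve (opens X) V L"
      unfolding is_sieve_def L_def arrow_to_opens V using B oV V by blast
    moreover have "\<Union>L = V"
      unfolding L_def V using B openin_subset by fastforce
    ultimately show ?thesis
      using oV by (simp add: open_covers_def)
  qed
  have m: "matching_family (opens X) F L x'"
    unfolding matching_family_def
  proof (intro ballI conjI allI impI)
    fix W T assume W: "W \<in> L" and T: "arrow_to (opens X) T W"
    have "restr F W T (x' W) = restr F (B (k W)) T (x (k W))"
      unfolding x'_def by (rule restr_restr[OF C F' _ T x[OF k(1)[OF W]]])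
        (use k[OF W] B W in \<open>auto simp: arrow_to_opens L_def\<close>)
    then show "restr F W T (x' W) = x' T"
      using x'[OF k(1)[OF W]] T k(2)[OF W] by (auto simp: arrow_to_opens)
  qed (rule x'_in)
  have iff: "(\<forall>i\<in>I. restr F V (B i) y = x i) \<longleftrightarrow> (\<forall>W\<in>L. restr F V W y = x' W)" if y: "y \<in> ob F V" for y
  proof
    assume a: "\<forall>i\<in>I. restr F V (B i) y = x i"
    show "\<forall>W\<in>L. restr F V W y = x' W"
    proof
      fix W assume W: "W \<in> L"
      have "restr F V W y = restr F (B (k W)) W (restr F V (B (k W)) y)"
        by (rule restr_restr[OF C F' _ _ y, symmetric]) (use k[OF W] B W oV V in \<open>auto simp: arrow_to_opens L_def\<close>)
      then show "restr F V W y = x' W"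
        using a k(1)[OF W] by (simp add: x'_def)
    qed
  next
    assume a: "\<forall>W\<in>L. restr F V W y = x' W"
    show "\<forall>i\<in>I. restr F V (B i) y = x i"
    proof
      fix i assume i: "i \<in> I"
      then have "B i \<in> L"
        using B by (auto simp: L_def)
      then have "restr F V (B i) y = restr F (B i) (B i) (x i)"
        using a x'[OF i B[OF i]] by simp
      then show "restr F V (B i) y = x i"
        using restr_id[OF C F' _ x[OF i]] B[OF i] by simp
    qed
  qed
  have "\<exists>!y. y \<in> ob F V \<and> (\<forall>W\<in>L. restr F V W y = x' W)"
    using F oV L m unfolding space_sheaves_def Obj_sheaves is_sheaf_def by simp
  then show ?thesis
    using iff by (metis (no_types, lifting))
qed

lemma space_separated:
  assumes F: "F \<in> Obj (space_sheaves U X)" and B: "\<And>i. i \<in> I \<Longrightarrow> openin X (B i)" and V: "V = (\<Union>i\<in>I. B i)"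
    and y: "y \<in> ob F V" "z \<in> ob F V" "\<And>i. i \<in> I \<Longrightarrow> restr F V (B i) y = restr F V (B i) z"
  shows "y = z"
proof -
  note F' = space_sheaf_presheaf[OF F] and C = is_category_opens[of X]
  have oV: "openin X V"
    unfolding V using B by blast
  have a: "arrow_to (opens X) (B i) V" if "i \<in> I" for i
    using B that oV V by (auto simp: arrow_to_opens)
  have "\<exists>!w. w \<in> ob F V \<and> (\<forall>i\<in>I. restr F V (B i) w = restr F V (B i) y)"
  proof (rule space_glue[OF F B _ _ V])
    show "restr F V (B i) y \<in> ob F (B i)" if "i \<in> I" for i
      by (rule restr_in[OF C F' a[OF that] y(1)])
    show "restr F (B i) (B i \<inter> B j) (restr F V (B i) y) = restr F (B j) (B i \<inter> B j) (restr F V (B j) y)"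
      if ij: "i \<in> I" "j \<in> I" for i j
    proof -
      have "arrow_to (opens X) (B i \<inter> B j) (B i)" "arrow_to (opens X) (B i \<inter> B j) (B j)"
        using B ij by (auto simp: arrow_to_opens)
      then show ?thesis
        using restr_restr[OF C F' a[OF ij(1)] _ y(1)] restr_restr[OF C F' a[OF ij(2)] _ y(1)] by simp
    qed
  qed
  then show ?thesis
    using y by metis
qed

text \<open>One definition for both comparison functors of the square: \<open>S = UNIV\<close> gives
  \<open>base_sections\<close>.\<close>

definition sections_on ::
  "supernat set \<Rightarrow> ((supernat set, 'u) presheaf, supernat set \<Rightarrow> 'u \<Rightarrow> 'u, (nat, 'u) presheaf, nat \<Rightarrow> 'u \<Rightarrow> 'u) fctr"
  where
  "sections_on S =
     \<lparr>ob = (\<lambda>F. \<lparr>ob = (\<lambda>n. ob F (nat_open {n} \<inter> S)), ar = (\<lambda>m n. ar F (nat_open {m} \<inter> S) (nat_open {n} \<inter> S))\<rparr>),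
      ar = (\<lambda>F G \<alpha>. \<lambda>n\<in>Obj big_cell. \<alpha> (nat_open {n} \<inter> S))\<rparr>"

lemma sections_on_UNIV: "sections_on UNIV = base_sections"
  by (simp add: sections_on_def base_sections_def)

section \<open>Comparison of sheaves on a subspace with sheaves on the big cell\<close>

locale subspace_site =
  fixes U :: "'u set set" and S :: "supernat set"
  assumes U: "set_universe U"
begin

sublocale big_cell_site U "K_top S"
  using U by (rule big_cell_site_K_top)

abbreviation X :: "supernat topology"
  where "X \<equiv> subtopology localic S"

abbreviation ShS :: "((supernat set, 'u) presheaf, supernat set \<Rightarrow> 'u \<Rightarrow> 'u) cat"
  where "ShS \<equiv> space_sheaves U X"

abbreviation b :: "nat \<Rightarrow> supernat set"
  where "b n \<equiv> nat_open {n} \<inter> S"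

lemma cat_ShS: "is_category ShS"
  unfolding space_sheaves_def by (rule is_category_sheaves[OF is_category_opens])

lemma Hom_ShS: "Hom ShS = Hom (presheaves U (opens X))" and Cmp_ShS: "Cmp ShS = Cmp (presheaves U (opens X))"
  and Idn_ShS: "Idn ShS = Idn (presheaves U (opens X))"
  by (simp_all add: space_sheaves_def)

lemma open_b: "n > 0 \<Longrightarrow> openin X (b n)"
  unfolding openin_subtopology openin_localic by (intro exI[of _ "nat_open {n}"] conjI exI[of _ "{n}"]) auto

lemma b_mono: "n dvd m \<Longrightarrow> m > 0 \<Longrightarrow> b m \<subseteq> b n"
  using snat_sdvd_trans by (auto simp: nat_open_iff)

lemma b_lcm: "m > 0 \<Longrightarrow> n > 0 \<Longrightarrow> b m \<inter> b n = b (lcm m n)"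
  using snat_lcm_sdvd[of m n] by (auto simp: nat_open_iff)

lemma arrow_b: "n > 0 \<Longrightarrow> m > 0 \<Longrightarrow> b m \<subseteq> b n \<Longrightarrow> arrow_to (opens X) (b m) (b n)"
  using open_b by (simp add: arrow_to_opens)

lemma open_basis:
  assumes "openin X V" "s \<in> V"
  shows "\<exists>n>0. s \<in> b n \<and> b n \<subseteq> V"
proof -
  obtain I where I: "I \<subseteq> {0<..}" "V = nat_open I \<inter> S"
    using assms(1) by (auto simp: openin_subtopology openin_localic)
  then obtain n where n: "n \<in> I" "snat n sdvd s" "s \<in> S"
    using assms(2) by (auto simp: nat_open_iff)
  have "b n \<subseteq> V"
    using n(1) unfolding I(2) nat_open_def by blast
  then show ?thesis
    using n I(1) by (auto simp: nat_open_iff)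
qed

text \<open>Membership is by inclusion of basic opens in \<open>V\<close>, not by divisibility: in a
  subspace \<open>S\<close>, inclusion of \<open>b m\<close> in \<open>b n\<close> does not imply
  that \<open>n\<close> divides \<open>m\<close>, and different numbers may give the same
  open.\<close>

definition basics :: "supernat set \<Rightarrow> nat set" where
  "basics V = {n. n > 0 \<and> b n \<subseteq> V}"

lemma Union_basics: "openin X V \<Longrightarrow> V = (\<Union>n\<in>basics V. b n)"
  using open_basis[of V] unfolding basics_def by blast

lemma Union_cover:
  assumes L: "L \<in> K_top S n"
  shows "b n = (\<Union>m\<in>L. b m)"
proof (intro equalityI subsetI)
  fix s assume "s \<in> b n"
  then show "s \<in> (\<Union>m\<in>L. b m)"
    using K_topD[OF L, of s] by (auto simp: nat_open_iff)
next
  fix s assume "s \<in> (\<Union>m\<in>L. b m)"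
  then obtain m where m: "m \<in> L" "s \<in> b m" by blast
  then show "s \<in> b n"
    using b_mono[of n m] sieve_big_cellD(1,3)[OF J_sieve[OF L]] by blast
qed

abbreviation H :: "((supernat set, 'u) presheaf, supernat set \<Rightarrow> 'u \<Rightarrow> 'u, (nat, 'u) presheaf, nat \<Rightarrow> 'u \<Rightarrow> 'u) fctr"
  where "H \<equiv> sections_on S"

lemma ob_H: "ob (ob H F) n = ob F (b n)"
  by (simp add: sections_on_def)

lemma restr_H: "restr (ob H F) n m = restr F (b n) (b m)"
  by (simp add: sections_on_def restr_def)

lemma ar_H: "n > 0 \<Longrightarrow> ar H F G \<alpha> n = \<alpha> (b n)"
  by (simp add: sections_on_def)

context
  notes C = is_category_opens[of X]
begin

lemma s_in: "F \<in> Obj ShS \<Longrightarrow> openin X V \<Longrightarrow> openin X W \<Longrightarrow> W \<subseteq> V \<Longrightarrow> x \<in> ob F V \<Longrightarrow> restr F V W x \<in> ob F W"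
  by (rule restr_in[OF C space_sheaf_presheaf]) (auto simp: arrow_to_opens)

lemma s_id: "F \<in> Obj ShS \<Longrightarrow> openin X V \<Longrightarrow> x \<in> ob F V \<Longrightarrow> restr F V V x = x"
  by (rule restr_id[OF C space_sheaf_presheaf]) auto

lemma s_restr: "F \<in> Obj ShS \<Longrightarrow> openin X V \<Longrightarrow> openin X W \<Longrightarrow> openin X T \<Longrightarrow> T \<subseteq> W \<Longrightarrow> W \<subseteq> V \<Longrightarrow> x \<in> ob F V \<Longrightarrow>
  restr F W T (restr F V W x) = restr F V T x"
  by (rule restr_restr[OF C space_sheaf_presheaf]) (auto simp: arrow_to_opens)

lemma sections_sheaf:
  assumes F: "F \<in> Obj ShS"
  shows "ob H F \<in> Obj Sh"
  unfolding Obj_sheaves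
proof
  note F' = space_sheaf_presheaf[OF F]
  have mono: "b m \<subseteq> b n" "openin X (b m)" "openin X (b n)" if "arrow_to big_cell m n" for m n
    using that b_mono[of n m] open_b by (auto simp: arrow_to_big_cell)
  show "ob H F \<in> Obj PSh"
    unfolding presheaf_iff[OF bc] ob_H restr_H
  proof (intro conjI ballI allI impI)
    show "ob F (b n) \<in> U" if "n \<in> Obj big_cell" for n
      using presheaf_ob[OF C F', of "b n"] open_b that by simp
    show "restr F (b n) (b m) \<in> ob F (b n) \<rightarrow>\<^sub>E ob F (b m)" if "arrow_to big_cell m n" for n m
      by (rule restr_PiE[OF C F']) (use mono[OF that] in \<open>simp add: arrow_to_opens\<close>)
    show "restr F (b n) (b n) x = x" if "n \<in> Obj big_cell" "x \<in> ob F (b n)" for n x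
      using s_id[OF F open_b] that by simp
    show "restr F (b m) (b k) (restr F (b n) (b m) x) = restr F (b n) (b k) x"
      if "arrow_to big_cell m n" "arrow_to big_cell k m" "x \<in> ob F (b n)" for n m k x
      using s_restr[OF F mono(3,2)[OF that(1)] mono(2)[OF that(2)] mono(1)[OF that(2)] mono(1)[OF that(1)] that(3)] .
  qed
  show "is_sheaf big_cell (K_top S) (ob H F)"
    unfolding is_sheaf_def ob_H restr_H
  proof (intro ballI allI impI)
    fix n L x assume n: "n \<in> Obj big_cell" and L: "L \<in> K_top S n" and x: "matching_family big_cell (ob H F) L x"
    have L0: "m > 0" if "m \<in> L" for m
      using J_sieveD[OF L that] by simp
    have xr: "restr F (b m) (b k) (x m) = x k" if "m \<in> L" "k > 0" "m dvd k" for m k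
      using x that L0[OF that(1)] unfolding matching_family_def restr_H by (auto simp: arrow_to_big_cell)
    show "\<exists>!y. y \<in> ob F (b n) \<and> (\<forall>m\<in>L. restr F (b n) (b m) y = x m)"
    proof (rule space_glue[OF F _ _ _ Union_cover[OF L]])
      show "openin X (b m)" if "m \<in> L" for m
        using open_b L0[OF that] .
      show "x m \<in> ob F (b m)" if "m \<in> L" for m
        using x that unfolding matching_family_def ob_H by blast
      show "restr F (b m) (b m \<inter> b k) (x m) = restr F (b k) (b m \<inter> b k) (x k)" if mk: "m \<in> L" "k \<in> L" for m k
      proof -
        have "lcm m k > 0"
          using L0 mk by (simp add: lcm_pos_nat)
        then show ?thesis
          using xr[OF mk(1), of "lcm m k"] xr[OF mk(2), of "lcm m k"] b_lcm[OF L0[OF mk(1)] L0[OF mk(2)]] by simp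
      qed
    qed
  qed
qed

lemma sections_functor: "is_functor ShS Sh H"
  unfolding is_functor_def
proof (intro conjI ballI)
  show "ob H F \<in> Obj Sh" if "F \<in> Obj ShS" for F
    using that by (rule sections_sheaf)
  show "ar H F G \<alpha> \<in> Hom Sh (ob H F) (ob H G)" if \<alpha>: "\<alpha> \<in> Hom ShS F G" for F G \<alpha>
  proof -
    have "ar H F G \<alpha> \<in> extensional (Obj big_cell)"
      by (simp add: sections_on_def)
    moreover have "ar H F G \<alpha> n \<in> ob (ob H F) n \<rightarrow>\<^sub>E ob (ob H G) n" if "n > 0" for n
      using hom_PiE[of \<alpha> U "opens X" F G "b n"] \<alpha> open_b[OF that] by (simp add: ar_H[OF that] ob_H Hom_ShS)
    moreover have "ar H F G \<alpha> m (restr (ob H F) n m x) = restr (ob H G) n m (ar H F G \<alpha> n x)"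
      if "n > 0" "m > 0" "n dvd m" "x \<in> ob F (b n)" for n m x
      using hom_restr[of \<alpha> U "opens X" F G "b m" "b n" x] \<alpha> arrow_b[OF that(1,2) b_mono[OF that(3,2)]] that
      by (simp add: ar_H restr_H Hom_ShS)
    ultimately show ?thesis
      by (auto simp: hom_presheaves_iff arrow_to_big_cell ob_H)
  qed
  show "ar H F F (Idn ShS F) = Idn Sh (ob H F)" for F
    using open_b by (auto simp: sections_on_def Idn_ShS presheaves_def functor_cat_def op_cat_def set_cat_def intro!: restrict_ext)
  show "ar H F K (Cmp ShS F G K \<beta> \<alpha>) = Cmp Sh (ob H F) (ob H G) (ob H K) (ar H G K \<beta>) (ar H F G \<alpha>)" for F G K \<alpha> \<beta>
    using open_b by (auto simp: sections_on_def Cmp_ShS presheaves_def functor_cat_def op_cat_def set_cat_def intro!: restrict_ext)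
qed

text \<open>Every open is the union of the basic ones inside it, so an arrow is determined by its
  components there, and components given on basic opens extend by gluing in
  \<open>G\<close>.\<close>

lemma sections_fully_faithful: "fully_faithful ShS Sh H"
  unfolding fully_faithful_def
proof (intro ballI)
  fix F G assume F: "F \<in> Obj ShS" and G: "G \<in> Obj ShS"
  note F' = space_sheaf_presheaf[OF F] and G' = space_sheaf_presheaf[OF G]
  have basic: "n > 0" "openin X (b n)" "b n \<subseteq> V" if "n \<in> basics V" for n V
    using that open_b by (auto simp: basics_def)
  have sep: "y = z" if "openin X V" "y \<in> ob G V" "z \<in> ob G V" "\<And>n. n \<in> basics V \<Longrightarrow> restr G V (b n) y = restr G V (b n) z" for V y z
    by (rule space_separated[OF G basic(2) Union_basics[OF that(1)] that(2,3)]) (use that(4) in auto)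
  have inj: "\<alpha> = \<beta>" if \<alpha>: "\<alpha> \<in> Hom (presheaves U (opens X)) F G" and \<beta>: "\<beta> \<in> Hom (presheaves U (opens X)) F G"
    and eq: "ar H F G \<alpha> = ar H F G \<beta>" for \<alpha> \<beta>
  proof (rule hom_eqI[OF \<alpha> \<beta>])
    fix V x assume "V \<in> Obj (opens X)" and x: "x \<in> ob F V"
    then have V: "openin X V" by simp
    show "\<alpha> V x = \<beta> V x"
    proof (rule sep[OF V])
      show "\<alpha> V x \<in> ob G V" "\<beta> V x \<in> ob G V"
        using hom_in[OF \<alpha> _ x] hom_in[OF \<beta> _ x] V by simp_all
      fix n assume n: "n \<in> basics V"
      have a: "arrow_to (opens X) (b n) V"
        using basic[OF n] V by (simp add: arrow_to_opens)
      have "\<alpha> (b n) = \<beta> (b n)"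
        using fun_cong[OF eq, of n] basic(1)[OF n] by (simp add: ar_H)
      then show "restr G V (b n) (\<alpha> V x) = restr G V (b n) (\<beta> V x)"
        using hom_restr[OF \<alpha> a x] hom_restr[OF \<beta> a x] by simp
    qed
  qed
  have surj: "\<exists>\<alpha>\<in>Hom (presheaves U (opens X)) F G. ar H F G \<alpha> = \<beta>" if \<beta>: "\<beta> \<in> Hom PSh (ob H F) (ob H G)" for \<beta>
  proof -
    have \<beta>in: "\<beta> n x \<in> ob G (b n)" if "n > 0" "x \<in> ob F (b n)" for n x
      using h_in[OF \<beta>, of x n] that by (simp add: ob_H)
    have \<beta>r: "\<beta> m (restr F (b n) (b m) x) = restr G (b n) (b m) (\<beta> n x)" if "n > 0" "m > 0" "n dvd m" "x \<in> ob F (b n)" for n m x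
      using h_restr[OF \<beta>, of x n m] that by (simp add: ob_H restr_H)
    \<comment> \<open>Naturality of \<open>\<beta>\<close> is given for divisibility only. For a
      mere inclusion of \<open>b m\<close> in \<open>b n\<close> one compares through
      \<open>lcm n m\<close>, a multiple of both whose basic open is again
      \<open>b m\<close>.\<close>
    have \<beta>sub: "\<beta> m (restr F (b n) (b m) x) = restr G (b n) (b m) (\<beta> n x)"
      if nm: "n > 0" "m > 0" "b m \<subseteq> b n" "x \<in> ob F (b n)" for n m x
    proof -
      let ?l = "lcm n m"
      have l: "?l > 0" "b ?l = b m"
        using nm b_lcm[OF nm(1,2)] by (auto simp: lcm_pos_nat)
      have xm: "restr F (b n) (b m) x \<in> ob F (b m)"
        by (rule s_in[OF F open_b[OF nm(1)] open_b[OF nm(2)] nm(3,4)])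
      have "\<beta> ?l (restr F (b m) (b ?l) (restr F (b n) (b m) x)) = restr G (b m) (b ?l) (\<beta> m (restr F (b n) (b m) x))"
        by (rule \<beta>r[OF nm(2) l(1) _ xm]) simp
      then have "\<beta> ?l (restr F (b n) (b m) x) = \<beta> m (restr F (b n) (b m) x)"
        unfolding l(2) s_id[OF F open_b[OF nm(2)] xm] s_id[OF G open_b[OF nm(2)] \<beta>in[OF nm(2) xm]] .
      moreover have "\<beta> ?l (restr F (b n) (b ?l) x) = restr G (b n) (b ?l) (\<beta> n x)"
        by (rule \<beta>r[OF nm(1) l(1) _ nm(4)]) simp
      ultimately show ?thesis
        unfolding l(2) by simp
    qed
    define R where "R V x y \<longleftrightarrow> y \<in> ob G V \<and> (\<forall>n\<in>basics V. restr G V (b n) y = \<beta> n (restr F V (b n) x))" for V x y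
    have Rex: "\<exists>y. R V x y" if V: "openin X V" and x: "x \<in> ob F V" for V x
    proof -
      have xn: "restr F V (b n) x \<in> ob F (b n)" if "n \<in> basics V" for n
        by (rule s_in[OF F V basic(2,3)[OF that] x])
      have "\<exists>!y. y \<in> ob G V \<and> (\<forall>n\<in>basics V. restr G V (b n) y = \<beta> n (restr F V (b n) x))"
      proof (rule space_glue[OF G basic(2) _ _ Union_basics[OF V]])
        show "\<beta> n (restr F V (b n) x) \<in> ob G (b n)" if "n \<in> basics V" for n
          by (rule \<beta>in[OF basic(1)[OF that] xn[OF that]])
        show "restr G (b n) (b n \<inter> b m) (\<beta> n (restr F V (b n) x)) = restr G (b m) (b n \<inter> b m) (\<beta> m (restr F V (b m) x))"
          if nm: "n \<in> basics V" "m \<in> basics V" for n m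
        proof -
          let ?l = "lcm n m"
          note n0 = basic[OF nm(1)] and m0 = basic[OF nm(2)]
          have l: "?l > 0" "b n \<inter> b m = b ?l"
            using b_lcm[OF n0(1) m0(1)] n0(1) m0(1) by (auto simp: lcm_pos_nat)
          have ol: "openin X (b ?l)" by (rule open_b[OF l(1)])
          have "restr F (b n) (b ?l) (restr F V (b n) x) = restr F V (b ?l) x"
            "restr F (b m) (b ?l) (restr F V (b m) x) = restr F V (b ?l) x"
            using s_restr[OF F V n0(2) ol _ n0(3) x] s_restr[OF F V m0(2) ol _ m0(3) x] l(2) by blast+
          then show ?thesis
            unfolding l(2) using \<beta>r[OF n0(1) l(1) _ xn[OF nm(1)]] \<beta>r[OF m0(1) l(1) _ xn[OF nm(2)]] by simp
        qed
      qed auto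
      then show ?thesis
        unfolding R_def by blast
    qed
    have Runi: "y = y'" if "openin X V" "R V x y" "R V x y'" for V x y y'
      by (rule sep[OF that(1)]) (use that(2,3) in \<open>auto simp: R_def\<close>)
    define k where "k V x = (SOME y. R V x y)" for V x
    have k: "R V x (k V x)" if "openin X V" "x \<in> ob F V" for V x
      unfolding k_def by (rule someI_ex[OF Rex[OF that]])
    let ?\<alpha> = "\<lambda>V\<in>Obj (opens X). \<lambda>x\<in>ob F V. k V x"
    have \<alpha>: "?\<alpha> \<in> Hom (presheaves U (opens X)) F G"
    proof (rule hom_intro[OF _ _ C F'])
      show "k V x \<in> ob G V" if "V \<in> Obj (opens X)" "x \<in> ob F V" for V x
        using k[of V x] that by (simp add: R_def)
      fix V W x assume a: "arrow_to (opens X) W V" and x: "x \<in> ob F V" and xW: "restr F V W x \<in> ob F W"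
      have VW: "openin X V" "openin X W" "W \<subseteq> V"
        using a by (auto simp: arrow_to_opens)
      have kG: "k V x \<in> ob G V"
        using k[OF VW(1) x] by (simp add: R_def)
      have "R W (restr F V W x) (restr G V W (k V x))"
        unfolding R_def
      proof (intro conjI ballI)
        show "restr G V W (k V x) \<in> ob G W"
          by (rule s_in[OF G VW kG])
        fix n assume n: "n \<in> basics W"
        then have nV: "n \<in> basics V"
          using VW(3) by (auto simp: basics_def)
        note n0 = basic[OF n]
        show "restr G W (b n) (restr G V W (k V x)) = \<beta> n (restr F W (b n) (restr F V W x))"
          using s_restr[OF G VW(1,2) n0(2,3) VW(3) kG] s_restr[OF F VW(1,2) n0(2,3) VW(3) x] k[OF VW(1) x] nV
          by (simp add: R_def)
      qed
      then show "k W (restr F V W x) = restr G V W (k V x)"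
        using Runi[OF VW(2)] k[OF VW(2) xW] by blast
    qed
    have "ar H F G ?\<alpha> = \<beta>"
    proof (rule h_eqI[OF _ \<beta>])
      show "ar H F G ?\<alpha> \<in> Hom PSh (ob H F) (ob H G)"
        using fun_ar[OF sections_functor F G, of ?\<alpha>] \<alpha> by (simp add: Hom_ShS)
      fix n x assume n: "n > 0" and "x \<in> ob (ob H F) n"
      then have x: "x \<in> ob F (b n)"
        by (simp add: ob_H)
      have "R (b n) x (\<beta> n x)"
        unfolding R_def
      proof (intro conjI ballI \<beta>in[OF n x])
        fix m assume m: "m \<in> basics (b n)"
        show "restr G (b n) (b m) (\<beta> n x) = \<beta> m (restr F (b n) (b m) x)"
          using \<beta>sub[OF n basic(1,3)[OF m] x] by simp
      qed
      then have "k (b n) x = \<beta> n x"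
        using Runi[OF open_b[OF n]] k[OF open_b[OF n] x] by blast
      then show "ar H F G ?\<alpha> n x = \<beta> n x"
        using open_b[OF n] x by (simp add: ar_H[OF n])
    qed
    then show ?thesis
      using \<alpha> by blast
  qed
  have "ar H F G \<alpha> \<in> Hom PSh (ob H F) (ob H G)" if "\<alpha> \<in> Hom (presheaves U (opens X)) F G" for \<alpha>
    using fun_ar[OF sections_functor F G, of \<alpha>] that by (simp add: Hom_ShS)
  then show "bij_betw (ar H F G) (Hom ShS F G) (Hom Sh (ob H F) (ob H G))"
    unfolding bij_betw_def Hom_ShS Hom_sheaves using inj surj by (intro conjI inj_onI) blast+
qed

text \<open>\<open>G\<close> is extended from the basis to all opens as a right Kan extension: a
  section over \<open>V\<close> is a compatible family of sections of \<open>G\<close> over all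
  \<open>n\<close> in \<open>basics V\<close>. Such a family is a partial function on
  \<open>nat\<close>, so it can be coded in the universe.\<close>

lemma sections_essentially_surjective:
  assumes G: "G \<in> Obj Sh"
  shows "\<exists>F\<in>Obj ShS. \<exists>f. is_iso Sh G (ob H F) f"
proof -
  note G' = Sh_PSh[OF G]
  define M where "M V = {f. f \<in> extensional (basics V) \<and> (\<forall>n\<in>basics V. f n \<in> ob G n) \<and>
    (\<forall>n\<in>basics V. \<forall>m>0. n dvd m \<longrightarrow> restr G n m (f n) = f m)}" for V
  have up: "m \<in> basics V" if "n \<in> basics V" "m > 0" "n dvd m" for n m V
    using that b_mono[OF that(3,2)] by (auto simp: basics_def)
  have pos: "n > 0" if "n \<in> basics V" for n V
    using that by (simp add: basics_def)
  have MD: "f \<in> extensional (basics V)" "n \<in> basics V \<Longrightarrow> f n \<in> ob G n"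
    "n \<in> basics V \<Longrightarrow> m > 0 \<Longrightarrow> n dvd m \<Longrightarrow> restr G n m (f n) = f m" if "f \<in> M V" for f n m V
    using that unfolding M_def by blast+
  have mono: "basics W \<subseteq> basics V" if "W \<subseteq> V" for V W
    using that by (auto simp: basics_def)
  have Mr: "restrict f (basics W) \<in> M W" if "f \<in> M V" "W \<subseteq> V" for f V W
    unfolding M_def
  proof (intro CollectI conjI ballI allI impI)
    fix n assume n: "n \<in> basics W"
    then have nV: "n \<in> basics V" using mono[OF that(2)] by blast
    show "restrict f (basics W) n \<in> ob G n"
      using n MD(2)[OF that(1) nV] by simp
    fix m :: nat assume "m > 0" "n dvd m"
    then show "restr G n m (restrict f (basics W) n) = restrict f (basics W) m"
      using n up[OF n] MD(3)[OF that(1) nV] by simp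
  qed simp
  have small: "\<exists>e. inj_on e (M V) \<and> e ` M V \<in> U" for V
  proof -
    let ?P = "\<lambda>n. if n = 0 then {} else ob G n"
    have P: "?P n \<in> U" for n
      using universe_empty[OF U] presheaf_ob[OF bc G', of n] by simp
    have i: "inj_on (\<lambda>f n. if n \<in> basics V then Some (f n) else None) (M V)"
    proof (rule inj_onI)
      fix f g assume fg: "f \<in> M V" "g \<in> M V"
        and eq: "(\<lambda>n. if n \<in> basics V then Some (f n) else None) = (\<lambda>n. if n \<in> basics V then Some (g n) else None)"
      show "f = g"
      proof (rule extensionalityI[OF MD(1)[OF fg(1)] MD(1)[OF fg(2)]])
        show "f n = g n" if "n \<in> basics V" for n
          using fun_cong[OF eq, of n] that by simp
      qed
    qed
    have v: "(if n \<in> basics V then Some (f n) else None) \<in> insert None (Some ` ?P n)" if "f \<in> M V" for f n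
      using MD(2)[OF that] pos by auto
    show ?thesis
    proof (rule universe_code[OF U, of ?P, OF P i])
      show "(if n \<in> basics V then Some (f n) else None) \<in> insert None (Some ` ?P n)" if "f \<in> M V" for f n
        using that by (rule v)
    qed blast
  qed
  have sheaf: "\<exists>!y. y \<in> M V \<and> (\<forall>W\<in>L. restrict y (basics W) = z W)"
    if V: "openin X V" and L: "L \<in> open_covers X V"
      and z: "\<And>W. W \<in> L \<Longrightarrow> z W \<in> M W" and zz: "\<And>W T. W \<in> L \<Longrightarrow> openin X T \<Longrightarrow> T \<subseteq> W \<Longrightarrow> restrict (z W) (basics T) = z T" for V L z
  proof -
    have self: "n \<in> basics (b n)" if "n > 0" for n
      using that by (simp add: basics_def)
    \<comment> \<open>The sieve \<open>L\<close> of opens induces a cover in the big cell: a point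
      \<open>s\<close> over \<open>n\<close> lies in some member of \<open>L\<close>, hence in a
      basic \<open>b k\<close> inside it, and \<open>lcm n k\<close> is the required multiple of
      \<open>n\<close>.\<close>
    have loc: "locally n (\<lambda>m. b m \<in> L)" if n: "n \<in> basics V" for n
      unfolding locally_K_top[OF refl]
    proof (intro conjI ballI impI)
      show n0: "n > 0" by (rule pos[OF n])
      show "stable n (\<lambda>m. b m \<in> L)"
        by (rule stableI) (rule open_coversD(5)[OF L _ open_b b_mono], assumption+)
      fix s assume s: "s \<in> S" "snat n sdvd s"
      then have "s \<in> V"
        using n by (auto simp: basics_def nat_open_iff)
      then obtain W where W: "W \<in> L" "s \<in> W"
        using open_coversD(3)[OF L] by blast
      then obtain k where k: "k > 0" "s \<in> b k" "b k \<subseteq> W"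
        using open_basis[OF open_coversD(4)[OF L W(1)] W(2)] by blast
      let ?l = "lcm n k"
      have l: "?l > 0" "snat ?l sdvd s" "b ?l \<subseteq> W"
        using n0 k s snat_lcm_sdvd[OF n0 k(1)] b_mono[of k ?l] by (auto simp: lcm_pos_nat nat_open_iff)
      have "b ?l \<in> L"
        by (rule open_coversD(5)[OF L W(1) open_b[OF l(1)] l(3)])
      then show "\<exists>m>0. n dvd m \<and> b m \<in> L \<and> snat m sdvd s"
        using l by (intro exI[of _ ?l]) simp
    qed
    \<comment> \<open>The glued family takes at \<open>n\<close> the section with the prescribed
      values over all multiples \<open>m\<close> with \<open>b m\<close> in \<open>L\<close>; these
      cover \<open>n\<close> by \<open>loc\<close>.\<close>
    define R where "R n y \<longleftrightarrow> y \<in> ob G n \<and> (\<forall>m>0. n dvd m \<longrightarrow> b m \<in> L \<longrightarrow> restr G n m y = z (b m) m)" for n y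
    have Rex: "\<exists>y. R n y" if n: "n \<in> basics V" for n
    proof -
      obtain y where "y \<in> ob G n" "\<And>m. m > 0 \<Longrightarrow> n dvd m \<Longrightarrow> b m \<in> L \<Longrightarrow> restr G n m y = z (b m) m"
      proof (rule glue[OF G loc[OF n], of "\<lambda>m. z (b m) m"])
        show "z (b m) m \<in> ob G m" if "m > 0" "b m \<in> L" for m
          by (rule MD(2)[OF z[OF that(2)] self[OF that(1)]])
        fix m k assume mk: "m > 0" "b m \<in> L" "k > 0" "m dvd k"
        have "restrict (z (b m)) (basics (b k)) = z (b k)"
          by (rule zz[OF mk(2) open_b[OF mk(3)] b_mono[OF mk(4,3)]])
        from fun_cong[OF this, of k] have "z (b m) k = z (b k) k"
          using self[OF mk(3)] by simp
        then show "restr G m k (z (b m) m) = z (b k) k"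
          using MD(3)[OF z[OF mk(2)] self[OF mk(1)] mk(3,4)] by simp
      qed blast
      then show ?thesis
        unfolding R_def by blast
    qed
    have Runi: "y = y'" if n: "n \<in> basics V" and y: "R n y" "R n y'" for n y y'
    proof (rule separated[OF G])
      show yG: "y \<in> ob G n" "y' \<in> ob G n"
        using y by (auto simp: R_def)
      show "locally n (\<lambda>m. restr G n m y = restr G n m y')"
        by (rule locally_mono[OF loc[OF n] stable_restr_eq[OF G' yG pos[OF n]]]) (use y in \<open>simp add: R_def\<close>)
    qed
    define f where "f = (\<lambda>n\<in>basics V. SOME y. R n y)"
    have f: "R n (f n)" if "n \<in> basics V" for n
      using someI_ex[OF Rex[OF that]] that by (simp add: f_def)
    have fM: "f \<in> M V"
      unfolding M_def
    proof (intro CollectI conjI ballI allI impI)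
      show "f \<in> extensional (basics V)"
        by (simp add: f_def)
      fix n assume n: "n \<in> basics V"
      show fn: "f n \<in> ob G n"
        using f[OF n] by (simp add: R_def)
      fix m :: nat assume m: "m > 0" "n dvd m"
      have "R m (restr G n m (f n))"
        unfolding R_def
      proof (intro conjI allI impI)
        show "restr G n m (f n) \<in> ob G m"
          by (rule p_in[OF G' fn pos[OF n] m])
        fix k :: nat assume k: "k > 0" "m dvd k" "b k \<in> L"
        show "restr G m k (restr G n m (f n)) = z (b k) k"
          using p_restr[OF G' fn pos[OF n] m(1) k(1) m(2) k(2)] f[OF n] k dvd_trans[OF m(2) k(2)] by (simp add: R_def)
      qed
      then show "restr G n m (f n) = f m"
        by (rule Runi[OF up[OF n m] _ f[OF up[OF n m]]])
    qed
    have fz: "restrict f (basics W) = z W" if W: "W \<in> L" for W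
    proof (rule extensionalityI[OF _ MD(1)[OF z[OF W]]])
      fix n assume n: "n \<in> basics W"
      have WV: "W \<subseteq> V"
        using open_coversD(3)[OF L] W by blast
      have bn: "b n \<in> L"
        by (rule open_coversD(5)[OF L W open_b[OF pos[OF n]]]) (use n in \<open>simp add: basics_def\<close>)
      have nV: "n \<in> basics V"
        using n mono[OF WV] by blast
      have "restrict (z W) (basics (b n)) = z (b n)"
        by (rule zz[OF W open_b[OF pos[OF n]]]) (use n in \<open>simp add: basics_def\<close>)
      from fun_cong[OF this, of n] have "z W n = z (b n) n"
        using self[OF pos[OF n]] by simp
      moreover have "restr G n n (f n) = z (b n) n"
        using f[OF nV] bn pos[OF n] by (simp add: R_def)
      moreover have "restr G n n (f n) = f n"
        by (rule p_id[OF G' MD(2)[OF fM nV] pos[OF n]])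
      ultimately show "restrict f (basics W) n = z W n"
        using n by simp
    qed simp
    show ?thesis
    proof (rule ex1I[of _ f])
      show "f \<in> M V \<and> (\<forall>W\<in>L. restrict f (basics W) = z W)"
        using fM fz by blast
      fix g assume g: "g \<in> M V \<and> (\<forall>W\<in>L. restrict g (basics W) = z W)"
      show "g = f"
      proof (rule extensionalityI[OF MD(1)[OF conjunct1[OF g]] MD(1)[OF fM]])
        fix n assume n: "n \<in> basics V"
        have "R n (g n)"
          unfolding R_def
        proof (intro conjI allI impI)
          show "g n \<in> ob G n"
            by (rule MD(2)[OF conjunct1[OF g] n])
          fix m :: nat assume m: "m > 0" "n dvd m" "b m \<in> L"
          have "restrict g (basics (b m)) = z (b m)"
            using g m(3) by blast
          from fun_cong[OF this, of m] have "g m = z (b m) m"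
            using self[OF m(1)] by simp
          then show "restr G n m (g n) = z (b m) m"
            using MD(3)[OF conjunct1[OF g] n m(1,2)] by simp
        qed
        then show "g n = f n"
          using Runi[OF n] f[OF n] by blast
      qed
    qed
  qed
  obtain F e where F: "F \<in> Obj (sheaves U (opens X) (open_covers X))"
    and e: "\<And>V. V \<in> Obj (opens X) \<Longrightarrow> bij_betw (e V) (M V) (ob F V)"
    and er: "\<And>V W f. arrow_to (opens X) W V \<Longrightarrow> f \<in> M V \<Longrightarrow> restr F V W (e V f) = e W (restrict f (basics W))"
  proof (rule coded_presheaf[OF C, of M U "\<lambda>V W f. restrict f (basics W)" "open_covers X"])
    show "restrict f (basics W) \<in> M W" if "arrow_to (opens X) W V" "f \<in> M V" for V W f
      using that Mr by (simp add: arrow_to_opens)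
    show "restrict f (basics V) = f" if "f \<in> M V" for V f
      using MD(1)[OF that] by (rule extensional_restrict)
    show "restrict (restrict f (basics W)) (basics T) = restrict f (basics T)"
      if "arrow_to (opens X) T W" for W T and f :: "nat \<Rightarrow> 'u"
      using that mono[of T W] by (simp add: arrow_to_opens restrict_restrict Int_absorb1)
    show "is_sieve (opens X) V L" if "L \<in> open_covers X V" for V L
      by (rule open_coversD(2)[OF that])
    show "\<exists>!y. y \<in> M V \<and> (\<forall>W\<in>L. restrict y (basics W) = z W)"
      if "L \<in> open_covers X V" "\<forall>W\<in>L. z W \<in> M W \<and> (\<forall>T. arrow_to (opens X) T W \<longrightarrow> restrict (z W) (basics T) = z T)" for V L z
      by (rule sheaf[OF open_coversD(1)[OF that(1)] that(1)])
        (use that(2) open_coversD(4)[OF that(1)] in \<open>auto simp: arrow_to_opens\<close>)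
  qed (use small in auto)
  have FS: "F \<in> Obj ShS"
    using F by (simp add: space_sheaves_def)
  define i where "i n = inv_into (M (b n)) (e (b n))" for n
  have eb: "bij_betw (e (b n)) (M (b n)) (ob F (b n))" if "n > 0" for n
    using e[of "b n"] open_b[OF that] by simp
  have i: "i n w \<in> M (b n)" "e (b n) (i n w) = w" if "n > 0" "w \<in> ob F (b n)" for n w
    using eb[OF that(1)] that(2) by (auto simp: i_def bij_betw_def inv_into_into f_inv_into_f)
  have ie: "i n (e (b n) f) = f" if "n > 0" "f \<in> M (b n)" for n f
    using eb[OF that(1)] that(2) by (simp add: i_def bij_betw_def)
  have self: "n \<in> basics (b n)" if "n > 0" for n
    using that by (simp add: basics_def)
  let ?\<alpha> = "\<lambda>n\<in>{0<..}. \<lambda>w\<in>ob (ob H F) n. i n w n"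
  note HF = Sh_PSh[OF sections_sheaf[OF FS]]
  have \<alpha>: "?\<alpha> \<in> Hom PSh (ob H F) G"
  proof (rule h_intro[OF _ _ HF])
    show "i n w n \<in> ob G n" if "n > 0" "w \<in> ob (ob H F) n" for n w
      using MD(2)[OF i(1) self] that by (simp add: ob_H)
    fix n m w assume *: "n > 0" "m > 0" "n dvd m" "w \<in> ob (ob H F) n"
    then have w: "w \<in> ob F (b n)" by (simp add: ob_H)
    have "restr F (b n) (b m) w = e (b m) (restrict (i n w) (basics (b m)))"
      using er[OF arrow_b[OF *(1,2) b_mono[OF *(3,2)]] i(1)[OF *(1) w]] i(2)[OF *(1) w] by simp
    then have "i m (restr F (b n) (b m) w) = restrict (i n w) (basics (b m))"
      using ie[OF *(2) Mr[OF i(1)[OF *(1) w] b_mono[OF *(3,2)]]] by simp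
    then show "i m (restr (ob H F) n m w) m = restr G n m (i n w n)"
      using MD(3)[OF i(1)[OF *(1) w] self[OF *(1)] *(2,3)] self[OF *(2)] by (simp add: restr_H)
  qed
  \<comment> \<open>Although \<open>k\<close> with \<open>b k\<close> inside \<open>b n\<close> need
    not be a multiple of \<open>n\<close>, its common multiples with \<open>n\<close> cover it. This
    lets the value of a family at \<open>n\<close> determine the whole family over
    \<open>b n\<close>.\<close>
  have locb: "locally k (\<lambda>m. m > 0 \<and> n dvd m)" if k: "k \<in> basics (b n)" and n: "n > 0" for k n
    unfolding locally_K_top[OF refl]
  proof (intro conjI ballI impI)
    show k0: "k > 0" by (rule pos[OF k])
    show "stable k (\<lambda>m. m > 0 \<and> n dvd m)"
      by (rule stableI) (use dvd_trans in blast)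
    fix s assume "s \<in> S" "snat k sdvd s"
    then have "s \<in> b k" by (simp add: nat_open_iff)
    then have "snat n sdvd s"
      using k by (auto simp: basics_def nat_open_iff)
    then show "\<exists>m>0. k dvd m \<and> (m > 0 \<and> n dvd m) \<and> snat m sdvd s"
      using \<open>snat k sdvd s\<close> snat_lcm_sdvd[OF k0 n] k0 n by (intro exI[of _ "lcm k n"]) (simp add: lcm_pos_nat)
  qed
  have bij: "bij_betw (?\<alpha> n) (ob (ob H F) n) (ob G n)" if n: "n > 0" for n
  proof -
    have inj: "f = g" if f: "f \<in> M (b n)" and g: "g \<in> M (b n)" and eq: "f n = g n" for f g
    proof (rule extensionalityI[OF MD(1)[OF f] MD(1)[OF g]])
      fix k assume k: "k \<in> basics (b n)"
      show "f k = g k"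
      proof (rule separated[OF G MD(2)[OF f k] MD(2)[OF g k]])
        show "locally k (\<lambda>m. restr G k m (f k) = restr G k m (g k))"
        proof (rule locally_mono[OF locb[OF k n] stable_restr_eq[OF G' MD(2)[OF f k] MD(2)[OF g k] pos[OF k]]])
          fix m assume m: "m > 0" "k dvd m" "m > 0 \<and> n dvd m"
          show "restr G k m (f k) = restr G k m (g k)"
            using MD(3)[OF f k m(1,2)] MD(3)[OF g k m(1,2)] MD(3)[OF f self[OF n], of m] MD(3)[OF g self[OF n], of m] m eq by simp
        qed
      qed
    qed
    have surj: "\<exists>f\<in>M (b n). f n = y" if y: "y \<in> ob G n" for y
    \<comment> \<open>The family extending \<open>y\<close> consists of the values of the Yoneda
      arrow of \<open>y\<close>; they are defined at every \<open>k\<close> in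
      \<open>basics (b n)\<close> because such \<open>k\<close> lie in the closure of the multiples
      of \<open>n\<close>, by \<open>locb\<close>.\<close>
    proof (rule bexI[of _ "\<lambda>k\<in>basics (b n). hat n G y k undefined"])
      let ?f = "\<lambda>k\<in>basics (b n). hat n G y k undefined"
      note h = hat[OF G n y]
      have u: "undefined \<in> ob (yon n) k" if "k \<in> basics (b n)" for k
        using locb[OF that n] by (simp add: yon_mem)
      show "?f n = y"
        using h(2) self[OF n] by simp
      show "?f \<in> M (b n)"
        unfolding M_def
      proof (intro CollectI conjI ballI allI impI)
        fix k assume k: "k \<in> basics (b n)"
        show "?f k \<in> ob G k"
          using h_in[OF h(1) u[OF k] pos[OF k]] k by simp
        fix m :: nat assume m: "m > 0" "k dvd m"
        have "restr (yon n) k m undefined = undefined"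
          using u[OF k] by (simp add: yon_def restr_subterm)
        then show "restr G k m (?f k) = ?f m"
          using h_restr[OF h(1) u[OF k] pos[OF k] m] k up[OF k m] by simp
      qed simp
    qed
    have "inj_on (\<lambda>w. i n w n) (ob F (b n))"
    proof (rule inj_onI)
      fix v w assume vw: "v \<in> ob F (b n)" "w \<in> ob F (b n)" "i n v n = i n w n"
      have "i n v = i n w"
        by (rule inj[OF i(1)[OF n vw(1)] i(1)[OF n vw(2)] vw(3)])
      then show "v = w"
        using i(2)[OF n vw(1)] i(2)[OF n vw(2)] by argo
    qed
    moreover have "(\<lambda>w. i n w n) ` ob F (b n) = ob G n"
    proof (intro equalityI subsetI)
      fix y assume "y \<in> (\<lambda>w. i n w n) ` ob F (b n)"
      then show "y \<in> ob G n"
        using MD(2)[OF i(1)[OF n] self[OF n]] by (elim imageE) simp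
    next
      fix y assume "y \<in> ob G n"
      then obtain f where f: "f \<in> M (b n)" "f n = y"
        using surj by blast
      have "i n (e (b n) f) n = y"
        using ie[OF n f(1)] f(2) by simp
      moreover have "e (b n) f \<in> ob F (b n)"
        by (rule bij_betw_apply[OF eb[OF n] f(1)])
      ultimately show "y \<in> (\<lambda>w. i n w n) ` ob F (b n)"
        by blast
    qed
    ultimately have "bij_betw (\<lambda>w. i n w n) (ob F (b n)) (ob G n)"
      by (simp add: bij_betw_def)
    moreover have "bij_betw (?\<alpha> n) (ob F (b n)) (ob G n) \<longleftrightarrow> bij_betw (\<lambda>w. i n w n) (ob F (b n)) (ob G n)"
      by (rule bij_betw_cong) (use n in \<open>simp add: ob_H\<close>)
    ultimately show ?thesis
      by (simp only: ob_H)
  qed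
  have "is_iso PSh (ob H F) G ?\<alpha>"
    by (rule iso_of_bij[OF bc \<alpha> HF G']) (rule bij, simp)
  then obtain g where "is_iso PSh G (ob H F) g"
    unfolding is_iso_def by blast
  then show ?thesis
    using FS unfolding is_iso_sheaves by blast
qed

end

end

section \<open>The commutative square and the assembly of the results\<close>

lemma fully_faithful_cancel:
  assumes R: "is_functor C D R" and K: "fully_faithful D E K" and KR: "fully_faithful C E (comp_fctr K R)"
  shows "fully_faithful C D R"
  unfolding fully_faithful_def
proof (intro ballI)
  fix a b assume ab: "a \<in> Obj C" "b \<in> Obj C"
  have "bij_betw (ar K (ob R a) (ob R b) \<circ> ar R a b) (Hom C a b) (Hom E (ob K (ob R a)) (ob K (ob R b)))"
    using KR ab by (simp add: fully_faithful_def comp_fctr_def comp_def)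
  moreover have "bij_betw (ar K (ob R a) (ob R b)) (Hom D (ob R a) (ob R b)) (Hom E (ob K (ob R a)) (ob K (ob R b)))"
    using K fun_ob[OF R] ab by (simp add: fully_faithful_def)
  moreover have "ar R a b ` Hom C a b \<subseteq> Hom D (ob R a) (ob R b)"
    using fun_ar[OF R ab] by blast
  ultimately show "bij_betw (ar R a b) (Hom C a b) (Hom D (ob R a) (ob R b))"
    using bij_betw_comp_iff2 by blast
qed

lemma geometric_equivalence_of_quasi_inverse:
  assumes E: "is_category E" and F: "is_category F" and adj: "adjoint E F R L" "adjoint F E L R"
    and iso: "isomorphic_functors F F (comp_fctr R L) id_fctr" "isomorphic_functors E E (comp_fctr L R) id_fctr"
  shows "geometric_equivalence E F \<lparr>inv_im = L, dir_im = R\<rparr>"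
  using right_adjoint_left_exact[OF E F adj(1)] adj iso
  by (auto simp: geometric_equivalence_def geometric_morphism_def is_equivalence_def adjoint_def)

context subspace_site
begin

lemma sections_quasi_inverse:
  obtains H' where "adjoint ShS Sh H H'" "adjoint Sh ShS H' H"
    "isomorphic_functors Sh Sh (comp_fctr H H') id_fctr" "isomorphic_functors ShS ShS (comp_fctr H' H) id_fctr"
  using quasi_inverse[OF cat_Sh cat_ShS sections_functor sections_fully_faithful sections_essentially_surjective] .

abbreviation push :: "((supernat set, 'u) presheaf, supernat set \<Rightarrow> 'u \<Rightarrow> 'u, (supernat set, 'u) presheaf, supernat set \<Rightarrow> 'u \<Rightarrow> 'u) fctr"
  where "push \<equiv> pushforward X localic id"

lemma push_eq: "push = \<lparr>ob = (\<lambda>F. \<lparr>ob = (\<lambda>V. ob F (V \<inter> S)), ar = (\<lambda>V W. ar F (V \<inter> S) (W \<inter> S))\<rparr>),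
    ar = (\<lambda>F G \<alpha>. \<lambda>V\<in>Obj (opens localic). \<alpha> (V \<inter> S))\<rparr>"
proof -
  have "{x \<in> topspace X. id x \<in> V} = V \<inter> S" for V
    by (auto simp: topspace_localic)
  then show ?thesis
    by (simp add: pushforward_def Let_def)
qed

lemma ob_push: "ob (ob push F) V = ob F (V \<inter> S)"
  by (simp add: push_eq)

lemma restr_push: "restr (ob push F) V W = restr F (V \<inter> S) (W \<inter> S)"
  by (simp add: push_eq restr_def)

lemma ar_push: "openin localic V \<Longrightarrow> ar push F G \<alpha> V = \<alpha> (V \<inter> S)"
  by (simp add: push_eq)

lemma open_Int_S: "openin localic V \<Longrightarrow> openin X (V \<inter> S)"
  by (auto simp: openin_subtopology)

lemma push_sheaf:
  assumes F: "F \<in> Obj ShS"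
  shows "ob push F \<in> Obj (space_sheaves U localic)"
  unfolding space_sheaves_def Obj_sheaves
proof
  note F' = space_sheaf_presheaf[OF F] and C = is_category_opens[of X]
  have mono: "openin localic W" "openin localic V" "W \<inter> S \<subseteq> V \<inter> S" "openin X (W \<inter> S)" "openin X (V \<inter> S)"
    if "arrow_to (opens localic) W V" for V W
    using that open_Int_S by (auto simp: arrow_to_opens)
  show "ob push F \<in> Obj (presheaves U (opens localic))"
    unfolding presheaf_iff[OF is_category_opens] ob_push restr_push
  proof (intro conjI ballI allI impI)
    show "ob F (V \<inter> S) \<in> U" if "V \<in> Obj (opens localic)" for V
      using presheaf_ob[OF C F', of "V \<inter> S"] open_Int_S that by simp
    show "restr F (V \<inter> S) (W \<inter> S) \<in> ob F (V \<inter> S) \<rightarrow>\<^sub>E ob F (W \<inter> S)" if "arrow_to (opens localic) W V" for V W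
      by (rule restr_PiE[OF C F']) (use mono[OF that] in \<open>simp add: arrow_to_opens\<close>)
    show "restr F (V \<inter> S) (V \<inter> S) x = x" if "V \<in> Obj (opens localic)" "x \<in> ob F (V \<inter> S)" for V x
      using s_id[OF F open_Int_S] that by simp
    show "restr F (W \<inter> S) (T \<inter> S) (restr F (V \<inter> S) (W \<inter> S) x) = restr F (V \<inter> S) (T \<inter> S) x"
      if "arrow_to (opens localic) W V" "arrow_to (opens localic) T W" "x \<in> ob F (V \<inter> S)" for V W T x
      by (rule s_restr[OF F mono(5,4)[OF that(1)] mono(4)[OF that(2)] mono(3)[OF that(2)] mono(3)[OF that(1)] that(3)])
  qed
  show "is_sheaf (opens localic) (open_covers localic) (ob push F)"
    unfolding is_sheaf_def ob_push restr_push
  proof (intro ballI allI impI)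
    fix V L x assume L: "L \<in> open_covers localic V" and x: "matching_family (opens localic) (ob push F) L x"
    note Lo = open_coversD(4)[OF L]
    have xr: "restr F (W \<inter> S) (T \<inter> S) (x W) = x T" if "W \<in> L" "openin localic T" "T \<subseteq> W" for W T
      using x that Lo[OF that(1)] unfolding matching_family_def restr_push by (auto simp: arrow_to_opens)
    show "\<exists>!y. y \<in> ob F (V \<inter> S) \<and> (\<forall>W\<in>L. restr F (V \<inter> S) (W \<inter> S) y = x W)"
    proof (rule space_glue[OF F])
      show "openin X (W \<inter> S)" if "W \<in> L" for W
        by (rule open_Int_S[OF Lo[OF that]])
      show "x W \<in> ob F (W \<inter> S)" if "W \<in> L" for W
        using x that unfolding matching_family_def ob_push by blast
      show "restr F (W \<inter> S) ((W \<inter> S) \<inter> (T \<inter> S)) (x W) = restr F (T \<inter> S) ((W \<inter> S) \<inter> (T \<inter> S)) (x T)"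
        if WT: "W \<in> L" "T \<in> L" for W T
      proof -
        have eq: "(W \<inter> S) \<inter> (T \<inter> S) = (W \<inter> T) \<inter> S" by blast
        have o: "openin localic (W \<inter> T)"
          by (rule openin_Int[OF Lo[OF WT(1)] Lo[OF WT(2)]])
        show ?thesis
          unfolding eq using xr[OF WT(1) o Int_lower1] xr[OF WT(2) o Int_lower2] by argo
      qed
      show "V \<inter> S = (\<Union>W\<in>L. W \<inter> S)"
        using open_coversD(3)[OF L] by blast
    qed
  qed
qed

lemma push_functor: "is_functor ShS (space_sheaves U localic) push"
  unfolding is_functor_def
proof (intro conjI ballI)
  show "ob push F \<in> Obj (space_sheaves U localic)" if "F \<in> Obj ShS" for F
    using that by (rule push_sheaf)
  show "ar push F G \<alpha> \<in> Hom (space_sheaves U localic) (ob push F) (ob push G)" if \<alpha>: "\<alpha> \<in> Hom ShS F G" for F G \<alpha>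
  proof -
    have "ar push F G \<alpha> \<in> extensional (Obj (opens localic))"
      by (simp add: push_eq)
    moreover have "ar push F G \<alpha> V \<in> ob (ob push F) V \<rightarrow>\<^sub>E ob (ob push G) V" if "openin localic V" for V
      using hom_PiE[of \<alpha> U "opens X" F G "V \<inter> S"] \<alpha> open_Int_S[OF that] by (simp add: ar_push[OF that] ob_push Hom_ShS)
    moreover have "ar push F G \<alpha> W (restr (ob push F) V W x) = restr (ob push G) V W (ar push F G \<alpha> V x)"
      if "openin localic V" "openin localic W" "W \<subseteq> V" "x \<in> ob F (V \<inter> S)" for V W x
    proof -
      have "arrow_to (opens X) (W \<inter> S) (V \<inter> S)"
        using that open_Int_S by (auto simp: arrow_to_opens)
      from hom_restr[OF _ this that(4), of \<alpha> U G] show ?thesis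
        using \<alpha> that by (simp add: ar_push restr_push Hom_ShS)
    qed
    ultimately show ?thesis
      by (simp add: space_sheaves_def hom_presheaves_iff arrow_to_opens ob_push)
  qed
  show "ar push F F (Idn ShS F) = Idn (space_sheaves U localic) (ob push F)" for F
    using open_Int_S by (auto simp: push_eq Idn_ShS space_sheaves_def presheaves_def functor_cat_def op_cat_def set_cat_def intro!: restrict_ext)
  show "ar push F K (Cmp ShS F G K \<beta> \<alpha>) = Cmp (space_sheaves U localic) (ob push F) (ob push G) (ob push K) (ar push G K \<beta>) (ar push F G \<alpha>)" for F G K \<alpha> \<beta>
    using open_Int_S by (auto simp: push_eq Cmp_ShS space_sheaves_def presheaves_def functor_cat_def op_cat_def set_cat_def intro!: restrict_ext)
qed

text \<open>The trace of \<open>nat_open {n}\<close> on \<open>S\<close> is \<open>b n\<close>, so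
  this composite equals \<open>H\<close> strictly. Through this equation \<open>push\<close>
  receives its left adjoint and its full faithfulness.\<close>

lemma base_sections_push: "comp_fctr base_sections push = H"
proof -
  have "openin localic (nat_open {n})" if "n > 0" for n
    unfolding openin_localic using that by (intro exI[of _ "{n}"]) simp
  then show ?thesis
    by (auto simp: comp_fctr_def base_sections_def push_eq sections_on_def fun_eq_iff restrict_def)
qed

end

text \<open>The inverse of \<open>K_top\<close> is \<open>spec\<close>.\<close>

lemma bij_betw_K_top:
  assumes U: "set_universe U"
  shows "bij_betw K_top {S. closedin pcfb S}
    {J. grothendieck_topology big_cell J \<and> has_enough_points U (sheaves U big_cell J)}"
proof (rule bij_betwI')
  fix S T assume S: "S \<in> {S. closedin pcfb S}" "T \<in> {S. closedin pcfb S}"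
  interpret big_cell_site U "K_top S"
    using U by (rule big_cell_site_K_top)
  show "K_top S = K_top T \<longleftrightarrow> S = T"
  proof
    assume eq: "K_top S = K_top T"
    \<comment> \<open>\<open>spec\<close> depends on the topology alone, and the one topology at
      hand is both \<open>K_top S\<close> and \<open>K_top T\<close>.\<close>
    have "spec = S" "spec = T"
      by (rule spec_K_top[OF refl] spec_K_top[OF eq], use S in simp)+
    then show "S = T"
      by (rule trans[OF sym])
  qed (rule arg_cong)
next
  fix S :: "supernat set"
  interpret big_cell_site U "K_top S"
    using U by (rule big_cell_site_K_top)
  show "K_top S \<in> {J. grothendieck_topology big_cell J \<and> has_enough_points U (sheaves U big_cell J)}"
    unfolding mem_Collect_eq using grothendieck_K_top enough_points[OF refl] by (rule conjI)
next
  fix J assume "J \<in> {J. grothendieck_topology big_cell J \<and> has_enough_points U (sheaves U big_cell J)}"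
  then have J: "grothendieck_topology big_cell J" and en: "has_enough_points U (sheaves U big_cell J)"
    by simp_all
  interpret big_cell_site U J
    using U J by (rule big_cell_site.intro)
  show "\<exists>S\<in>{S. closedin pcfb S}. J = K_top S"
  proof (rule bexI[of _ spec])
    show "J = K_top spec"
      by (rule K_top_spec[OF en, symmetric])
  qed (rule CollectI, rule spec_closed)
qed

lemma homeomorphic_map_point_at:
  assumes U: "set_universe U" and S: "closedin pcfb S"
  shows "homeomorphic_map (subtopology localic S) (space_of_points U (sheaves U big_cell (K_top S)))
    (point_at U (sheaves U big_cell (K_top S)))"
proof -
  interpret big_cell_site U "K_top S"
    using U by (rule big_cell_site_K_top)
  show ?thesis
    using space_of_points_homeomorphic unfolding spec_K_top[OF refl S] .
qed

lemma (in big_cell_site) geometric_inclusion_sheaves: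
  assumes "sheafification a \<eta>"
  shows "geometric_inclusion Sh PSh \<lparr>inv_im = a, dir_im = id_fctr\<rparr>"
  using assms sheafification_left_exact[OF assms] inclusion_fully_faithful
  by (simp add: geometric_inclusion_def geometric_morphism_def sheafification_def)

text \<open>A left adjoint of the pushforward is not built directly. Followed by the fully faithful
  \<open>base_sections\<close>, the pushforward is \<open>H\<close> into presheaves, whose left
  adjoint is \<open>comp_fctr H' a\<close>, and \<open>adjoint_restrict\<close> cancels
  \<open>base_sections\<close>. With this choice the inverse images around the square differ only by
  \<open>comp_fctr H H'\<close>, which is isomorphic to the identity.\<close>

lemma subspace_sheaves:
  assumes U: "set_universe U"
    and H0: "adjoint (space_sheaves U localic) (presheaves U big_cell) base_sections H0'"
      "adjoint (presheaves U big_cell) (space_sheaves U localic) H0' base_sections"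
    and H0_ff: "fully_faithful (space_sheaves U localic) (presheaves U big_cell) base_sections"
  shows "\<exists>i j h.
    geometric_inclusion (sheaves U big_cell (K_top S)) (presheaves U big_cell) i \<and> dir_im i = id_fctr \<and>
    geometric_inclusion (space_sheaves U (subtopology localic S)) (space_sheaves U localic) j \<and>
    dir_im j = pushforward (subtopology localic S) localic id \<and>
    geometric_equivalence (sheaves U big_cell (K_top S)) (space_sheaves U (subtopology localic S)) h \<and>
    isomorphic_geom (sheaves U big_cell (K_top S)) (space_sheaves U localic) (comp_geom j h)
      (comp_geom \<lparr>inv_im = base_sections, dir_im = H0'\<rparr> i)"
proof -
  interpret subspace_site U S
    using U by (rule subspace_site.intro)
  let ?ShL = "space_sheaves U localic"
  have cat_ShL: "is_category ?ShL"
    unfolding space_sheaves_def by (rule is_category_sheaves[OF is_category_opens])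
  have H0f: "is_functor ?ShL PSh base_sections"
    using H0(1) by (simp add: adjoint_def)
  obtain a \<eta> where a: "sheafification a \<eta>"
    using sheafification_functor by blast
  then have a_adj: "adjoint PSh Sh a id_fctr"
    by (simp add: sheafification_def)
  then have af: "is_functor PSh Sh a"
    by (simp add: adjoint_def)
  obtain H' where H': "adjoint ShS Sh H H'" "adjoint Sh ShS H' H"
    "isomorphic_functors Sh Sh (comp_fctr H H') id_fctr" "isomorphic_functors ShS ShS (comp_fctr H' H) id_fctr"
    by (rule sections_quasi_inverse)
  have f: "is_functor PSh ShS (comp_fctr H' a)" "is_functor ?ShL Sh (comp_fctr a base_sections)"
    using H'(2) af H0f is_functor_comp by (auto simp: adjoint_def)
  let ?i = "\<lparr>inv_im = a, dir_im = id_fctr\<rparr>"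
  let ?j = "\<lparr>inv_im = comp_fctr (comp_fctr H' a) base_sections, dir_im = push\<rparr>"
  let ?h = "\<lparr>inv_im = H, dir_im = H'\<rparr>"
  have "adjoint PSh ShS (comp_fctr H' a) (comp_fctr id_fctr H)"
    by (rule adjoint_comp[OF cat_PSh cat_Sh cat_ShS a_adj H'(2)])
  from adjoint_restrict[OF cat_ShL cat_PSh cat_ShS H0f H0_ff push_functor this]
  have j_adj: "adjoint ?ShL ShS (comp_fctr (comp_fctr H' a) base_sections) push"
    by (simp add: base_sections_push)
  have "left_exact PSh ShS (comp_fctr H' a)"
    by (rule left_exact_comp[OF af sheafification_left_exact[OF a] right_adjoint_left_exact[OF cat_ShS cat_Sh H'(1)]])
  with right_adjoint_left_exact[OF cat_PSh cat_ShL H0(2)]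
  have j_lex: "left_exact ?ShL ShS (comp_fctr (comp_fctr H' a) base_sections)"
    by (rule left_exact_comp[OF H0f])
  have "fully_faithful ShS PSh H"
    using sections_fully_faithful unfolding fully_faithful_def by simp
  then have "fully_faithful ShS ?ShL push"
    using fully_faithful_cancel[OF push_functor H0_ff] by (simp add: base_sections_push)
  then have j: "geometric_inclusion ShS ?ShL ?j"
    using j_adj j_lex by (simp add: geometric_inclusion_def geometric_morphism_def)
  have "geometric_equivalence Sh ShS ?h"
    using geometric_equivalence_of_quasi_inverse[OF cat_Sh cat_ShS H'(2,1,4,3)] .
  moreover have "isomorphic_geom Sh ?ShL (comp_geom ?j ?h) (comp_geom \<lparr>inv_im = base_sections, dir_im = H0'\<rparr> ?i)"
    using isomorphic_functors_comp_right[OF f(2) H'(3)]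
    by (simp add: isomorphic_geom_def comp_geom_def comp_fctr_assoc)
  ultimately show ?thesis
    using geometric_inclusion_sheaves[OF a] j
    by (intro exI[of _ ?i] exI[of _ ?j] exI[of _ ?h]) simp
qed

theorem corollary2p4:
  fixes U :: "'u set set"
  assumes "set_universe U"
  shows "bij_betw K_top
           {S. closedin pcfb S}
           {J. grothendieck_topology big_cell J \<and> has_enough_points U (sheaves U big_cell J)}
         \<and>
         (\<forall>S. closedin pcfb S \<longrightarrow>
           homeomorphic_map (subtopology localic S)
             (space_of_points U (sheaves U big_cell (K_top S)))
             (point_at U (sheaves U big_cell (K_top S))))
         \<and>
         (\<exists>e. geometric_equivalence (presheaves U big_cell) (space_sheaves U localic) e \<and>
           inv_im e = base_sections \<and>
           (\<forall>S. closedin pcfb S \<longrightarrow>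
             (\<exists>i j h.
               geometric_inclusion (sheaves U big_cell (K_top S)) (presheaves U big_cell) i \<and>
               dir_im i = id_fctr \<and>
               geometric_inclusion (space_sheaves U (subtopology localic S)) (space_sheaves U localic) j \<and>
               dir_im j = pushforward (subtopology localic S) localic id \<and>
               geometric_equivalence (sheaves U big_cell (K_top S))
                 (space_sheaves U (subtopology localic S)) h \<and>
               isomorphic_geom (sheaves U big_cell (K_top S)) (space_sheaves U localic)
                 (comp_geom j h) (comp_geom e i))))"
proof (intro conjI allI impI)
  \<comment> \<open>The standard equivalence is the comparison for the whole space, where all
    presheaves are sheaves and \<open>H\<close> is \<open>base_sections\<close>.\<close>
  interpret subspace_site U UNIV
    using assms by (rule subspace_site.intro)
  have P: "Sh = presheaves U big_cell" and S: "ShS = space_sheaves U localic" and H: "H = base_sections"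
    by (simp_all add: presheaves_eq_sheaves sections_on_UNIV)
  obtain H0' where adj: "adjoint ShS Sh H H0'" "adjoint Sh ShS H0' H"
    and iso: "isomorphic_functors Sh Sh (comp_fctr H H0') id_fctr" "isomorphic_functors ShS ShS (comp_fctr H0' H) id_fctr"
    by (rule sections_quasi_inverse)
  have "geometric_equivalence Sh ShS \<lparr>inv_im = H, dir_im = H0'\<rparr>"
    using geometric_equivalence_of_quasi_inverse[OF cat_Sh cat_ShS adj(2,1) iso(2,1)] .
  then show "\<exists>e. geometric_equivalence (presheaves U big_cell) (space_sheaves U localic) e \<and>
      inv_im e = base_sections \<and>
      (\<forall>S. closedin pcfb S \<longrightarrow>
        (\<exists>i j h.
          geometric_inclusion (sheaves U big_cell (K_top S)) (presheaves U big_cell) i \<and>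
          dir_im i = id_fctr \<and>
          geometric_inclusion (space_sheaves U (subtopology localic S)) (space_sheaves U localic) j \<and>
          dir_im j = pushforward (subtopology localic S) localic id \<and>
          geometric_equivalence (sheaves U big_cell (K_top S))
            (space_sheaves U (subtopology localic S)) h \<and>
          isomorphic_geom (sheaves U big_cell (K_top S)) (space_sheaves U localic)
            (comp_geom j h) (comp_geom e i)))"
    using subspace_sheaves[OF assms adj[unfolded P S H] sections_fully_faithful[unfolded P S H]]
    unfolding P S H by (intro exI[of _ "\<lparr>inv_im = base_sections, dir_im = H0'\<rparr>"]) simp
qed (use bij_betw_K_top[OF assms] homeomorphic_map_point_at[OF assms] in blast)+

end
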